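(* Assume that (a) $\theta\mapsto H^\alpha$ and $\theta\mapsto L_k^\beta$ ($k=1,\dots,r$) are twice continuously differentiable on $\Theta$; (b) (identifiability) for every $\theta=(\alpha,\beta)\in\Theta$ with $\theta\neq\theta_0$ there is at least one $t\in[0,T]$ with $b(\mathbf L^\beta,\bar\rho_t^\theta)\neq b(\mathbf L^{\beta_0},\bar\rho_t^{\theta_0})$; (c) the $p\times p$ matrix $I(\theta_0)=\int_0^T\nabla_\theta h(t,\theta_0)\nabla_\theta h(t,\theta_0)^\top dt$ is positive definite. Let $$\Phi_N(\theta)=\int_0^T h(t,\theta)\cdot d\overline{\mathbf Y}^N_t-\frac12\int_0^T\|h(t,\theta)\|_{\mathbb R^r}^2\,dt,\qquad \hat\theta_N=\operatorname{arg\,max}_{\theta\in\Theta}\Phi_N(\theta),$$ $$\eta_i(\theta)=\int_0^T\nabla_\theta h(t,\theta)\{d\mathbf Y^{(i)}_t-h(t,\theta)\,dt\},\qquad \Sigma=\mathbb E[\eta_i(\theta_0)\eta_i(\theta_0)^\top],$$ $$\hat\eta_i=\eta_i(\hat\theta_N),\quad \bar\eta_N=\frac1N\sum_{i=1}^N\hat\eta_i,\quad \hat\Sigma_N=\frac1N\sum_{i=1}^N(\hat\eta_i-\bar\eta_N)(\hat\eta_i-\bar\eta_N)^\top,$$ $$\hat I_N=\int_0^T\nabla_\theta h(t,\hat\theta_N)\nabla_\theta h(t,\hat\theta_N)^\top dt,\qquad \hat V_N=\hat I_N^{-1}\hat\Sigma_N\hat I_N^{-1}.$$ Then, as $N\to\infty$,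 almost surely $$\hat\Sigma_N\to\Sigma\qquad\text{and}\qquad \hat V_N\to I(\theta_0)^{-1}\Sigma I(\theta_0)^{-1}.$$
   Context: Fix $T>0$ and integers $d,r,p\ge1$. Let $\Theta^\circ\subset\mathbb R^p$ be a bounded convex open set, $\Theta=\overline{\Theta^\circ}$ (compact), and let the true parameter $\theta_0=(\alpha_0,\beta_0)$ lie in $\Theta^\circ$. Each $\theta\in\Theta$ is written $\theta=(\alpha,\beta)$ with $\alpha,\beta$ vector-valued. For each $\theta$ there are given a self-adjoint matrix $H^\alpha\in M_d(\mathbb C)$ and matrices $L_1^\beta,\dots,L_r^\beta\in M_d(\mathbb C)$; $\mathbf L^\beta=(L_1^\beta,\dots,L_r^\beta)$. "$\ell$-times continuously differentiable on $\Theta$" means on $\Theta^\circ$, with all derivatives of order at most $\ell$ extending continuously to $\Theta$. Put $b(A,B)=2\operatorname{Re}\operatorname{Tr}(A^*B)$ for $A,B\in M_d(\mathbb C)$ and $b(\mathbf L^\beta,\rho)=(b(L_1^\beta,\rho),\dots,b(L_r^\beta,\rho))^\top\in\mathbb R^r$. With $[A,B]=AB-BA$, $\{A,B\}=AB+BA$, put $$\mathcal L^\theta(\rho)=-i[H^\alpha,\rho]+\sum_{k=1}^r\Big(L_k^\beta\rho(L_k^\beta)^*-\tfrac12\{(L_k^\beta)^*L_k^\beta,\rho\}\Big),\qquad \mathcal H_k^\beta(\rho)=L_k^\beta\rho+\rho(L_k^\beta)^*-b(L_k^\beta,\rho)\rho.$$ Let $\mathbf W^{(1)},\mathbf W^{(2)},\dots$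 be independent $r$-dimensional standard Wiener processes on $[0,T]$, $\mathbf W^{(i)}=(W^{(i,1)},\dots,W^{(i,r)})^\top$, and let $\rho_0\in M_d(\mathbb C)$ be a fixed (known) density matrix (positive semidefinite, trace one). For $\theta\in\Theta$, $i\ge1$, $\rho_t^{\theta,(i)}$ is the unique solution of $$d\rho_t^{\theta,(i)}=\mathcal L^\theta(\rho_t^{\theta,(i)})\,dt+\sum_{k=1}^r\mathcal H_k^\beta(\rho_t^{\theta,(i)})\,dW_t^{(i,k)},\qquad \rho_0^{\theta,(i)}=\rho_0;$$ it is known that it exists, is unique and is density-matrix valued. Put $\bar\rho_t^\theta=\mathbb E[\rho_t^{\theta,(i)}]$ (independent of $i$) and $h(t,\theta)=b(\mathbf L^\beta,\bar\rho_t^\theta)\in\mathbb R^r$; $\nabla_\theta h(t,\theta)$ is the $p\times r$ matrix whose $k$-th column is the gradient in $\theta$ of the $k$-th component of $h$. Observations: the records are generated under $\theta_0$, i.e. $d\mathbf Y^{(i)}_t=b(\mathbf L^{\beta_0},\rho_t^{\theta_0,(i)})\,dt+d\mathbf W^{(i)}_t$, $\mathbf Y_0^{(i)}=0$; $\overline{\mathbf Y}^N=\frac1N\sum_{i=1}^N\mathbf Y^{(i)}$. Stochastic integrals depending on $\theta$ (in particular $\eta_i(\theta)$) are taken in versions continuous in $\theta\in\Theta$; $\eta_i(\hat\theta_N)$ means this version evaluated at the random point $\hat\theta_N$; $\hat\theta_N$ is a measurable choice of a maximizer. $\hat V_N$ is defined when $\hat I_N$ is invertible (set to an arbitrary value,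 e.g. $0$, otherwise). *)

theory Defs
  imports "HOL-Probability.Probability"
begin

subsection \<open>Parameters\<close>

text \<open>
  A parameter \<theta> is split as (\<alpha>, \<beta>) by a set of coordinates: \<alpha> collects the coordinates in \<open>A\<close>
  and \<beta> those in \<open>- A\<close>, both padded with zeros. \<open>A = {}\<close> and \<open>A = UNIV\<close> are possible.
\<close>

definition sub_coords :: "'p set \<Rightarrow> real^'p \<Rightarrow> real^'p" where
  "sub_coords A \<theta> = (\<chi> j. if j \<in> A then \<theta> $ j else 0)"

text \<open>
  \<open>Ck_closure l U f\<close>: \<open>f\<close> is \<open>l\<close>-times continuously differentiable on the open set \<open>U\<close>, and \<open>f\<close> and
  all its derivatives of order at most \<open>l\<close> extend continuously to the closure of \<open>U\<close>. The extension
  of \<open>f\<close> is \<open>f\<close> itself; the functions \<open>D b\<close> are the extended partial derivatives.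
\<close>

primrec Ck_closure ::
  "nat \<Rightarrow> 'a::euclidean_space set \<Rightarrow> ('a \<Rightarrow> 'b::real_normed_vector) \<Rightarrow> bool" where
  "Ck_closure 0 U f \<longleftrightarrow> continuous_on (closure U) f"
| "Ck_closure (Suc l) U f \<longleftrightarrow> continuous_on (closure U) f \<and>
     (\<exists>D. (\<forall>x\<in>U. (f has_derivative (\<lambda>v. \<Sum>b\<in>Basis. (v \<bullet> b) *\<^sub>R D b x)) (at x)) \<and>
          (\<forall>b\<in>Basis. Ck_closure l U (D b)))"

text \<open>
  The gradients of the components of \<open>f\<close> as the columns of a matrix: the derivative on \<open>U\<close>, and its
  continuous extension at the remaining points of the closure of \<open>U\<close>.
\<close>

definition partial_deriv :: "'p::finite \<Rightarrow> (real^'p \<Rightarrow> real) \<Rightarrow> real^'p \<Rightarrow> real" where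
  "partial_deriv j f \<theta> = frechet_derivative f (at \<theta>) (axis j 1)"

definition grad_closure ::
  "(real^'p::finite) set \<Rightarrow> (real^'p \<Rightarrow> real^'r::finite) \<Rightarrow> real^'p \<Rightarrow> real^'r^'p" where
  "grad_closure U f \<theta> = (\<chi> j k.
     if \<theta> \<in> U then partial_deriv j (\<lambda>\<theta>'. f \<theta>' $ k) \<theta>
     else Lim (at \<theta> within U) (partial_deriv j (\<lambda>\<theta>'. f \<theta>' $ k)))"

subsection \<open>Matrices\<close>

definition outer :: "real^'n \<Rightarrow> real^'m \<Rightarrow> real^'m^'n" where
  "outer v w = (\<chi> i j. v $ i * w $ j)"

definition pos_definite :: "real^'n::finite^'n \<Rightarrow> bool" where
  "pos_definite S \<longleftrightarrow> transpose S = S \<and> (\<forall>v. v \<noteq> 0 \<longrightarrow> v \<bullet> (S *v v) > 0)"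

definition adj :: "complex^'n^'m \<Rightarrow> complex^'m^'n" where
  "adj A = (\<chi> i j. cnj (A $ j $ i))"

definition cscale :: "complex \<Rightarrow> complex^'n^'m \<Rightarrow> complex^'n^'m" where
  "cscale c A = (\<chi> i j. c * A $ i $ j)"

definition density_matrix :: "complex^'d::finite^'d \<Rightarrow> bool" where
  "density_matrix \<rho> \<longleftrightarrow> adj \<rho> = \<rho> \<and>
     (\<forall>v. 0 \<le> Re (\<Sum>i\<in>UNIV. cnj (v $ i) * (\<rho> *v v) $ i)) \<and> trace \<rho> = 1"

definition b_form :: "complex^'d::finite^'d \<Rightarrow> complex^'d^'d \<Rightarrow> real" where
  "b_form A B = 2 * Re (trace (adj A ** B))"

definition b_vec :: "('r \<Rightarrow> complex^'d::finite^'d) \<Rightarrow> complex^'d^'d \<Rightarrow> real^'r" where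
  "b_vec L \<rho> = (\<chi> k. b_form (L k) \<rho>)"

definition lindblad ::
  "complex^'d::finite^'d \<Rightarrow> ('r::finite \<Rightarrow> complex^'d^'d) \<Rightarrow> complex^'d^'d \<Rightarrow> complex^'d^'d" where
  "lindblad H L \<rho> = cscale (- \<i>) (H ** \<rho> - \<rho> ** H) +
     (\<Sum>k\<in>UNIV. L k ** \<rho> ** adj (L k)
        - (1/2) *\<^sub>R (adj (L k) ** L k ** \<rho> + \<rho> ** (adj (L k) ** L k)))"

definition diffusion_op :: "complex^'d::finite^'d \<Rightarrow> complex^'d^'d \<Rightarrow> complex^'d^'d" where
  "diffusion_op L \<rho> = L ** \<rho> + \<rho> ** adj L - b_form L \<rho> *\<^sub>R \<rho>"

subsection \<open>Wiener processes\<close>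

text \<open>
  A standard Wiener process on \<open>[0, T]\<close> relative to the filtration \<open>F\<close>, with values in a Euclidean
  space: the increment over \<open>[s, t]\<close> is independent of \<open>F s\<close> and has law N(0, (t - s) I).
\<close>

definition filtration_on :: "'w measure \<Rightarrow> (real \<Rightarrow> 'w measure) \<Rightarrow> bool" where
  "filtration_on M F \<longleftrightarrow> filtration (space M) F \<and> (\<forall>t. subalgebra M (F t))"

definition wiener_process ::
  "'w measure \<Rightarrow> (real \<Rightarrow> 'w measure) \<Rightarrow> real \<Rightarrow> (real \<Rightarrow> 'w \<Rightarrow> real^'r::finite) \<Rightarrow> bool" where
  "wiener_process M F T W \<longleftrightarrow>
     (AE x in M. W 0 x = 0) \<and>
     (AE x in M. continuous_on {0..T} (\<lambda>t. W t x)) \<and>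
     (\<forall>t\<in>{0..T}. W t \<in> borel_measurable (F t)) \<and>
     (\<forall>s t. 0 \<le> s \<and> s < t \<and> t \<le> T \<longrightarrow>
        prob_space.indep_set M (sets (F s))
          {(\<lambda>x. W t x - W s x) -` B \<inter> space M | B. B \<in> sets borel} \<and>
        prob_space.indep_vars M (\<lambda>_. borel) (\<lambda>k x. (W t x - W s x) $ k) UNIV \<and>
        (\<forall>k. distributed M lborel (\<lambda>x. (W t x - W s x) $ k) (normal_density 0 (sqrt (t - s)))))"

subsection \<open>Stochastic integrals\<close>

text \<open>
  The simple process with values \<open>\<xi> j\<close> on \<open>(\<tau> j, \<tau> (j + 1)]\<close>, \<open>j < n\<close>, on the time interval \<open>[0, t]\<close>.
\<close>

definition simple_data ::
  "'w measure \<Rightarrow> (real \<Rightarrow> 'w measure) \<Rightarrow> real \<Rightarrow> nat \<Rightarrow> (nat \<Rightarrow> real) \<Rightarrow>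
   (nat \<Rightarrow> 'w \<Rightarrow> 'b::euclidean_space) \<Rightarrow> bool" where
  "simple_data M F t n \<tau> \<xi> \<longleftrightarrow>
     0 \<le> \<tau> 0 \<and> (\<forall>j<n. \<tau> j \<le> \<tau> (Suc j)) \<and> \<tau> n \<le> t \<and>
     (\<forall>j<n. \<xi> j \<in> borel_measurable (F (\<tau> j)) \<and> bounded (\<xi> j ` space M))"

definition simple_process ::
  "nat \<Rightarrow> (nat \<Rightarrow> real) \<Rightarrow> (nat \<Rightarrow> 'w \<Rightarrow> 'b::euclidean_space) \<Rightarrow> real \<Rightarrow> 'w \<Rightarrow> 'b" where
  "simple_process n \<tau> \<xi> s x = (\<Sum>j<n. indicator {\<tau> j<..\<tau> (Suc j)} s *\<^sub>R \<xi> j x)"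

definition simple_integral ::
  "(real \<Rightarrow> 'w \<Rightarrow> real) \<Rightarrow> nat \<Rightarrow> (nat \<Rightarrow> real) \<Rightarrow> (nat \<Rightarrow> 'w \<Rightarrow> 'b::euclidean_space) \<Rightarrow> 'w \<Rightarrow> 'b" where
  "simple_integral B n \<tau> \<xi> x = (\<Sum>j<n. (B (\<tau> (Suc j)) x - B (\<tau> j) x) *\<^sub>R \<xi> j x)"

text \<open>
  \<open>has_stoch_integral M F B X t Z\<close>: the random variable \<open>Z\<close> is (a version of) the stochastic integral
  of \<open>X\<close> against the scalar process \<open>B\<close> over \<open>[0, t]\<close>, as the mean-square limit of the integrals of
  adapted simple processes converging to \<open>X\<close> in mean square on \<open>[0, t]\<close>. For a Wiener process \<open>B\<close>
  this is the Ito integral. By the Ito isometry \<open>Z\<close> is determined almost surely and independent of the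
  approximating sequence also when \<open>B\<close> is a finite linear combination of Wiener processes plus the time
  integral of a bounded process, which covers all integrators used here.
\<close>

definition has_stoch_integral ::
  "'w measure \<Rightarrow> (real \<Rightarrow> 'w measure) \<Rightarrow> (real \<Rightarrow> 'w \<Rightarrow> real) \<Rightarrow>
   (real \<Rightarrow> 'w \<Rightarrow> 'b::euclidean_space) \<Rightarrow> real \<Rightarrow> ('w \<Rightarrow> 'b) \<Rightarrow> bool" where
  "has_stoch_integral M F B X t Z \<longleftrightarrow>
     (\<lambda>(s, x). X s x) \<in> borel_measurable (restrict_space lborel {0..t} \<Otimes>\<^sub>M M) \<and>
     Z \<in> borel_measurable M \<and>
     (\<exists>n \<tau> \<xi>. (\<forall>m. simple_data M F t (n m) (\<tau> m) (\<xi> m)) \<and>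
        (\<lambda>m. \<integral>\<^sup>+(s, x). ennreal ((norm (X s x - simple_process (n m) (\<tau> m) (\<xi> m) s x))\<^sup>2)
                \<partial>(restrict_space lborel {0..t} \<Otimes>\<^sub>M M)) \<longlonglongrightarrow> 0 \<and>
        (\<lambda>m. \<integral>\<^sup>+x. ennreal ((norm (Z x - simple_integral B (n m) (\<tau> m) (\<xi> m) x))\<^sup>2) \<partial>M)
          \<longlonglongrightarrow> 0)"

text \<open>
  The integral against a vector-valued process \<open>B\<close>: the sum over \<open>k\<close> of the integrals of \<open>X k\<close> against
  the component \<open>B $ k\<close>. For a matrix integrand, \<open>X k\<close> is its \<open>k\<close>-th column.
\<close>

definition has_stoch_integral_vec ::
  "'w measure \<Rightarrow> (real \<Rightarrow> 'w measure) \<Rightarrow> (real \<Rightarrow> 'w \<Rightarrow> real^'r::finite) \<Rightarrow>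
   ('r \<Rightarrow> real \<Rightarrow> 'w \<Rightarrow> 'b::euclidean_space) \<Rightarrow> real \<Rightarrow> ('w \<Rightarrow> 'b) \<Rightarrow> bool" where
  "has_stoch_integral_vec M F B X t Z \<longleftrightarrow>
     (\<exists>J. (\<forall>k. has_stoch_integral M F (\<lambda>s x. B s x $ k) (X k) t (J k)) \<and>
          Z \<in> borel_measurable M \<and> (AE x in M. Z x = (\<Sum>k\<in>UNIV. J k x)))"

text \<open>
  A version, continuous in the parameter \<open>\<theta> \<in> \<Theta>\<close>, of the integrals over \<open>[0, t]\<close> of the deterministic
  integrands \<open>X \<theta>\<close>.
\<close>

definition continuous_integral_version ::
  "'w measure \<Rightarrow> (real \<Rightarrow> 'w measure) \<Rightarrow> (real \<Rightarrow> 'w \<Rightarrow> real^'r::finite) \<Rightarrow> real \<Rightarrow>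
   'a::topological_space set \<Rightarrow> ('a \<Rightarrow> 'r \<Rightarrow> real \<Rightarrow> 'b::euclidean_space) \<Rightarrow>
   ('a \<Rightarrow> 'w \<Rightarrow> 'b) \<Rightarrow> bool" where
  "continuous_integral_version M F B t \<Theta> X Z \<longleftrightarrow>
     (\<forall>\<theta>\<in>\<Theta>. has_stoch_integral_vec M F B (\<lambda>k s _. X \<theta> k s) t (Z \<theta>)) \<and>
     (AE x in M. continuous_on \<Theta> (\<lambda>\<theta>. Z \<theta> x))"

subsection \<open>The stochastic master equation\<close>

text \<open>
  \<open>\<rho>\<close> is an adapted continuous solution on \<open>[0, T]\<close>, with initial state \<open>\<rho>0\<close>, which is density-matrix
  valued. That the solution exists, is unique and stays in the set of density matrices is known; here
  the last property is part of the definition.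
\<close>

definition sme_solution ::
  "'w measure \<Rightarrow> (real \<Rightarrow> 'w measure) \<Rightarrow> real \<Rightarrow> (real \<Rightarrow> 'w \<Rightarrow> real^'r::finite) \<Rightarrow>
   complex^'d::finite^'d \<Rightarrow> ('r \<Rightarrow> complex^'d^'d) \<Rightarrow> complex^'d^'d \<Rightarrow>
   (real \<Rightarrow> 'w \<Rightarrow> complex^'d^'d) \<Rightarrow> bool" where
  "sme_solution M F T W H L \<rho>0 \<rho> \<longleftrightarrow>
     (\<forall>t\<in>{0..T}. \<rho> t \<in> borel_measurable (F t)) \<and>
     (AE x in M. continuous_on {0..T} (\<lambda>t. \<rho> t x)) \<and>
     (AE x in M. \<forall>t\<in>{0..T}. density_matrix (\<rho> t x)) \<and>
     (\<forall>t\<in>{0..T}. \<exists>J.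
        has_stoch_integral_vec M F W (\<lambda>k s x. diffusion_op (L k) (\<rho> s x)) t J \<and>
        (AE x in M. \<rho> t x = \<rho>0 + (LBINT s:{0..t}. lindblad H L (\<rho> s x)) + J x))"

end

theory Submission
  imports Defs "HOL-Library.Discrete_Functions"
begin

text \<open>
The estimator maximizes a contrast that is an average of independent terms, and its limit is a constant minus half of the squared
L2 distance of the signals h at \<open>\<theta>\<close> and at the true parameter. Identifiability makes the true parameter the unique maximizer, so the
estimator is consistent. The empirical covariance of the scores at the estimator then behaves like the one at the true
parameter, to which the law of large numbers applies, and continuity of the information matrix and of matrix inversion give the
second claim.

Three points need care. First, the estimator is random and depends on all records, so the stochastic integrals must be
controlled for all parameters at once. The integrands are deterministic, and the mean state is the exponential of the
generator applied to the initial state (\<open>mean_state_equation\<close>, \<open>mean_signal_series\<close>). So the signal and its gradient are continuously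
differentiable in time up to the boundary of the parameter set (\<open>mean_signal_time_C1\<close>), and integration by parts turns every
stochastic integral into a continuous functional of the record (\<open>smooth_stoch_integral\<close>, \<open>continuous_version_by_parts\<close>). Its modulus
of continuity in the parameter is a constant times the size of the record (\<open>by_parts_regular\<close>). All limits along the estimator
thereby become deterministic statements about one realization (\<open>argmax_tendsto\<close>, \<open>empirical_product_tendsto\<close>, \<open>pathwise_consistency\<close>).

Second, the records must be independent with a common law, although each one is only given as a process that satisfies a stochastic
equation. The Euler scheme expresses the solution as a limit of explicit functions of the noise, the same for every record
(\<open>euler_converges\<close>, \<open>path_functional_sme\<close>); a projection onto a ball makes the coefficients globally Lipschitz. Functionals of the
independent noises, whose laws agree (\<open>distr_wiener_path\<close>), obey the strong law of large numbers (\<open>path_functional_slln\<close>), which is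
proved for square-integrable variables by a subsequence argument (\<open>slln_uncorrelated_centred\<close>).

Third, the stochastic integral is defined by mean-square approximation, against a Wiener process with a bounded drift. One
estimate, implied by the Ito isometry and stable under sums (\<open>integrator\<close>), makes the integral independent of the
approximation (\<open>stoch_integral_approx\<close>), and it is what both the Euler scheme and the integration by parts rest on.
\<close>

section \<open>Mean-square convergence\<close>

text \<open>The squared mean-square norm, with values in the extended reals so that it can be manipulated before any
integrability is known.\<close>

definition msq :: "'a measure => ('a => 'b::euclidean_space) => ennreal" where
 "msq M f = (\<integral>\<^sup>+x. ennreal ((norm (f x))\<^sup>2) \<partial>M)"

lemma power2_norm_add_le:
 fixes a b :: "'b::real_normed_vector"
 shows "(norm (a + b))\<^sup>2 <= 2 * (norm a)\<^sup>2 + 2 * (norm b)\<^sup>2"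
proof -
 have "(norm (a + b))\<^sup>2 <= (norm a + norm b)\<^sup>2"
  by (intro power_mono norm_triangle_ineq) auto
 also have "\<dots> <= 2 * (norm a)\<^sup>2 + 2 * (norm b)\<^sup>2"
  using zero_le_power2[of "norm a - norm b"] unfolding power2_sum power2_diff by linarith
 finally show ?thesis .
qed

lemma msq_cong: "(!!x. x \<in> space M ==> norm (f x) = norm (g x)) ==> msq M f = msq M g"
 unfolding msq_def by (intro nn_integral_cong) auto

lemma msq_cong_AE: "AE x in M. f x = g x ==> msq M f = msq M g"
 unfolding msq_def by (intro nn_integral_cong_AE) auto

lemma msq_mono_AE: "AE x in M. norm (f x) <= norm (g x) ==> msq M f <= msq M g"
 unfolding msq_def by (intro nn_integral_mono_AE) (auto elim!: eventually_mono intro!: ennreal_leI power_mono)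

lemma msq_add_le:
 assumes [measurable]: "f \<in> borel_measurable M" "g \<in> borel_measurable M"
 shows "msq M (%x. f x + g x) <= 2 * msq M f + 2 * msq M g"
proof -
 have "msq M (%x. f x + g x) <= (\<integral>\<^sup>+x. 2 * ennreal ((norm (f x))\<^sup>2) + 2 * ennreal ((norm (g x))\<^sup>2) \<partial>M)"
  unfolding msq_def
 proof (intro nn_integral_mono)
  fix x
  have "ennreal ((norm (f x + g x))\<^sup>2) <= ennreal (2 * (norm (f x))\<^sup>2 + 2 * (norm (g x))\<^sup>2)"
   by (intro ennreal_leI power2_norm_add_le)
  also have "\<dots> = 2 * ennreal ((norm (f x))\<^sup>2) + 2 * ennreal ((norm (g x))\<^sup>2)"
   by (simp add: ennreal_plus ennreal_mult)
  finally show "ennreal ((norm (f x + g x))\<^sup>2) <= 2 * ennreal ((norm (f x))\<^sup>2) + 2 * ennreal ((norm (g x))\<^sup>2)" .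
 qed
 also have "\<dots> = 2 * msq M f + 2 * msq M g"
  unfolding msq_def by (simp add: nn_integral_add nn_integral_cmult)
 finally show ?thesis .
qed

lemma msq_minus: "msq M (%x. - f x) = msq M f"
 unfolding msq_def by simp

lemma msq_minus_commute: "msq M (%x. f x - g x) = msq M (%x. g x - f x)"
 unfolding msq_def by (simp add: norm_minus_commute)

lemma msq_diff_le:
 assumes [measurable]: "f \<in> borel_measurable M" "g \<in> borel_measurable M"
 shows "msq M (%x. f x - g x) <= 2 * msq M f + 2 * msq M g"
 using msq_add_le[of f M "%x. - g x"] by (simp add: msq_minus)

lemma msq_triangle:
 assumes [measurable]: "f \<in> borel_measurable M" "g \<in> borel_measurable M" "k \<in> borel_measurable M"
 shows "msq M (%x. f x - g x) <= 2 * msq M (%x. f x - k x) + 2 * msq M (%x. k x - g x)"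
 using msq_add_le[of "%x. f x - k x" M "%x. k x - g x"] by simp

lemma msq_scaleR:
 assumes [measurable]: "f \<in> borel_measurable M"
 shows "msq M (%x. c *\<^sub>R f x) = ennreal (c\<^sup>2) * msq M f"
 unfolding msq_def
 by (subst nn_integral_cmult[symmetric]) (auto simp: power_mult_distrib ennreal_mult)

lemma power2_norm_sum_le:
 fixes f :: "'k => 'b::real_normed_vector"
 assumes "finite K"
 shows "(norm (\<Sum>k\<in>K. f k))\<^sup>2 <= real (card K) * (\<Sum>k\<in>K. (norm (f k))\<^sup>2)"
proof -
 have "(norm (\<Sum>k\<in>K. f k))\<^sup>2 <= (\<Sum>k\<in>K. norm (f k))\<^sup>2"
  by (intro power_mono norm_sum) auto
 also have "\<dots> <= (\<Sum>k\<in>K. (1::real)\<^sup>2) * (\<Sum>k\<in>K. (norm (f k))\<^sup>2)"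
  using Cauchy_Schwarz_ineq_sum[of "%_. 1::real" "%k. norm (f k)" K] by simp
 finally show ?thesis by simp
qed

lemma msq_sum_le:
 assumes "finite K" and [measurable]: "!!k. k \<in> K ==> f k \<in> borel_measurable M"
 shows "msq M (%x. \<Sum>k\<in>K. f k x) <= of_nat (card K) * (\<Sum>k\<in>K. msq M (f k))"
proof -
 have "msq M (%x. \<Sum>k\<in>K. f k x) <= (\<integral>\<^sup>+x. of_nat (card K) * (\<Sum>k\<in>K. ennreal ((norm (f k x))\<^sup>2)) \<partial>M)"
  unfolding msq_def
 proof (intro nn_integral_mono)
  fix x
  have "ennreal ((norm (\<Sum>k\<in>K. f k x))\<^sup>2) <= ennreal (real (card K) * (\<Sum>k\<in>K. (norm (f k x))\<^sup>2))"
   by (intro ennreal_leI power2_norm_sum_le assms)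
  also have "\<dots> = of_nat (card K) * (\<Sum>k\<in>K. ennreal ((norm (f k x))\<^sup>2))"
   by (simp add: ennreal_mult sum_nonneg sum_ennreal ennreal_of_nat_eq_real_of_nat)
  finally show "ennreal ((norm (\<Sum>k\<in>K. f k x))\<^sup>2) <= of_nat (card K) * (\<Sum>k\<in>K. ennreal ((norm (f k x))\<^sup>2))" .
 qed
 also have "\<dots> = of_nat (card K) * (\<Sum>k\<in>K. msq M (f k))"
  unfolding msq_def by (subst nn_integral_cmult) (auto simp: nn_integral_sum simp del: sum_ennreal)
 finally show ?thesis .
qed

lemma msq_sum_Basis:
 fixes f :: "'a => 'b::euclidean_space"
 assumes [measurable]: "f \<in> borel_measurable M"
 shows "msq M f = (\<Sum>b\<in>Basis. msq M (%x. f x \<bullet> b))"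
proof -
 have norm_sum: "ennreal ((norm v)\<^sup>2) = (\<Sum>b\<in>Basis. ennreal ((norm (v \<bullet> b))\<^sup>2))" for v :: 'b
 proof -
  have "(norm v)\<^sup>2 = (\<Sum>b\<in>Basis. (v \<bullet> b) * (v \<bullet> b))"
   unfolding power2_norm_eq_inner by (rule euclidean_inner)
  then show ?thesis by (simp add: sum_ennreal power2_eq_square)
 qed
 have "msq M f = (\<integral>\<^sup>+x. (\<Sum>b\<in>Basis. ennreal ((norm (f x \<bullet> b))\<^sup>2)) \<partial>M)"
  unfolding msq_def by (intro nn_integral_cong norm_sum)
 also have "\<dots> = (\<Sum>b\<in>Basis. msq M (%x. f x \<bullet> b))"
  unfolding msq_def by (subst nn_integral_sum) auto
 finally show ?thesis .
qed

lemma msq_finite_integrable: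
 fixes f g :: "'a => 'b::euclidean_space"
 assumes [measurable]: "f \<in> borel_measurable M" "g \<in> borel_measurable M"
  and "msq M f < \<infinity>" "msq M g < \<infinity>"
 shows "integrable M (%x. f x \<bullet> g x)"
proof (rule integrableI_bounded)
 have "(\<integral>\<^sup>+x. ennreal (norm (f x \<bullet> g x)) \<partial>M) <= (\<integral>\<^sup>+x. ennreal ((norm (f x))\<^sup>2) + ennreal ((norm (g x))\<^sup>2) \<partial>M)"
 proof (intro nn_integral_mono)
  fix x
  have "norm (f x \<bullet> g x) <= norm (f x) * norm (g x)" by (simp add: Cauchy_Schwarz_ineq2)
  also have "\<dots> <= (norm (f x))\<^sup>2 + (norm (g x))\<^sup>2"
   using sum_squares_bound[of "norm (f x)" "norm (g x)"] mult_nonneg_nonneg[OF norm_ge_zero[of "f x"] norm_ge_zero[of "g x"]]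
   by linarith
  finally have "ennreal (norm (f x \<bullet> g x)) <= ennreal ((norm (f x))\<^sup>2 + (norm (g x))\<^sup>2)"
   by (rule ennreal_leI)
  then show "ennreal (norm (f x \<bullet> g x)) <= ennreal ((norm (f x))\<^sup>2) + ennreal ((norm (g x))\<^sup>2)"
   by (simp add: ennreal_plus)
 qed
 also have "\<dots> = msq M f + msq M g" unfolding msq_def by (rule nn_integral_add) auto
 also have "\<dots> < \<infinity>" using assms by simp
 finally show "(\<integral>\<^sup>+x. ennreal (norm (f x \<bullet> g x)) \<partial>M) < \<infinity>" .
qed simp

lemma msq_eq_integral:
 assumes [measurable]: "f \<in> borel_measurable M" and "msq M f < \<infinity>"
 shows "msq M f = ennreal (\<integral>x. (norm (f x))\<^sup>2 \<partial>M)"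
 unfolding msq_def
proof (rule nn_integral_eq_integral)
 show "integrable M (%x. (norm (f x))\<^sup>2)"
  using msq_finite_integrable[OF assms(1,1,2,2)] by (simp add: power2_norm_eq_inner)
qed simp

lemma (in finite_measure) msq_bounded:
 assumes "AE x in M. norm (f x) <= c"
 shows "msq M f <= ennreal (c\<^sup>2) * emeasure M (space M)"
proof -
 have "msq M f <= (\<integral>\<^sup>+x. ennreal (c\<^sup>2) \<partial>M)" unfolding msq_def
  using assms by (intro nn_integral_mono_AE) (auto elim!: eventually_mono intro!: ennreal_leI power_mono)
 then show ?thesis by simp
qed

lemma (in prob_space) msq_finite_integrable1:
 fixes f :: "'a => 'b::euclidean_space"
 assumes [measurable]: "f \<in> borel_measurable M" and "msq M f < \<infinity>"
 shows "integrable M f"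
proof (rule integrableI_bounded)
 have "(\<integral>\<^sup>+x. ennreal (norm (f x)) \<partial>M) <= (\<integral>\<^sup>+x. 1 + ennreal ((norm (f x))\<^sup>2) \<partial>M)"
 proof (intro nn_integral_mono)
  fix x
  have "norm (f x) <= 1 + (norm (f x))\<^sup>2"
   using zero_le_power2[of "norm (f x) - 1/2"] unfolding power2_diff by (simp add: power2_eq_square field_simps)
  then show "ennreal (norm (f x)) <= 1 + ennreal ((norm (f x))\<^sup>2)"
   by (metis ennreal_1 ennreal_leI ennreal_plus zero_le_one zero_le_power2)
 qed
 also have "\<dots> = 1 + msq M f" unfolding msq_def by (subst nn_integral_add) (auto simp: emeasure_space_1)
 also have "\<dots> < \<infinity>" using assms by simp
 finally show "(\<integral>\<^sup>+x. ennreal (norm (f x)) \<partial>M) < \<infinity>" .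
qed simp

lemma AE_tendsto_0_of_summable_msq:
 fixes f :: "nat => 'a => 'b::euclidean_space"
 assumes [measurable]: "!!n. f n \<in> borel_measurable M" and "(\<Sum>n. msq M (f n)) < \<infinity>"
 shows "AE x in M. (%n. f n x) \<longlonglongrightarrow> 0"
proof -
 have "(\<integral>\<^sup>+x. (\<Sum>n. ennreal ((norm (f n x))\<^sup>2)) \<partial>M) \<noteq> \<infinity>"
  using assms(2) unfolding msq_def by (subst nn_integral_suminf) auto
 then have "AE x in M. (\<Sum>n. ennreal ((norm (f n x))\<^sup>2)) \<noteq> \<infinity>"
  by (intro nn_integral_PInf_AE) auto
 then show ?thesis
 proof eventually_elim
  case (elim x)
  then have "summable (%n. (norm (f n x))\<^sup>2)"
   by (intro summable_suminf_not_top) auto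
  then have "(%n. (norm (f n x))\<^sup>2) \<longlonglongrightarrow> 0" by (rule summable_LIMSEQ_zero)
  then have "(%n. sqrt ((norm (f n x))\<^sup>2)) \<longlonglongrightarrow> sqrt 0" by (rule tendsto_real_sqrt)
  then show ?case by (simp add: tendsto_norm_zero_iff)
 qed
qed

lemma ex_summable_subseq_0:
 fixes a :: "nat => ennreal"
 assumes "a \<longlonglongrightarrow> 0"
 shows "\<exists>s. strict_mono s \<and> (\<forall>k. a (s k) <= ennreal ((1/2)^k))"
proof -
 have "\<exists>N. \<forall>n\<ge>N. a n <= ennreal ((1/2)^k)" for k
 proof -
  have "eventually (%n. a n < ennreal ((1/2)^k)) sequentially"
   by (rule order_tendstoD(2)[OF assms]) simp
  then show ?thesis unfolding eventually_sequentially by (meson less_imp_le)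
 qed
 then obtain N where N: "!!k n. n >= N k ==> a n <= ennreal ((1/2)^k)" by metis
 define s where "s k = k + (\<Sum>j\<le>k. N j)" for k
 have "strict_mono s" unfolding s_def strict_mono_Suc_iff by simp
 moreover have "N k <= s k" for k
  unfolding s_def using member_le_sum[of k "{..k}" N] by simp
 ultimately show ?thesis using N by blast
qed

lemma suminf_half_powers_finite: "(\<Sum>k. ennreal ((1/2)^k)) < \<infinity>"
proof -
 have "summable (%k. (1/2::real)^k)" by (rule summable_geometric) simp
 then show ?thesis by (subst suminf_ennreal2) auto
qed

lemma msq_limit_AE_subseq:
 fixes f :: "nat => 'a => 'b::euclidean_space"
 assumes [measurable]: "!!n. f n \<in> borel_measurable M" "g \<in> borel_measurable M"
  and "(%n. msq M (%x. f n x - g x)) \<longlonglongrightarrow> 0"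
 shows "\<exists>s. strict_mono s \<and> (AE x in M. (%k. f (s k) x) \<longlonglongrightarrow> g x)"
proof -
 obtain s where s: "strict_mono s" "!!k. msq M (%x. f (s k) x - g x) <= ennreal ((1/2)^k)"
  using ex_summable_subseq_0[OF assms(3)] by auto
 have "AE x in M. (%k. f (s k) x - g x) \<longlonglongrightarrow> 0"
 proof (rule AE_tendsto_0_of_summable_msq)
  have "(\<Sum>k. msq M (%x. f (s k) x - g x)) <= (\<Sum>k. ennreal ((1/2)^k))"
   by (intro suminf_le s) auto
  also have "\<dots> < \<infinity>" by (rule suminf_half_powers_finite)
  finally show "(\<Sum>k. msq M (%x. f (s k) x - g x)) < \<infinity>" .
 qed simp
 then have "AE x in M. (%k. f (s k) x) \<longlonglongrightarrow> g x"
  by eventually_elim (simp add: LIM_zero_cancel)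
 with s show ?thesis by blast
qed

lemma msq_limit_eq_AE_limit:
 fixes f :: "nat => 'a => 'b::euclidean_space"
 assumes "!!n. f n \<in> borel_measurable M" "g \<in> borel_measurable M"
  and "(%n. msq M (%x. f n x - g x)) \<longlonglongrightarrow> 0"
  and "AE x in M. (%n. f n x) \<longlonglongrightarrow> g' x"
 shows "AE x in M. g x = g' x"
proof -
 obtain s where s: "strict_mono s" "AE x in M. (%k. f (s k) x) \<longlonglongrightarrow> g x"
  using msq_limit_AE_subseq[OF assms(1-3)] by auto
 show ?thesis using s(2) assms(4)
 proof eventually_elim
  case (elim x)
  have "(%k. f (s k) x) \<longlonglongrightarrow> g' x"
   using LIMSEQ_subseq_LIMSEQ[OF elim(2) s(1)] by (simp add: o_def)
  with elim(1) show ?case by (rule LIMSEQ_unique)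
 qed
qed

text \<open>Mean-square convergence on a probability space implies convergence in mean, so expectations pass to the limit.\<close>

lemma (in prob_space) msq_limit_tendsto_expectation:
 fixes f :: "nat => 'a => 'b::euclidean_space"
 assumes fi: "!!n. integrable M (f n)" and gm [measurable]: "g \<in> borel_measurable M"
  and lim: "(%n. msq M (%x. g x - f n x)) \<longlonglongrightarrow> 0" and e: "(%n. expectation (f n)) \<longlonglongrightarrow> l"
 shows "integrable M g" "expectation g = l"
proof -
 have fm [measurable]: "f n \<in> borel_measurable M" for n using fi by (rule borel_measurable_integrable)
 have ev: "eventually (%n. msq M (%x. g x - f n x) < 1) sequentially"
  by (rule order_tendstoD(2)[OF lim]) simp
 then obtain n where "msq M (%x. g x - f n x) < 1" by (auto simp: eventually_sequentially)
 then have "integrable M (%x. g x - f n x)" by (intro msq_finite_integrable1) (auto intro: less_trans)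
 from Bochner_Integration.integrable_add[OF this fi[of n]] show gi: "integrable M g" by simp
 have b: "ennreal ((norm (expectation g - expectation (f n)))\<^sup>2) <= msq M (%x. g x - f n x)" for n
 proof (cases "msq M (%x. g x - f n x) < \<infinity>")
  case True
  have i2: "integrable M (%x. (norm (g x - f n x))\<^sup>2)"
   using msq_finite_integrable[of "%x. g x - f n x" M "%x. g x - f n x"] True by (simp add: power2_norm_eq_inner)
  have i1: "integrable M (%x. norm (g x - f n x))" using gi fi[of n] by simp
  have "norm (expectation g - expectation (f n)) = norm (expectation (%x. g x - f n x))" using gi fi[of n] by simp
  also have "\<dots> <= expectation (%x. norm (g x - f n x))" by (rule integral_norm_bound)
  finally have "(norm (expectation g - expectation (f n)))\<^sup>2 <= (expectation (%x. norm (g x - f n x)))\<^sup>2" by (intro power_mono) auto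
  also have "\<dots> <= expectation (%x. (norm (g x - f n x))\<^sup>2)"
  proof -
   have "0 <= variance (%x. norm (g x - f n x))" by (rule variance_positive)
   then show ?thesis using variance_eq[OF i1 i2] by simp
  qed
  finally show ?thesis using msq_eq_integral[OF _ True] by (auto intro: ennreal_leI)
 qed (simp add: less_top[symmetric])
 have z: "(%n. ennreal ((norm (expectation g - expectation (f n)))\<^sup>2)) \<longlonglongrightarrow> 0"
  by (rule tendsto_sandwich[OF always_eventually[OF allI[OF zero_le]] always_eventually[OF allI[OF b]] tendsto_const lim])
 have "(%n. ennreal ((norm (expectation g - expectation (f n)))\<^sup>2)) \<longlonglongrightarrow> ennreal ((norm (expectation g - l))\<^sup>2)"
  by (intro tendsto_intros e)
 from LIMSEQ_unique[OF this z] show "expectation g = l" by simp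
qed

section \<open>A strong law of large numbers\<close>

lemma (in prob_space) msq_sum_uncorrelated:
 fixes X :: "'i => 'a => real"
 assumes [measurable]: "!!i. i \<in> I ==> X i \<in> borel_measurable M"
  and bd: "!!i. i \<in> I ==> msq M (X i) <= ennreal v"
  and unc: "!!i j. i \<in> I ==> j \<in> I ==> i \<noteq> j ==> expectation (%x. X i x * X j x) = 0"
  and "finite I" "v >= 0"
 shows "msq M (%x. \<Sum>i\<in>I. X i x) <= ennreal (real (card I) * v)"
proof -
 have fin: "msq M (X i) < \<infinity>" if "i \<in> I" for i
  using bd[OF that] by (auto intro: le_less_trans)
 have ii: "integrable M (%x. X i x * X j x)" if "i \<in> I" "j \<in> I" for i j
  using msq_finite_integrable[of "X i" M "X j"] fin that by auto
 have fs: "msq M (%x. \<Sum>i\<in>I. X i x) < \<infinity>"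
  using msq_sum_le[of I X M] assms(4) fin
  by (auto simp: ennreal_mult_less_top of_nat_less_top intro!: le_less_trans[OF msq_sum_le])
 have "(\<integral>x. (norm (\<Sum>i\<in>I. X i x))\<^sup>2 \<partial>M) = (\<integral>x. (\<Sum>i\<in>I. \<Sum>j\<in>I. X i x * X j x) \<partial>M)"
  by (simp add: power2_eq_square sum_product)
 also have "\<dots> = (\<Sum>i\<in>I. \<Sum>j\<in>I. expectation (%x. X i x * X j x))"
  using ii by (simp add: integral_sum integrable_sum)
 also have "\<dots> = (\<Sum>i\<in>I. \<Sum>j\<in>I. if i = j then expectation (%x. X i x * X i x) else 0)"
  using unc by (intro sum.cong) auto
 also have "\<dots> = (\<Sum>i\<in>I. expectation (%x. X i x * X i x))" using assms(4) by simp
 also have "\<dots> <= (\<Sum>i\<in>I. v)"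
 proof (rule sum_mono)
  fix i assume "i \<in> I"
  have "ennreal (expectation (%x. X i x * X i x)) <= ennreal v"
   using bd[OF \<open>i \<in> I\<close>] msq_eq_integral[of "X i" M] fin[OF \<open>i \<in> I\<close>] \<open>i \<in> I\<close> by (simp add: power2_eq_square)
  then show "expectation (%x. X i x * X i x) <= v" using assms(5) by simp
 qed
 finally show ?thesis using msq_eq_integral[OF _ fs] by (auto intro!: ennreal_leI)
qed

lemma summable_inverse_squares_ennreal:
 fixes a :: "nat => ennreal"
 assumes "!!n. a n <= ennreal (c / real (Suc n)^2)" and "c >= 0"
 shows "(\<Sum>n. a n) < \<infinity>"
proof -
 have "summable (%n. c * (1 / real (Suc n)^2))"
  using inverse_power_summable[of 2, where 'a=real] 
  by (intro summable_mult) (simp add: summable_Suc_iff[of "%n. 1 / real n ^ 2"] inverse_eq_divide del: of_nat_Suc)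
 then have s: "summable (%n. c / real (Suc n)^2)" by simp
 have "(\<Sum>n. a n) <= (\<Sum>n. ennreal (c / real (Suc n)^2))" by (intro suminf_le assms) auto
 also have "\<dots> < \<infinity>" using s assms(2) by (subst suminf_ennreal2) auto
 finally show ?thesis .
qed

lemma abs_sum_between_le:
 fixes a :: "nat => real"
 assumes "m <= N" "N <= n"
 shows "\<bar>\<Sum>i=1..N. a i\<bar> <= \<bar>\<Sum>i=1..m. a i\<bar> + (\<Sum>i=m+1..n. \<bar>a i\<bar>)"
proof -
 have "(\<Sum>i=1..N. a i) = (\<Sum>i=1..m. a i) + (\<Sum>i=m+1..N. a i)"
  using sum.ub_add_nat[of 1 m a "N - m"] assms by simp
 moreover have "\<bar>\<Sum>i=m+1..N. a i\<bar> <= (\<Sum>i=m+1..N. \<bar>a i\<bar>)" by (rule sum_abs)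
 moreover have "(\<Sum>i=m+1..N. \<bar>a i\<bar>) <= (\<Sum>i=m+1..n. \<bar>a i\<bar>)"
  using assms by (intro sum_mono2) auto
 ultimately show ?thesis by linarith
qed

text \<open>Pairwise uncorrelated variables suffice because only second moments are used. Along the squares n = k^2 the second
moments of the averages are of order 1/k^2, hence summable. Between consecutive squares the average moves by at most the
sum of the absolute values over a block of length of order k divided by k^2, and these quantities are summable in mean square too.\<close>

lemma (in prob_space) slln_uncorrelated_centred:
 fixes X :: "nat => 'a => real"
 assumes [measurable]: "!!i. i >= 1 ==> X i \<in> borel_measurable M"
  and bd: "!!i. i >= 1 ==> msq M (X i) <= ennreal v"
  and unc: "!!i j. i >= 1 ==> j >= 1 ==> i \<noteq> j ==> expectation (%x. X i x * X j x) = 0"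
  and "v >= 0"
 shows "AE x in M. (%N. (1 / real N) * (\<Sum>i=1..N. X i x)) \<longlonglongrightarrow> 0"
proof -
 define f where "f n x = (1 / real (Suc n)^2) *\<^sub>R (\<Sum>i=1..(Suc n)^2. X i x)" for n x
 define g where "g n x = (1 / real (Suc n)^2) *\<^sub>R (\<Sum>i=(Suc n)^2+1..(Suc n+1)^2. \<bar>X i x\<bar>)" for n x
 have [measurable]: "f n \<in> borel_measurable M" "g n \<in> borel_measurable M" for n
  unfolding f_def g_def by (intro borel_measurable_scaleR borel_measurable_sum borel_measurable_abs; simp)+
 have card_scale: "(1 / m^2)\<^sup>2 * (m^2 * v) = v / m^2" "(1 / m^2)\<^sup>2 * ((3 * m) * ((3 * m) * v)) = 9 * v / m^2"
  if "m > 0" for m :: real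
  using that by (simp_all add: power2_eq_square field_simps)
 have "AE x in M. (%n. f n x) \<longlonglongrightarrow> 0"
 proof (rule AE_tendsto_0_of_summable_msq)
  show "(\<Sum>n. msq M (f n)) < \<infinity>"
  proof (rule summable_inverse_squares_ennreal[of _ v])
   fix n
   have "msq M (f n) = ennreal ((1 / real (Suc n)^2)\<^sup>2) * msq M (%x. \<Sum>i=1..(Suc n)^2. X i x)"
    unfolding f_def by (rule msq_scaleR) simp
   also have "\<dots> <= ennreal ((1 / real (Suc n)^2)\<^sup>2) * ennreal (real (card {1..(Suc n)^2}) * v)"
    by (intro mult_left_mono msq_sum_uncorrelated) (auto intro: bd unc assms)
   also have "\<dots> = ennreal (v / real (Suc n)^2)"
    using assms(4) by (subst ennreal_mult[symmetric]) (auto simp: card_scale simp del: of_nat_Suc)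
   finally show "msq M (f n) <= ennreal (v / real (Suc n)^2)" .
  qed fact
 qed simp
 moreover have "AE x in M. (%n. g n x) \<longlonglongrightarrow> 0"
 proof (rule AE_tendsto_0_of_summable_msq)
  show "(\<Sum>n. msq M (g n)) < \<infinity>"
  proof (rule summable_inverse_squares_ennreal[of _ "9 * v"])
   fix n
   let ?m = "real (Suc n)"
   let ?I = "{(Suc n)^2+1..(Suc n+1)^2}"
   have c: "card ?I = 2 * Suc n + 1" by (simp add: power2_eq_square)
   have "msq M (g n) = ennreal ((1 / ?m^2)\<^sup>2) * msq M (%x. \<Sum>i\<in>?I. \<bar>X i x\<bar>)"
    unfolding g_def by (rule msq_scaleR) (intro borel_measurable_sum borel_measurable_abs, simp)
   also have "\<dots> <= ennreal ((1 / ?m^2)\<^sup>2) * (of_nat (card ?I) * (\<Sum>i\<in>?I. msq M (%x. \<bar>X i x\<bar>)))"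
    by (intro mult_left_mono msq_sum_le borel_measurable_abs) auto
   also have "\<dots> <= ennreal ((1 / ?m^2)\<^sup>2) * (of_nat (card ?I) * (\<Sum>i\<in>?I. ennreal v))"
   proof (intro mult_left_mono sum_mono)
    fix i assume "i \<in> ?I"
    then show "msq M (%x. \<bar>X i x\<bar>) <= ennreal v" using bd[of i] by (simp add: msq_def)
   qed auto
   also have "\<dots> = ennreal ((1 / ?m^2)\<^sup>2 * (real (card ?I) * (real (card ?I) * v)))"
    using assms(4) by (simp add: ennreal_mult ennreal_of_nat_eq_real_of_nat del: card_atLeastAtMost of_nat_Suc)
   also have "\<dots> <= ennreal (9 * v / ?m^2)"
   proof (rule ennreal_leI)
    have "real (card ?I) <= 3 * ?m" unfolding c by simp
    then have "real (card ?I) * (real (card ?I) * v) <= (3 * ?m) * ((3 * ?m) * v)"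
     using assms(4) by (intro mult_mono) auto
    then have "(1 / ?m^2)\<^sup>2 * (real (card ?I) * (real (card ?I) * v)) <= (1 / ?m^2)\<^sup>2 * ((3 * ?m) * ((3 * ?m) * v))"
     by (intro mult_left_mono) auto
    also have "\<dots> = 9 * v / ?m^2" by (intro card_scale) simp
    finally show "(1 / ?m^2)\<^sup>2 * (real (card ?I) * (real (card ?I) * v)) <= 9 * v / ?m^2" .
   qed
   finally show "msq M (g n) <= ennreal (9 * v / real (Suc n)^2)" .
  qed (use assms in auto)
 qed simp
 ultimately show ?thesis
 proof eventually_elim
  case (elim x)
  \<comment> \<open>the consecutive squares (m N + 1)^2 and (m N + 2)^2 enclose N\<close>
  define m where "m N = floor_sqrt N - 1" for N :: nat
  have m: "(Suc (m N))^2 <= N \<and> N <= (Suc (m N) + 1)^2" if "N >= 1" for N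
  proof -
   have "1 <= floor_sqrt N" using le_floor_sqrt_iff[of 1 N] that by simp
   then have k: "Suc (m N) = floor_sqrt N" unfolding m_def by simp
   show ?thesis unfolding k using floor_sqrt_power2_le[of N] Suc_floor_sqrt_power2_gt[of N] by simp
  qed
  have mlim: "filterlim m at_top sequentially"
   unfolding filterlim_at_top
  proof
   fix K
   show "\<forall>\<^sub>F N in sequentially. K <= m N"
    unfolding eventually_sequentially
   proof (intro exI allI impI)
    fix N assume N: "(K + 1)^2 <= N"
    then have "K + 1 <= floor_sqrt N" by (simp add: le_floor_sqrt_iff)
    then show "K <= m N" unfolding m_def by simp
   qed
  qed
  have l0: "(%N. \<bar>f (m N) x\<bar> + g (m N) x) \<longlonglongrightarrow> 0"
   using tendsto_add[OF tendsto_rabs[OF filterlim_compose[OF elim(1) mlim]] filterlim_compose[OF elim(2) mlim]]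
   by simp
  show ?case
  proof (rule Lim_null_comparison[OF _ l0])
   show "\<forall>\<^sub>F N in sequentially. norm ((1 / real N) * (\<Sum>i=1..N. X i x)) <= \<bar>f (m N) x\<bar> + g (m N) x"
    unfolding eventually_sequentially
   proof (intro exI allI impI)
    fix N :: nat assume N: "1 <= N"
    let ?k = "Suc (m N)"
    have k: "?k^2 <= N" "N <= (?k+1)^2" using m[OF N] by auto
    have "\<bar>\<Sum>i=1..N. X i x\<bar> <= \<bar>\<Sum>i=1..?k^2. X i x\<bar> + (\<Sum>i=?k^2+1..(?k+1)^2. \<bar>X i x\<bar>)"
     by (rule abs_sum_between_le[OF k])
    moreover have "1 / real N <= 1 / real ?k^2"
    proof (rule divide_left_mono)
     show "real ?k^2 <= real N" using k(1) by (metis of_nat_le_iff of_nat_power)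
     show "0 < real N * real ?k^2" using N by (simp only: zero_less_mult_iff zero_less_power of_nat_0_less_iff) simp
    qed simp
    ultimately have "1 / real N * \<bar>\<Sum>i=1..N. X i x\<bar> \<le>
      1 / real ?k^2 * (\<bar>\<Sum>i=1..?k^2. X i x\<bar> + (\<Sum>i=?k^2+1..(?k+1)^2. \<bar>X i x\<bar>))"
     by (intro mult_mono) (simp_all only: abs_ge_zero zero_le_divide_1_iff zero_le_power2)
    also have "\<dots> = 1 / real ?k^2 * \<bar>\<Sum>i=1..?k^2. X i x\<bar> + 1 / real ?k^2 * (\<Sum>i=?k^2+1..(?k+1)^2. \<bar>X i x\<bar>)"
     by (rule distrib_left)
    also have "\<dots> = \<bar>f (m N) x\<bar> + g (m N) x"
     unfolding f_def g_def real_scaleR_def abs_mult by (simp only: abs_of_nonneg zero_le_divide_1_iff zero_le_power2)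
    finally show "norm ((1 / real N) * (\<Sum>i=1..N. X i x)) <= \<bar>f (m N) x\<bar> + g (m N) x"
     by (simp only: real_norm_def abs_mult abs_of_nonneg zero_le_divide_1_iff of_nat_0_le_iff)
   qed
  qed
 qed
qed

lemma borel_measurable_continuous_in_time:
 fixes f :: "real => 'w => 'b::euclidean_space"
 assumes "!!x. x \<in> space M ==> continuous_on UNIV (%t. f t x)" and [measurable]: "!!t. f t \<in> borel_measurable M"
 shows "(%(t, x). f t x) \<in> borel_measurable (borel \<Otimes>\<^sub>M M)"
proof (rule borel_measurable_LIMSEQ_metric)
 fix n :: nat
 have "(%p. (%i p. f (real_of_int i / real (Suc n)) (snd p)) \<lfloor>real (Suc n) * fst p\<rfloor> p)
   \<in> borel_measurable (borel \<Otimes>\<^sub>M M)"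
  by (rule measurable_compose_countable) measurable
 then show "(%p. f (real_of_int \<lfloor>real (Suc n) * fst p\<rfloor> / real (Suc n)) (snd p)) \<in> borel_measurable (borel \<Otimes>\<^sub>M M)"
  by simp
next
 fix p :: "real \<times> 'w" assume "p \<in> space (borel \<Otimes>\<^sub>M M)"
 then obtain t x where p: "p = (t, x)" "x \<in> space M" by (auto simp: space_pair_measure)
 have dist_scale: "\<bar>a - m * b\<bar> / m = \<bar>a / m - b\<bar>" if "m > 0" for a b m :: real
 proof -
  have "a / m - b = (a - m * b) / m" using that by (simp add: field_simps)
  then show ?thesis using that by (simp add: abs_divide)
 qed
 have "(%n. real_of_int \<lfloor>real (Suc n) * t\<rfloor> / real (Suc n) - t) \<longlonglongrightarrow> 0"
 proof (rule Lim_null_comparison)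
  show "\<forall>\<^sub>F n in sequentially. norm (real_of_int \<lfloor>real (Suc n) * t\<rfloor> / real (Suc n) - t) <= 1 / real (Suc n)"
  proof (intro always_eventually allI)
   fix n :: nat
   have "\<bar>real_of_int \<lfloor>real (Suc n) * t\<rfloor> - real (Suc n) * t\<bar> <= 1" by linarith
   then have "\<bar>real_of_int \<lfloor>real (Suc n) * t\<rfloor> - real (Suc n) * t\<bar> / real (Suc n) <= 1 / real (Suc n)"
    by (intro divide_right_mono) auto
   also have "\<bar>real_of_int \<lfloor>real (Suc n) * t\<rfloor> - real (Suc n) * t\<bar> / real (Suc n) =
     norm (real_of_int \<lfloor>real (Suc n) * t\<rfloor> / real (Suc n) - t)"
    using dist_scale[of "real (Suc n)" "real_of_int \<lfloor>real (Suc n) * t\<rfloor>" t] by (simp del: of_nat_Suc)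
   finally show "norm (real_of_int \<lfloor>real (Suc n) * t\<rfloor> / real (Suc n) - t) <= 1 / real (Suc n)" .
  qed
  show "(%n. 1 / real (Suc n)) \<longlonglongrightarrow> 0" by (rule LIMSEQ_Suc[OF lim_1_over_n])
 qed
 then have "(%n. real_of_int \<lfloor>real (Suc n) * t\<rfloor> / real (Suc n)) \<longlonglongrightarrow> t" by (rule LIM_zero_cancel)
 moreover have "isCont (%t. f t x) t" using assms(1)[OF p(2)] by (simp add: continuous_on_eq_continuous_at)
 ultimately show "(%n. f (real_of_int \<lfloor>real (Suc n) * fst p\<rfloor> / real (Suc n)) (snd p)) \<longlonglongrightarrow> (case p of (t, x) => f t x)"
  unfolding p by (auto intro: isCont_tendsto_compose)
qed

text \<open>A process given only up to null sets and only on the time interval is replaced by one that is continuous at every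
outcome and jointly measurable: time is clamped to the interval, and on a measurable null set of bad outcomes the path is the constant c.\<close>

lemma continuous_modification:
 fixes Z :: "real => 'w => 'b::euclidean_space"
 assumes "T >= 0" and Zm: "!!t. t \<in> {0..T} ==> Z t \<in> borel_measurable M"
  and cont: "AE x in M. continuous_on {0..T} (%t. Z t x)"
  and S: "AE x in M. \<forall>t\<in>{0..T}. Z t x \<in> S" and "c \<in> S"
 obtains Z' where "!!t x. Z' t x \<in> S" "!!x. continuous_on UNIV (%t. Z' t x)"
  "!!t. Z' t \<in> borel_measurable M" "(%(t, x). Z' t x) \<in> borel_measurable (borel \<Otimes>\<^sub>M M)"
  "AE x in M. \<forall>t\<in>{0..T}. Z t x = Z' t x"
proof -
 have "AE x in M. continuous_on {0..T} (%t. Z t x) \<and> (\<forall>t\<in>{0..T}. Z t x \<in> S)"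
  using cont S by eventually_elim auto
 then obtain N where N: "{x \<in> space M. \<not> (continuous_on {0..T} (%t. Z t x) \<and> (\<forall>t\<in>{0..T}. Z t x \<in> S))} \<subseteq> N"
  "emeasure M N = 0" "N \<in> sets M"
  by (rule AE_E)
 define cl where "cl t = max 0 (min T t)" for t :: real
 have cl: "cl t \<in> {0..T}" for t unfolding cl_def using \<open>T >= 0\<close> by auto
 have cl_id: "cl t = t" if "t \<in> {0..T}" for t unfolding cl_def using that by auto
 have cl_cont: "continuous_on UNIV cl" unfolding cl_def by (intro continuous_intros)
 define Z' where "Z' t x = (if x \<in> space M - N then Z (cl t) x else c)" for t x
 have good: "continuous_on {0..T} (%t. Z t x)" "\<forall>t\<in>{0..T}. Z t x \<in> S" if "x \<in> space M - N" for x
  using N(1) that by blast+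
 have 1: "Z' t x \<in> S" for t x
  unfolding Z'_def using good(2)[of x] cl[of t] \<open>c \<in> S\<close> by (cases "x \<in> space M - N") auto
 have 2: "continuous_on UNIV (%t. Z' t x)" for x
 proof (cases "x \<in> space M - N")
  case True
  from good(1)[OF this] have "continuous_on UNIV (%t. Z (cl t) x)"
   by (rule continuous_on_compose2[OF _ cl_cont]) (use cl in auto)
  then show ?thesis using True by (simp add: Z'_def)
 next
  case False
  then have "Z' t x = c" for t by (simp only: Z'_def if_False)
  then show ?thesis by (auto intro: continuous_on_eq[OF continuous_on_const[of UNIV c]])
 qed
 have 3: "Z' t \<in> borel_measurable M" for t
 proof -
  have [measurable]: "Z (cl t) \<in> borel_measurable M" "N \<in> sets M" using Zm cl N by auto
  show ?thesis unfolding Z'_def by measurable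
 qed
 have 4: "(%(t, x). Z' t x) \<in> borel_measurable (borel \<Otimes>\<^sub>M M)"
  by (rule borel_measurable_continuous_in_time) (auto intro: 2 3)
 have "N \<in> null_sets M" using N by auto
 then have 5: "AE x in M. \<forall>t\<in>{0..T}. Z t x = Z' t x"
  by (intro AE_I'[of N]) (auto simp: Z'_def cl_id)
 show thesis using that[of Z'] 1 2 3 4 5 by blast
qed

section \<open>Uniform grids and Riemann sums\<close>

definition grid :: "real => nat => nat => real" where
 "grid t n j = t * (real j / real n)"

lemma grid_0 [simp]: "grid t n 0 = 0" by (simp add: grid_def)

lemma grid_last [simp]: "n >= 1 ==> grid t n n = t" by (simp add: grid_def)

lemma grid_mono: "t >= 0 ==> i <= j ==> grid t n i <= grid t n j"
 unfolding grid_def by (intro mult_left_mono divide_right_mono) auto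

lemma grid_in: "t >= 0 ==> j <= n ==> n >= 1 ==> grid t n j \<in> {0..t}"
 using grid_mono[of t 0 j n] grid_mono[of t j n n] by simp

lemma grid_step: "grid t n (Suc j) - grid t n j = t / real n"
 unfolding grid_def by (simp add: field_simps add_divide_distrib)

lemma grid_index:
 assumes "0 < s" "s <= t" "n >= 1"
 obtains j where "j < n" "s \<in> {grid t n j<..grid t n (Suc j)}"
proof -
 define P where "P j \<longleftrightarrow> s <= grid t n j" for j
 have Pn: "P n" using assms by (simp add: P_def)
 define k where "k = (LEAST j. P j)"
 have k: "P k" unfolding k_def using Pn by (rule LeastI)
 have "k \<noteq> 0" using k assms(1) unfolding P_def by (cases k) auto
 then obtain j where j: "k = Suc j" by (cases k) auto
 have "\<not> P j" using not_less_Least[of j P] j unfolding k_def by simp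
 moreover have "k <= n" unfolding k_def using Pn by (rule Least_le)
 ultimately show ?thesis using that[of j] k j by (auto simp: P_def)
qed

lemma grid_index_unique:
 assumes "t >= 0" "s \<in> {grid t n j<..grid t n (Suc j)}" "s \<in> {grid t n i<..grid t n (Suc i)}"
 shows "i = j"
proof (rule ccontr)
 assume "i \<noteq> j"
 then consider "Suc i <= j" | "Suc j <= i" by linarith
 then show False using grid_mono[OF assms(1), of "Suc i" j n] grid_mono[OF assms(1), of "Suc j" i n] assms
  by cases auto
qed

lemma simple_process_grid:
 assumes "0 <= t" "j < m" "s \<in> {grid t n j<..grid t n (Suc j)}"
 shows "simple_process m (grid t n) \<xi> s x = \<xi> j x"
proof -
 have "simple_process m (grid t n) \<xi> s x = (\<Sum>i<m. if i = j then \<xi> j x else 0)"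
  unfolding simple_process_def
 proof (intro sum.cong refl)
  fix i
  show "indicat_real {grid t n i<..grid t n (Suc i)} s *\<^sub>R \<xi> i x = (if i = j then \<xi> j x else 0)"
  proof (cases "i = j")
   case True
   then show ?thesis using assms(3) by simp
  next
   case False
   then have "s \<notin> {grid t n i<..grid t n (Suc i)}" using grid_index_unique[OF assms(1,3)] by blast
   then show ?thesis using False by simp
  qed
 qed
 also have "\<dots> = \<xi> j x" using assms(2) by simp
 finally show ?thesis .
qed

lemma simple_data_grid:
 assumes "t >= 0" "n >= 1"
  and "!!j. j < m ==> \<xi> j \<in> borel_measurable (F (grid t n j))"
  and "!!j. j < m ==> bounded (\<xi> j ` space M)"
 shows "simple_data M F (grid t n m) m (grid t n) \<xi>"
 using assms grid_mono[of t] unfolding simple_data_def by auto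

lemma integral_uniform_partition:
 fixes f :: "real => 'b::banach"
 assumes "t >= 0" "n >= 1" "continuous_on {0..t} f" "k <= n"
 shows "integral {0..grid t n k} f = (\<Sum>j<k. integral {grid t n j..grid t n (Suc j)} f)"
 using assms(4)
proof (induction k)
 case (Suc k)
 have 1: "0 <= grid t n k" using grid_mono[OF assms(1), of 0 k n] by simp
 have 2: "grid t n k <= grid t n (Suc k)" by (rule grid_mono[OF assms(1)]) simp
 have 3: "grid t n (Suc k) <= t" using grid_mono[OF assms(1) Suc(2), of n] assms(2) by simp
 have "f integrable_on {0..grid t n (Suc k)}"
  using 3 by (intro integrable_continuous_real continuous_on_subset[OF assms(3)]) auto
 then have "integral {0..grid t n (Suc k)} f =
   integral {0..grid t n k} f + integral {grid t n k..grid t n (Suc k)} f"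
  by (rule Henstock_Kurzweil_Integration.integral_combine[OF 1 2, symmetric])
 then show ?case using Suc by simp
qed simp

text \<open>The error of each cell is bounded by the oscillation of y over that cell, which tends to zero uniformly.\<close>

lemma riemann_stieltjes_sum_tendsto:
 fixes y :: "real => 'a::banach" and f :: "real => 'b::banach" and pr :: "'a => 'b => 'c::banach"
 assumes pr: "bounded_bilinear pr" and t: "t >= 0"
  and y: "continuous_on {0..t} y" and f: "continuous_on {0..t} f"
  and pt: "!!n j. j < Suc n ==> pt n j \<in> {grid t (Suc n) j..grid t (Suc n) (Suc j)}"
 shows "(%n. \<Sum>j<Suc n. pr (y (pt n j)) (integral {grid t (Suc n) j..grid t (Suc n) (Suc j)} f))
   \<longlonglongrightarrow> integral {0..t} (%s. pr (y s) (f s))"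
proof (rule LIMSEQ_I)
 fix e :: real assume e: "e > 0"
 interpret bounded_bilinear pr by fact
 obtain K where K: "K >= 0" "!!a b. norm (pr a b) <= norm a * norm b * K" using nonneg_bounded by blast
 obtain B where "\<forall>v\<in>f ` {0..t}. norm v <= B"
  using compact_imp_bounded[OF compact_continuous_image[OF f compact_Icc]] unfolding bounded_iff by blast
 then have B: "norm (f s) <= B" if "s \<in> {0..t}" for s using that by blast
 have B0: "B >= 0" using B[of 0] t norm_ge_zero[of "f 0"] by (meson atLeastAtMost_iff order_refl order_trans)
 define d where "d = e / (2 * (t + 1) * (B + 1) * (K + 1))"
 have d: "d > 0" unfolding d_def using e t B0 K by (intro divide_pos_pos mult_pos_pos) auto
 have "uniformly_continuous_on {0..t} y" by (rule compact_uniformly_continuous[OF y compact_Icc])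
 then obtain r where r: "r > 0" "!!s s'. s \<in> {0..t} ==> s' \<in> {0..t} ==> dist s' s < r ==> dist (y s') (y s) < d"
  using d unfolding uniformly_continuous_on_def by blast
 obtain N :: nat where N: "t / r < real N" using reals_Archimedean2 by blast
 show "\<exists>no. \<forall>n\<ge>no. norm ((\<Sum>j<Suc n. pr (y (pt n j)) (integral {grid t (Suc n) j..grid t (Suc n) (Suc j)} f)) -
   integral {0..t} (%s. pr (y s) (f s))) < e"
 proof (intro exI allI impI)
  fix n assume n: "n >= N"
  let ?g = "grid t (Suc n)"
  have step: "?g (Suc j) - ?g j < r" for j
  proof -
   have "t / r < real (Suc n)" using N n by linarith
   then show ?thesis unfolding grid_step using r(1) by (simp add: field_simps)
  qed
  have c: "continuous_on {0..t} (%s. pr (y s) (f s))" by (intro continuous_on y f)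
  have "integral {0..t} (%s. pr (y s) (f s)) = (\<Sum>j<Suc n. integral {?g j..?g (Suc j)} (%s. pr (y s) (f s)))"
   using integral_uniform_partition[OF t _ c, of "Suc n" "Suc n"] by simp
  then have "norm ((\<Sum>j<Suc n. pr (y (pt n j)) (integral {?g j..?g (Suc j)} f)) - integral {0..t} (%s. pr (y s) (f s)))
   = norm (\<Sum>j<Suc n. pr (y (pt n j)) (integral {?g j..?g (Suc j)} f) - integral {?g j..?g (Suc j)} (%s. pr (y s) (f s)))"
   by (simp add: sum_subtractf)
  also have "\<dots> <= (\<Sum>j<Suc n. norm (pr (y (pt n j)) (integral {?g j..?g (Suc j)} f) - integral {?g j..?g (Suc j)} (%s. pr (y s) (f s))))"
   by (rule norm_sum)
  also have "\<dots> <= (\<Sum>j<Suc n. (d * B * K) * (t / real (Suc n)))"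
  proof (rule sum_mono)
   fix j assume "j \<in> {..<Suc n}"
   then have j: "j < Suc n" by simp
   have sub: "{?g j..?g (Suc j)} \<subseteq> {0..t}"
    using grid_in[OF t, of j "Suc n"] grid_in[OF t, of "Suc j" "Suc n"] j by auto
   have le: "?g j <= ?g (Suc j)" by (rule grid_mono[OF t]) simp
   have f': "continuous_on {?g j..?g (Suc j)} f" and c': "continuous_on {?g j..?g (Suc j)} (%s. pr (y s) (f s))"
    and y': "continuous_on {?g j..?g (Suc j)} y"
    using continuous_on_subset sub f c y by blast+
   have fi: "f integrable_on {?g j..?g (Suc j)}" by (rule integrable_continuous_real[OF f'])
   have "pr (y (pt n j)) (integral {?g j..?g (Suc j)} f) = integral {?g j..?g (Suc j)} (%s. pr (y (pt n j)) (f s))"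
    using integral_linear[OF fi bounded_linear_right[of "y (pt n j)"]] by (simp add: o_def)
   then have "pr (y (pt n j)) (integral {?g j..?g (Suc j)} f) - integral {?g j..?g (Suc j)} (%s. pr (y s) (f s))
    = integral {?g j..?g (Suc j)} (%s. pr (y (pt n j) - y s) (f s))"
    using c' by (simp add: Henstock_Kurzweil_Integration.integral_diff[symmetric] integrable_continuous_real
     continuous_on[OF continuous_on_const f'] diff_left)
   also have "norm \<dots> <= (d * B * K) * (?g (Suc j) - ?g j)"
   proof (rule integral_bound[OF le])
    show "continuous_on {?g j..?g (Suc j)} (%s. pr (y (pt n j) - y s) (f s))"
     by (intro continuous_on continuous_intros f' y')
    fix s assume s: "s \<in> {?g j..?g (Suc j)}"
    have "dist (pt n j) s < r" using s pt[OF j] step[of j] by (auto simp: dist_real_def)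
    then have "norm (y (pt n j) - y s) <= d"
     using r(2)[of s "pt n j"] s pt[OF j] sub by (auto simp: dist_norm intro: less_imp_le)
    moreover have "norm (f s) <= B" using B s sub by auto
    ultimately have "norm (y (pt n j) - y s) * norm (f s) * K <= d * B * K"
     using K d B0 by (intro mult_mono) auto
    then show "norm (pr (y (pt n j) - y s) (f s)) <= d * B * K"
     using K(2)[of "y (pt n j) - y s" "f s"] by linarith
   qed
   finally show "norm (pr (y (pt n j)) (integral {?g j..?g (Suc j)} f) - integral {?g j..?g (Suc j)} (%s. pr (y s) (f s)))
    <= (d * B * K) * (t / real (Suc n))" unfolding grid_step .
  qed
  also have "\<dots> = d * (t * B * K)" by (simp add: field_simps)
  also have "\<dots> <= d * ((t + 1) * (B + 1) * (K + 1))"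
   using d t B0 K by (intro mult_left_mono mult_mono) auto
  also have "\<dots> = e / 2"
  proof -
   have "(t + 1) * (B + 1) * (K + 1) > 0" using t B0 K by (intro mult_pos_pos) auto
   then show ?thesis unfolding d_def by (simp add: field_simps)
  qed
  also have "\<dots> < e" using e by simp
  finally show "norm ((\<Sum>j<Suc n. pr (y (pt n j)) (integral {?g j..?g (Suc j)} f)) - integral {0..t} (%s. pr (y s) (f s))) < e" .
 qed
qed

lemma riemann_sum_tendsto:
 fixes y :: "real => 'a::banach"
 assumes t: "t >= 0" and y: "continuous_on {0..t} y"
 shows "(%n. \<Sum>j<Suc n. (t / real (Suc n)) *\<^sub>R y (grid t (Suc n) j)) \<longlonglongrightarrow> integral {0..t} y"
proof -
 have "integral {grid t (Suc n) j..grid t (Suc n) (Suc j)} (%s. 1::real) = t / real (Suc n)" for n j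
  using grid_mono[OF t, of j "Suc j" "Suc n"] by (simp add: grid_step del: of_nat_Suc)
 then show ?thesis
  using riemann_stieltjes_sum_tendsto[OF bounded_bilinear.flip[OF bounded_bilinear_scaleR] t y, of "%s. 1" "%n j. grid t (Suc n) j"]
   grid_mono[OF t, of _ "Suc _"] by (simp del: of_nat_Suc sum.lessThan_Suc)
qed

lemma abel_summation:
 fixes g :: "nat => 'b::real_vector" and B :: "nat => real"
 shows "(\<Sum>j<n. (B (Suc j) - B j) *\<^sub>R g j) = B n *\<^sub>R g n - B 0 *\<^sub>R g 0 - (\<Sum>j<n. B (Suc j) *\<^sub>R (g (Suc j) - g j))"
 by (induction n) (simp_all add: algebra_simps)

text \<open>Abel summation moves the increments from the path, which has unbounded variation, to the smooth integrand. The limit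
then exists for every continuous path, and this makes stochastic integrals of smooth deterministic integrands pathwise objects.\<close>

lemma stieltjes_sum_by_parts_tendsto:
 fixes g g' :: "real => 'b::banach" and B :: "real => real"
 assumes t: "t >= 0" and B: "continuous_on {0..t} B" and g': "continuous_on {0..t} g'"
  and g: "!!s. s \<in> {0..t} ==> (g has_vector_derivative g' s) (at s within {0..t})"
 shows "(%n. \<Sum>j<Suc n. (B (grid t (Suc n) (Suc j)) - B (grid t (Suc n) j)) *\<^sub>R g (grid t (Suc n) j))
  \<longlonglongrightarrow> B t *\<^sub>R g t - B 0 *\<^sub>R g 0 - integral {0..t} (%s. B s *\<^sub>R g' s)"
proof -
 have ftc: "integral {grid t (Suc n) j..grid t (Suc n) (Suc j)} g' = g (grid t (Suc n) (Suc j)) - g (grid t (Suc n) j)"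
  if "j < Suc n" for n j
 proof (rule integral_unique, rule fundamental_theorem_of_calculus)
  show "grid t (Suc n) j <= grid t (Suc n) (Suc j)" by (rule grid_mono[OF t]) simp
  have sub: "{grid t (Suc n) j..grid t (Suc n) (Suc j)} \<subseteq> {0..t}"
   using grid_in[OF t, of j "Suc n"] grid_in[OF t, of "Suc j" "Suc n"] that by auto
  fix s assume "s \<in> {grid t (Suc n) j..grid t (Suc n) (Suc j)}"
  then show "(g has_vector_derivative g' s) (at s within {grid t (Suc n) j..grid t (Suc n) (Suc j)})"
   using g sub has_vector_derivative_within_subset by blast
 qed
 have "(%n. \<Sum>j<Suc n. B (grid t (Suc n) (Suc j)) *\<^sub>R integral {grid t (Suc n) j..grid t (Suc n) (Suc j)} g')
   \<longlonglongrightarrow> integral {0..t} (%s. B s *\<^sub>R g' s)"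
  using grid_mono[OF t, of _ "Suc _"]
  by (intro riemann_stieltjes_sum_tendsto[OF bounded_bilinear_scaleR t B g']) auto
 then have "(%n. \<Sum>j<Suc n. B (grid t (Suc n) (Suc j)) *\<^sub>R (g (grid t (Suc n) (Suc j)) - g (grid t (Suc n) j)))
   \<longlonglongrightarrow> integral {0..t} (%s. B s *\<^sub>R g' s)"
  by (rule Lim_transform_eventually) (auto intro!: always_eventually sum.cong simp: ftc simp del: sum.lessThan_Suc)
 then have "(%n. B t *\<^sub>R g t - B 0 *\<^sub>R g 0 - (\<Sum>j<Suc n. B (grid t (Suc n) (Suc j)) *\<^sub>R (g (grid t (Suc n) (Suc j)) - g (grid t (Suc n) j))))
   \<longlonglongrightarrow> B t *\<^sub>R g t - B 0 *\<^sub>R g 0 - integral {0..t} (%s. B s *\<^sub>R g' s)"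
  by (intro tendsto_intros)
 moreover have "(\<Sum>j<Suc n. (B (grid t (Suc n) (Suc j)) - B (grid t (Suc n) j)) *\<^sub>R g (grid t (Suc n) j)) =
   B t *\<^sub>R g t - B 0 *\<^sub>R g 0 - (\<Sum>j<Suc n. B (grid t (Suc n) (Suc j)) *\<^sub>R (g (grid t (Suc n) (Suc j)) - g (grid t (Suc n) j)))" for n
  using abel_summation[of "%j. B (grid t (Suc n) j)" "%j. g (grid t (Suc n) j)" "Suc n"]
  by (simp del: sum.lessThan_Suc)
 ultimately show ?thesis by simp
qed

abbreviation time_space :: "real => 'w measure => (real \<times> 'w) measure" where
 "time_space t M \<equiv> restrict_space lborel {0..t} \<Otimes>\<^sub>M M"

lemma measurable_time_spaceI:
 assumes "(%(s, x). U s x) \<in> borel_measurable (borel \<Otimes>\<^sub>M M)"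
 shows "(%(s, x). U s x) \<in> borel_measurable (time_space t M)"
proof -
 have "(%p. (fst p, snd p)) \<in> time_space t M \<rightarrow>\<^sub>M borel \<Otimes>\<^sub>M M"
  by (intro measurable_Pair) (auto intro!: measurable_compose[OF measurable_fst measurable_restrict_space1])
 from measurable_compose[OF this assms] show ?thesis by (simp add: case_prod_beta)
qed

lemma borel_measurable_simple_process:
 fixes \<xi> :: "nat => 'w => 'b::euclidean_space"
 assumes "!!j. j < n ==> \<xi> j \<in> borel_measurable M"
 shows "(%(s, x). simple_process n \<tau> \<xi> s x) \<in> borel_measurable (time_space t M)"
 unfolding simple_process_def case_prod_beta
proof (intro borel_measurable_sum borel_measurable_scaleR)
 fix j assume "j \<in> {..<n}"
 then show "(%p. \<xi> j (snd p)) \<in> borel_measurable (time_space t M)"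
  using assms by (auto intro: measurable_compose[OF measurable_snd])
 have "indicat_real {\<tau> j<..\<tau> (Suc j)} \<in> borel_measurable (restrict_space lborel {0..t})"
  by (intro measurable_restrict_space1) simp
 then show "(%p. indicat_real {\<tau> j<..\<tau> (Suc j)} (fst p)) \<in> borel_measurable (time_space t M)"
  by (rule measurable_compose[OF measurable_fst])
qed

lemma AE_time_space_pos: "AE s in restrict_space lborel {0..t}. 0 < s \<and> s <= (t::real)"
proof -
 have "AE s in lborel. s \<in> {0..t} \<longrightarrow> 0 < s \<and> s <= t"
  using AE_lborel_singleton[of "0::real"] by eventually_elim auto
 then show ?thesis by (subst AE_restrict_space_iff) auto
qed

lemma finite_measure_restrict_lborel: "finite_measure (restrict_space lborel {0..t::real})"
 by (intro finite_measureI) (simp add: emeasure_restrict_space space_restrict_space emeasure_lborel_Icc_eq)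

text \<open>A bounded continuous process is approximated by its values at the left end points of a uniform grid, by dominated convergence.\<close>

lemma msq_grid_approximation:
 fixes U :: "real => 'w => 'b::euclidean_space"
 assumes "prob_space M" and t: "t >= 0"
  and U: "(%(s, x). U s x) \<in> borel_measurable (borel \<Otimes>\<^sub>M M)"
  and cont: "!!x. continuous_on {0..t} (%s. U s x)"
  and bd: "!!s x. s \<in> {0..t} ==> x \<in> space M ==> norm (U s x) <= B"
 shows "(%n. msq (time_space t M) (%(s, x). U s x - simple_process (Suc n) (grid t (Suc n)) (%j. U (grid t (Suc n) j)) s x))
   \<longlonglongrightarrow> 0"
proof -
 interpret M: prob_space M by fact
 interpret R: finite_measure "restrict_space lborel {0..t}" by (rule finite_measure_restrict_lborel)
 interpret P: pair_sigma_finite "restrict_space lborel {0..t}" M ..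
 let ?P = "time_space t M"
 define V where "V n p = (case p of (s, x) => U s x - simple_process (Suc n) (grid t (Suc n)) (%j. U (grid t (Suc n) j)) s x)" for n p
 have Ut [measurable]: "U s \<in> borel_measurable M" for s
  using measurable_compose[OF measurable_Pair1' U, of s] by simp
 have [measurable]: "V n \<in> borel_measurable ?P" for n
  unfolding V_def case_prod_beta
  using borel_measurable_diff[OF measurable_time_spaceI[OF U, of t]
    borel_measurable_simple_process[of "Suc n" "%j. U (grid t (Suc n) j)" M "grid t (Suc n)" t]]
  by (simp add: case_prod_beta Ut)
 have [measurable]: "fst \<in> borel_measurable ?P"
  by (rule measurable_compose[OF measurable_fst, of "%s. s", simplified]) (intro measurable_restrict_space1, simp)
 have "AE p in ?P. 0 < fst p \<and> fst p <= t"
 proof (rule P.AE_pair_measure)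
  show "{p \<in> space ?P. 0 < fst p \<and> fst p <= t} \<in> sets ?P" by measurable
  show "AE s in restrict_space lborel {0..t}. AE x in M. 0 < fst (s, x) \<and> fst (s, x) <= t"
   using AE_time_space_pos[of t] by eventually_elim simp
 qed
 then have AEp: "AE p in ?P. 0 < fst p \<and> fst p <= t \<and> snd p \<in> space M"
  using AE_space by eventually_elim (auto simp: space_pair_measure)
 have fin: "emeasure ?P (space ?P) < \<infinity>"
  using M.emeasure_pair_measure_Times[of "space (restrict_space lborel {0..t})" "restrict_space lborel {0..t}" "space M"]
  by (simp only: space_pair_measure M.emeasure_space_1 sets.top mult_1_right) (simp add: R.emeasure_finite less_top[symmetric])
 have "(%n. \<integral>\<^sup>+p. ennreal ((norm (V n p))\<^sup>2) \<partial>?P) \<longlonglongrightarrow> (\<integral>\<^sup>+p. 0 \<partial>?P)"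
 proof (rule nn_integral_dominated_convergence[where w="%_. ennreal ((2 * B)\<^sup>2)"])
  show "(\<integral>\<^sup>+p. ennreal ((2 * B)\<^sup>2) \<partial>?P) < \<infinity>" using fin by (simp add: ennreal_mult_less_top)
  have idx: "V n (s, x) = U s x - U (grid t (Suc n) j) x"
   if "j < Suc n" "s \<in> {grid t (Suc n) j<..grid t (Suc n) (Suc j)}" for n s x j
   unfolding V_def using simple_process_grid[OF t that] by simp
  show "AE p in ?P. ennreal ((norm (V n p))\<^sup>2) <= ennreal ((2 * B)\<^sup>2)" for n
   using AEp
  proof eventually_elim
   case (elim p)
   obtain s x where p: "p = (s, x)" by (cases p)
   obtain j where j: "j < Suc n" "s \<in> {grid t (Suc n) j<..grid t (Suc n) (Suc j)}"
    using elim grid_index[of s t "Suc n"] unfolding p by auto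
   have "norm (V n p) <= norm (U s x) + norm (U (grid t (Suc n) j) x)"
    unfolding p idx[OF j] by (rule norm_triangle_ineq4)
   also have "\<dots> <= B + B"
    using elim grid_in[OF t, of j "Suc n"] j unfolding p by (intro add_mono bd) auto
   finally show ?case by (intro ennreal_leI power_mono) auto
  qed
  show "AE p in ?P. (%n. ennreal ((norm (V n p))\<^sup>2)) \<longlonglongrightarrow> 0"
   using AEp
  proof eventually_elim
   case (elim p)
   obtain s x where p: "p = (s, x)" by (cases p)
   have "\<exists>j. j < Suc n \<and> s \<in> {grid t (Suc n) j<..grid t (Suc n) (Suc j)}" for n
    using elim grid_index[of s t "Suc n"] unfolding p by (metis Suc_le_mono fst_conv le0 One_nat_def)
   then obtain j where j: "!!n. j n < Suc n" "!!n. s \<in> {grid t (Suc n) (j n)<..grid t (Suc n) (Suc (j n))}" by metis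
   have "(%n. grid t (Suc n) (j n)) \<longlonglongrightarrow> s"
   proof (rule LIM_zero_cancel, rule Lim_null_comparison)
    show "\<forall>\<^sub>F n in sequentially. norm (grid t (Suc n) (j n) - s) <= t * (1 / real (Suc n))"
    proof (intro always_eventually allI)
     fix n show "norm (grid t (Suc n) (j n) - s) <= t * (1 / real (Suc n))"
      using j(2)[of n] grid_step[of t "Suc n" "j n"] by (simp del: of_nat_Suc)
    qed
    show "(%n. t * (1 / real (Suc n))) \<longlonglongrightarrow> 0"
     using tendsto_mult[OF tendsto_const LIMSEQ_Suc[OF lim_1_over_n], of t] by simp
   qed
   then have "(%n. U (grid t (Suc n) (j n)) x) \<longlonglongrightarrow> U s x"
   proof (rule continuous_on_tendsto_compose[OF cont[of x]])
    show "s \<in> {0..t}" using elim p by auto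
    show "\<forall>\<^sub>F n in sequentially. grid t (Suc n) (j n) \<in> {0..t}"
     using j(1) by (intro always_eventually allI grid_in[OF t]) (auto simp: less_Suc_eq_le intro: le_SucI)
   qed
   then have "(%n. V n p) \<longlonglongrightarrow> 0"
    unfolding p idx[OF j] using tendsto_diff[OF tendsto_const, of _ "U s x" sequentially "U s x"] by fastforce
   then have "(%n. ennreal ((norm (V n p))\<^sup>2)) \<longlonglongrightarrow> ennreal ((norm (0::'b))\<^sup>2)" by (intro tendsto_intros)
   then show ?case by simp
  qed
 qed simp_all
 then show ?thesis unfolding msq_def V_def by simp
qed

lemma filtration_on_measurable:
 assumes "filtration_on M F" "f \<in> borel_measurable (F s)"
 shows "f \<in> borel_measurable M"
 using assms measurable_from_subalg unfolding filtration_on_def by blast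

lemma filtration_on_mono:
 assumes "filtration_on M F" "s <= t" "f \<in> borel_measurable (F s)"
 shows "f \<in> borel_measurable (F t)"
proof -
 have "filtration (space M) F" using assms by (simp add: filtration_on_def)
 then have "space (F s) = space (F t)" "sets (F s) \<subseteq> sets (F t)"
  using assms(2) by (auto simp: filtration_def)
 then show ?thesis using assms(3) unfolding measurable_def by auto
qed

section \<open>Square-integrable stochastic integrators\<close>

text \<open>In contrast to a simple process the intervals may overlap, so that these sums are closed under addition.\<close>

definition simple_sum :: "nat => (nat => real) => (nat => real) => (nat => 'w => 'b::euclidean_space) => real => 'w => 'b" where
 "simple_sum n a b \<xi> s x = (\<Sum>j<n. indicator {a j<..b j} s *\<^sub>R \<xi> j x)"

definition increment_sum :: "(real => 'w => real) => nat => (nat => real) => (nat => real) => (nat => 'w => 'b::euclidean_space) => 'w => 'b" where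
 "increment_sum B n a b \<xi> x = (\<Sum>j<n. (B (b j) x - B (a j) x) *\<^sub>R \<xi> j x)"

definition elementary :: "'w measure => (real => 'w measure) => real => nat => (nat => real) => (nat => real) => (nat => 'w => 'b::euclidean_space) => bool" where
 "elementary M F t n a b \<xi> \<longleftrightarrow>
   (\<forall>j<n. 0 <= a j \<and> a j <= b j \<and> b j <= t \<and> \<xi> j \<in> borel_measurable (F (a j)) \<and> bounded (\<xi> j ` space M))"

text \<open>The one estimate behind the stochastic integral. It passes to sums and scalar multiples, which a Wiener process plus
drift needs, as the Ito isometry itself does not.\<close>

definition integrator :: "'w measure => (real => 'w measure) => real => (real => 'w => real) => bool" where
 "integrator M F T B \<longleftrightarrow> (\<forall>t\<in>{0..T}. B t \<in> borel_measurable M) \<and>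
   (\<exists>C\<ge>0. \<forall>t\<in>{0..T}. \<forall>n a b (\<xi> :: nat => 'w => real). elementary M F t n a b \<xi> \<longrightarrow>
    msq M (increment_sum B n a b \<xi>) <= ennreal C * msq (time_space t M) (%(s, x). simple_sum n a b \<xi> s x))"

lemma borel_measurable_simple_sum:
 assumes "!!j. j < n ==> \<xi> j \<in> borel_measurable M"
 shows "(%(s, x). simple_sum n a b \<xi> s x) \<in> borel_measurable (time_space t M)"
 unfolding simple_sum_def case_prod_beta
proof (intro borel_measurable_sum borel_measurable_scaleR)
 fix j assume "j \<in> {..<n}"
 then show "(%p. \<xi> j (snd p)) \<in> borel_measurable (time_space t M)"
  using assms by (auto intro: measurable_compose[OF measurable_snd])
 have "indicat_real {a j<..b j} \<in> borel_measurable (restrict_space lborel {0..t})"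
  by (intro measurable_restrict_space1) simp
 then show "(%p. indicat_real {a j<..b j} (fst p)) \<in> borel_measurable (time_space t M)"
  by (rule measurable_compose[OF measurable_fst])
qed

lemma elementary_measurable:
 assumes "filtration_on M F" "elementary M F t n a b \<xi>" "j < n"
 shows "\<xi> j \<in> borel_measurable M"
 using assms filtration_on_measurable unfolding elementary_def by blast

lemma borel_measurable_increment_sum:
 assumes B: "!!s. s \<in> {0..T} ==> B s \<in> borel_measurable M" and "filtration_on M F" "elementary M F t n a b \<xi>" "t <= T"
 shows "increment_sum B n a b \<xi> \<in> borel_measurable M"
 unfolding increment_sum_def
proof (intro borel_measurable_sum borel_measurable_scaleR borel_measurable_diff)
 fix j assume "j \<in> {..<n}"
 then have j: "j < n" by simp
 show "\<xi> j \<in> borel_measurable M" by (rule elementary_measurable[OF assms(2,3) j])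
 have "a j \<in> {0..T}" "b j \<in> {0..T}" using assms(3,4) j unfolding elementary_def by force+
 then show "B (a j) \<in> borel_measurable M" "B (b j) \<in> borel_measurable M" using B by auto
qed

lemma integrator_vec:
 fixes M :: "'w measure"
 assumes "integrator M F T B" "filtration_on M F"
 shows "\<exists>C\<ge>0. \<forall>t\<in>{0..T}. \<forall>n a b (\<xi> :: nat => 'w => 'b::euclidean_space). elementary M F t n a b \<xi> \<longrightarrow>
    msq M (increment_sum B n a b \<xi>) <= ennreal C * msq (time_space t M) (%(s, x). simple_sum n a b \<xi> s x)"
proof -
 from assms(1) obtain C where C: "C >= 0" "!!t n a b (\<xi> :: nat => 'w => real). t \<in> {0..T} ==> elementary M F t n a b \<xi> ==>
    msq M (increment_sum B n a b \<xi>) <= ennreal C * msq (time_space t M) (%(s, x). simple_sum n a b \<xi> s x)"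
  and Bm: "!!s. s \<in> {0..T} ==> B s \<in> borel_measurable M"
  unfolding integrator_def by blast
 have "msq M (increment_sum B n a b \<xi>) <= ennreal C * msq (time_space t M) (%(s, x). simple_sum n a b \<xi> s x)"
  if t: "t \<in> {0..T}" and e: "elementary M F t n a b \<xi>" for t n a b and \<xi> :: "nat => 'w => 'b"
 proof -
  have el: "elementary M F t n a b (%j x. \<xi> j x \<bullet> c)" for c
  proof -
   have "bounded ((%x. \<xi> j x \<bullet> c) ` space M)" if "bounded (\<xi> j ` space M)" for j
    using bounded_linear_image[OF that bounded_linear_inner_left[of c]] by (simp add: image_image)
   then show ?thesis using e unfolding elementary_def by auto
  qed
  have "msq M (increment_sum B n a b \<xi>) = (\<Sum>c\<in>Basis. msq M (%x. increment_sum B n a b \<xi> x \<bullet> c))"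
   using t by (intro msq_sum_Basis borel_measurable_increment_sum[OF Bm assms(2) e]) auto
  also have "\<dots> = (\<Sum>c\<in>Basis. msq M (increment_sum B n a b (%j x. \<xi> j x \<bullet> c)))"
  proof (intro sum.cong refl)
   fix c :: 'b
   have "(%x. increment_sum B n a b \<xi> x \<bullet> c) = increment_sum B n a b (%j x. \<xi> j x \<bullet> c)"
    by (intro ext) (simp add: increment_sum_def inner_sum_left)
   then show "msq M (%x. increment_sum B n a b \<xi> x \<bullet> c) = msq M (increment_sum B n a b (%j x. \<xi> j x \<bullet> c))"
    by simp
  qed
  also have "\<dots> <= (\<Sum>c\<in>Basis. ennreal C * msq (time_space t M) (%(s, x). simple_sum n a b (%j x. \<xi> j x \<bullet> c) s x))"
   by (intro sum_mono C(2) t el)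
  also have "\<dots> = ennreal C * (\<Sum>c\<in>Basis. msq (time_space t M) (%p. (case p of (s, x) => simple_sum n a b \<xi> s x) \<bullet> c))"
  proof -
   have "(%(s, x). simple_sum n a b (%j x. \<xi> j x \<bullet> c) s x) = (%p. (case p of (s, x) => simple_sum n a b \<xi> s x) \<bullet> c)" for c
    by (intro ext) (simp only: simple_sum_def inner_sum_left inner_scaleR_left real_scaleR_def case_prod_beta)
   then show ?thesis by (simp only: sum_distrib_left)
  qed
  also have "\<dots> = ennreal C * msq (time_space t M) (%(s, x). simple_sum n a b \<xi> s x)"
   by (subst msq_sum_Basis[OF borel_measurable_simple_sum[OF elementary_measurable[OF assms(2) e]], symmetric]) auto
  finally show ?thesis .
 qed
 then show ?thesis using C(1) by blast
qed

lemma integrator_add: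
 assumes "integrator M F T B1" "integrator M F T B2" "filtration_on M F"
 shows "integrator M F T (%t x. B1 t x + B2 t x)"
proof -
 from assms(1) obtain C1 where C1: "C1 >= 0"
  "!!t n a b \<xi>. t \<in> {0..T} ==> elementary M F t n a b (\<xi> :: nat => _ => real) ==>
    msq M (increment_sum B1 n a b \<xi>) <= ennreal C1 * msq (time_space t M) (%(s, x). simple_sum n a b \<xi> s x)"
  unfolding integrator_def by blast
 from assms(2) obtain C2 where C2: "C2 >= 0"
  "!!t n a b \<xi>. t \<in> {0..T} ==> elementary M F t n a b (\<xi> :: nat => _ => real) ==>
    msq M (increment_sum B2 n a b \<xi>) <= ennreal C2 * msq (time_space t M) (%(s, x). simple_sum n a b \<xi> s x)"
  unfolding integrator_def by blast
 note C = C1(1) C2(1) C1(2) C2(2)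
 have m: "!!s. s \<in> {0..T} ==> B1 s \<in> borel_measurable M" "!!s. s \<in> {0..T} ==> B2 s \<in> borel_measurable M"
  using assms unfolding integrator_def by auto
 have "msq M (increment_sum (%t x. B1 t x + B2 t x) n a b \<xi>) \<le>
   ennreal (2 * C1 + 2 * C2) * msq (time_space t M) (%(s, x). simple_sum n a b \<xi> s x)"
  if t: "t \<in> {0..T}" and e: "elementary M F t n a b \<xi>" for t n a b and \<xi> :: "nat => _ => real"
 proof -
  have "increment_sum (%t x. B1 t x + B2 t x) n a b \<xi> = (%x. increment_sum B1 n a b \<xi> x + increment_sum B2 n a b \<xi> x)"
   by (intro ext) (simp add: increment_sum_def sum.distrib[symmetric] algebra_simps)
  then have "msq M (increment_sum (%t x. B1 t x + B2 t x) n a b \<xi>) <= 2 * msq M (increment_sum B1 n a b \<xi>) + 2 * msq M (increment_sum B2 n a b \<xi>)"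
   using t e by (auto intro!: msq_add_le borel_measurable_increment_sum[OF _ assms(3) e] m)
  also have "\<dots> <= 2 * (ennreal C1 * msq (time_space t M) (%(s, x). simple_sum n a b \<xi> s x))
    + 2 * (ennreal C2 * msq (time_space t M) (%(s, x). simple_sum n a b \<xi> s x))"
   by (intro add_mono mult_left_mono C t e) auto
  also have "\<dots> = ennreal (2 * C1 + 2 * C2) * msq (time_space t M) (%(s, x). simple_sum n a b \<xi> s x)"
   using C(1,2) by (simp add: ennreal_plus ennreal_mult distrib_right mult.assoc)
  finally show ?thesis .
 qed
 moreover have "2 * C1 + 2 * C2 >= 0" using C by simp
 ultimately show ?thesis using m unfolding integrator_def by (auto intro!: exI[of _ "2 * C1 + 2 * C2"])
qed

lemma integrator_scale:
 assumes "integrator M F T B" "filtration_on M F"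
 shows "integrator M F T (%t x. c * B t x)"
proof -
 from assms obtain C where C: "C >= 0"
  "!!t n a b \<xi>. t \<in> {0..T} ==> elementary M F t n a b (\<xi> :: nat => _ => real) ==>
    msq M (increment_sum B n a b \<xi>) <= ennreal C * msq (time_space t M) (%(s, x). simple_sum n a b \<xi> s x)"
  unfolding integrator_def by blast
 have m: "!!s. s \<in> {0..T} ==> B s \<in> borel_measurable M"
  using assms unfolding integrator_def by auto
 have "msq M (increment_sum (%t x. c * B t x) n a b \<xi>) \<le>
   ennreal (c\<^sup>2 * C) * msq (time_space t M) (%(s, x). simple_sum n a b \<xi> s x)"
  if t: "t \<in> {0..T}" and e: "elementary M F t n a b \<xi>" for t n a b and \<xi> :: "nat => _ => real"
 proof -
  have "increment_sum (%t x. c * B t x) n a b \<xi> = (%x. c *\<^sub>R increment_sum B n a b \<xi> x)"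
   by (intro ext) (simp add: increment_sum_def sum_distrib_left algebra_simps)
  then have "msq M (increment_sum (%t x. c * B t x) n a b \<xi>) = msq M (%x. c *\<^sub>R increment_sum B n a b \<xi> x)"
   by (rule arg_cong)
  also have "\<dots> = ennreal (c\<^sup>2) * msq M (increment_sum B n a b \<xi>)"
   using t by (intro msq_scaleR borel_measurable_increment_sum[OF _ assms(2) e, of T] m) auto
  also have "\<dots> <= ennreal (c\<^sup>2) * (ennreal C * msq (time_space t M) (%(s, x). simple_sum n a b \<xi> s x))"
   by (intro mult_left_mono C t e) auto
  also have "\<dots> = ennreal (c\<^sup>2 * C) * msq (time_space t M) (%(s, x). simple_sum n a b \<xi> s x)"
   using C(1) by (simp add: ennreal_mult mult.assoc)
  finally show ?thesis .
 qed
 moreover have "c\<^sup>2 * C >= 0" using C by simp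
 ultimately show ?thesis using m unfolding integrator_def by (auto intro!: exI[of _ "c\<^sup>2 * C"])
qed

lemma integrator_zero: "integrator M F T (%t x. 0)"
 unfolding integrator_def by (auto intro!: exI[of _ 0] simp: increment_sum_def msq_def)

lemma integrator_sum:
 assumes "finite I" "!!i. i \<in> I ==> integrator M F T (B i)" "filtration_on M F"
 shows "integrator M F T (%t x. \<Sum>i\<in>I. B i t x)"
 using assms(1,2)
 by (induction I rule: finite_induct) (auto intro: integrator_zero integrator_add[OF _ _ assms(3)])

lemma sum_lessThan_append:
 fixes f :: "nat => 'b::comm_monoid_add"
 shows "(\<Sum>j<n + m. f j) = (\<Sum>j<n. f j) + (\<Sum>j<m. f (n + j))"
 by (induction m) (simp_all add: add.assoc)

lemma simple_data_elementary:
 assumes "simple_data M F t n \<tau> \<xi>"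
 shows "elementary M F t n \<tau> (%j. \<tau> (Suc j)) \<xi>"
proof -
 have mono: "\<tau> i <= \<tau> j" if "i <= j" "j <= n" for i j
  using that
 proof (induction j)
  case (Suc j)
  then show ?case using assms unfolding simple_data_def
   by (metis Suc_leD Suc_le_lessD le_SucE order_refl order_trans)
 qed simp
 show ?thesis
  unfolding elementary_def
 proof (intro allI impI)
  fix j assume j: "j < n"
  have "\<tau> 0 <= \<tau> j" "\<tau> (Suc j) <= \<tau> n" using mono[of 0 j] mono[of "Suc j" n] j by simp_all
  then show "0 <= \<tau> j \<and> \<tau> j <= \<tau> (Suc j) \<and> \<tau> (Suc j) <= t \<and> \<xi> j \<in> borel_measurable (F (\<tau> j)) \<and> bounded (\<xi> j ` space M)"
   using assms j unfolding simple_data_def by auto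
 qed
qed

lemma simple_integral_eq: "simple_integral B n \<tau> \<xi> = increment_sum B n \<tau> (%j. \<tau> (Suc j)) \<xi>"
 unfolding simple_integral_def increment_sum_def ..

lemma simple_process_eq: "simple_process n \<tau> \<xi> = simple_sum n \<tau> (%j. \<tau> (Suc j)) \<xi>"
 unfolding simple_process_def simple_sum_def ..

text \<open>The defining sequence of the integral consists of simple processes, and its difference from the given simple process is
an elementary process. The integrator estimate for that difference passes to the limit.\<close>

lemma stoch_integral_approx:
 fixes M :: "'w measure"
 assumes B: "integrator M F T B" and F: "filtration_on M F"
 shows "\<exists>C\<ge>0. \<forall>t\<in>{0..T}. \<forall>(X :: real => 'w => 'b::euclidean_space) Z n \<tau> \<xi>.
   has_stoch_integral M F B X t Z \<longrightarrow> simple_data M F t n \<tau> \<xi> \<longrightarrow>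
   msq M (%x. Z x - simple_integral B n \<tau> \<xi> x) <= ennreal C * msq (time_space t M) (%(s, x). X s x - simple_process n \<tau> \<xi> s x)"
proof -
 obtain C where C0: "C >= 0" and C': "!!t n a b (\<xi> :: nat => 'w => 'b). t \<in> {0..T} ==> elementary M F t n a b \<xi> ==>
    msq M (increment_sum B n a b \<xi>) <= ennreal C * msq (time_space t M) (%(s, x). simple_sum n a b \<xi> s x)"
  using integrator_vec[OF B F, where 'b='b] by blast
 have Bm: "!!s. s \<in> {0..T} ==> B s \<in> borel_measurable M" using B unfolding integrator_def by auto
 have "msq M (%x. Z x - simple_integral B n \<tau> \<xi> x) <= ennreal (4 * C) * msq (time_space t M) (%(s, x). X s x - simple_process n \<tau> \<xi> s x)"
  if t: "t \<in> {0..T}" and Z: "has_stoch_integral M F B X t Z" and s: "simple_data M F t n \<tau> \<xi>"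
  for t n \<tau> \<xi> Z and X :: "real => 'w => 'b"
 proof -
 note C = C0 C'[OF t]
 obtain n' \<tau>' and \<xi>' :: "nat => nat => 'w => 'b" where
  sd: "!!m. simple_data M F t (n' m) (\<tau>' m) (\<xi>' m)"
  and l1': "(%m. \<integral>\<^sup>+(s, x). ennreal ((norm (X s x - simple_process (n' m) (\<tau>' m) (\<xi>' m) s x))\<^sup>2) \<partial>(time_space t M)) \<longlonglongrightarrow> 0"
  and l2': "(%m. \<integral>\<^sup>+x. ennreal ((norm (Z x - simple_integral B (n' m) (\<tau>' m) (\<xi>' m) x))\<^sup>2) \<partial>M) \<longlonglongrightarrow> 0"
  using Z unfolding has_stoch_integral_def by blast
 have l1: "(%m. msq (time_space t M) (%(s, x). X s x - simple_process (n' m) (\<tau>' m) (\<xi>' m) s x)) \<longlonglongrightarrow> 0"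
  and l2: "(%m. msq M (%x. Z x - simple_integral B (n' m) (\<tau>' m) (\<xi>' m) x)) \<longlonglongrightarrow> 0"
  using l1' l2' unfolding msq_def case_prod_beta by blast+
 have Xm: "(%(s, x). X s x) \<in> borel_measurable (time_space t M)" and Zm: "Z \<in> borel_measurable M"
  using Z unfolding has_stoch_integral_def by blast+
 have sim: "simple_integral B n \<tau> \<xi> \<in> borel_measurable M" if "simple_data M F t n \<tau> (\<xi> :: nat => 'w => 'b)" for n \<tau> \<xi>
  unfolding simple_integral_eq using t borel_measurable_increment_sum[OF Bm F simple_data_elementary[OF that]] by simp
 have spm: "(%(s, x). simple_process n \<tau> \<xi> s x) \<in> borel_measurable (time_space t M)"
  if "simple_data M F t n \<tau> (\<xi> :: nat => 'w => 'b)" for n \<tau> \<xi>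
  unfolding simple_process_eq
  using borel_measurable_simple_sum[OF elementary_measurable[OF F simple_data_elementary[OF that]]] by simp
 have diff: "msq M (%x. simple_integral B n \<tau> \<xi> x - simple_integral B m \<sigma> \<zeta> x) \<le>
   ennreal C * msq (time_space t M) (%(s, x). simple_process n \<tau> \<xi> s x - simple_process m \<sigma> \<zeta> s x)"
  if s1: "simple_data M F t n \<tau> \<xi>" and s2: "simple_data M F t m \<sigma> \<zeta>" for n m \<tau> \<sigma> and \<xi> \<zeta> :: "nat => 'w => 'b"
 proof -
  define a where "a j = (if j < n then \<tau> j else \<sigma> (j - n))" for j
  define b where "b j = (if j < n then \<tau> (Suc j) else \<sigma> (Suc (j - n)))" for j
  define \<phi> where "\<phi> j = (if j < n then \<xi> j else (%x. - \<zeta> (j - n) x))" for j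
  have bd: "bounded ((%x. - \<zeta> j x) ` space M)" if "bounded (\<zeta> j ` space M)" for j
   using that by (auto simp: bounded_iff)
  have "elementary M F t (n + m) a b \<phi>"
   unfolding elementary_def
  proof (intro allI impI)
   fix j assume j: "j < n + m"
   show "0 <= a j \<and> a j <= b j \<and> b j <= t \<and> \<phi> j \<in> borel_measurable (F (a j)) \<and> bounded (\<phi> j ` space M)"
   proof (cases "j < n")
    case True
    then show ?thesis using simple_data_elementary[OF s1] unfolding elementary_def a_def b_def \<phi>_def by simp
   next
    case False
    then have "j - n < m" using j by simp
    then show ?thesis using False simple_data_elementary[OF s2] bd[of "j - n"] unfolding elementary_def a_def b_def \<phi>_def
     by simp
   qed
  qed
  from C(2)[OF this]
  have "msq M (increment_sum B (n + m) a b \<phi>) <= ennreal C * msq (time_space t M) (%(s, x). simple_sum (n + m) a b \<phi> s x)" .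
  moreover have "increment_sum B (n + m) a b \<phi> = (%x. simple_integral B n \<tau> \<xi> x - simple_integral B m \<sigma> \<zeta> x)"
   unfolding increment_sum_def simple_integral_def sum_lessThan_append a_def b_def \<phi>_def by (simp add: sum_negf)
  moreover have "simple_sum (n + m) a b \<phi> = (%s x. simple_process n \<tau> \<xi> s x - simple_process m \<sigma> \<zeta> s x)"
   unfolding simple_sum_def simple_process_def sum_lessThan_append a_def b_def \<phi>_def by (simp add: sum_negf)
  ultimately show ?thesis by simp
 qed
  let ?d = "%m. msq (time_space t M) (%(s, x). X s x - simple_process (n' m) (\<tau>' m) (\<xi>' m) s x)"
  let ?z = "%m. msq M (%x. Z x - simple_integral B (n' m) (\<tau>' m) (\<xi>' m) x)"
  let ?R = "msq (time_space t M) (%(s, x). X s x - simple_process n \<tau> \<xi> s x)"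
  have le: "msq M (%x. Z x - simple_integral B n \<tau> \<xi> x) <= 2 * ?z m + 2 * (ennreal C * (2 * ?d m + 2 * ?R))" for m
  proof -
   have "msq M (%x. Z x - simple_integral B n \<tau> \<xi> x) <= 2 * ?z m +
     2 * msq M (%x. simple_integral B (n' m) (\<tau>' m) (\<xi>' m) x - simple_integral B n \<tau> \<xi> x)"
    by (rule msq_triangle[OF Zm sim[OF s] sim[OF sd]])
   also have "\<dots> <= 2 * ?z m + 2 * (ennreal C *
     msq (time_space t M) (%(s, x). simple_process (n' m) (\<tau>' m) (\<xi>' m) s x - simple_process n \<tau> \<xi> s x))"
    by (intro add_left_mono mult_left_mono diff sd s) auto
   finally have 1: "msq M (%x. Z x - simple_integral B n \<tau> \<xi> x) <= 2 * ?z m + 2 * (ennreal C *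
     msq (time_space t M) (%(s, x). simple_process (n' m) (\<tau>' m) (\<xi>' m) s x - simple_process n \<tau> \<xi> s x))" .
   have 2: "msq (time_space t M) (%(s, x). simple_process (n' m) (\<tau>' m) (\<xi>' m) s x - simple_process n \<tau> \<xi> s x) <= 2 * ?d m + 2 * ?R"
    using msq_triangle[OF spm[OF sd[of m]] spm[OF s] Xm]
     msq_minus_commute[of "time_space t M" "%(s, x). simple_process (n' m) (\<tau>' m) (\<xi>' m) s x" "%(s, x). X s x"]
    unfolding case_prod_unfold by simp
   show ?thesis by (rule order_trans[OF 1]) (intro add_left_mono mult_left_mono 2 zero_le)
  qed
  have "(%m. 2 * ?z m + 2 * (ennreal C * (2 * ?d m + 2 * ?R))) \<longlonglongrightarrow> 2 * 0 + 2 * (ennreal C * (2 * 0 + 2 * ?R))"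
   by (intro tendsto_add tendsto_const ennreal_tendsto_cmult l1 l2) auto
  then have "msq M (%x. Z x - simple_integral B n \<tau> \<xi> x) <= 2 * 0 + 2 * (ennreal C * (2 * 0 + 2 * ?R))"
   by (rule LIMSEQ_le_const) (use le in auto)
  also have "\<dots> = ennreal (4 * C) * ?R" using C(1)
   by (simp add: ennreal_mult mult.assoc[symmetric]) (simp add: mult.commute mult.left_commute mult.assoc[symmetric])
  finally show ?thesis .
 qed
 then show ?thesis using C0 by (intro exI[of _ "4 * C"]) auto
qed

lemma has_stoch_integral_cong_AE:
 assumes "has_stoch_integral M F B X t Z" "AE x in M. \<forall>s\<in>{0..t}. B s x = B' s x"
 shows "has_stoch_integral M F B' X t Z"
proof -
 obtain n \<tau> \<xi> where sd: "!!m. simple_data M F t (n m) (\<tau> m) (\<xi> m)"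
  and l1: "(%m. \<integral>\<^sup>+(s, x). ennreal ((norm (X s x - simple_process (n m) (\<tau> m) (\<xi> m) s x))\<^sup>2) \<partial>(time_space t M)) \<longlonglongrightarrow> 0"
  and l2: "(%m. \<integral>\<^sup>+x. ennreal ((norm (Z x - simple_integral B (n m) (\<tau> m) (\<xi> m) x))\<^sup>2) \<partial>M) \<longlonglongrightarrow> 0"
  using assms(1) unfolding has_stoch_integral_def by blast
 have "(\<integral>\<^sup>+x. ennreal ((norm (Z x - simple_integral B (n m) (\<tau> m) (\<xi> m) x))\<^sup>2) \<partial>M) =
   (\<integral>\<^sup>+x. ennreal ((norm (Z x - simple_integral B' (n m) (\<tau> m) (\<xi> m) x))\<^sup>2) \<partial>M)" for m
 proof (rule nn_integral_cong_AE)
  have in_t: "\<tau> m j \<in> {0..t}" "\<tau> m (Suc j) \<in> {0..t}" if "j < n m" for j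
   using simple_data_elementary[OF sd[of m]] that unfolding elementary_def by force+
  show "AE x in M. ennreal ((norm (Z x - simple_integral B (n m) (\<tau> m) (\<xi> m) x))\<^sup>2) =
    ennreal ((norm (Z x - simple_integral B' (n m) (\<tau> m) (\<xi> m) x))\<^sup>2)"
   using assms(2)
  proof eventually_elim
   case (elim x)
   have "simple_integral B (n m) (\<tau> m) (\<xi> m) x = simple_integral B' (n m) (\<tau> m) (\<xi> m) x"
    unfolding simple_integral_def using elim in_t by (intro sum.cong) auto
   then show ?case by simp
  qed
 qed
 then show ?thesis using assms(1) sd l1 l2 unfolding has_stoch_integral_def by (simp del: ex_simps) blast
qed

section \<open>The Ito isometry\<close>

lemma integral_double_sum:
 fixes f :: "nat => nat => 'a => real"
 assumes "!!j k. j < n ==> k < n ==> integrable M (f j k)"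
 shows "(\<integral>x. (\<Sum>j<n. \<Sum>k<n. f j k x) \<partial>M) = (\<Sum>j<n. \<Sum>k<n. integral\<^sup>L M (f j k))"
proof -
 have "(\<integral>x. (\<Sum>j<n. \<Sum>k<n. f j k x) \<partial>M) = (\<Sum>j<n. \<integral>x. (\<Sum>k<n. f j k x) \<partial>M)"
  by (intro Bochner_Integration.integral_sum Bochner_Integration.integrable_sum assms) auto
 also have "\<dots> = (\<Sum>j<n. \<Sum>k<n. integral\<^sup>L M (f j k))"
  by (intro sum.cong refl Bochner_Integration.integral_sum assms) auto
 finally show ?thesis .
qed

locale scalar_brownian = prob_space M for M :: "'w measure" +
 fixes F :: "real => 'w measure" and T :: real and B :: "real => 'w => real"
 assumes filt: "filtration_on M F"
  and adapted: "!!t. t \<in> {0..T} ==> B t \<in> borel_measurable (F t)"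
  and indep: "!!s t (U :: 'w => real). 0 <= s ==> s < t ==> t <= T ==> U \<in> borel_measurable (F s) ==>
    indep_var borel U borel (%x. B t x - B s x)"
  and mean: "!!s t. 0 <= s ==> s < t ==> t <= T ==> expectation (%x. B t x - B s x) = 0"
  and var: "!!s t. 0 <= s ==> s < t ==> t <= T ==> msq M (%x. B t x - B s x) = ennreal (t - s)"
begin

lemma B_measurable: "t \<in> {0..T} ==> B t \<in> borel_measurable M"
 using adapted filtration_on_measurable[OF filt] by blast

lemma msq_increment:
 assumes "0 <= s" "s <= t" "t <= T"
 shows "msq M (%x. B t x - B s x) = ennreal (t - s)"
 using assms var[of s t] by (cases "s = t") (auto simp: msq_def)

lemma increment_measurable: "0 <= s ==> s <= t ==> t <= T ==> (%x. B t x - B s x) \<in> borel_measurable M"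
 using B_measurable by (intro borel_measurable_diff) auto

lemma increment_integrable: "0 <= s ==> s <= t ==> t <= T ==> integrable M (%x. B t x - B s x)"
 using msq_increment by (intro msq_finite_integrable1 increment_measurable) auto

lemma increment_sq:
 assumes "0 <= s" "s <= t" "t <= T"
 shows "integrable M (%x. (B t x - B s x)\<^sup>2)" "expectation (%x. (B t x - B s x)\<^sup>2) = t - s"
proof -
 have m: "(%x. B t x - B s x) \<in> borel_measurable M" and f: "msq M (%x. B t x - B s x) < \<infinity>"
  using increment_measurable[OF assms] msq_increment[OF assms] by auto
 show "integrable M (%x. (B t x - B s x)\<^sup>2)" using msq_finite_integrable[OF m m f f] by (simp add: power2_eq_square)
 show "expectation (%x. (B t x - B s x)\<^sup>2) = t - s"
  using msq_eq_integral[OF m f] msq_increment[OF assms] assms by (simp add: ennreal_inj)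
qed

lemma expectation_past_times_increment:
 assumes "0 <= s" "s <= t" "t <= T" "U \<in> borel_measurable (F s)" "integrable M U"
 shows "integrable M (%x. U x * (B t x - B s x))" "expectation (%x. U x * (B t x - B s x)) = 0"
proof -
 have "integrable M (%x. U x * (B t x - B s x)) \<and> expectation (%x. U x * (B t x - B s x)) = 0"
 proof (cases "s = t")
  case False
  then have "s < t" using assms by simp
  then have iv: "indep_var borel U borel (%x. B t x - B s x)" using indep assms by blast
  have i: "integrable M (%x. B t x - B s x)" by (rule increment_integrable) (use assms in auto)
  show ?thesis
   using indep_var_integrable[OF iv assms(5) i] indep_var_lebesgue_integral[OF iv assms(5) i]
    mean[of s t] assms \<open>s < t\<close> by simp
 qed simp
 then show "integrable M (%x. U x * (B t x - B s x))" "expectation (%x. U x * (B t x - B s x)) = 0" by auto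
qed

lemma expectation_past_times_increment_sq:
 assumes "0 <= s" "s <= t" "t <= T" "U \<in> borel_measurable (F s)" "integrable M U"
 shows "expectation (%x. U x * (B t x - B s x)\<^sup>2) = (t - s) * expectation U"
proof (cases "s = t")
 case False
 then have "s < t" using assms by simp
 then have "indep_var borel U borel (%x. B t x - B s x)" using indep assms by blast
 from indep_var_compose[OF this, of "%u. u" borel "%v. v\<^sup>2" borel]
 have iv: "indep_var borel U borel (%x. (B t x - B s x)\<^sup>2)" by (simp add: o_def)
 have i: "integrable M (%x. (B t x - B s x)\<^sup>2)" by (rule increment_sq) (use assms in auto)
 show ?thesis
  using indep_var_lebesgue_integral[OF iv assms(5) i] increment_sq(2)[of s t] assms \<open>s < t\<close> by simp
qed simp

lemma bounded_measurable_times_increment: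
 assumes "0 <= s" "s <= t" "t <= T" "\<xi> \<in> borel_measurable M" "bounded (\<xi> ` space M)"
 shows "(%x. (B t x - B s x) *\<^sub>R (\<xi> x :: 'b::euclidean_space)) \<in> borel_measurable M"
  "msq M (%x. (B t x - B s x) *\<^sub>R \<xi> x) < \<infinity>"
proof -
 note [measurable] = increment_measurable[OF assms(1-3)] assms(4)
 show "(%x. (B t x - B s x) *\<^sub>R \<xi> x) \<in> borel_measurable M" by measurable
 obtain c where c: "!!x. x \<in> space M ==> norm (\<xi> x) <= c" using assms(5) by (auto simp: bounded_iff)
 have "msq M (%x. (B t x - B s x) *\<^sub>R \<xi> x) <= msq M (%x. c *\<^sub>R (B t x - B s x))"
 proof (rule msq_mono_AE, rule AE_I2)
  fix x assume "x \<in> space M"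
  then have "norm (\<xi> x) <= \<bar>c\<bar>" using c[of x] by linarith
  then show "norm ((B t x - B s x) *\<^sub>R \<xi> x) <= norm (c *\<^sub>R (B t x - B s x))"
   using mult_right_mono[of "norm (\<xi> x)" "\<bar>c\<bar>" "\<bar>B t x - B s x\<bar>"] by (simp add: abs_mult mult.commute)
 qed
 also have "\<dots> = ennreal (c\<^sup>2) * ennreal (t - s)"
  using msq_scaleR[OF increment_measurable[OF assms(1-3)], of c] msq_increment[OF assms(1-3)] by simp
 also have "\<dots> < \<infinity>" by (simp add: ennreal_mult_less_top)
 finally show "msq M (%x. (B t x - B s x) *\<^sub>R \<xi> x) < \<infinity>" .
qed

text \<open>The length of the intersection of two intervals.\<close>

definition overlap :: "real => real => real => real => real" where
 "overlap a b c d = max 0 (min b d - max a c)"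

text \<open>For disjoint intervals the later increment is independent of everything else and has mean zero. Overlapping intervals
are split at the four end points into disjoint and identical ones.\<close>

lemma ito_pairing:
 assumes "0 <= a" "a <= b" "b <= T" "0 <= c" "c <= d" "d <= T"
  and \<xi>: "\<xi> \<in> borel_measurable (F a)" "bounded (\<xi> ` space M)"
  and \<zeta>: "\<zeta> \<in> borel_measurable (F c)" "bounded (\<zeta> ` space M)"
 shows "integrable M (%x. ((B b x - B a x) * \<xi> x) * ((B d x - B c x) * \<zeta> x))" (is ?int)
  and "expectation (%x. ((B b x - B a x) * \<xi> x) * ((B d x - B c x) * \<zeta> x)) = overlap a b c d * expectation (%x. \<xi> x * \<zeta> x)" (is ?eq)
proof -
 have int: "integrable M (%x. ((B b x - B a x) * \<xi> x) * ((B d x - B c x) * \<zeta> x))"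
  if "0 <= a" "a <= b" "b <= T" "0 <= c" "c <= d" "d <= T"
   "\<xi> \<in> borel_measurable M" "bounded (\<xi> ` space M)" "\<zeta> \<in> borel_measurable M" "bounded (\<zeta> ` space M)"
  for a b c d and \<xi> \<zeta> :: "'w => real"
  using msq_finite_integrable[OF bounded_measurable_times_increment(1)[OF that(1,2,3,7,8)]
    bounded_measurable_times_increment(1)[OF that(4,5,6,9,10)]
    bounded_measurable_times_increment(2)[OF that(1,2,3,7,8)]
    bounded_measurable_times_increment(2)[OF that(4,5,6,9,10)]] by simp
 have FM: "f \<in> borel_measurable M" if "f \<in> borel_measurable (F s)" for f :: "'w => real" and s
  using filtration_on_measurable[OF filt that] .
 show ?int by (rule int[OF assms(1-6) FM[OF \<xi>(1)] \<xi>(2) FM[OF \<zeta>(1)] \<zeta>(2)])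
 have disj: "expectation (%x. ((B b x - B a x) * \<xi> x) * ((B d x - B c x) * \<zeta> x)) = 0"
  if "0 <= a" "a <= b" "b <= c" "c <= d" "d <= T"
   and \<xi>: "\<xi> \<in> borel_measurable (F c)" "bounded (\<xi> ` space M)" and \<zeta>: "\<zeta> \<in> borel_measurable (F c)" "bounded (\<zeta> ` space M)"
  for a b c d and \<xi> \<zeta> :: "'w => real"
 proof -
  obtain z where z: "!!x. x \<in> space M ==> \<bar>\<zeta> x\<bar> <= z" using \<zeta>(2) by (auto simp: bounded_iff)
  have "B a \<in> borel_measurable (F c)" "B b \<in> borel_measurable (F c)"
   using that by (auto intro: filtration_on_mono[OF filt _ adapted])
  then have m: "(%x. (B b x - B a x) * \<xi> x * \<zeta> x) \<in> borel_measurable (F c)" using \<xi> \<zeta> by simp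
  have "integrable M (%x. (B b x - B a x) *\<^sub>R \<xi> x)"
   using that(1-5) by (intro msq_finite_integrable1 bounded_measurable_times_increment FM[OF \<xi>(1)] \<xi>(2)) auto
  then have "integrable M (%x. z * ((B b x - B a x) * \<xi> x))" by simp
  then have "integrable M (%x. (B b x - B a x) * \<xi> x * \<zeta> x)"
  proof (rule Bochner_Integration.integrable_bound)
   show "AE x in M. norm ((B b x - B a x) * \<xi> x * \<zeta> x) <= norm (z * ((B b x - B a x) * \<xi> x))"
   proof (rule AE_I2)
    fix x assume "x \<in> space M"
    then have "\<bar>\<zeta> x\<bar> <= \<bar>z\<bar>" using z[of x] by linarith
    then show "norm ((B b x - B a x) * \<xi> x * \<zeta> x) <= norm (z * ((B b x - B a x) * \<xi> x))"
     using mult_right_mono[of "\<bar>\<zeta> x\<bar>" "\<bar>z\<bar>" "\<bar>(B b x - B a x) * \<xi> x\<bar>"] by (simp add: abs_mult mult.commute)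
   qed
  qed (rule FM[OF m])
  from expectation_past_times_increment(2)[OF _ that(4,5) m this] that
  show ?thesis by (simp add: algebra_simps)
 qed
 have same: "expectation (%x. ((B b x - B a x) * \<xi> x) * ((B b x - B a x) * \<zeta> x)) = (b - a) * expectation (%x. \<xi> x * \<zeta> x)"
  if "0 <= a" "a <= b" "b <= T"
   and \<xi>: "\<xi> \<in> borel_measurable (F a)" "bounded (\<xi> ` space M)" and \<zeta>: "\<zeta> \<in> borel_measurable (F a)" "bounded (\<zeta> ` space M)"
  for a b and \<xi> \<zeta> :: "'w => real"
 proof -
  have "msq M \<xi> < \<infinity>" if bd: "bounded (\<xi> ` space M)" for \<xi> :: "'w => real"
  proof -
   obtain c where "!!x. x \<in> space M ==> norm (\<xi> x) <= c" using bd by (auto simp: bounded_iff)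
   then have "msq M \<xi> <= ennreal (c\<^sup>2) * emeasure M (space M)" by (intro msq_bounded) auto
   then show ?thesis by (auto simp: emeasure_space_1 intro: le_less_trans)
  qed
  then have "integrable M (%x. \<xi> x * \<zeta> x)"
   using msq_finite_integrable[OF FM[OF \<xi>(1)] FM[OF \<zeta>(1)]] \<xi> \<zeta> by simp
  moreover have "(%x. \<xi> x * \<zeta> x) \<in> borel_measurable (F a)" using \<xi> \<zeta> by simp
  ultimately show ?thesis
   using expectation_past_times_increment_sq[OF that(1-3), of "%x. \<xi> x * \<zeta> x"]
   by (simp add: power2_eq_square algebra_simps)
 qed
 have ordered: "expectation (%x. ((B b x - B a x) * \<xi> x) * ((B d x - B c x) * \<zeta> x)) = overlap a b c d * expectation (%x. \<xi> x * \<zeta> x)"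
  if "0 <= a" "a <= b" "b <= T" "0 <= c" "c <= d" "d <= T" "a <= c"
   and \<xi>a: "\<xi> \<in> borel_measurable (F a)" and \<xi>b: "bounded (\<xi> ` space M)" and \<zeta>: "\<zeta> \<in> borel_measurable (F c)" "bounded (\<zeta> ` space M)"
  for a b c d and \<xi> \<zeta> :: "'w => real"
 proof -
  have \<xi>: "\<xi> \<in> borel_measurable (F c)" by (rule filtration_on_mono[OF filt _ \<xi>a]) fact
  have \<xi>m: "\<xi> \<in> borel_measurable M" and \<zeta>m: "\<zeta> \<in> borel_measurable M"
   using FM[OF \<xi>] FM[OF \<zeta>(1)] by auto
  show ?thesis
  proof (cases "b <= c")
   case True
   then show ?thesis using disj[OF that(1,2) True that(5,6) \<xi> \<xi>b \<zeta>] that by (simp add: overlap_def)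
  next
   case False
   define m where "m = min b d"
   have m: "c <= m" "m <= b" "m <= d" "m = b \<or> m = d" using False that by (auto simp: m_def)
   let ?I = "%a b c d x. ((B b x - B a x) * \<xi> x) * ((B d x - B c x) * \<zeta> x)"
   have ii: "integrable M (?I a' b' c' d')" if "0 <= a'" "a' <= b'" "b' <= T" "0 <= c'" "c' <= d'" "d' <= T" for a' b' c' d'
    using that by (intro int \<xi>m \<zeta>m \<xi>b \<zeta>)
   have "?I a b c d x = ?I a c c d x + ?I c m c m x + ?I c m m d x + ?I m b c m x + ?I m b m d x" for x
    by (simp add: algebra_simps)
   moreover have "?I m b m d x = 0" for x using m(4) by auto
   ultimately have "expectation (?I a b c d) = expectation (?I a c c d) + expectation (?I c m c m) + expectation (?I c m m d) + expectation (?I m b c m)"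
    using that m by (simp add: ii)
   also have "expectation (?I a c c d) = 0" by (rule disj) (use that \<xi> \<xi>b \<zeta> in auto)
   also have "expectation (?I c m m d) = 0"
    by (rule disj) (use that m \<xi>b \<zeta> filtration_on_mono[OF filt m(1) \<xi>] filtration_on_mono[OF filt m(1) \<zeta>(1)] in auto)
   also have "expectation (?I m b c m) = expectation (%x. ((B m x - B c x) * \<zeta> x) * ((B b x - B m x) * \<xi> x))"
    by (simp add: mult.commute)
   also have "\<dots> = 0"
    by (rule disj) (use that m \<xi>b \<zeta> filtration_on_mono[OF filt m(1) \<xi>] filtration_on_mono[OF filt m(1) \<zeta>(1)] in auto)
   also have "expectation (?I c m c m) = (m - c) * expectation (%x. \<xi> x * \<zeta> x)"
    by (rule same) (use that m \<xi> \<xi>b \<zeta> in auto)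
   finally show ?thesis using m that(7) by (simp add: overlap_def m_def)
  qed
 qed
 show ?eq
 proof (cases "a <= c")
  case True
  then show ?thesis using ordered assms by blast
 next
  case False
  then have "expectation (%x. ((B d x - B c x) * \<zeta> x) * ((B b x - B a x) * \<xi> x)) = overlap c d a b * expectation (%x. \<zeta> x * \<xi> x)"
   using assms by (intro ordered) auto
  moreover have "overlap c d a b = overlap a b c d" by (simp add: overlap_def min.commute max.commute)
  ultimately show ?thesis by (simp add: mult.commute)
 qed
qed

lemma integral_indicator_overlap:
 assumes "0 <= a" "b <= t" "0 <= c" "d <= t"
 shows "integrable (restrict_space lborel {0..t}) (%s. indicator {a<..b} s * indicator {c<..d} s :: real)"
  "(\<integral>s. indicator {a<..b} s * indicator {c<..d} s \<partial>restrict_space lborel {0..t}) = overlap a b c d"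
proof -
 have eq: "indicator {a<..b} s * indicator {c<..d} s = (indicator {max a c<..min b d} s :: real)" for s
  by (auto simp: indicator_def)
 interpret R: finite_measure "restrict_space lborel {0..t}" by (rule finite_measure_restrict_lborel)
 have sub: "{max a c<..min b d} \<subseteq> {0..t}" using assms by auto
 have s: "{max a c<..min b d} \<in> sets (restrict_space lborel {0..t})"
  using sub by (subst sets_restrict_space_iff) auto
 show "integrable (restrict_space lborel {0..t}) (%s. indicator {a<..b} s * indicator {c<..d} s :: real)"
  unfolding eq using s by (simp add: R.emeasure_finite less_top[symmetric])
 have "(\<integral>s. indicator {a<..b} s * indicator {c<..d} s \<partial>restrict_space lborel {0..t}) = measure (restrict_space lborel {0..t}) {max a c<..min b d}"
  unfolding eq using s sub by (simp add: space_restrict_space Int_absorb1 Int_absorb2)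
 also have "\<dots> = measure lborel {max a c<..min b d}" using sub by (intro measure_restrict_space) auto
 also have "\<dots> = overlap a b c d"
 proof (cases "max a c <= min b d")
  case True
  then show ?thesis unfolding overlap_def by (subst measure_lborel_Ioc) auto
 next
  case False
  then have e: "{max a c<..min b d} = {}" and o: "overlap a b c d = 0" by (auto simp: overlap_def)
  show ?thesis unfolding e o by simp
 qed
 finally show "(\<integral>s. indicator {a<..b} s * indicator {c<..d} s \<partial>restrict_space lborel {0..t}) = overlap a b c d" .
qed

text \<open>Both sides are double sums over pairs of intervals, and these agree term by term by the pairing formula.\<close>

lemma ito_isometry:
 fixes \<xi> :: "nat => 'w => real"
 assumes e: "elementary M F t n a b \<xi>" and t: "t \<in> {0..T}"
 shows "msq M (increment_sum B n a b \<xi>) = msq (time_space t M) (%(s, x). simple_sum n a b \<xi> s x)"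
proof -
 have el: "0 <= a j" "a j <= b j" "b j <= t" "b j <= T" "\<xi> j \<in> borel_measurable (F (a j))" "bounded (\<xi> j ` space M)" if "j < n" for j
  using e t that unfolding elementary_def by force+
 have \<xi>m [measurable]: "j < n ==> \<xi> j \<in> borel_measurable M" for j by (rule elementary_measurable[OF filt e])
 define E where "E j k = expectation (%x. \<xi> j x * \<xi> k x)" for j k
 have \<xi>i: "integrable M (%x. \<xi> j x * \<xi> k x)" if jk: "j < n" "k < n" for j k
 proof -
  have f: "msq M (\<xi> j) < \<infinity>" if j: "j < n" for j
  proof -
   obtain c where "!!x. x \<in> space M ==> norm (\<xi> j x) <= c" using el(6)[OF j] by (auto simp: bounded_iff)
   then have "msq M (\<xi> j) <= ennreal (c\<^sup>2) * emeasure M (space M)" by (intro msq_bounded) auto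
   then show ?thesis by (auto simp: emeasure_space_1 intro: le_less_trans)
  qed
  show ?thesis using msq_finite_integrable[OF \<xi>m \<xi>m f f, of j k] jk by simp
 qed
 note pair = ito_pairing[OF el(1,2,4) el(1,2,4) el(5,6) el(5,6)]
 let ?f = "%j k x. ((B (b j) x - B (a j) x) * \<xi> j x) * ((B (b k) x - B (a k) x) * \<xi> k x)"
 have eq: "increment_sum B n a b \<xi> x * increment_sum B n a b \<xi> x = (\<Sum>j<n. \<Sum>k<n. ?f j k x)" for x
  by (simp add: increment_sum_def sum_product)
 have fi: "integrable M (?f j k)" and fe: "expectation (?f j k) = overlap (a j) (b j) (a k) (b k) * E j k"
  if "j < n" "k < n" for j k
  using pair[of j k] that by (simp_all add: E_def)
 have "expectation (%x. \<Sum>j<n. \<Sum>k<n. ?f j k x) = (\<Sum>j<n. \<Sum>k<n. expectation (?f j k))"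
  by (rule integral_double_sum[OF fi])
 also have "\<dots> = (\<Sum>j<n. \<Sum>k<n. overlap (a j) (b j) (a k) (b k) * E j k)"
  by (intro sum.cong refl fe) auto
 finally have 1: "expectation (%x. increment_sum B n a b \<xi> x * increment_sum B n a b \<xi> x) = (\<Sum>j<n. \<Sum>k<n. overlap (a j) (b j) (a k) (b k) * E j k)"
  by (simp only: eq)
 have 0: "integrable M (%x. increment_sum B n a b \<xi> x * increment_sum B n a b \<xi> x)"
  unfolding eq by (intro Bochner_Integration.integrable_sum fi) auto
 have lhs: "msq M (increment_sum B n a b \<xi>) = ennreal (\<Sum>j<n. \<Sum>k<n. overlap (a j) (b j) (a k) (b k) * E j k)"
  unfolding msq_def using nn_integral_eq_integral[OF 0] 1 by (simp add: power2_eq_square)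
 let ?R = "restrict_space lborel {0..t}"
 have sm: "(%(s, x). simple_sum n a b \<xi> s x) \<in> borel_measurable (time_space t M)"
  by (rule borel_measurable_simple_sum) simp
 define G where "G s = (\<Sum>j<n. \<Sum>k<n. (indicator {a j<..b j} s * indicator {a k<..b k} s) * E j k)" for s :: real
 have G: "msq M (simple_sum n a b \<xi> s) = ennreal (G s)" "G s >= 0" for s
 proof -
  let ?i = "%j k. indicator {a j<..b j} s * indicator {a k<..b k} s :: real"
  have eq: "simple_sum n a b \<xi> s x * simple_sum n a b \<xi> s x = (\<Sum>j<n. \<Sum>k<n. ?i j k * (\<xi> j x * \<xi> k x))" for x
   by (simp only: simple_sum_def sum_product real_scaleR_def) (simp only: ac_simps)
  have fi: "integrable M (%x. ?i j k * (\<xi> j x * \<xi> k x))" if "j < n" "k < n" for j k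
   by (rule integrable_mult_right) (rule \<xi>i[OF that])
  have "expectation (%x. \<Sum>j<n. \<Sum>k<n. ?i j k * (\<xi> j x * \<xi> k x)) = (\<Sum>j<n. \<Sum>k<n. expectation (%x. ?i j k * (\<xi> j x * \<xi> k x)))"
   by (rule integral_double_sum[OF fi])
  also have "\<dots> = G s"
   unfolding G_def E_def by (intro sum.cong refl integral_mult_right_zero)
  finally have 2: "expectation (%x. simple_sum n a b \<xi> s x * simple_sum n a b \<xi> s x) = G s"
   by (simp only: eq)
  have 3: "integrable M (%x. simple_sum n a b \<xi> s x * simple_sum n a b \<xi> s x)"
   unfolding eq by (intro Bochner_Integration.integrable_sum fi) auto
  show "msq M (simple_sum n a b \<xi> s) = ennreal (G s)"
   unfolding msq_def using nn_integral_eq_integral[OF 3] 2 by (simp add: power2_eq_square)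
  show "G s >= 0" unfolding 2[symmetric] by (intro integral_nonneg_AE AE_I2) simp
 qed
 have "msq (time_space t M) (%(s, x). simple_sum n a b \<xi> s x) = (\<integral>\<^sup>+s. msq M (simple_sum n a b \<xi> s) \<partial>?R)"
  unfolding msq_def using sm by (subst nn_integral_fst[symmetric]) (simp_all add: case_prod_unfold)
 also have "\<dots> = (\<integral>\<^sup>+s. ennreal (G s) \<partial>?R)" by (simp only: G(1))
 also have "\<dots> = ennreal (\<integral>s. G s \<partial>?R)"
  using G(2) el by (intro nn_integral_eq_integral) (auto simp: G_def intro!: Bochner_Integration.integrable_sum integrable_mult_left integral_indicator_overlap(1))
 also have "(\<integral>s. G s \<partial>?R) = (\<Sum>j<n. \<Sum>k<n. overlap (a j) (b j) (a k) (b k) * E j k)"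
  unfolding G_def
  using el by (subst integral_double_sum) (auto intro!: sum.cong integrable_mult_left integral_indicator_overlap(1) simp: integral_indicator_overlap(2))
 finally show ?thesis using lhs by simp
qed

lemma integrator_brownian: "integrator M F T B"
 unfolding integrator_def using B_measurable ito_isometry by (auto intro!: exI[of _ 1])

lemma stoch_integral_mean_zero:
 fixes X :: "real => 'w => 'b::euclidean_space"
 assumes "has_stoch_integral M F B X t Z" "t \<in> {0..T}"
 shows "integrable M Z" "expectation Z = 0"
proof -
 obtain n \<tau> \<xi> where sd: "!!m. simple_data M F t (n m) (\<tau> m) (\<xi> m)"
  and l2: "(%m. \<integral>\<^sup>+x. ennreal ((norm (Z x - simple_integral B (n m) (\<tau> m) (\<xi> m) x))\<^sup>2) \<partial>M) \<longlonglongrightarrow> 0"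
  and Zm: "Z \<in> borel_measurable M"
  using assms(1) unfolding has_stoch_integral_def by blast
 define f where "f m = simple_integral B (n m) (\<tau> m) (\<xi> m)" for m
 have el: "0 <= \<tau> m j" "\<tau> m j <= \<tau> m (Suc j)" "\<tau> m (Suc j) <= T"
  "\<xi> m j \<in> borel_measurable (F (\<tau> m j))" "bounded (\<xi> m j ` space M)" if "j < n m" for m j
  using simple_data_elementary[OF sd[of m]] assms(2) that unfolding elementary_def by force+
 have \<xi>m: "\<xi> m j \<in> borel_measurable M" if "j < n m" for m j
  using filtration_on_measurable[OF filt el(4)[OF that]] .
 note b = bounded_measurable_times_increment[OF el(1-3) \<xi>m el(5)]
 have fm: "f m \<in> borel_measurable M" for m
  unfolding f_def simple_integral_def using b by (intro borel_measurable_sum) auto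
 have ff: "msq M (f m) < \<infinity>" for m
 proof -
  have "msq M (f m) <= of_nat (card {..<n m}) * (\<Sum>j<n m. msq M (%x. (B (\<tau> m (Suc j)) x - B (\<tau> m j) x) *\<^sub>R \<xi> m j x))"
   unfolding f_def simple_integral_def using b by (intro msq_sum_le) auto
  also have "\<dots> < \<infinity>" using b(2) by (auto simp: ennreal_mult_less_top of_nat_less_top)
  finally show ?thesis .
 qed
 have fe: "expectation (f m) = 0" for m
 proof -
  have t: "integrable M (%x. (B (\<tau> m (Suc j)) x - B (\<tau> m j) x) *\<^sub>R \<xi> m j x) \<and>
    expectation (%x. (B (\<tau> m (Suc j)) x - B (\<tau> m j) x) *\<^sub>R \<xi> m j x) = 0" if j: "j < n m" for j
  proof
   show i: "integrable M (%x. (B (\<tau> m (Suc j)) x - B (\<tau> m j) x) *\<^sub>R \<xi> m j x)"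
    by (rule msq_finite_integrable1[OF b[OF j j j j j]])
   obtain c where c: "!!x. x \<in> space M ==> norm (\<xi> m j x) <= c" using el(5)[OF j] by (auto simp: bounded_iff)
   have "integrable M (\<xi> m j)" using c by (intro integrable_const_bound[of _ c] \<xi>m j AE_I2) auto
   then have i2: "integrable M (%x. \<xi> m j x \<bullet> u)" for u by simp
   have "expectation (%x. (\<xi> m j x \<bullet> u) * (B (\<tau> m (Suc j)) x - B (\<tau> m j) x)) = 0" for u
    using el(4)[OF j] by (intro expectation_past_times_increment el[OF j] i2) auto
   then have "expectation (%x. (B (\<tau> m (Suc j)) x - B (\<tau> m j) x) *\<^sub>R \<xi> m j x) \<bullet> u = 0" for u
    by (subst integral_inner_left[symmetric]) (use i in \<open>auto simp: mult.commute\<close>)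
   then show "expectation (%x. (B (\<tau> m (Suc j)) x - B (\<tau> m j) x) *\<^sub>R \<xi> m j x) = 0"
    using inner_eq_zero_iff by blast
  qed
  then show ?thesis unfolding f_def simple_integral_def by (subst Bochner_Integration.integral_sum) auto
 qed
 have lim: "(%m. msq M (%x. Z x - f m x)) \<longlonglongrightarrow> 0" using l2 unfolding f_def by (simp add: msq_def)
 have fi: "integrable M (f m)" for m by (rule msq_finite_integrable1[OF fm ff])
 have "(%m. expectation (f m)) \<longlonglongrightarrow> 0" by (simp add: fe)
 from msq_limit_tendsto_expectation[OF fi Zm lim this]
 show "integrable M Z" "expectation Z = 0" by auto
qed

end

lemma indep_set_indep_var:
 assumes "prob_space M" "prob_space.indep_set M (sets G) {Y -` B \<inter> space M | B. B \<in> sets N}"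
  and "space G = space M" "U \<in> measurable G K" "Y \<in> measurable M N"
 shows "prob_space.indep_var M K U N Y"
proof -
 interpret prob_space M by fact
 have G: "sets G \<subseteq> sets M" using indep_setD_ev1[OF assms(2)] .
 have U: "U \<in> measurable M K" using assms(3,4) G unfolding measurable_def by auto
 have sub: "sigma_sets (space M) {U -` A \<inter> space M | A. A \<in> sets K} \<subseteq> sets G"
 proof -
  have "{U -` A \<inter> space M | A. A \<in> sets K} \<subseteq> sets G" using measurable_sets[OF assms(4)] assms(3) by auto
  then show ?thesis using sets.sigma_sets_subset[of _ G] assms(3) by simp
 qed
 have sY: "sigma_sets (space M) {Y -` B \<inter> space M | B. B \<in> sets N} = {Y -` B \<inter> space M | B. B \<in> sets N}"
 proof -
  have "space M \<in> {Y -` B \<inter> space M | B. B \<in> sets N}" using measurable_space[OF assms(5)] by (auto intro!: exI[of _ "space N"])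
  have "sigma_sets (space M) {Y -` B \<inter> space M | B. B \<in> sets N} = {Y -` B \<inter> space M | B. B \<in> sigma_sets (space N) (sets N)}"
   using sigma_sets_vimage_commute[of Y "space M" "space N" "sets N"] measurable_space[OF assms(5)] by auto
  then show ?thesis by (simp add: sets.sigma_sets_eq)
 qed
 show ?thesis
  unfolding indep_var_eq sY
 proof (intro conjI U assms(5))
  show "indep_set (sigma_sets (space M) {U -` A \<inter> space M |A. A \<in> sets K}) {Y -` B \<inter> space M | B. B \<in> sets N}"
   using assms(2) sub unfolding indep_sets2_eq by blast
 qed
qed

lemma wiener_measurable:
 assumes "filtration_on M F" "wiener_process M F T W" "t \<in> {0..T}"
 shows "W t \<in> borel_measurable M"
 using assms filtration_on_measurable unfolding wiener_process_def by blast

lemma wiener_increment_indep_set: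
 assumes "prob_space M" "wiener_process M F T W" "0 <= s" "s < t" "t <= T" "g \<in> measurable borel N"
 shows "prob_space.indep_set M (sets (F s)) {(%x. g (W t x - W s x)) -` B \<inter> space M | B. B \<in> sets N}"
proof -
 interpret prob_space M by fact
 have i: "indep_set (sets (F s)) {(%x. W t x - W s x) -` B \<inter> space M | B. B \<in> sets borel}"
  using assms(2-5) unfolding wiener_process_def by blast
 have sub: "{(%x. g (W t x - W s x)) -` B \<inter> space M | B. B \<in> sets N} \<subseteq>
   {(%x. W t x - W s x) -` B \<inter> space M | B. B \<in> sets borel}"
 proof
  fix S assume "S \<in> {(%x. g (W t x - W s x)) -` B \<inter> space M | B. B \<in> sets N}"
  then obtain B where B: "B \<in> sets N" "S = (%x. g (W t x - W s x)) -` B \<inter> space M" by blast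
  have "g -` B \<in> sets borel" using measurable_sets[OF assms(6) B(1)] by simp
  moreover have "S = (%x. W t x - W s x) -` (g -` B) \<inter> space M" using B(2) by auto
  ultimately show "S \<in> {(%x. W t x - W s x) -` B \<inter> space M | B. B \<in> sets borel}" by blast
 qed
 show ?thesis
  unfolding indep_sets2_eq
 proof (intro conjI ballI)
  show "sets (F s) \<subseteq> events" by (rule indep_setD_ev1[OF i])
  show "{(%x. g (W t x - W s x)) -` B \<inter> space M | B. B \<in> sets N} \<subseteq> events"
   by (rule order_trans[OF sub indep_setD_ev2[OF i]])
  fix X Y assume "X \<in> sets (F s)" "Y \<in> {(%x. g (W t x - W s x)) -` B \<inter> space M | B. B \<in> sets N}"
  then show "prob (X \<inter> Y) = prob X * prob Y" by (intro indep_setD[OF i] subsetD[OF sub])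
 qed
qed

lemma wiener_scalar_brownian:
 fixes W :: "real => 'w => real^'r::finite"
 assumes "prob_space M" "filtration_on M F" "wiener_process M F T W"
 shows "scalar_brownian M F T (%t x. W t x $ k)"
proof -
 interpret prob_space M by fact
 have nth [measurable]: "(%v :: real^'r. v $ k) \<in> borel_measurable borel"
  by (intro borel_measurable_continuous_onI continuous_intros)
 have D: "distributed M lborel (%x. (W t x - W s x) $ k) (normal_density 0 (sqrt (t - s)))"
  if "0 <= s" "s < t" "t <= T" for s t
  using assms(3) that unfolding wiener_process_def by blast
 show ?thesis
 proof
  show "filtration_on M F" by fact
  fix t assume "t \<in> {0..T}"
  then have "W t \<in> borel_measurable (F t)" using assms(3) unfolding wiener_process_def by blast
  then show "(%x. W t x $ k) \<in> borel_measurable (F t)" by (rule measurable_compose[OF _ nth])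
 next
  fix s t and U :: "'w => real"
  assume st: "0 <= s" "s < t" "t <= T" and U: "U \<in> borel_measurable (F s)"
  have "indep_var borel U borel (%x. (W t x - W s x) $ k)"
  proof (rule indep_set_indep_var[OF assms(1) wiener_increment_indep_set[OF assms(1,3) st nth] _ U])
   show "space (F s) = space M" using assms(2) unfolding filtration_on_def by (simp add: subalgebra_def)
   show "(%x. (W t x - W s x) $ k) \<in> borel_measurable M"
    using st by (intro measurable_compose[OF _ nth] borel_measurable_diff wiener_measurable[OF assms(2,3)]) auto
  qed
  then show "indep_var borel U borel (%x. W t x $ k - W s x $ k)" by simp
 next
  fix s t assume st: "0 <= s" "s < t" "t <= T"
  have e: "expectation (%x. (W t x - W s x) $ k) = 0"
   using normal_distributed_expectation[OF _ D[OF st]] st by simp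
  then show "expectation (%x. W t x $ k - W s x $ k) = 0" by simp
  have v: "variance (%x. (W t x - W s x) $ k) = t - s"
   using normal_distributed_variance[OF _ D[OF st]] st by simp
  have m: "(%x. (W t x - W s x) $ k) \<in> borel_measurable M"
   using distributed_measurable[OF D[OF st]] by simp
  have "integrable M (%x. ((W t x - W s x) $ k)\<^sup>2)"
  proof (rule ccontr)
   assume "\<not> ?thesis"
   then have "expectation (%x. ((W t x - W s x) $ k)\<^sup>2) = 0" by (rule not_integrable_integral_eq)
   then show False using v e st by simp
  qed
  then show "msq M (%x. W t x $ k - W s x $ k) = ennreal (t - s)"
   unfolding msq_def using v e by (subst nn_integral_eq_integral) auto
 qed
qed

section \<open>Integrators with bounded drift\<close>

lemma set_lebesgue_integral_increment:
 fixes c :: "real => real"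
 assumes "c \<in> borel_measurable borel" "!!s. \<bar>c s\<bar> <= K" "0 <= a" "a <= b" "b <= t"
 shows "(LBINT s:{0..b}. c s) - (LBINT s:{0..a}. c s) = (\<integral>s. indicator {a<..b} s * c s \<partial>restrict_space lborel {0..t})"
proof -
 have i: "integrable lborel (%s. indicator A s * c s)" if "A \<in> sets borel" "A \<subseteq> {0..t}" for A :: "real set"
 proof (rule Bochner_Integration.integrable_bound)
  show "integrable lborel (%s. K * indicator {0..t} s :: real)"
   by (intro integrable_mult_right integrable_real_indicator) (auto simp: emeasure_lborel_Icc_eq)
  show "(%s. indicator A s * c s) \<in> borel_measurable lborel" using assms(1) that by simp
  show "AE s in lborel. norm (indicator A s * c s) <= norm (K * indicator {0..t} s :: real)"
  proof (rule AE_I2)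
   fix s :: real
   have "\<bar>c s\<bar> <= \<bar>K\<bar>" using assms(2)[of s] by linarith
   then show "norm (indicator A s * c s) <= norm (K * indicator {0..t} s :: real)"
    using that(2) by (auto simp: indicator_def)
  qed
 qed
 have "(LBINT s:{0..b}. c s) - (LBINT s:{0..a}. c s) = (\<integral>s. indicator {0..b} s * c s - indicator {0..a} s * c s \<partial>lborel)"
  unfolding set_lebesgue_integral_def using i[of "{0..b}"] i[of "{0..a}"] assms by simp
 also have "\<dots> = (\<integral>s. indicator {0..t} s * (indicator {a<..b} s * c s) \<partial>lborel)"
  using assms by (intro Bochner_Integration.integral_cong) (auto simp: indicator_def)
 also have "\<dots> = (\<integral>s. indicator {a<..b} s * c s \<partial>restrict_space lborel {0..t})"
  by (subst integral_restrict_space) auto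
 finally show ?thesis .
qed

text \<open>The Cauchy-Schwarz inequality in time, integrated over the outcomes.\<close>

lemma msq_time_integral_le:
 fixes \<phi> :: "real => 'w => 'b::euclidean_space"
 assumes "prob_space M" "t >= 0" and \<phi>: "(%(s, x). \<phi> s x) \<in> borel_measurable (time_space t M)"
  and i: "!!x. x \<in> space M ==> integrable (restrict_space lborel {0..t}) (%s. \<phi> s x)"
 shows "msq M (%x. \<integral>s. \<phi> s x \<partial>restrict_space lborel {0..t}) <= ennreal t * msq (time_space t M) (%(s, x). \<phi> s x)"
proof -
 interpret prob_space M by fact
 let ?R = "restrict_space lborel {0..t}"
 interpret R: finite_measure ?R by (rule finite_measure_restrict_lborel)
 interpret P: pair_sigma_finite ?R M ..
 have eR: "emeasure ?R (space ?R) = ennreal t"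
  using assms(2) by (simp add: emeasure_restrict_space space_restrict_space)
 have pm: "(%s. \<phi> s x) \<in> borel_measurable ?R" if "x \<in> space M" for x
  using measurable_compose[OF measurable_Pair2'[OF that] \<phi>] by simp
 have "msq M (%x. \<integral>s. \<phi> s x \<partial>?R) <= (\<integral>\<^sup>+x. ennreal t * (\<integral>\<^sup>+s. ennreal ((norm (\<phi> s x))\<^sup>2) \<partial>?R) \<partial>M)"
  unfolding msq_def
 proof (rule nn_integral_mono)
  fix x assume x: "x \<in> space M"
  note [measurable] = pm[OF x]
  have "ennreal ((norm (\<integral>s. \<phi> s x \<partial>?R))\<^sup>2) = (ennreal (norm (\<integral>s. \<phi> s x \<partial>?R)))\<^sup>2"
   by (simp add: ennreal_power)
  also have "\<dots> <= (\<integral>\<^sup>+s. 1 * ennreal (norm (\<phi> s x)) \<partial>?R)\<^sup>2"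
   using integral_norm_bound_ennreal[OF i[OF x]] by (intro power_mono) auto
  also have "\<dots> <= (\<integral>\<^sup>+s. 1 ^ 2 \<partial>?R) * (\<integral>\<^sup>+s. (ennreal (norm (\<phi> s x)))\<^sup>2 \<partial>?R)"
   by (rule Cauchy_Schwarz_nn_integral) measurable
  also have "\<dots> = ennreal t * (\<integral>\<^sup>+s. ennreal ((norm (\<phi> s x))\<^sup>2) \<partial>?R)"
   using eR by (simp add: ennreal_power space_restrict_space)
  finally show "ennreal ((norm (\<integral>s. \<phi> s x \<partial>?R))\<^sup>2) <= ennreal t * (\<integral>\<^sup>+s. ennreal ((norm (\<phi> s x))\<^sup>2) \<partial>?R)" .
 qed
 also have "\<dots> = ennreal t * (\<integral>\<^sup>+x. (\<integral>\<^sup>+s. ennreal ((norm (\<phi> s x))\<^sup>2) \<partial>?R) \<partial>M)"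
 proof (rule nn_integral_cmult)
  have "(%(s, x). ennreal ((norm (\<phi> s x))\<^sup>2)) \<in> borel_measurable (time_space t M)"
   using \<phi> by (simp add: case_prod_unfold)
  from measurable_pair_swap[OF this]
  have "(%(x, s). ennreal ((norm (\<phi> s x))\<^sup>2)) \<in> borel_measurable (M \<Otimes>\<^sub>M ?R)" by simp
  then show "(%x. \<integral>\<^sup>+s. ennreal ((norm (\<phi> s x))\<^sup>2) \<partial>?R) \<in> borel_measurable M"
   by (rule R.borel_measurable_nn_integral)
 qed
 also have "(\<integral>\<^sup>+x. (\<integral>\<^sup>+s. ennreal ((norm (\<phi> s x))\<^sup>2) \<partial>?R) \<partial>M) = msq (time_space t M) (%(s, x). \<phi> s x)"
  unfolding msq_def using \<phi> P.nn_integral_snd[of "%p. ennreal ((norm (case p of (s, x) => \<phi> s x))\<^sup>2)"] by simp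
 finally show ?thesis .
qed

text \<open>A bounded drift contributes at most its bound times the time integral of the integrand.\<close>

lemma integrator_drift:
 fixes c :: "real => 'w => real"
 assumes "prob_space M" "filtration_on M F" and c: "(%(s, x). c s x) \<in> borel_measurable (borel \<Otimes>\<^sub>M M)"
  and K: "!!s x. \<bar>c s x\<bar> <= K"
 shows "integrator M F T (%t x. LBINT s:{0..t}. c s x)"
proof -
 interpret prob_space M by fact
 have K0: "K >= 0" using K[of 0 undefined] by linarith
 have cx: "(%s. c s x) \<in> borel_measurable borel" if "x \<in> space M" for x
  using measurable_compose[OF measurable_Pair2'[OF that] c] by simp
 have meas: "(%x. LBINT s:{0..t}. c s x) \<in> borel_measurable M" for t
 proof -
  have "(%(x, s). indicator {0..t} s * c s x) \<in> borel_measurable (M \<Otimes>\<^sub>M lborel)"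
  proof -
   have "(%p. (snd p, fst p)) \<in> M \<Otimes>\<^sub>M lborel \<rightarrow>\<^sub>M borel \<Otimes>\<^sub>M M" by simp
   from measurable_compose[OF this c] show ?thesis by (simp add: case_prod_unfold)
  qed
  then show ?thesis unfolding set_lebesgue_integral_def
   using lborel.borel_measurable_lebesgue_integral[of "%x s. indicator {0..t} s * c s x" M] by simp
 qed
 have "msq M (increment_sum (%t x. LBINT s:{0..t}. c s x) n a b \<xi>) \<le>
   ennreal (\<bar>T\<bar> * K\<^sup>2) * msq (time_space t M) (%(s, x). simple_sum n a b \<xi> s x)"
  if t: "t \<in> {0..T}" and e: "elementary M F t n a b \<xi>" for t n a b and \<xi> :: "nat => 'w => real"
 proof -
  let ?R = "restrict_space lborel {0..t}"
  interpret R: finite_measure ?R by (rule finite_measure_restrict_lborel)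
  have el: "0 <= a j" "a j <= b j" "b j <= t" if "j < n" for j
   using e that unfolding elementary_def by force+
  have sm: "(%(s, x). simple_sum n a b \<xi> s x) \<in> borel_measurable (time_space t M)"
   by (rule borel_measurable_simple_sum) (rule elementary_measurable[OF assms(2) e])
  have ii: "integrable ?R (%s. indicator {a j<..b j} s * c s x)" if "x \<in> space M" for x j
   using K[of _ x] cx[OF that]
   by (intro R.integrable_const_bound[of _ K] AE_I2 measurable_restrict_space1) (auto simp: indicator_def K0)
  have eq: "increment_sum (%t x. LBINT s:{0..t}. c s x) n a b \<xi> x = (\<integral>s. c s x * simple_sum n a b \<xi> s x \<partial>?R)"
   if x: "x \<in> space M" for x
  proof -
   have "increment_sum (%t x. LBINT s:{0..t}. c s x) n a b \<xi> x =
     (\<Sum>j<n. (\<integral>s. indicator {a j<..b j} s * c s x \<partial>?R) * \<xi> j x)"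
    unfolding increment_sum_def
    using set_lebesgue_integral_increment[OF cx[OF x] K[of _ x] el] by (intro sum.cong) auto
   also have "\<dots> = (\<integral>s. (\<Sum>j<n. (indicator {a j<..b j} s * c s x) * \<xi> j x) \<partial>?R)"
    using ii[OF x] by (subst Bochner_Integration.integral_sum) auto
   also have "\<dots> = (\<integral>s. c s x * simple_sum n a b \<xi> s x \<partial>?R)"
    by (simp only: simple_sum_def sum_distrib_left real_scaleR_def) (simp only: ac_simps)
   finally show ?thesis .
  qed
  have cm: "(%(s, x). c s x) \<in> borel_measurable (time_space t M)" by (rule measurable_time_spaceI[OF c])
  have "msq M (increment_sum (%t x. LBINT s:{0..t}. c s x) n a b \<xi>) = msq M (%x. \<integral>s. c s x * simple_sum n a b \<xi> s x \<partial>?R)"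
   by (rule msq_cong) (simp add: eq)
  also have "\<dots> <= ennreal t * msq (time_space t M) (%(s, x). c s x * simple_sum n a b \<xi> s x)"
  proof (rule msq_time_integral_le[OF assms(1)])
   show "(%(s, x). c s x * simple_sum n a b \<xi> s x) \<in> borel_measurable (time_space t M)"
    using borel_measurable_times[OF cm sm] by (simp add: case_prod_unfold)
   fix x assume x: "x \<in> space M"
   have "(%s. c s x * simple_sum n a b \<xi> s x) = (%s. \<Sum>j<n. (indicator {a j<..b j} s * c s x) * \<xi> j x)"
    by (intro ext) (simp only: simple_sum_def sum_distrib_left real_scaleR_def ac_simps)
   then show "integrable ?R (%s. c s x * simple_sum n a b \<xi> s x)" using ii[OF x] by simp
  qed (use t in auto)
  also have "\<dots> <= ennreal t * (ennreal (K\<^sup>2) * msq (time_space t M) (%(s, x). simple_sum n a b \<xi> s x))"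
  proof (rule mult_left_mono)
   have "msq (time_space t M) (%(s, x). c s x * simple_sum n a b \<xi> s x) \<le>
     msq (time_space t M) (%p. K *\<^sub>R (case p of (s, x) => simple_sum n a b \<xi> s x))"
   proof (rule msq_mono_AE, rule AE_I2)
    fix p :: "real \<times> 'w"
    obtain s x where p: "p = (s, x)" by (cases p)
    have "\<bar>c s x\<bar> * \<bar>simple_sum n a b \<xi> s x\<bar> <= \<bar>K\<bar> * \<bar>simple_sum n a b \<xi> s x\<bar>"
     using K[of s x] by (intro mult_right_mono) linarith+
    then show "norm (case p of (s, x) => c s x * simple_sum n a b \<xi> s x) <= norm (K *\<^sub>R (case p of (s, x) => simple_sum n a b \<xi> s x))"
     unfolding p by (simp only: prod.case real_norm_def abs_mult real_scaleR_def)
   qed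
   also have "\<dots> = ennreal (K\<^sup>2) * msq (time_space t M) (%(s, x). simple_sum n a b \<xi> s x)"
    by (rule msq_scaleR[OF sm])
   finally show "msq (time_space t M) (%(s, x). c s x * simple_sum n a b \<xi> s x) <= ennreal (K\<^sup>2) * msq (time_space t M) (%(s, x). simple_sum n a b \<xi> s x)" .
  qed simp
  also have "\<dots> = ennreal (t * K\<^sup>2) * msq (time_space t M) (%(s, x). simple_sum n a b \<xi> s x)"
   using t by (simp add: ennreal_mult mult.assoc)
  also have "\<dots> <= ennreal (\<bar>T\<bar> * K\<^sup>2) * msq (time_space t M) (%(s, x). simple_sum n a b \<xi> s x)"
   using t by (intro mult_right_mono ennreal_leI) auto
  finally show ?thesis .
 qed
 moreover have "\<bar>T\<bar> * K\<^sup>2 >= 0" by simp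
 ultimately show ?thesis unfolding integrator_def using meas by (intro conjI ballI exI[of _ "\<bar>T\<bar> * K\<^sup>2"]) auto
qed

section \<open>The law of the driving noise\<close>

lemma borel_measurable_vec_lambda_PiM:
 "(%f. (\<chi> k. f k) :: real^'r::finite) \<in> borel_measurable (Pi\<^sub>M UNIV (%_. borel))"
proof (subst borel_measurable_euclidean_space, intro ballI)
 fix b :: "real^'r" assume "b \<in> Basis"
 have "(%f. (\<chi> k. f k) \<bullet> b) = (%f. \<Sum>k\<in>UNIV. f k * b $ k)"
  by (intro ext) (simp add: inner_vec_def)
 moreover have "(%f. \<Sum>k\<in>(UNIV :: 'r set). f k * b $ k) \<in> borel_measurable (Pi\<^sub>M UNIV (%_. borel :: real measure))"
  by (intro borel_measurable_sum borel_measurable_times measurable_component_singleton) auto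
 ultimately show "(%f. (\<chi> k. f k) \<bullet> b) \<in> borel_measurable (Pi\<^sub>M UNIV (%_. borel :: real measure))" by simp
qed

lemma distr_wiener_increment:
 fixes W W' :: "real => 'w => real^'r::finite"
 assumes "prob_space M" "filtration_on M F" "wiener_process M F T W" "wiener_process M F T W'" "0 <= s" "s < t" "t <= T"
 shows "distr M borel (%x. W t x - W s x) = distr M borel (%x. W' t x - W' s x)"
proof -
 interpret prob_space M by fact
 let ?P = "\<Pi>\<^sub>M k\<in>(UNIV :: 'r set). density lborel (normal_density 0 (sqrt (t - s)))"
 have key: "distr M borel (%x. W t x - W s x) = distr ?P borel (%f. \<chi> k. f k)"
  if w: "wiener_process M F T W" for W :: "real => 'w => real^'r"
 proof -
  let ?D = "%k x. (W t x - W s x) $ k"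
  have D: "distributed M lborel (?D k) (normal_density 0 (sqrt (t - s)))" for k
   using w assms(5-) unfolding wiener_process_def by blast
  have m: "?D k \<in> borel_measurable M" for k using distributed_measurable[OF D[of k]] by simp
  have iv: "indep_vars (%_. borel) ?D UNIV" using w assms(5-) unfolding wiener_process_def by blast
  have dd: "distr M borel (?D k) = density lborel (normal_density 0 (sqrt (t - s)))" for k
   using distributed_distr_eq_density[OF D[of k]] by (simp cong: distr_cong)
  have "distr M (\<Pi>\<^sub>M k\<in>UNIV. borel) (%x. \<lambda>k\<in>UNIV. ?D k x) = (\<Pi>\<^sub>M k\<in>UNIV. distr M borel (?D k))"
   using indep_vars_iff_distr_eq_PiM'[of UNIV ?D "%_. borel"] m iv by blast
  also have "\<dots> = ?P" by (simp only: dd)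
  finally have "distr M (\<Pi>\<^sub>M k\<in>UNIV. borel) (%x. \<lambda>k\<in>UNIV. ?D k x) = ?P" .
  then have "distr ?P borel (%f. (\<chi> k. f k) :: real^'r) = distr (distr M (\<Pi>\<^sub>M k\<in>UNIV. borel) (%x. \<lambda>k\<in>UNIV. ?D k x)) borel (%f. \<chi> k. f k)"
   by simp
  also have "\<dots> = distr M borel ((%f. \<chi> k. f k) \<circ> (%x. \<lambda>k\<in>UNIV. ?D k x))"
   using m by (intro distr_distr borel_measurable_vec_lambda_PiM measurable_restrict) auto
  also have "\<dots> = distr M borel (%x. W t x - W s x)"
   by (intro distr_cong) (auto simp: vec_eq_iff)
  finally show ?thesis by simp
 qed
 show ?thesis by (rule trans[OF key[OF assms(3)] key[OF assms(4), symmetric]])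
qed

lemma distr_pair_indep_set:
 assumes "prob_space M" "prob_space.indep_set M (sets G) {Y -` B \<inter> space M | B. B \<in> sets N}"
  and "space G = space M" "U \<in> measurable G K" "Y \<in> measurable M N"
 shows "distr M (K \<Otimes>\<^sub>M N) (%x. (U x, Y x)) = distr M K U \<Otimes>\<^sub>M distr M N Y"
proof -
 interpret prob_space M by fact
 have G: "sets G \<subseteq> sets M" using indep_setD_ev1[OF assms(2)] .
 have U: "U \<in> measurable M K" using assms(3,4) G unfolding measurable_def by auto
 interpret U: prob_space "distr M K U" by (rule prob_space_distr[OF U])
 interpret Y: prob_space "distr M N Y" by (rule prob_space_distr[OF assms(5)])
 have UY: "(%x. (U x, Y x)) \<in> M \<rightarrow>\<^sub>M K \<Otimes>\<^sub>M N" by (intro measurable_Pair U assms(5))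
 show ?thesis
 proof (rule pair_measure_eqI[symmetric])
  show "sigma_finite_measure (distr M K U)" "sigma_finite_measure (distr M N Y)" by unfold_locales
  show "sets (distr M K U \<Otimes>\<^sub>M distr M N Y) = sets (distr M (K \<Otimes>\<^sub>M N) (%x. (U x, Y x)))"
   by (simp cong: sets_pair_measure_cong)
  fix A B assume AB: "A \<in> sets (distr M K U)" "B \<in> sets (distr M N Y)"
  then have AB': "A \<in> sets K" "B \<in> sets N" by auto
  have "U -` A \<inter> space M \<in> sets G" using measurable_sets[OF assms(4) AB'(1)] assms(3) by simp
  moreover have "Y -` B \<inter> space M \<in> {Y -` B \<inter> space M | B. B \<in> sets N}" using AB' by blast
  ultimately have "prob ((U -` A \<inter> space M) \<inter> (Y -` B \<inter> space M)) = prob (U -` A \<inter> space M) * prob (Y -` B \<inter> space M)"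
   by (rule indep_setD[OF assms(2)])
  moreover have "(%x. (U x, Y x)) -` (A \<times> B) \<inter> space M = (U -` A \<inter> space M) \<inter> (Y -` B \<inter> space M)" by auto
  ultimately show "emeasure (distr M K U) A * emeasure (distr M N Y) B = emeasure (distr M (K \<Otimes>\<^sub>M N) (%x. (U x, Y x))) (A \<times> B)"
   using AB' U assms(5) UY by (simp add: emeasure_distr emeasure_eq_measure ennreal_mult)
 qed
qed

text \<open>By induction on the finite set of times: the increment after the largest earlier time is independent of the past and its
law is prescribed, so the joint law is a product of laws which agree for the two processes.\<close>

lemma distr_wiener_finite_dim:
 fixes W W' :: "real => 'w => real^'r::finite"
 assumes "prob_space M" "filtration_on M F" "wiener_process M F T W" "wiener_process M F T W'"
  and "finite J" "J \<subseteq> {0..T}"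
 shows "distr M (Pi\<^sub>M J (%_. borel)) (%x. \<lambda>t\<in>J. W t x) = distr M (Pi\<^sub>M J (%_. borel)) (%x. \<lambda>t\<in>J. W' t x)"
 using assms(5,6)
proof (induction J rule: finite_linorder_max_induct)
 case empty
 show ?case by (simp add: restrict_def)
next
 case (insert b A)
 interpret prob_space M by fact
 define m where "m = (if A = {} then 0 else Max A)"
 have mA: "m \<in> A" if "A \<noteq> {}" using that insert.hyps(1) by (simp add: m_def)
 have "0 <= m \<and> m <= b \<and> m \<in> {0..T} \<and> b \<in> {0..T}"
 proof (cases "A = {}")
  case True
  then show ?thesis using insert.prems by (auto simp: m_def)
 next
  case False
  then have "m \<in> A" by (rule mA)
  then have "m < b" "m \<in> {0..T}" "b \<in> {0..T}" using insert.hyps(2) insert.prems by blast+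
  then show ?thesis by auto
 qed
 then have m: "0 <= m" "m <= b" "m \<in> {0..T}" "b \<in> {0..T}" by blast+
 have Am: "a \<in> {0..m}" if "a \<in> A" for a
 proof -
  have "a \<in> {0..T}" using insert.prems that by blast
  moreover have "a <= m" using Max_ge[OF insert.hyps(1) that] that by (auto simp: m_def)
  ultimately show ?thesis by simp
 qed
 define \<Phi> :: "(real => real^'r) \<times> (real^'r) => real => real^'r" where
  "\<Phi> = (%(v, \<delta>). \<lambda>t\<in>insert b A. if t = b then (if A = {} then 0 else v m) + \<delta> else v t)"
 let ?PA = "Pi\<^sub>M A (%_. borel :: (real^'r) measure)"
 let ?PB = "Pi\<^sub>M (insert b A) (%_. borel :: (real^'r) measure)"
 have \<Phi>: "\<Phi> \<in> ?PA \<Otimes>\<^sub>M borel \<rightarrow>\<^sub>M ?PB"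
  unfolding \<Phi>_def case_prod_unfold
 proof (rule measurable_restrict)
  fix t assume t: "t \<in> insert b A"
  have c: "(%p. fst p a) \<in> borel_measurable (?PA \<Otimes>\<^sub>M borel)" if "a \<in> A" for a
   by (rule measurable_compose[OF measurable_fst measurable_component_singleton[OF that]])
  show "(%p. if t = b then (if A = {} then 0 else fst p m) + snd p else fst p t) \<in> borel_measurable (?PA \<Otimes>\<^sub>M borel)"
   using t c mA by (cases "t = b"; cases "A = {}") (auto intro!: borel_measurable_add)
 qed
 have key: "distr M ?PB (%x. \<lambda>t\<in>insert b A. W t x) = distr (distr M (?PA \<Otimes>\<^sub>M borel) (%x. (\<lambda>t\<in>A. W t x, W b x - W m x))) ?PB \<Phi>"
  "m < b ==> distr M (?PA \<Otimes>\<^sub>M borel) (%x. (\<lambda>t\<in>A. W t x, W b x - W m x)) =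
    distr M ?PA (%x. \<lambda>t\<in>A. W t x) \<Otimes>\<^sub>M distr M borel (%x. W b x - W m x)"
  if w: "wiener_process M F T W" for W :: "real => 'w => real^'r"
 proof -
  have Wm: "W t \<in> borel_measurable M" if "t \<in> {0..T}" for t by (rule wiener_measurable[OF assms(2) w that])
  have pm: "(%x. (\<lambda>t\<in>A. W t x, W b x - W m x)) \<in> M \<rightarrow>\<^sub>M ?PA \<Otimes>\<^sub>M borel"
   using insert.prems m by (intro measurable_Pair measurable_restrict borel_measurable_diff Wm) auto
  have "AE x in M. W 0 x = 0" using w by (simp add: wiener_process_def)
  then have "AE x in M. (\<lambda>t\<in>insert b A. W t x) = (\<Phi> \<circ> (%x. (\<lambda>t\<in>A. W t x, W b x - W m x))) x"
  proof eventually_elim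
   case (elim x)
   show ?case
   proof (rule ext)
    fix t show "(\<lambda>t\<in>insert b A. W t x) t = (\<Phi> \<circ> (%x. (\<lambda>t\<in>A. W t x, W b x - W m x))) x t"
     using elim mA insert.hyps(2) unfolding \<Phi>_def by (auto simp: m_def)
   qed
  qed
  then have "distr M ?PB (%x. \<lambda>t\<in>insert b A. W t x) = distr M ?PB (\<Phi> \<circ> (%x. (\<lambda>t\<in>A. W t x, W b x - W m x)))"
   using insert.prems by (intro distr_cong_AE measurable_comp[OF pm \<Phi>] measurable_restrict Wm) auto
  also have "\<dots> = distr (distr M (?PA \<Otimes>\<^sub>M borel) (%x. (\<lambda>t\<in>A. W t x, W b x - W m x))) ?PB \<Phi>"
   by (rule distr_distr[OF \<Phi> pm, symmetric])
  finally show "distr M ?PB (%x. \<lambda>t\<in>insert b A. W t x) = \<dots>" .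
  assume "m < b"
  show "distr M (?PA \<Otimes>\<^sub>M borel) (%x. (\<lambda>t\<in>A. W t x, W b x - W m x)) =
    distr M ?PA (%x. \<lambda>t\<in>A. W t x) \<Otimes>\<^sub>M distr M borel (%x. W b x - W m x)"
  proof (rule distr_pair_indep_set[OF assms(1)])
   show "indep_set (sets (F m)) {(%x. W b x - W m x) -` B \<inter> space M | B. B \<in> sets borel}"
    using wiener_increment_indep_set[OF assms(1) w m(1) \<open>m < b\<close> _ measurable_ident_sets[OF refl]] m by simp
   show "space (F m) = space M" using assms(2) unfolding filtration_on_def by (simp add: subalgebra_def)
   have "W t \<in> borel_measurable (F m)" if "t \<in> A" for t
   proof -
    have "t \<in> {0..T}" "t <= m" using Am[OF that] m by auto
    then show ?thesis using w filtration_on_mono[OF assms(2), of t m "W t"] unfolding wiener_process_def by blast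
   qed
   then show "(%x. \<lambda>t\<in>A. W t x) \<in> F m \<rightarrow>\<^sub>M ?PA" by (rule measurable_restrict)
   show "(%x. W b x - W m x) \<in> borel_measurable M" using m by (intro borel_measurable_diff Wm)
  qed
 qed
 have "distr M (?PA \<Otimes>\<^sub>M borel) (%x. (\<lambda>t\<in>A. W t x, W b x - W m x)) = distr M (?PA \<Otimes>\<^sub>M borel) (%x. (\<lambda>t\<in>A. W' t x, W' b x - W' m x))"
 proof (cases "m < b")
  case True
  have "distr M ?PA (%x. \<lambda>t\<in>A. W t x) = distr M ?PA (%x. \<lambda>t\<in>A. W' t x)"
   by (rule insert.IH) (use insert.prems in blast)
  moreover have "distr M borel (%x. W b x - W m x) = distr M borel (%x. W' b x - W' m x)"
   using distr_wiener_increment[OF assms(1-4) m(1) True] m by simp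
  ultimately show ?thesis unfolding key(2)[OF assms(3) True] key(2)[OF assms(4) True] by simp
 next
  case False
  then have "m = b" using m by simp
  moreover have "A = {}" using mA insert.hyps(2) \<open>m = b\<close> by blast
  ultimately show ?thesis by (simp add: restrict_def)
 qed
 then show ?case unfolding key(1)[OF assms(3)] key(1)[OF assms(4)] by simp
qed

abbreviation noise_path :: "real => (real => 'w => 'c) => 'w => real => 'c" where
 "noise_path T W x \<equiv> (\<lambda>t\<in>{0..T}. W t x)"

text \<open>Finite-dimensional distributions generate the product sigma-algebra.\<close>

lemma distr_wiener_path:
 fixes W W' :: "real => 'w => real^'r::finite"
 assumes "prob_space M" "filtration_on M F" "wiener_process M F T W" "wiener_process M F T W'"
 shows "distr M (Pi\<^sub>M {0..T} (%_. borel)) (noise_path T W) = distr M (Pi\<^sub>M {0..T} (%_. borel)) (noise_path T W')"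
proof -
 interpret prob_space M by fact
 have pm: "noise_path T W \<in> M \<rightarrow>\<^sub>M Pi\<^sub>M {0..T} (%_. borel)" if "wiener_process M F T W" for W :: "real => 'w => real^'r"
  by (rule measurable_restrict) (rule wiener_measurable[OF assms(2) that])
 have fd: "emeasure (distr M (Pi\<^sub>M {0..T} (%_. borel)) (noise_path T W)) (prod_emb {0..T} (%_. borel) J (Pi\<^sub>E J A)) =
   emeasure (distr M (Pi\<^sub>M J (%_. borel)) (%x. \<lambda>t\<in>J. W t x)) (Pi\<^sub>E J A)"
  if w: "wiener_process M F T W" and J: "finite J" "J \<subseteq> {0..T}" "!!i. i \<in> J ==> A i \<in> sets borel" for W :: "real => 'w => real^'r" and J and A :: "real => (real^'r) set"
 proof -
  have PJ: "Pi\<^sub>E J A \<in> sets (Pi\<^sub>M J (%_. borel))" using J by (intro sets_PiM_I_finite) auto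
  have "(%x. \<lambda>t\<in>J. W t x) \<in> M \<rightarrow>\<^sub>M Pi\<^sub>M J (%_. borel)"
   using J by (intro measurable_restrict wiener_measurable[OF assms(2) w]) auto
  moreover have "noise_path T W -` prod_emb {0..T} (%_. borel) J (Pi\<^sub>E J A) \<inter> space M = (%x. \<lambda>t\<in>J. W t x) -` Pi\<^sub>E J A \<inter> space M"
   using J(2) by (auto simp: prod_emb_def PiE_iff subset_eq)
  ultimately show ?thesis
   using PJ J pm[OF w] by (subst (1 2) emeasure_distr) (auto intro!: sets_PiM_I)
 qed
 show ?thesis
 proof (rule measure_eqI_PiM_infinite)
  show "finite_measure (distr M (Pi\<^sub>M {0..T} (%_. borel)) (noise_path T W))"
   using prob_space.finite_measure[OF prob_space_distr[OF pm[OF assms(3)]]] .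
  fix A :: "real => (real^'r) set" and J assume J: "finite J" "J \<subseteq> {0..T}" "!!i. i \<in> J ==> A i \<in> sets borel"
  show "emeasure (distr M (Pi\<^sub>M {0..T} (%_. borel)) (noise_path T W)) (prod_emb {0..T} (%_. borel) J (Pi\<^sub>E J A)) =
    emeasure (distr M (Pi\<^sub>M {0..T} (%_. borel)) (noise_path T W')) (prod_emb {0..T} (%_. borel) J (Pi\<^sub>E J A))"
   using fd[OF assms(3) J] fd[OF assms(4) J] distr_wiener_finite_dim[OF assms J(1,2)] by simp
 qed simp_all
qed

section \<open>Common functionals of the driving noises\<close>

locale noise = prob_space M for M :: "'w measure" +
 fixes F :: "real => 'w measure" and T :: real and W :: "nat => real => 'w => real^'r::finite"
 assumes filt: "filtration_on M F" and T: "T > 0"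
  and wiener: "!!i. i >= 1 ==> wiener_process M F T (W i)"
  and indep: "indep_vars (%_. Pi\<^sub>M {0..T} (%_. borel)) (%i. noise_path T (W i)) {1..}"
begin

text \<open>A family of random variables obtained by applying one measurable map G to the independent noise paths. Such a family
is independent and identically distributed without a computation of its law, and the property is stable under
continuous operations and limits.\<close>

definition path_functional :: "(nat => 'w => 'b::euclidean_space) => bool" where
 "path_functional X \<longleftrightarrow> (\<exists>G\<in>borel_measurable (Pi\<^sub>M {0..T} (%_. borel)).
   \<forall>i\<ge>1. X i \<in> borel_measurable M \<and> (AE x in M. X i x = G (noise_path T (W i) x)))"

lemma path_measurable: "i >= 1 ==> noise_path T (W i) \<in> M \<rightarrow>\<^sub>M Pi\<^sub>M {0..T} (%_. borel)"
 by (rule measurable_restrict) (rule wiener_measurable[OF filt wiener])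

lemma path_functional_measurable: "path_functional X ==> i >= 1 ==> X i \<in> borel_measurable M"
 unfolding path_functional_def by blast

lemma path_functional_const: "path_functional (%i x. c)"
 unfolding path_functional_def by (intro bexI[of _ "%_. c"]) auto

lemma path_functional_noise: "t \<in> {0..T} ==> path_functional (%i. W i t)"
 unfolding path_functional_def
 by (intro bexI[of _ "%w. w t"] allI impI conjI wiener_measurable[OF filt wiener]) (auto intro: measurable_component_singleton)

lemma path_functional_compose2:
 fixes X :: "nat => 'w => 'b::euclidean_space" and Y :: "nat => 'w => 'c::euclidean_space"
  and f :: "'b => 'c => 'e::euclidean_space"
 assumes "path_functional X" "path_functional Y" and f: "continuous_on UNIV (%p. f (fst p) (snd p))"
 shows "path_functional (%i x. f (X i x) (Y i x))"
proof -
 obtain G where G: "G \<in> borel_measurable (Pi\<^sub>M {0..T} (%_. borel))"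
  "!!i. i >= 1 ==> X i \<in> borel_measurable M" "!!i. i >= 1 ==> AE x in M. X i x = G (noise_path T (W i) x)"
  using assms(1) unfolding path_functional_def by blast
 obtain K where K: "K \<in> borel_measurable (Pi\<^sub>M {0..T} (%_. borel))"
  "!!i. i >= 1 ==> Y i \<in> borel_measurable M" "!!i. i >= 1 ==> AE x in M. Y i x = K (noise_path T (W i) x)"
  using assms(2) unfolding path_functional_def by blast
 show ?thesis
  unfolding path_functional_def
 proof (intro bexI[of _ "%w. f (G w) (K w)"] allI impI conjI)
  show "(%w. f (G w) (K w)) \<in> borel_measurable (Pi\<^sub>M {0..T} (%_. borel))"
   by (rule borel_measurable_continuous_Pair[OF G(1) K(1) f])
  fix i :: nat assume i: "i >= 1"
  show "(%x. f (X i x) (Y i x)) \<in> borel_measurable M"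
   by (rule borel_measurable_continuous_Pair[OF G(2)[OF i] K(2)[OF i] f])
  show "AE x in M. f (X i x) (Y i x) = f (G (noise_path T (W i) x)) (K (noise_path T (W i) x))"
   using G(3)[OF i] K(3)[OF i] by eventually_elim simp
 qed
qed

lemma path_functional_compose:
 fixes X :: "nat => 'w => 'b::euclidean_space" and f :: "'b => 'e::euclidean_space"
 assumes "path_functional X" and f: "continuous_on UNIV f"
 shows "path_functional (%i x. f (X i x))"
 using path_functional_compose2[OF assms(1,1), of "%a b. f a"] continuous_on_compose2[OF f, of UNIV fst]
 by (simp add: continuous_on_fst)

lemma path_functional_add:
 "path_functional X ==> path_functional Y ==> path_functional (%i x. X i x + Y i x)"
 by (rule path_functional_compose2[of X Y "%a b. a + b"]) (auto intro!: continuous_intros)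

lemma path_functional_sum:
 assumes "finite J" "!!j. j \<in> J ==> path_functional (X j)"
 shows "path_functional (%i x. \<Sum>j\<in>J. X j i x)"
 using assms by (induction J rule: finite_induct) (auto intro: path_functional_const path_functional_add)

text \<open>The maps that represent the members of the sequence have a measurable pointwise limit, one and the same for every i.\<close>

lemma path_functional_limit_AE:
 fixes X :: "nat => nat => 'w => 'b::euclidean_space"
 assumes "!!n. path_functional (X n)" "!!i. i >= 1 ==> Z i \<in> borel_measurable M"
  and lim: "!!i. i >= 1 ==> AE x in M. (%n. X n i x) \<longlonglongrightarrow> Z i x"
 shows "path_functional Z"
proof -
 have "\<forall>n. \<exists>G. G \<in> borel_measurable (Pi\<^sub>M {0..T} (%_. borel)) \<and> (\<forall>i\<ge>1. AE x in M. X n i x = G (noise_path T (W i) x))"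
  using assms(1) unfolding path_functional_def by blast
 from choice[OF this] obtain G where "\<forall>n. G n \<in> borel_measurable (Pi\<^sub>M {0..T} (%_. borel)) \<and>
   (\<forall>i\<ge>1. AE x in M. X n i x = G n (noise_path T (W i) x))" ..
 then have G: "!!n. G n \<in> borel_measurable (Pi\<^sub>M {0..T} (%_. borel))"
  "!!n i. i >= 1 ==> AE x in M. X n i x = G n (noise_path T (W i) x)" by blast+
 show ?thesis
  unfolding path_functional_def
 proof (intro bexI[of _ "%w. lim (%n. G n w)"] allI impI conjI assms(2))
  show "(%w. lim (%n. G n w)) \<in> borel_measurable (Pi\<^sub>M {0..T} (%_. borel))"
   by (intro borel_measurable_lim_metric G)
  fix i :: nat assume i: "i >= 1"
  have "AE x in M. \<forall>n. X n i x = G n (noise_path T (W i) x)" using G(2)[OF i] by (simp add: AE_all_countable)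
  then show "AE x in M. Z i x = lim (%n. G n (noise_path T (W i) x))"
   using lim[OF i]
  proof eventually_elim
   case (elim x)
   then have "(%n. G n (noise_path T (W i) x)) \<longlonglongrightarrow> Z i x" by simp
   then show ?case by (simp add: limI)
  qed
 qed
qed

lemma path_functional_limit_msq:
 fixes X :: "nat => nat => 'w => 'b::euclidean_space"
 assumes X: "!!n. path_functional (X n)" and Zm: "!!i. i >= 1 ==> Z i \<in> borel_measurable M"
  and lim: "!!i. i >= 1 ==> (%n. msq M (%x. X n i x - Z i x)) \<longlonglongrightarrow> 0"
 shows "path_functional Z"
proof -
 have "\<exists>n. \<forall>i\<in>{1..k}. msq M (%x. X n i x - Z i x) <= ennreal ((1/2)^k)" for k
 proof -
  have "eventually (%n. \<forall>i\<in>{1..k}. msq M (%x. X n i x - Z i x) < ennreal ((1/2)^k)) sequentially"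
   by (intro eventually_ball_finite ballI order_tendstoD(2)[OF lim]) auto
  then obtain n where "\<forall>i\<in>{1..k}. msq M (%x. X n i x - Z i x) < ennreal ((1/2)^k)"
   unfolding eventually_sequentially by blast
  then show ?thesis by (auto intro!: exI[of _ n] less_imp_le)
 qed
 then have "\<forall>k. \<exists>n. \<forall>i\<in>{1..k}. msq M (%x. X n i x - Z i x) <= ennreal ((1/2)^k)" ..
 from choice[OF this] obtain s where "\<forall>k. \<forall>i\<in>{1..k}. msq M (%x. X (s k) i x - Z i x) <= ennreal ((1/2)^k)" ..
 then have s: "!!k i. i \<in> {1..k} ==> msq M (%x. X (s k) i x - Z i x) <= ennreal ((1/2)^k)" by blast
 show ?thesis
 proof (rule path_functional_limit_AE[of "%k. X (s k)", OF X Zm])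
  fix i :: nat assume i: "i >= 1"
  have m: "X n i \<in> borel_measurable M" for n by (rule path_functional_measurable[OF X i])
  have "AE x in M. (%k. X (s (k + i)) i x - Z i x) \<longlonglongrightarrow> 0"
  proof (rule AE_tendsto_0_of_summable_msq)
   show "(%x. X (s (k + i)) i x - Z i x) \<in> borel_measurable M" for k using m Zm[OF i] by simp
   have "msq M (%x. X (s (k + i)) i x - Z i x) <= ennreal ((1/2)^k)" for k
   proof -
    have "msq M (%x. X (s (k + i)) i x - Z i x) <= ennreal ((1/2)^(k + i))" by (rule s) (use i in auto)
    also have "\<dots> <= ennreal ((1/2)^k)" by (intro ennreal_leI power_decreasing) auto
    finally show ?thesis .
   qed
   then have "(\<Sum>k. msq M (%x. X (s (k + i)) i x - Z i x)) <= (\<Sum>k. ennreal ((1/2)^k))" by (intro suminf_le) auto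
   also have "\<dots> < \<infinity>" by (rule suminf_half_powers_finite)
   finally show "(\<Sum>k. msq M (%x. X (s (k + i)) i x - Z i x)) < \<infinity>" .
  qed
  then show "AE x in M. (%k. X (s k) i x) \<longlonglongrightarrow> Z i x"
  proof eventually_elim
   case (elim x)
   then have "(%k. X (s (k + i)) i x) \<longlonglongrightarrow> Z i x" by (rule LIM_zero_cancel)
   then show ?case by (rule LIMSEQ_offset)
  qed
 qed
qed

lemma path_functional_law:
 assumes "path_functional X" "i >= 1" "f \<in> borel_measurable borel"
 shows "(\<integral>\<^sup>+x. f (X i x) \<partial>M) = (\<integral>\<^sup>+x. f (X 1 x) \<partial>M)"
proof -
 obtain G where G: "G \<in> borel_measurable (Pi\<^sub>M {0..T} (%_. borel))"
  "!!i. i >= 1 ==> AE x in M. X i x = G (noise_path T (W i) x)"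
  using assms(1) unfolding path_functional_def by blast
 have "(\<integral>\<^sup>+x. f (X i x) \<partial>M) = (\<integral>\<^sup>+w. f (G w) \<partial>distr M (Pi\<^sub>M {0..T} (%_. borel)) (noise_path T (W i)))" if "i >= 1" for i
 proof -
  have "(\<integral>\<^sup>+x. f (X i x) \<partial>M) = (\<integral>\<^sup>+x. f (G (noise_path T (W i) x)) \<partial>M)"
   using G(2)[OF that] by (intro nn_integral_cong_AE) auto
  also have "\<dots> = (\<integral>\<^sup>+w. f (G w) \<partial>distr M (Pi\<^sub>M {0..T} (%_. borel)) (noise_path T (W i)))"
   using measurable_compose[OF G(1) assms(3)] by (intro nn_integral_distr[symmetric] path_measurable that) simp
  finally show ?thesis .
 qed
 then show ?thesis
  using assms(2) distr_wiener_path[OF prob_space_axioms filt wiener wiener, of i 1] by simp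
qed

lemma path_functional_expectation:
 fixes X :: "nat => 'w => real"
 assumes "path_functional X" "i >= 1"
 shows "expectation (X i) = expectation (X 1)"
proof -
 obtain G where G: "G \<in> borel_measurable (Pi\<^sub>M {0..T} (%_. borel))"
  "!!i. i >= 1 ==> AE x in M. X i x = G (noise_path T (W i) x)"
  using assms(1) unfolding path_functional_def by blast
 have "expectation (X i) = (\<integral>w. G w \<partial>distr M (Pi\<^sub>M {0..T} (%_. borel)) (noise_path T (W i)))" if "i >= 1" for i
 proof -
  have "expectation (X i) = expectation (%x. G (noise_path T (W i) x))"
   using G(2)[OF that] measurable_compose[OF path_measurable[OF that] G(1)]
   by (intro integral_cong_AE path_functional_measurable[OF assms(1) that]) auto
  also have "\<dots> = (\<integral>w. G w \<partial>distr M (Pi\<^sub>M {0..T} (%_. borel)) (noise_path T (W i)))"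
   by (intro integral_distr[symmetric] path_measurable that G)
  finally show ?thesis .
 qed
 then show ?thesis
  using assms(2) distr_wiener_path[OF prob_space_axioms filt wiener wiener, of i 1] by simp
qed

text \<open>Independence of the noise paths makes the centred variables uncorrelated, with a common variance.\<close>

lemma path_functional_slln:
 fixes X :: "nat => 'w => real"
 assumes X: "path_functional X" and f: "msq M (X 1) < \<infinity>"
 shows "AE x in M. (%N. (1 / real N) * (\<Sum>i=1..N. X i x)) \<longlonglongrightarrow> expectation (X 1)"
proof -
 define \<mu> where "\<mu> = expectation (X 1)"
 define Z where "Z i x = X i x - \<mu>" for i x
 have Z: "path_functional Z"
  unfolding Z_def using path_functional_compose[OF X, of "%v. v - \<mu>"] by (simp add: continuous_intros)
 obtain G where G: "G \<in> borel_measurable (Pi\<^sub>M {0..T} (%_. borel))"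
  "!!i. i >= 1 ==> AE x in M. Z i x = G (noise_path T (W i) x)"
  using Z unfolding path_functional_def by blast
 have Xm: "X i \<in> borel_measurable M" and Zm: "Z i \<in> borel_measurable M" if "i >= 1" for i
  using path_functional_measurable X Z that by auto
 have "msq M (Z 1) <= 2 * msq M (X 1) + 2 * msq M (%x. \<mu>)" unfolding Z_def using Xm by (intro msq_diff_le) auto
 also have "\<dots> < \<infinity>" using f by (auto simp: msq_def ennreal_mult_less_top emeasure_space_1)
 finally have fZ: "msq M (Z 1) < \<infinity>" .
 obtain v where v: "v >= 0" "msq M (Z 1) = ennreal v" using fZ by (cases "msq M (Z 1)") auto
 have Zv: "msq M (Z i) = ennreal v" if "i >= 1" for i
  using path_functional_law[OF Z that, of "%z. ennreal ((norm z)\<^sup>2)"] v(2) unfolding msq_def by simp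
 have Zi: "integrable M (Z i)" if "i >= 1" for i using Zv[OF that] Zm[OF that] by (intro msq_finite_integrable1) auto
 have X1: "integrable M (X 1)" using f Xm by (intro msq_finite_integrable1) auto
 have EZ: "expectation (Z i) = 0" if "i >= 1" for i
 proof -
  have "expectation (Z 1) = expectation (%x. X 1 x - \<mu>)" by (rule arg_cong[of _ _ expectation]) (simp add: Z_def fun_eq_iff)
  also have "\<dots> = 0" using X1 by (simp add: \<mu>_def prob_space)
  finally show ?thesis using path_functional_expectation[OF Z that] by (rule trans[rotated])
 qed
 define Z' where "Z' i x = G (noise_path T (W i) x)" for i x
 have Z'i: "integrable M (Z' i)" and EZ': "expectation (Z' i) = 0" if "i >= 1" for i
 proof -
  have m: "Z' i \<in> borel_measurable M" unfolding Z'_def by (rule measurable_compose[OF path_measurable[OF that] G(1)])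
  have ae: "AE x in M. Z i x = Z' i x" unfolding Z'_def by (rule G(2)[OF that])
  show "integrable M (Z' i)" using integrable_cong_AE_imp[OF Zi[OF that] m] ae by simp
  show "expectation (Z' i) = 0" using integral_cong_AE[OF Zm[OF that] m ae] EZ[OF that] by simp
 qed
 have iv: "indep_vars (%_. borel) Z' {1..}"
  unfolding Z'_def using indep_vars_compose2[OF indep, of "%_. G" "%_. borel"] G(1) by simp
 have "AE x in M. (%N. (1 / real N) * (\<Sum>i=1..N. Z i x)) \<longlonglongrightarrow> 0"
 proof (rule slln_uncorrelated_centred[where v=v])
  fix i j :: nat assume ij: "i >= 1" "j >= 1" "i \<noteq> j"
  have "expectation (%x. Z i x * Z j x) = expectation (%x. Z' i x * Z' j x)"
  proof (rule integral_cong_AE)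
   show "AE x in M. Z i x * Z j x = Z' i x * Z' j x"
    using G(2)[OF ij(1)] G(2)[OF ij(2)] unfolding Z'_def by eventually_elim simp
  qed (use Zm ij Z'i borel_measurable_integrable in auto)
  also have "\<dots> = expectation (%x. \<Prod>k\<in>{i, j}. Z' k x)" using ij by simp
  also have "\<dots> = (\<Prod>k\<in>{i, j}. expectation (Z' k))"
   using ij by (intro indep_vars_lebesgue_integral indep_vars_subset[OF iv] Z'i) auto
  also have "\<dots> = 0" using ij EZ' by simp
  finally show "expectation (%x. Z i x * Z j x) = 0" .
 qed (use Zm Zv v in auto)
 then show ?thesis
 proof eventually_elim
  case (elim x)
  then have "(%N. (1 / real N) * (\<Sum>i=1..N. Z i x) + \<mu>) \<longlonglongrightarrow> 0 + \<mu>" by (intro tendsto_intros)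
  moreover have "eventually (%N. (1 / real N) * (\<Sum>i=1..N. Z i x) + \<mu> = (1 / real N) * (\<Sum>i=1..N. X i x)) sequentially"
   using eventually_gt_at_top[of 0]
  proof eventually_elim
   case (elim N)
   then show ?case by (simp add: Z_def sum_subtractf field_simps)
  qed
  ultimately show ?case unfolding \<mu>_def[symmetric] using Lim_transform_eventually by fastforce
 qed
qed

end

section \<open>Strong solutions as functionals of the noise\<close>

lemma AE_time_space_fst:
 assumes "prob_space M"
 shows "AE p in time_space t M. 0 < fst p \<and> fst p <= t"
proof -
 interpret M: prob_space M by fact
 interpret R: finite_measure "restrict_space lborel {0..t}" by (rule finite_measure_restrict_lborel)
 interpret P: pair_sigma_finite "restrict_space lborel {0..t}" M ..
 have [measurable]: "fst \<in> borel_measurable (time_space t M)"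
  by (rule measurable_compose[OF measurable_fst, of "%s. s", simplified]) (intro measurable_restrict_space1, simp)
 show ?thesis
 proof (rule P.AE_pair_measure)
  show "{p \<in> space (time_space t M). 0 < fst p \<and> fst p <= t} \<in> sets (time_space t M)" by measurable
  show "AE s in restrict_space lborel {0..t}. AE x in M. 0 < fst (s, x) \<and> fst (s, x) <= t"
   using AE_time_space_pos[of t] by eventually_elim simp
 qed
qed

lemma AE_time_space_snd:
 assumes "prob_space M" "AE x in M. P x"
 shows "AE p in time_space t M. P (snd p)"
proof -
 interpret M: prob_space M by fact
 interpret R: finite_measure "restrict_space lborel {0..t}" by (rule finite_measure_restrict_lborel)
 interpret P: pair_sigma_finite "restrict_space lborel {0..t}" M ..
 obtain N where N: "{x \<in> space M. \<not> P x} \<subseteq> N" "emeasure M N = 0" "N \<in> sets M"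
  using assms(2) by (rule AE_E)
 have "AE p in time_space t M. snd p \<notin> N"
 proof (rule P.AE_pair_measure)
  have [measurable]: "N \<in> sets M" by fact
  show "{p \<in> space (time_space t M). snd p \<notin> N} \<in> sets (time_space t M)" by measurable
  have "AE x in M. x \<notin> N" using N by (intro AE_not_in) auto
  then show "AE s in restrict_space lborel {0..t}. AE x in M. snd (s, x) \<notin> N" by simp
 qed
 then show ?thesis
  using AE_space
 proof eventually_elim
  case (elim p)
  then have "snd p \<in> space M" by (auto simp: space_pair_measure)
  then show ?case using elim(1) N(1) by blast
 qed
qed

lemma AE_time_space_all:
 assumes "prob_space M" "AE x in M. \<forall>s\<in>{0..t}. P s x"
 shows "AE p in time_space t M. P (fst p) (snd p)"
 using AE_time_space_snd[OF assms, of t] AE_time_space_fst[OF assms(1), of t] by eventually_elim auto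

lemma has_stoch_integral_cong_integrand:
 assumes "prob_space M" "has_stoch_integral M F B X t Z" "AE x in M. \<forall>s\<in>{0..t}. X s x = X' s x"
  and "(%(s, x). X' s x) \<in> borel_measurable (time_space t M)"
 shows "has_stoch_integral M F B X' t Z"
proof -
 obtain n \<tau> \<xi> where sd: "!!m. simple_data M F t (n m) (\<tau> m) (\<xi> m)"
  and l1: "(%m. \<integral>\<^sup>+(s, x). ennreal ((norm (X s x - simple_process (n m) (\<tau> m) (\<xi> m) s x))\<^sup>2) \<partial>(time_space t M)) \<longlonglongrightarrow> 0"
  and l2: "(%m. \<integral>\<^sup>+x. ennreal ((norm (Z x - simple_integral B (n m) (\<tau> m) (\<xi> m) x))\<^sup>2) \<partial>M) \<longlonglongrightarrow> 0"
  using assms(2) unfolding has_stoch_integral_def by blast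
 have "(\<integral>\<^sup>+(s, x). ennreal ((norm (X s x - simple_process (n m) (\<tau> m) (\<xi> m) s x))\<^sup>2) \<partial>(time_space t M)) =
   (\<integral>\<^sup>+(s, x). ennreal ((norm (X' s x - simple_process (n m) (\<tau> m) (\<xi> m) s x))\<^sup>2) \<partial>(time_space t M))" for m
  using AE_time_space_all[OF assms(1,3)]
  by (intro nn_integral_cong_AE) (auto simp: case_prod_unfold elim!: eventually_mono)
 then have l1': "(%m. \<integral>\<^sup>+(s, x). ennreal ((norm (X' s x - simple_process (n m) (\<tau> m) (\<xi> m) s x))\<^sup>2) \<partial>(time_space t M)) \<longlonglongrightarrow> 0"
  using l1 by simp
 have "Z \<in> borel_measurable M" using assms(2) unfolding has_stoch_integral_def by blast
 then show ?thesis using assms(4) sd l1' l2 unfolding has_stoch_integral_def by blast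
qed

lemma simple_process_grid_outside:
 assumes "!!l. l < j ==> s \<notin> {grid t n l<..grid t n (Suc l)}"
 shows "simple_process j (grid t n) \<xi> s x = 0"
 unfolding simple_process_def using assms by (intro sum.neutral) auto

text \<open>On a grid cell the simple process is constant in time.\<close>

lemma msq_simple_process_grid:
 fixes Z :: "nat => 'w => 'b::euclidean_space"
 assumes "prob_space M" "0 <= t" "n >= 1" "j <= n" and Z: "!!l. l < j ==> Z l \<in> borel_measurable M"
 shows "msq (time_space (grid t n j) M) (%(s, x). simple_process j (grid t n) Z s x) = (\<Sum>l<j. ennreal (t / real n) * msq M (Z l))"
proof -
 interpret prob_space M by fact
 let ?R = "restrict_space lborel {0..grid t n j}"
 have sm: "(%(s, x). simple_process j (grid t n) Z s x) \<in> borel_measurable (time_space (grid t n j) M)"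
  by (rule borel_measurable_simple_process[OF Z])
 have slice: "msq M (simple_process j (grid t n) Z s) = (\<Sum>l<j. msq M (Z l) * indicator {grid t n l<..grid t n (Suc l)} s)" for s
 proof (cases "\<exists>l<j. s \<in> {grid t n l<..grid t n (Suc l)}")
  case True
  then obtain l where l: "l < j" "s \<in> {grid t n l<..grid t n (Suc l)}" by blast
  have "(\<Sum>k<j. msq M (Z k) * indicator {grid t n k<..grid t n (Suc k)} s) = (\<Sum>k<j. if k = l then msq M (Z l) else 0)"
  proof (rule sum.cong[OF refl])
   fix k
   show "msq M (Z k) * indicator {grid t n k<..grid t n (Suc k)} s = (if k = l then msq M (Z l) else 0)"
   proof (cases "k = l")
    case True
    then show ?thesis using l(2) by simp
   next
    case False
    then have "s \<notin> {grid t n k<..grid t n (Suc k)}" using grid_index_unique[OF assms(2) l(2)] by blast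
    then show ?thesis using False by simp
   qed
  qed
  also have "\<dots> = msq M (Z l)" using l(1) by simp
  finally show ?thesis by (simp add: msq_def simple_process_grid[OF assms(2) l])
 next
  case False
  then have "simple_process j (grid t n) Z s x = 0" for x by (intro simple_process_grid_outside) blast
  moreover have "(\<Sum>l<j. msq M (Z l) * indicator {grid t n l<..grid t n (Suc l)} s) = 0"
   using False by (intro sum.neutral) auto
  ultimately show ?thesis by (simp add: msq_def)
 qed
 have em: "emeasure ?R {grid t n l<..grid t n (Suc l)} = ennreal (t / real n)" "{grid t n l<..grid t n (Suc l)} \<in> sets ?R" if "l < j" for l
 proof -
  have sub: "{grid t n l<..grid t n (Suc l)} \<subseteq> {0..grid t n j}"
   using grid_mono[OF assms(2), of 0 l n] grid_mono[OF assms(2), of "Suc l" j n] that by auto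
  then show "{grid t n l<..grid t n (Suc l)} \<in> sets ?R" by (subst sets_restrict_space_iff) auto
  have "emeasure ?R {grid t n l<..grid t n (Suc l)} = emeasure lborel {grid t n l<..grid t n (Suc l)}"
   using sub by (subst emeasure_restrict_space) auto
  also have "\<dots> = ennreal (t / real n)"
   using grid_step[of t n l] grid_mono[OF assms(2), of l "Suc l" n] by simp
  finally show "emeasure ?R {grid t n l<..grid t n (Suc l)} = ennreal (t / real n)" .
 qed
 have "msq (time_space (grid t n j) M) (%(s, x). simple_process j (grid t n) Z s x) = (\<integral>\<^sup>+s. msq M (simple_process j (grid t n) Z s) \<partial>?R)"
  unfolding msq_def using sm by (subst nn_integral_fst[symmetric]) (simp_all add: case_prod_unfold)
 also have "\<dots> = (\<integral>\<^sup>+s. (\<Sum>l<j. msq M (Z l) * indicator {grid t n l<..grid t n (Suc l)} s) \<partial>?R)" by (simp only: slice)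
 also have "\<dots> = (\<Sum>l<j. \<integral>\<^sup>+s. msq M (Z l) * indicator {grid t n l<..grid t n (Suc l)} s \<partial>?R)"
  using em(2) by (intro nn_integral_sum) auto
 also have "\<dots> = (\<Sum>l<j. ennreal (t / real n) * msq M (Z l))"
  using em by (intro sum.cong refl) (simp add: nn_integral_cmult_indicator mult.commute)
 finally show ?thesis .
qed

lemma msq_time_space_mono:
 assumes "prob_space M" "s <= t" and f: "(%(r, x). f r x) \<in> borel_measurable (borel \<Otimes>\<^sub>M M)"
 shows "msq (time_space s M) (%(r, x). f r x) <= msq (time_space t M) (%(r, x). f r x)"
proof -
 interpret prob_space M by fact
 have eq: "msq (time_space u M) (%(r, x). f r x) = (\<integral>\<^sup>+r. msq M (f r) * indicator {0..u} r \<partial>lborel)" for u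
 proof -
  have "msq (time_space u M) (%(r, x). f r x) = (\<integral>\<^sup>+r. msq M (f r) \<partial>restrict_space lborel {0..u})"
   unfolding msq_def using measurable_time_spaceI[OF f, of u]
   by (subst nn_integral_fst[symmetric]) (simp_all add: case_prod_unfold)
  then show ?thesis by (simp add: nn_integral_restrict_space)
 qed
 show ?thesis unfolding eq using assms(2) by (intro nn_integral_mono) (auto simp: indicator_def)
qed

lemma gronwall_sum_ennreal:
 fixes e :: "nat => ennreal"
 assumes "!!j. j <= n ==> e j <= a + b * (\<Sum>l<j. e l)"
 shows "j <= n ==> e j <= a * (1 + b) ^ j"
proof (induction j rule: less_induct)
 case (less j)
 have "e j <= a + b * (\<Sum>l<j. e l)" using assms less.prems by blast
 also have "\<dots> <= a + b * (\<Sum>l<j. a * (1 + b) ^ l)"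
  using less by (intro add_left_mono mult_left_mono sum_mono) auto
 also have "\<dots> = a * (1 + b) ^ j"
 proof (induction j)
  case (Suc j)
  have "a + b * (\<Sum>l<Suc j. a * (1 + b) ^ l) = (a + b * (\<Sum>l<j. a * (1 + b) ^ l)) + b * (a * (1 + b) ^ j)"
   by (simp add: distrib_left add.assoc)
  also have "\<dots> = a * (1 + b) ^ Suc j" unfolding Suc by (simp add: algebra_simps)
  finally show ?case .
 qed simp
 finally show ?case .
qed

lemma power_one_plus_le_exp:
 assumes "b >= 0" "n >= 1"
 shows "(1 + ennreal (b / real n)) ^ n <= ennreal (exp b)"
proof -
 have "1 + ennreal (b / real n) = ennreal (1 + b / real n)" using assms ennreal_plus[of 1 "b / real n"] by simp
 then have "(1 + ennreal (b / real n)) ^ n = ennreal (1 + b / real n) ^ n" by (rule arg_cong)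
 also have "\<dots> = ennreal ((1 + b / real n) ^ n)" using assms by (intro ennreal_power) simp
 also have "ennreal ((1 + b / real n) ^ n) <= ennreal (exp (b / real n) ^ n)"
  using assms by (intro ennreal_leI power_mono exp_ge_add_one_self) auto
 also have "exp (b / real n) ^ n = exp b" using assms by (simp flip: exp_of_nat_mult)
 finally show ?thesis .
qed

text \<open>The Euler scheme with n steps of equal length on the interval from 0 to t.\<close>

primrec euler :: "('b => 'b) => ('r::finite => 'b => 'b) => 'b::euclidean_space => (real => 'w => real^'r) => real => nat => nat => 'w => 'b" where
 "euler a \<sigma> ini W t n 0 x = ini"
| "euler a \<sigma> ini W t n (Suc j) x = euler a \<sigma> ini W t n j x + (t / real n) *\<^sub>R a (euler a \<sigma> ini W t n j x) +
   (\<Sum>k\<in>UNIV. (W (grid t n (Suc j)) x $ k - W (grid t n j) x $ k) *\<^sub>R \<sigma> k (euler a \<sigma> ini W t n j x))"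

lemma euler_0_fun: "euler a \<sigma> ini W t n 0 = (%x. ini)"
 by (rule ext) simp

lemma euler_Suc_fun:
 "euler a \<sigma> ini W t n (Suc j) = (%x. euler a \<sigma> ini W t n j x + (t / real n) *\<^sub>R a (euler a \<sigma> ini W t n j x) +
   (\<Sum>k\<in>UNIV. (W (grid t n (Suc j)) x $ k - W (grid t n j) x $ k) *\<^sub>R \<sigma> k (euler a \<sigma> ini W t n j x)))"
 by (rule ext) simp

lemma euler_eq_sum:
 "euler a \<sigma> ini W t n j x = ini + (\<Sum>l<j. (t / real n) *\<^sub>R a (euler a \<sigma> ini W t n l x)) +
   (\<Sum>k\<in>UNIV. simple_integral (%s x. W s x $ k) j (grid t n) (%l x. \<sigma> k (euler a \<sigma> ini W t n l x)) x)"
 by (induction j) (simp_all add: simple_integral_def sum.distrib ac_simps)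

lemma time_integral_simple_process_grid:
 fixes v :: "nat => 'b::euclidean_space"
 assumes "0 <= t" "n >= 1"
 shows "integrable (restrict_space lborel {0..grid t n j}) (%s. simple_process j (grid t n) (%l x. v l) s x)"
  "(\<integral>s. simple_process j (grid t n) (%l x. v l) s x \<partial>restrict_space lborel {0..grid t n j}) = (\<Sum>l<j. (t / real n) *\<^sub>R v l)"
proof -
 let ?R = "restrict_space lborel {0..grid t n j}"
 interpret R: finite_measure ?R by (rule finite_measure_restrict_lborel)
 have em: "integrable ?R (indicat_real {grid t n l<..grid t n (Suc l)})"
  "(\<integral>s. indicat_real {grid t n l<..grid t n (Suc l)} s \<partial>?R) = t / real n" if "l < j" for l
 proof -
  have sub: "{grid t n l<..grid t n (Suc l)} \<subseteq> {0..grid t n j}"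
   using grid_mono[OF assms(1), of 0 l n] grid_mono[OF assms(1), of "Suc l" j n] that by auto
  then have s: "{grid t n l<..grid t n (Suc l)} \<in> sets ?R" by (subst sets_restrict_space_iff) auto
  show "integrable ?R (indicat_real {grid t n l<..grid t n (Suc l)})"
   by (rule integrable_real_indicator[OF s]) (simp add: R.emeasure_finite less_top[symmetric])
  have "(\<integral>s. indicat_real {grid t n l<..grid t n (Suc l)} s \<partial>?R) = measure ?R {grid t n l<..grid t n (Suc l)}"
   using s sets.sets_into_space[OF s] by (simp add: Int_absorb2)
  also have "\<dots> = measure lborel {grid t n l<..grid t n (Suc l)}" using sub by (intro measure_restrict_space) auto
  also have "\<dots> = t / real n" using grid_step[of t n l] grid_mono[OF assms(1), of l "Suc l" n] by simp
  finally show "(\<integral>s. indicat_real {grid t n l<..grid t n (Suc l)} s \<partial>?R) = t / real n" .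
 qed
 show "integrable ?R (%s. simple_process j (grid t n) (%l x. v l) s x)"
  unfolding simple_process_def using em(1) by (intro Bochner_Integration.integrable_sum integrable_scaleR_left) auto
 have "(\<integral>s. simple_process j (grid t n) (%l x. v l) s x \<partial>?R) = (\<Sum>l<j. \<integral>s. indicat_real {grid t n l<..grid t n (Suc l)} s *\<^sub>R v l \<partial>?R)"
  unfolding simple_process_def using em(1) by (intro Bochner_Integration.integral_sum integrable_scaleR_left) auto
 also have "\<dots> = (\<Sum>l<j. (t / real n) *\<^sub>R v l)"
  using em by (intro sum.cong refl) (simp add: integral_scaleR_left)
 finally show "(\<integral>s. simple_process j (grid t n) (%l x. v l) s x \<partial>?R) = (\<Sum>l<j. (t / real n) *\<^sub>R v l)" .
qed

lemma lipschitz_continuous_on: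
 fixes f :: "'b::real_normed_vector => 'c::real_normed_vector"
 assumes "!!u v. norm (f u - f v) <= \<Lambda> * norm (u - v)"
 shows "continuous_on UNIV f"
proof (rule lipschitz_on_continuous_on[of "\<bar>\<Lambda>\<bar>"], rule lipschitz_onI)
 fix u v
 have "norm (f u - f v) <= \<Lambda> * norm (u - v)" by (rule assms)
 also have "\<dots> <= \<bar>\<Lambda>\<bar> * norm (u - v)" by (intro mult_right_mono) auto
 finally show "dist (f u) (f v) <= \<bar>\<Lambda>\<bar> * dist u v" by (simp add: dist_norm)
qed simp

text \<open>The strong convergence of the Euler scheme for bounded Lipschitz coefficients. The scheme and the solution are both
integrals, the former of a simple process. The integrator estimate and the Cauchy-Schwarz inequality in time bound the mean-square error at a grid
point by a consistency error plus a multiple of the sum of the earlier errors, and the discrete Gronwall lemma concludes. The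
consistency error is the mean-square distance between the solution and its grid approximation.\<close>

lemma euler_converges:
 fixes W :: "real => 'w => real^'r::finite" and a :: "'b::euclidean_space => 'b" and \<sigma> :: "'r => 'b => 'b"
 assumes pM: "prob_space M" and filt: "filtration_on M F" and wien: "wiener_process M F T W"
  and lip_a: "!!u v. norm (a u - a v) <= \<Lambda> * norm (u - v)" and lip_\<sigma>: "!!k u v. norm (\<sigma> k u - \<sigma> k v) <= \<Lambda> * norm (u - v)"
  and bd_a: "!!u. norm (a u) <= K" and bd_\<sigma>: "!!k u. norm (\<sigma> k u) <= K"
  and \<rho>m: "(%(s, x). \<rho> s x) \<in> borel_measurable (borel \<Otimes>\<^sub>M M)" and \<rho>c: "!!x. continuous_on UNIV (%s. \<rho> s x)"
  and \<rho>b: "!!s x. norm (\<rho> s x) <= R"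
  and sol: "!!s. s \<in> {0..T} ==> \<exists>J. has_stoch_integral_vec M F W (%k s x. \<sigma> k (\<rho> s x)) s J \<and>
    (AE x in M. \<rho> s x = ini + (LBINT r:{0..s}. a (\<rho> r x)) + J x)"
  and t: "t \<in> {0..T}"
 shows "(%n. msq M (%x. euler a \<sigma> ini W t (Suc n) (Suc n) x - \<rho> t x)) \<longlonglongrightarrow> 0"
proof -
 interpret prob_space M by fact
 have t0: "t >= 0" using t by simp
 have ac: "continuous_on UNIV a" by (rule lipschitz_continuous_on[OF lip_a])
 have \<sigma>c: "continuous_on UNIV (\<sigma> k)" for k by (rule lipschitz_continuous_on[OF lip_\<sigma>])
 have am [measurable]: "a \<in> borel_measurable borel" by (rule borel_measurable_continuous_onI[OF ac])
 have \<sigma>m [measurable]: "\<sigma> k \<in> borel_measurable borel" for k by (rule borel_measurable_continuous_onI[OF \<sigma>c])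
 have B: "integrator M F T (%s x. W s x $ k)" for k
  by (rule scalar_brownian.integrator_brownian[OF wiener_scalar_brownian[OF pM filt wien]])
 have "\<forall>k. \<exists>C\<ge>0. \<forall>t\<in>{0..T}. \<forall>(X :: real => 'w => 'b) Z n \<tau> \<xi>.
   has_stoch_integral M F (%s x. W s x $ k) X t Z \<longrightarrow> simple_data M F t n \<tau> \<xi> \<longrightarrow>
   msq M (%x. Z x - simple_integral (%s x. W s x $ k) n \<tau> \<xi> x) <= ennreal C * msq (time_space t M) (%(s, x). X s x - simple_process n \<tau> \<xi> s x)"
  by (rule allI) (rule stoch_integral_approx[OF B filt])
 from choice[OF this] obtain C where CC: "\<forall>k. C k >= 0 \<and> (\<forall>t\<in>{0..T}. \<forall>(X :: real => 'w => 'b) Z n \<tau> \<xi>.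
   has_stoch_integral M F (%s x. W s x $ k) X t Z \<longrightarrow> simple_data M F t n \<tau> \<xi> \<longrightarrow>
   msq M (%x. Z x - simple_integral (%s x. W s x $ k) n \<tau> \<xi> x) <= ennreal (C k) * msq (time_space t M) (%(s, x). X s x - simple_process n \<tau> \<xi> s x))" ..
 have C0: "C k >= 0" for k using CC by blast
 have C: "msq M (%x. Z x - simple_integral (%s x. W s x $ k) n \<tau> \<xi> x) <= ennreal (C k) * msq (time_space t M) (%(s, x). X s x - simple_process n \<tau> \<xi> s x)"
  if "t \<in> {0..T}" "has_stoch_integral M F (%s x. W s x $ k) X t Z" "simple_data M F t n \<tau> \<xi>"
  for k t Z n \<tau> \<xi> and X :: "real => 'w => 'b"
  using CC that by blast
 define \<epsilon> where "\<epsilon> n = msq (time_space t M) (%(s, x). \<rho> s x - simple_process (Suc n) (grid t (Suc n)) (%j. \<rho> (grid t (Suc n) j)) s x)" for n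
 have \<epsilon>: "\<epsilon> \<longlonglongrightarrow> 0"
  unfolding \<epsilon>_def using \<rho>b by (intro msq_grid_approximation[OF pM t0 \<rho>m continuous_on_subset[OF \<rho>c]]) auto
 define A where "A = 4 * (T + real CARD('r) * (\<Sum>k\<in>UNIV. C k)) * \<Lambda>\<^sup>2"
 have T0: "T >= 0" using t by auto
 have A0: "A >= 0" unfolding A_def using T0 C0 by (intro mult_nonneg_nonneg add_nonneg_nonneg sum_nonneg) auto
 have main: "msq M (%x. euler a \<sigma> ini W t (Suc n) (Suc n) x - \<rho> t x) <= ennreal (exp (A * t)) * (ennreal A * \<epsilon> n)" for n
 proof -
  let ?N = "Suc n"
  let ?g = "grid t ?N"
  let ?X = "euler a \<sigma> ini W t ?N"
  define e where "e j = msq M (%x. ?X j x - \<rho> (?g j) x)" for j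
  have gT: "?g j \<in> {0..T}" if "j <= ?N" for j using grid_in[OF t0 that] t by auto
  have Xad: "?X j \<in> borel_measurable (F (?g j))" if "j <= ?N" for j
   using that
  proof (induction j)
   case (Suc j)
   have mono: "?g j <= ?g (Suc j)" by (rule grid_mono[OF t0]) simp
   have X: "?X j \<in> borel_measurable (F (?g (Suc j)))" using Suc by (intro filtration_on_mono[OF filt mono]) auto
   have Wad: "W s \<in> borel_measurable (F s)" if "s \<in> {0..T}" for s using wien that unfolding wiener_process_def by blast
   have W1: "W (?g (Suc j)) \<in> borel_measurable (F (?g (Suc j)))" using gT[OF Suc.prems] by (rule Wad)
   have W0: "W (?g j) \<in> borel_measurable (F (?g (Suc j)))"
    using Suc.prems by (intro filtration_on_mono[OF filt mono] Wad gT) auto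
   have nth: "(%v :: real^'r. v $ k) \<in> borel_measurable borel" for k
    by (intro borel_measurable_continuous_onI continuous_intros)
   show ?case
    unfolding euler_Suc_fun
    by (intro borel_measurable_add borel_measurable_sum borel_measurable_scaleR borel_measurable_diff borel_measurable_const
      X measurable_compose[OF X am] measurable_compose[OF X \<sigma>m] measurable_compose[OF W1 nth] measurable_compose[OF W0 nth])
  qed (simp add: euler_0_fun)
  have Xm: "?X j \<in> borel_measurable M" if "j <= ?N" for j using filtration_on_measurable[OF filt Xad[OF that]] .
  have \<rho>sm: "\<rho> s \<in> borel_measurable M" for s using measurable_compose[OF measurable_Pair1' \<rho>m, of s] by simp
  have step: "e j <= ennreal A * \<epsilon> n + ennreal (A * t / real ?N) * (\<Sum>l<j. e l)" if j: "j <= ?N" for j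
  proof -
   let ?s = "?g j"
   let ?R = "restrict_space lborel {0..?s}"
   interpret R: finite_measure ?R by (rule finite_measure_restrict_lborel)
   have s0: "0 <= ?s" "?s <= t" "?s <= T" using grid_in[OF t0 j] t by auto
   define G where "G = msq (time_space ?s M) (%(s, x). \<rho> s x - simple_process j ?g ?X s x)"
   have Xl: "?X l \<in> borel_measurable M" if "l < j" for l using Xm that j by simp
   have spX: "(%(s, x). simple_process j ?g ?X s x) \<in> borel_measurable (time_space ?s M)"
    by (rule borel_measurable_simple_process[OF Xl])
   have \<rho>ts: "(%(s, x). \<rho> s x) \<in> borel_measurable (time_space ?s M)" by (rule measurable_time_spaceI[OF \<rho>m])
   have lipG: "msq (time_space ?s M) (%(s, x). f (\<rho> s x) - simple_process j ?g (%l x. f (?X l x)) s x) <= ennreal (\<Lambda>\<^sup>2) * G"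
    if f: "!!u v. norm (f u - f v) <= \<Lambda> * norm (u - v)" for f :: "'b => 'b"
   proof -
    have "msq (time_space ?s M) (%(s, x). f (\<rho> s x) - simple_process j ?g (%l x. f (?X l x)) s x) \<le>
      msq (time_space ?s M) (%p. \<Lambda> *\<^sub>R (case p of (s, x) => \<rho> s x - simple_process j ?g ?X s x))"
    proof (rule msq_mono_AE)
     show "AE p in time_space ?s M. norm (case p of (s, x) => f (\<rho> s x) - simple_process j ?g (%l x. f (?X l x)) s x) \<le>
       norm (\<Lambda> *\<^sub>R (case p of (s, x) => \<rho> s x - simple_process j ?g ?X s x))"
      using AE_time_space_fst[OF pM, of ?s]
     proof eventually_elim
      case (elim p)
      obtain r x where p: "p = (r, x)" by (cases p)
      have r: "0 < r" "r <= ?s" using elim p by auto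
      obtain l where l: "l < ?N" "r \<in> {?g l<..?g (Suc l)}" using grid_index[of r t ?N] r s0 by auto
      have "l < j"
      proof (rule ccontr)
       assume "\<not> l < j"
       then have "?g j <= ?g l" by (intro grid_mono[OF t0]) simp
       then show False using l(2) r by simp
      qed
      note sp = simple_process_grid[OF t0 this l(2)]
      have "norm (f (\<rho> r x) - f (?X l x)) <= \<bar>\<Lambda>\<bar> * norm (\<rho> r x - ?X l x)"
       by (rule order_trans[OF f]) (intro mult_right_mono, auto)
      then show ?case unfolding p by (simp add: sp)
     qed
    qed
    also have "\<dots> = ennreal (\<Lambda>\<^sup>2) * G"
     unfolding G_def using borel_measurable_diff[OF \<rho>ts spX]
     by (intro msq_scaleR) (simp add: case_prod_unfold)
    finally show ?thesis .
   qed
   have G: "G <= 2 * \<epsilon> n + 2 * (\<Sum>l<j. ennreal (t / real ?N) * e l)"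
   proof -
    let ?sr = "simple_process j ?g (%l. \<rho> (?g l))"
    have spr: "(%(s, x). ?sr s x) \<in> borel_measurable (time_space ?s M)"
     by (rule borel_measurable_simple_process[OF \<rho>sm])
    have "G <= 2 * msq (time_space ?s M) (%(s, x). \<rho> s x - ?sr s x) + 2 * msq (time_space ?s M) (%(s, x). ?sr s x - simple_process j ?g ?X s x)"
     using msq_triangle[OF \<rho>ts spX spr] unfolding G_def case_prod_unfold .
    also have "msq (time_space ?s M) (%(s, x). ?sr s x - simple_process j ?g ?X s x) =
      msq (time_space ?s M) (%(s, x). simple_process j ?g (%l x. \<rho> (?g l) x - ?X l x) s x)"
     unfolding simple_process_def by (simp add: scaleR_diff_right sum_subtractf)
    also have "\<dots> = (\<Sum>l<j. ennreal (t / real ?N) * msq M (%x. \<rho> (?g l) x - ?X l x))"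
     using \<rho>sm Xl by (intro msq_simple_process_grid[OF pM t0 _ j]) auto
    also have "\<dots> = (\<Sum>l<j. ennreal (t / real ?N) * e l)"
     unfolding e_def by (subst msq_minus_commute) (rule refl)
    finally have 1: "G <= 2 * msq (time_space ?s M) (%(s, x). \<rho> s x - ?sr s x) + 2 * (\<Sum>l<j. ennreal (t / real ?N) * e l)" .
    have 2: "msq (time_space ?s M) (%(s, x). \<rho> s x - ?sr s x) <= \<epsilon> n"
    proof -
     let ?sN = "simple_process ?N ?g (%l. \<rho> (?g l))"
     have "msq (time_space ?s M) (%(s, x). \<rho> s x - ?sr s x) <= msq (time_space ?s M) (%(s, x). \<rho> s x - ?sN s x)"
     proof (rule msq_mono_AE)
      show "AE p in time_space ?s M. norm (case p of (s, x) => \<rho> s x - ?sr s x) <= norm (case p of (s, x) => \<rho> s x - ?sN s x)"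
       using AE_time_space_fst[OF pM, of ?s]
      proof eventually_elim
       case (elim p)
       obtain r x where p: "p = (r, x)" by (cases p)
       have r: "0 < r" "r <= ?s" using elim p by auto
       obtain l where l: "l < ?N" "r \<in> {?g l<..?g (Suc l)}" using grid_index[of r t ?N] r s0 by auto
       have "l < j"
       proof (rule ccontr)
        assume "\<not> l < j"
        then have "?g j <= ?g l" by (intro grid_mono[OF t0]) simp
        then show False using l(2) r by simp
       qed
       note sp = simple_process_grid[OF t0 this l(2)] simple_process_grid[OF t0 l]
       show ?case unfolding p by (simp add: sp)
      qed
     qed
     also have "\<dots> <= \<epsilon> n"
      unfolding \<epsilon>_def
     proof (rule msq_time_space_mono[OF pM s0(2)])
      have "(%p. simple_process ?N ?g (%l. \<rho> (?g l)) (fst p) (snd p)) \<in> borel_measurable (borel \<Otimes>\<^sub>M M)"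
       unfolding simple_process_def
      proof (intro borel_measurable_sum borel_measurable_scaleR)
       fix l
       show "(%p. indicat_real {?g l<..?g (Suc l)} (fst p)) \<in> borel_measurable (borel \<Otimes>\<^sub>M M)" by measurable
       show "(%p. \<rho> (?g l) (snd p)) \<in> borel_measurable (borel \<Otimes>\<^sub>M M)"
        by (rule measurable_compose[OF measurable_snd \<rho>sm])
      qed
      from borel_measurable_diff[OF \<rho>m this]
      show "(%(s, x). \<rho> s x - ?sN s x) \<in> borel_measurable (borel \<Otimes>\<^sub>M M)" by (simp add: case_prod_unfold)
     qed
     finally show ?thesis .
    qed
    show ?thesis by (rule order_trans[OF 1]) (intro add_right_mono mult_left_mono 2 zero_le)
   qed
   obtain J where "has_stoch_integral_vec M F W (%k s x. \<sigma> k (\<rho> s x)) ?s J"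
    and Jeq: "AE x in M. \<rho> ?s x = ini + (LBINT r:{0..?s}. a (\<rho> r x)) + J x"
    using sol[OF gT[OF j]] by blast
   then obtain Jk where Jk: "!!k. has_stoch_integral M F (%s x. W s x $ k) (%s x. \<sigma> k (\<rho> s x)) ?s (Jk k)"
    and Jsum: "AE x in M. J x = (\<Sum>k\<in>UNIV. Jk k x)" unfolding has_stoch_integral_vec_def by blast
   have Jkm: "Jk k \<in> borel_measurable M" for k using Jk[of k] unfolding has_stoch_integral_def by blast
   define D where "D x = (\<integral>r. a (\<rho> r x) - simple_process j ?g (%l x. a (?X l x)) r x \<partial>?R)" for x
   define S where "S k = simple_integral (%s x. W s x $ k) j ?g (%l x. \<sigma> k (?X l x))" for k
   have sd: "simple_data M F ?s j ?g (%l x. \<sigma> k (?X l x))" for k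
   proof (rule simple_data_grid[OF t0])
    fix l assume l: "l < j"
    show "(%x. \<sigma> k (?X l x)) \<in> borel_measurable (F (?g l))" using l j by (intro measurable_compose[OF Xad \<sigma>m]) auto
    show "bounded ((%x. \<sigma> k (?X l x)) ` space M)" using bd_\<sigma> by (auto simp: bounded_iff)
   qed simp
   have Sm: "S k \<in> borel_measurable M" for k
    unfolding S_def simple_integral_eq
    using borel_measurable_increment_sum[OF _ filt simple_data_elementary[OF sd] s0(3), of "%s x. W s x $ k"]
     scalar_brownian.B_measurable[OF wiener_scalar_brownian[OF pM filt wien]] by blast
   have am\<rho>: "(%(s, x). a (\<rho> s x)) \<in> borel_measurable (time_space ?s M)"
    using measurable_compose[OF \<rho>ts am] by (simp add: case_prod_unfold)
   have aX: "(%(s, x). simple_process j ?g (%l x. a (?X l x)) s x) \<in> borel_measurable (time_space ?s M)"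
    by (rule borel_measurable_simple_process) (rule measurable_compose[OF Xl am])
   have dm: "(%(s, x). a (\<rho> s x) - simple_process j ?g (%l x. a (?X l x)) s x) \<in> borel_measurable (time_space ?s M)"
    using borel_measurable_diff[OF am\<rho> aX] by (simp add: case_prod_unfold)
   have spi: "integrable ?R (%s. simple_process j ?g (%l x. a (?X l x)) s x)"
    "(\<integral>s. simple_process j ?g (%l x. a (?X l x)) s x \<partial>?R) = (\<Sum>l<j. (t / real ?N) *\<^sub>R a (?X l x))" for x
   proof -
    have eq: "simple_process j ?g (%l x. a (?X l x)) s x = simple_process j ?g (%l y. a (?X l x)) s x" for s
     unfolding simple_process_def ..
    show "integrable ?R (%s. simple_process j ?g (%l x. a (?X l x)) s x)"
     "(\<integral>s. simple_process j ?g (%l x. a (?X l x)) s x \<partial>?R) = (\<Sum>l<j. (t / real ?N) *\<^sub>R a (?X l x))"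
     unfolding eq by (rule time_integral_simple_process_grid[OF t0], simp)+
   qed
   have ai: "integrable ?R (%s. a (\<rho> s x))" for x
   proof (rule R.integrable_const_bound[of _ K])
    have "continuous_on UNIV (%s. a (\<rho> s x))" by (rule continuous_on_compose2[OF ac \<rho>c]) simp
    then show "(%s. a (\<rho> s x)) \<in> borel_measurable ?R"
     by (intro measurable_restrict_space1) (simp add: borel_measurable_continuous_onI)
   qed (simp add: bd_a)
   have Dm: "D \<in> borel_measurable M"
    unfolding D_def
   proof (rule R.borel_measurable_lebesgue_integral)
    from measurable_pair_swap[OF dm]
    show "(%(x, r). a (\<rho> r x) - simple_process j ?g (%l x. a (?X l x)) r x) \<in> borel_measurable (M \<Otimes>\<^sub>M ?R)" by simp
   qed
   have D: "msq M D <= ennreal T * (ennreal (\<Lambda>\<^sup>2) * G)"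
   proof -
    have "msq M D <= ennreal ?s * msq (time_space ?s M) (%(s, x). a (\<rho> s x) - simple_process j ?g (%l x. a (?X l x)) s x)"
     unfolding D_def by (rule msq_time_integral_le[OF pM s0(1) dm]) (intro Bochner_Integration.integrable_diff ai spi)
    also have "\<dots> <= ennreal T * (ennreal (\<Lambda>\<^sup>2) * G)" using s0 by (intro mult_mono lipG lip_a ennreal_leI) auto
    finally show ?thesis .
   qed
   have SJ: "msq M (%x. Jk k x - S k x) <= ennreal (C k) * (ennreal (\<Lambda>\<^sup>2) * G)" for k
   proof -
    have "msq M (%x. Jk k x - S k x) <= ennreal (C k) * msq (time_space ?s M) (%(s, x). \<sigma> k (\<rho> s x) - simple_process j ?g (%l x. \<sigma> k (?X l x)) s x)"
     unfolding S_def by (rule C[OF gT[OF j] Jk sd])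
    also have "\<dots> <= ennreal (C k) * (ennreal (\<Lambda>\<^sup>2) * G)" by (intro mult_left_mono lipG lip_\<sigma>) auto
    finally show ?thesis .
   qed
   have "AE x in M. \<rho> ?s x - ?X j x = D x + (\<Sum>k\<in>UNIV. Jk k x - S k x)"
    using Jeq Jsum
   proof eventually_elim
    case (elim x)
    have "(LBINT r:{0..?s}. a (\<rho> r x)) = (\<integral>r. a (\<rho> r x) \<partial>?R)"
     unfolding set_lebesgue_integral_def by (rule integral_restrict_space[symmetric]) simp
    then have "D x = (LBINT r:{0..?s}. a (\<rho> r x)) - (\<Sum>l<j. (t / real ?N) *\<^sub>R a (?X l x))"
     unfolding D_def by (subst Bochner_Integration.integral_diff[OF ai spi(1)]) (simp only: spi(2))
    moreover have "?X j x = ini + (\<Sum>l<j. (t / real ?N) *\<^sub>R a (?X l x)) + (\<Sum>k\<in>UNIV. S k x)"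
     unfolding S_def by (rule euler_eq_sum)
    ultimately show ?case using elim by (simp only: sum_subtractf) simp
   qed
   then have "e j = msq M (%x. D x + (\<Sum>k\<in>UNIV. Jk k x - S k x))"
    unfolding e_def by (subst msq_minus_commute) (rule msq_cong_AE)
   also have "\<dots> <= 2 * msq M D + 2 * msq M (%x. \<Sum>k\<in>UNIV. Jk k x - S k x)"
    using Dm Jkm Sm by (intro msq_add_le borel_measurable_sum borel_measurable_diff) auto
   also have "\<dots> <= 2 * msq M D + 2 * (of_nat CARD('r) * (\<Sum>k\<in>UNIV. msq M (%x. Jk k x - S k x)))"
    using Jkm Sm by (intro add_left_mono mult_left_mono msq_sum_le) auto
   also have "\<dots> <= 2 * (ennreal T * (ennreal (\<Lambda>\<^sup>2) * G)) + 2 * (of_nat CARD('r) * (\<Sum>k\<in>UNIV. ennreal (C k) * (ennreal (\<Lambda>\<^sup>2) * G)))"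
    by (intro add_mono mult_left_mono sum_mono D SJ) auto
   also have "\<dots> = ennreal (2 * T * \<Lambda>\<^sup>2 + 2 * (real CARD('r) * ((\<Sum>k\<in>UNIV. C k) * \<Lambda>\<^sup>2))) * G"
   proof -
    have "(\<Sum>k\<in>UNIV. ennreal (C k) * (ennreal (\<Lambda>\<^sup>2) * G)) = ennreal ((\<Sum>k\<in>UNIV. C k) * \<Lambda>\<^sup>2) * G"
     using C0 by (simp add: sum_distrib_right[symmetric] sum_ennreal sum_nonneg ennreal_mult mult.assoc)
    then show ?thesis
     using T0 C0 sum_nonneg[of UNIV C]
     by (simp add: ennreal_plus ennreal_mult ennreal_of_nat_eq_real_of_nat distrib_right mult.assoc)
   qed
   also have "2 * T * \<Lambda>\<^sup>2 + 2 * (real CARD('r) * ((\<Sum>k\<in>UNIV. C k) * \<Lambda>\<^sup>2)) = A / 2"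
    unfolding A_def by (simp add: algebra_simps)
   also have "ennreal (A / 2) * G <= ennreal (A / 2) * (2 * \<epsilon> n + 2 * (\<Sum>l<j. ennreal (t / real ?N) * e l))"
    by (intro mult_left_mono G) simp
   also have "\<dots> = ennreal A * \<epsilon> n + ennreal (A * t / real ?N) * (\<Sum>l<j. e l)"
   proof -
    have h: "ennreal (A / 2) * 2 = ennreal A"
     using A0 by (subst ennreal_numeral[symmetric], subst ennreal_mult[symmetric]) auto
    have "ennreal A * ennreal (t / real ?N) = ennreal (A * t / real ?N)"
     using A0 t0 by (subst ennreal_mult[symmetric]) auto
    then show ?thesis
     by (simp only: distrib_left sum_distrib_left[symmetric] mult.assoc[symmetric] h)
   qed
   finally show ?thesis .
  qed
  have "e ?N <= (ennreal A * \<epsilon> n) * (1 + ennreal (A * t / real ?N)) ^ ?N"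
   by (rule gronwall_sum_ennreal[of ?N e, OF step order_refl])
  also have "\<dots> <= (ennreal A * \<epsilon> n) * ennreal (exp (A * t))"
   using A0 t0 by (intro mult_left_mono power_one_plus_le_exp) auto
  finally show ?thesis unfolding e_def by (simp only: grid_last[of ?N] One_nat_def Suc_le_mono le0 mult.commute)
 qed
 have "(%n. ennreal (exp (A * t)) * (ennreal A * \<epsilon> n)) \<longlonglongrightarrow> ennreal (exp (A * t)) * (ennreal A * 0)"
  by (intro ennreal_tendsto_cmult \<epsilon>) auto
 then have "(%n. ennreal (exp (A * t)) * (ennreal A * \<epsilon> n)) \<longlonglongrightarrow> 0" by simp
 then show ?thesis
  by (rule tendsto_sandwich[OF always_eventually[OF allI[OF zero_le]] always_eventually[OF allI[OF main]] tendsto_const])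
qed

context noise
begin

lemma path_functional_euler:
 fixes a :: "'b::euclidean_space => 'b" and \<sigma> :: "'r => 'b => 'b"
 assumes a: "continuous_on UNIV a" and \<sigma>: "!!k. continuous_on UNIV (\<sigma> k)" and t: "0 <= t" "t <= T" and n: "n >= 1"
 shows "j <= n ==> path_functional (%i. euler a \<sigma> ini (W i) t n j)"
proof (induction j)
 case 0
 show ?case unfolding euler_0_fun by (rule path_functional_const)
next
 case (Suc j)
 have X: "path_functional (%i. euler a \<sigma> ini (W i) t n j)" using Suc by simp
 have g: "grid t n j \<in> {0..T}" "grid t n (Suc j) \<in> {0..T}"
  using grid_in[OF t(1) _ n, of j] grid_in[OF t(1) _ n, of "Suc j"] Suc.prems t(2) by auto
 have dW: "path_functional (%i x. W i (grid t n (Suc j)) x - W i (grid t n j) x)"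
  by (rule path_functional_compose2[OF path_functional_noise[OF g(2)] path_functional_noise[OF g(1)], of "%u v. u - v"])
   (intro continuous_intros)
 have aX: "path_functional (%i x. (t / real n) *\<^sub>R a (euler a \<sigma> ini (W i) t n j x))"
  by (rule path_functional_compose[OF X, of "%u. (t / real n) *\<^sub>R a u"]) (intro continuous_intros a)
 have sX: "path_functional (%i x. ((W i (grid t n (Suc j)) x - W i (grid t n j) x) $ k) *\<^sub>R \<sigma> k (euler a \<sigma> ini (W i) t n j x))" for k
  by (rule path_functional_compose2[OF dW X, of "%u v. (u $ k) *\<^sub>R \<sigma> k v"])
   (intro continuous_intros continuous_on_compose2[OF \<sigma> continuous_on_snd[OF continuous_on_id]], simp)
 show ?case
  unfolding euler_Suc_fun vector_minus_component[symmetric]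
  by (intro path_functional_add path_functional_sum X aX sX finite_class.finite_UNIV)
qed

text \<open>Every Euler iterate is an explicit function of the noise, hence so is the limit. This yields that the solutions driven
by the different noises are independent with a common law.\<close>

lemma path_functional_strong_solution:
 fixes a :: "'b::euclidean_space => 'b" and \<sigma> :: "'r => 'b => 'b" and \<rho> :: "nat => real => 'w => 'b"
 assumes lip_a: "!!u v. norm (a u - a v) <= \<Lambda> * norm (u - v)" and lip_\<sigma>: "!!k u v. norm (\<sigma> k u - \<sigma> k v) <= \<Lambda> * norm (u - v)"
  and bd_a: "!!u. norm (a u) <= K" and bd_\<sigma>: "!!k u. norm (\<sigma> k u) <= K"
  and \<rho>m: "!!i. i >= 1 ==> (%(s, x). \<rho> i s x) \<in> borel_measurable (borel \<Otimes>\<^sub>M M)"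
  and \<rho>c: "!!i x. i >= 1 ==> continuous_on UNIV (%s. \<rho> i s x)"
  and \<rho>b: "!!i s x. i >= 1 ==> norm (\<rho> i s x) <= R"
  and sol: "!!i s. i >= 1 ==> s \<in> {0..T} ==> \<exists>J. has_stoch_integral_vec M F (W i) (%k s x. \<sigma> k (\<rho> i s x)) s J \<and>
    (AE x in M. \<rho> i s x = ini + (LBINT r:{0..s}. a (\<rho> i r x)) + J x)"
  and t: "t \<in> {0..T}"
 shows "path_functional (%i. \<rho> i t)"
proof (rule path_functional_limit_msq[where X="%n i. euler a \<sigma> ini (W i) t (Suc n) (Suc n)"])
 have ac: "continuous_on UNIV a" by (rule lipschitz_continuous_on[OF lip_a])
 have \<sigma>c: "continuous_on UNIV (\<sigma> k)" for k by (rule lipschitz_continuous_on[OF lip_\<sigma>])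
 show "path_functional (%i. euler a \<sigma> ini (W i) t (Suc n) (Suc n))" for n
  using t by (intro path_functional_euler[OF ac \<sigma>c]) auto
 fix i :: nat assume i: "i >= 1"
 show "\<rho> i t \<in> borel_measurable M" using measurable_compose[OF measurable_Pair1' \<rho>m[OF i], of t] by simp
 show "(%n. msq M (%x. euler a \<sigma> ini (W i) t (Suc n) (Suc n) x - \<rho> i t x)) \<longlonglongrightarrow> 0"
  by (rule euler_converges[OF prob_space_axioms filt wiener[OF i] lip_a lip_\<sigma> bd_a bd_\<sigma> \<rho>m[OF i] \<rho>c[OF i] \<rho>b[OF i] sol[OF i] t])
qed

end

section \<open>Density matrices and the master equation\<close>

lemma linear_matrix_mult_left: "linear (%X :: complex^'k^'n. A ** X)"
 by (rule linearI) (simp_all add: vec_eq_iff matrix_matrix_mult_def sum.distrib scaleR_sum_right algebra_simps)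

lemma linear_matrix_mult_right: "linear (%X :: complex^'n^'m. X ** B)"
 by (rule linearI) (simp_all add: vec_eq_iff matrix_matrix_mult_def sum.distrib scaleR_sum_right algebra_simps)

lemma linear_adj: "linear adj"
 by (rule linearI) (simp_all add: vec_eq_iff adj_def)

lemma linear_cscale: "linear (cscale c)"
 by (rule linearI) (simp_all add: vec_eq_iff cscale_def algebra_simps)

lemmas bounded_linear_matrix_mult_left = linear_matrix_mult_left[unfolded linear_conv_bounded_linear]
lemmas bounded_linear_matrix_mult_right = linear_matrix_mult_right[unfolded linear_conv_bounded_linear]

lemma bounded_linear_lindblad: "bounded_linear (lindblad H L)"
proof -
 have c: "bounded_linear (cscale (- \<i>))" using linear_cscale by (simp add: linear_conv_bounded_linear)
 show ?thesis
  unfolding lindblad_def[abs_def]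
  by (intro bounded_linear_add bounded_linear_sub bounded_linear_sum bounded_linear_const_scaleR
    bounded_linear_compose[OF c] bounded_linear_matrix_mult_left bounded_linear_matrix_mult_right
    bounded_linear_compose[OF bounded_linear_matrix_mult_right bounded_linear_matrix_mult_left])
qed

lemma bilinear_b_form: "bilinear (b_form :: complex^'d::finite^'d => _)"
 unfolding bilinear_def
 by (intro conjI allI linearI)
  (simp_all add: b_form_def trace_def matrix_matrix_mult_def adj_def sum.distrib scaleR_sum_right sum_distrib_left algebra_simps)

lemma bounded_bilinear_b_form: "bounded_bilinear (b_form :: complex^'d::finite^'d => _)"
 using bilinear_b_form by (simp add: bilinear_conv_bounded_bilinear)

lemma bounded_linear_b_form: "bounded_linear (b_form A)"
 by (rule bounded_bilinear.bounded_linear_right[OF bounded_bilinear_b_form])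

lemma bounded_linear_b_vec: "bounded_linear (b_vec L)"
proof -
 have "linear (b_vec L)"
  by (intro linearI) (simp_all add: vec_eq_iff b_vec_def linear_add[OF bounded_linear.linear[OF bounded_linear_b_form]]
    linear_scale[OF bounded_linear.linear[OF bounded_linear_b_form]])
 then show ?thesis by (simp add: linear_conv_bounded_linear)
qed

lemma quadratic_form_pair:
 fixes \<rho> :: "complex^'d::finite^'d"
 shows "(\<Sum>a\<in>UNIV. cnj ((axis i 1 + z *s axis j 1) $ a) * (\<rho> *v (axis i 1 + z *s axis j 1)) $ a) =
   \<rho> $ i $ i + z * \<rho> $ i $ j + cnj z * \<rho> $ j $ i + cnj z * z * \<rho> $ j $ j"
proof -
 have 1: "(\<rho> *v (axis i 1 + z *s axis j 1)) $ a = \<rho> $ a $ i + z * \<rho> $ a $ j" for a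
 proof -
  have "(\<rho> *v axis k 1) $ a = \<rho> $ a $ k" for k
   by (simp add: matrix_vector_mult_def axis_def mult_delta_right)
  then show ?thesis by (simp add: matrix_vector_right_distrib vector_scalar_commute)
 qed
 have 2: "cnj ((axis i 1 + z *s axis j 1) $ a) * X a = (if a = i then X a else 0) + (if a = j then cnj z * X a else 0)" for a X
  by (simp add: axis_def distrib_right)
 show ?thesis
 proof -
  define Y where "Y a = \<rho> $ a $ i + z * \<rho> $ a $ j" for a
  have "(\<Sum>a\<in>UNIV. cnj ((axis i 1 + z *s axis j 1) $ a) * (\<rho> *v (axis i 1 + z *s axis j 1)) $ a) =
    (\<Sum>a\<in>UNIV. (if a = i then Y a else 0) + (if a = j then cnj z * Y a else 0))"
   by (rule sum.cong[OF refl], unfold 1 Y_def[symmetric], rule 2)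
  also have "\<dots> = Y i + cnj z * Y j" by (simp add: sum.distrib)
  finally show ?thesis by (simp add: Y_def algebra_simps)
 qed
qed

text \<open>The quadratic form at a sum of two coordinate vectors is nonnegative and the diagonal entries are at most
one. The unit z is chosen so as to extract the real or the imaginary part of the off-diagonal entry.\<close>

lemma density_matrix_entry_bound:
 fixes \<rho> :: "complex^'d::finite^'d"
 assumes "density_matrix \<rho>"
 shows "norm (\<rho> $ i $ j) <= 2"
proof -
 have pos: "0 <= Re (\<rho> $ i $ i + z * \<rho> $ i $ j + cnj z * \<rho> $ j $ i + cnj z * z * \<rho> $ j $ j)" for z i j
  using assms unfolding density_matrix_def quadratic_form_pair[symmetric] by blast
 have herm: "\<rho> $ j $ i = cnj (\<rho> $ i $ j)" for i j
 proof -
  have "adj \<rho> $ j $ i = \<rho> $ j $ i" using assms by (simp add: density_matrix_def)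
  then show ?thesis by (simp add: adj_def)
 qed
 have d0: "0 <= Re (\<rho> $ k $ k)" for k using pos[of k 0 k] by simp
 have "(\<Sum>k\<in>UNIV. Re (\<rho> $ k $ k)) = Re (trace \<rho>)" by (simp add: trace_def)
 also have "\<dots> = 1" using assms by (simp add: density_matrix_def)
 finally have d1: "Re (\<rho> $ k $ k) <= 1" for k
  using member_le_sum[of k UNIV "%k. Re (\<rho> $ k $ k)"] d0 by simp
 have "\<bar>Re (\<rho> $ i $ j)\<bar> <= 1"
  using pos[of i 1 j] pos[of i "-1" j] d1[of i] d1[of j] by (simp add: herm[of j i])
 moreover have "\<bar>Im (\<rho> $ i $ j)\<bar> <= 1"
  using pos[of i \<i> j] pos[of i "-\<i>" j] d1[of i] d1[of j] by (simp add: herm[of j i])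
 ultimately show ?thesis using cmod_le[of "\<rho> $ i $ j"] by linarith
qed

lemma density_matrix_bounded:
 "\<exists>R\<ge>0. \<forall>\<rho> :: complex^'d::finite^'d. density_matrix \<rho> \<longrightarrow> norm \<rho> <= R"
proof (intro exI conjI allI impI)
 show "0 <= (\<Sum>i\<in>(UNIV :: 'd set). \<Sum>j\<in>(UNIV :: 'd set). (2::real))" by (intro sum_nonneg) auto
 fix \<rho> :: "complex^'d^'d" assume d: "density_matrix \<rho>"
 have "norm \<rho> <= (\<Sum>i\<in>UNIV. norm (\<rho> $ i))" by (simp add: norm_vec_def L2_set_le_sum)
 also have "\<dots> <= (\<Sum>i\<in>UNIV. \<Sum>j\<in>UNIV. norm (\<rho> $ i $ j))"
  by (intro sum_mono) (simp add: norm_vec_def L2_set_le_sum)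
 also have "\<dots> <= (\<Sum>i\<in>(UNIV :: 'd set). \<Sum>j\<in>(UNIV :: 'd set). 2)" by (intro sum_mono density_matrix_entry_bound[OF d])
 finally show "norm \<rho> <= (\<Sum>i\<in>(UNIV :: 'd set). \<Sum>j\<in>(UNIV :: 'd set). (2::real))" .
qed

lemma diffusion_op_lipschitz:
 fixes L :: "complex^'d::finite^'d"
 assumes "R >= 0"
 shows "\<exists>\<Lambda>\<ge>0. \<forall>u\<in>cball 0 R. \<forall>v\<in>cball 0 R. norm (diffusion_op L u - diffusion_op L v) <= \<Lambda> * norm (u - v)"
proof -
 have "bounded_linear (%u. L ** u + u ** adj L)"
  by (intro bounded_linear_add bounded_linear_matrix_mult_left bounded_linear_matrix_mult_right)
 then obtain A where A: "!!u. norm (L ** u + u ** adj L) <= norm u * A" "A >= 0"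
  using bounded_linear.nonneg_bounded by blast
 interpret b: bounded_linear "b_form L" by (rule bounded_linear_b_form)
 obtain B where B: "!!u. norm (b_form L u) <= norm u * B" "B >= 0" using b.nonneg_bounded by blast
 have "norm (diffusion_op L u - diffusion_op L v) <= (A + 2 * (R * B)) * norm (u - v)" if uv: "u \<in> cball 0 R" "v \<in> cball 0 R" for u v
 proof -
  have nu: "norm u <= R" "norm v <= R" using uv by auto
  have "diffusion_op L u - diffusion_op L v = (L ** (u - v) + (u - v) ** adj L) - (b_form L (u - v) *\<^sub>R u + b_form L v *\<^sub>R (u - v))"
   unfolding diffusion_op_def
   using linear_diff[OF linear_matrix_mult_left, of L u v] linear_diff[OF linear_matrix_mult_right[where B="adj L"], of u v]
   by (simp add: b.diff algebra_simps)
  also have "norm \<dots> <= norm (u - v) * A + (norm (u - v) * B * R + R * B * norm (u - v))"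
  proof -
   have "norm (b_form L (u - v) *\<^sub>R u) <= norm (u - v) * B * R"
    unfolding norm_scaleR using B(1)[of "u - v"] nu B(2) by (intro mult_mono) auto
   moreover have "norm (b_form L v *\<^sub>R (u - v)) <= R * B * norm (u - v)"
    unfolding norm_scaleR using B(1)[of v] mult_right_mono[OF nu(2) B(2)] by (intro mult_right_mono) auto
   ultimately show ?thesis
    using A(1)[of "u - v"] norm_triangle_ineq4[of "L ** (u - v) + (u - v) ** adj L" "b_form L (u - v) *\<^sub>R u + b_form L v *\<^sub>R (u - v)"]
     norm_triangle_ineq[of "b_form L (u - v) *\<^sub>R u" "b_form L v *\<^sub>R (u - v)"] by linarith
  qed
  also have "\<dots> = (A + 2 * (R * B)) * norm (u - v)" by (simp add: algebra_simps)
  finally show ?thesis .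
 qed
 then show ?thesis using A(2) B(2) assms by (intro exI[of _ "A + 2 * (R * B)"]) auto
qed

text \<open>The coefficients of the master equation are quadratic. Composed with the projection onto a ball that contains all density
matrices they become bounded and globally Lipschitz, and along the solution they are unchanged.\<close>

lemma lipschitz_projection:
 fixes f :: "'b::euclidean_space => 'c::real_normed_vector"
 assumes "R >= 0" and lip: "!!u v. u \<in> cball 0 R ==> v \<in> cball 0 R ==> norm (f u - f v) <= \<Lambda> * norm (u - v)" and "\<Lambda> >= 0"
 shows "norm (f (closest_point (cball 0 R) u) - f (closest_point (cball 0 R) v)) <= \<Lambda> * norm (u - v)"
  "norm (f (closest_point (cball 0 R) u)) <= norm (f 0) + \<Lambda> * R"
proof -
 let ?P = "closest_point (cball (0::'b) R)"
 have ne: "cball (0::'b) R \<noteq> {}" using assms(1) by simp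
 have P: "?P u \<in> cball 0 R" for u by (rule closest_point_in_set[OF closed_cball ne])
 have "norm (f (?P u) - f (?P v)) <= \<Lambda> * norm (?P u - ?P v)" by (rule lip[OF P P])
 also have "\<dots> <= \<Lambda> * norm (u - v)"
  using closest_point_lipschitz[OF convex_cball closed_cball ne, of u v] assms(3) by (intro mult_left_mono) (simp_all add: dist_norm)
 finally show "norm (f (?P u) - f (?P v)) <= \<Lambda> * norm (u - v)" .
 have "norm (f (?P u) - f 0) <= \<Lambda> * norm (?P u - 0)" using assms(1) by (intro lip P) simp
 also have "\<dots> <= \<Lambda> * R" using P[of u] assms(3) by (intro mult_left_mono) auto
 finally show "norm (f (?P u)) <= norm (f 0) + \<Lambda> * R" using norm_triangle_sub[of "f (?P u)" "f 0"] by linarith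
qed

lemma sme_solution_modification:
 fixes \<rho> :: "real => 'w => complex^'d::finite^'d"
 assumes pM: "prob_space M" and filt: "filtration_on M F" and T: "T >= 0" and \<rho>0: "density_matrix \<rho>0"
  and sme: "sme_solution M F T W H L \<rho>0 \<rho>"
 obtains \<rho>' where "!!s x. density_matrix (\<rho>' s x)" "!!x. continuous_on UNIV (%s. \<rho>' s x)"
  "!!s. \<rho>' s \<in> borel_measurable M" "(%(s, x). \<rho>' s x) \<in> borel_measurable (borel \<Otimes>\<^sub>M M)"
  "AE x in M. \<forall>s\<in>{0..T}. \<rho> s x = \<rho>' s x"
  "!!s. s \<in> {0..T} ==> \<exists>J. has_stoch_integral_vec M F W (%k s x. diffusion_op (L k) (\<rho>' s x)) s J \<and>
    (AE x in M. \<rho>' s x = \<rho>0 + (LBINT r:{0..s}. lindblad H L (\<rho>' r x)) + J x)"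
proof -
 have m: "\<rho> s \<in> borel_measurable M" if "s \<in> {0..T}" for s
  using sme that filtration_on_measurable[OF filt] unfolding sme_solution_def by blast
 have c: "AE x in M. continuous_on {0..T} (%s. \<rho> s x)" using sme unfolding sme_solution_def by blast
 have d: "AE x in M. \<forall>s\<in>{0..T}. \<rho> s x \<in> Collect density_matrix" using sme unfolding sme_solution_def by simp
 have c0: "\<rho>0 \<in> Collect density_matrix" using \<rho>0 by simp
 obtain \<rho>' where \<rho>': "!!s x. \<rho>' s x \<in> Collect density_matrix" "!!x. continuous_on UNIV (%s. \<rho>' s x)"
  "!!s. \<rho>' s \<in> borel_measurable M" "(%(s, x). \<rho>' s x) \<in> borel_measurable (borel \<Otimes>\<^sub>M M)"
  and eq: "AE x in M. \<forall>s\<in>{0..T}. \<rho> s x = \<rho>' s x"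
  by (rule continuous_modification[OF T m c d c0]) (assumption, rule that)
 have \<sigma>m: "diffusion_op (L k) \<in> borel_measurable borel" for k
 proof (rule borel_measurable_continuous_onI)
  have "continuous_on UNIV (%u. L k ** u + u ** adj (L k))"
   by (intro linear_continuous_on bounded_linear_add bounded_linear_matrix_mult_left bounded_linear_matrix_mult_right)
  then show "continuous_on UNIV (diffusion_op (L k))"
   unfolding diffusion_op_def[abs_def]
   by (intro continuous_on_diff continuous_on_scaleR continuous_on_id linear_continuous_on[OF bounded_linear_b_form])
 qed
 have sol': "\<exists>J. has_stoch_integral_vec M F W (%k s x. diffusion_op (L k) (\<rho>' s x)) s J \<and>
    (AE x in M. \<rho>' s x = \<rho>0 + (LBINT r:{0..s}. lindblad H L (\<rho>' r x)) + J x)" if s: "s \<in> {0..T}" for s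
 proof -
  have "\<exists>J. has_stoch_integral_vec M F W (%k s x. diffusion_op (L k) (\<rho> s x)) s J \<and>
    (AE x in M. \<rho> s x = \<rho>0 + (LBINT r:{0..s}. lindblad H L (\<rho> r x)) + J x)"
   using sme s unfolding sme_solution_def by blast
  then obtain J where J: "has_stoch_integral_vec M F W (%k s x. diffusion_op (L k) (\<rho> s x)) s J"
   "AE x in M. \<rho> s x = \<rho>0 + (LBINT r:{0..s}. lindblad H L (\<rho> r x)) + J x" by blast
  have ae: "AE x in M. \<forall>r\<in>{0..s}. diffusion_op (L k) (\<rho> r x) = diffusion_op (L k) (\<rho>' r x)" for k
   using eq by eventually_elim (use s in auto)
  have ms: "(%(r, x). diffusion_op (L k) (\<rho>' r x)) \<in> borel_measurable (time_space s M)" for k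
   using measurable_compose[OF measurable_time_spaceI[OF \<rho>'(4)] \<sigma>m] by (simp add: case_prod_unfold)
  obtain Jk where Jk: "!!k. has_stoch_integral M F (%s x. W s x $ k) (%s x. diffusion_op (L k) (\<rho> s x)) s (Jk k)"
   and JJ: "J \<in> borel_measurable M" "AE x in M. J x = (\<Sum>k\<in>UNIV. Jk k x)"
   using J(1) unfolding has_stoch_integral_vec_def by blast
  have "has_stoch_integral_vec M F W (%k s x. diffusion_op (L k) (\<rho>' s x)) s J"
   unfolding has_stoch_integral_vec_def
   using has_stoch_integral_cong_integrand[OF pM Jk ae ms] JJ by blast
  moreover have "AE x in M. \<rho>' s x = \<rho>0 + (LBINT r:{0..s}. lindblad H L (\<rho>' r x)) + J x"
   using J(2) eq
  proof eventually_elim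
   case (elim x)
   have "(LBINT r:{0..s}. lindblad H L (\<rho> r x)) = (LBINT r:{0..s}. lindblad H L (\<rho>' r x))"
    using elim(2) s by (intro set_lebesgue_integral_cong) auto
   then show ?case using elim s by auto
  qed
  ultimately show ?thesis by blast
 qed
 have "density_matrix (\<rho>' s x)" for s x using \<rho>'(1)[of s x] by simp
 from that[OF this \<rho>'(2-4) eq sol'] show thesis .
qed

lemma (in noise) path_functional_cong_AE:
 assumes "path_functional X" "!!i. i >= 1 ==> Z i \<in> borel_measurable M" "!!i. i >= 1 ==> AE x in M. X i x = Z i x"
 shows "path_functional Z"
proof (rule path_functional_limit_AE[of "%_. X", OF assms(1,2)])
 fix i :: nat assume "i >= 1"
 from assms(3)[OF this] show "AE x in M. (%n. X i x) \<longlonglongrightarrow> Z i x" by eventually_elim simp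
qed
lemma (in noise) path_functional_sme:
 fixes \<rho> :: "nat => real => 'w => complex^'d::finite^'d"
 assumes \<rho>0: "density_matrix \<rho>0" and sme: "!!i. i >= 1 ==> sme_solution M F T (W i) H L \<rho>0 (\<rho> i)" and t: "t \<in> {0..T}"
 shows "path_functional (%i. \<rho> i t)"
proof -
 obtain R where R: "R >= 0" "!!\<rho> :: complex^'d^'d. density_matrix \<rho> ==> norm \<rho> <= R"
  using density_matrix_bounded by blast
 obtain A where A: "A >= 0" "!!u. norm (lindblad H L u) <= norm u * A"
  using bounded_linear.nonneg_bounded[OF bounded_linear_lindblad] by blast
 have "\<forall>k. \<exists>\<Lambda>\<ge>0. \<forall>u\<in>cball 0 R. \<forall>v\<in>cball 0 R. norm (diffusion_op (L k) u - diffusion_op (L k) v) <= \<Lambda> * norm (u - v)"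
  using diffusion_op_lipschitz[OF R(1)] by (rule allI)
 from choice[OF this] obtain D where D: "!!k. D k >= 0"
  "!!k u v. u \<in> cball 0 R ==> v \<in> cball 0 R ==> norm (diffusion_op (L k) u - diffusion_op (L k) v) <= D k * norm (u - v)"
  by blast
 define \<Lambda> where "\<Lambda> = A + (\<Sum>k\<in>UNIV. D k)"
 have D\<Lambda>: "D k <= \<Lambda>" for k
  using member_le_sum[of k UNIV D] D(1) A(1) by (simp add: \<Lambda>_def add_increasing)
 have A\<Lambda>: "A <= \<Lambda>" using sum_nonneg[of UNIV D] D(1) by (simp add: \<Lambda>_def)
 have \<Lambda>0: "\<Lambda> >= 0" using A\<Lambda> A(1) by simp
 define P :: "complex^'d^'d => complex^'d^'d" where "P = closest_point (cball 0 R)"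
 have lipa: "norm (lindblad H L u - lindblad H L v) <= \<Lambda> * norm (u - v)" for u v
 proof -
  have "norm (lindblad H L u - lindblad H L v) <= norm (u - v) * A"
   using A(2)[of "u - v"] by (simp add: linear_diff[OF bounded_linear.linear[OF bounded_linear_lindblad]])
  also have "\<dots> <= \<Lambda> * norm (u - v)" using mult_right_mono[OF A\<Lambda>, of "norm (u - v)"] by (simp add: mult.commute)
  finally show ?thesis .
 qed
 have lips: "norm (diffusion_op (L k) u - diffusion_op (L k) v) <= \<Lambda> * norm (u - v)" if "u \<in> cball 0 R" "v \<in> cball 0 R" for k u v
  by (rule order_trans[OF D(2)[OF that]]) (intro mult_right_mono D\<Lambda>, simp)
 have z: "lindblad H L 0 = 0" by (rule linear_0[OF bounded_linear.linear[OF bounded_linear_lindblad]])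
 have z': "diffusion_op (L k) 0 = 0" for k
  unfolding diffusion_op_def by (simp add: linear_0[OF linear_matrix_mult_left] linear_0[OF linear_matrix_mult_right])
 have Pd: "P u = u" if "density_matrix u" for u
  unfolding P_def using R(2)[OF that] by (intro closest_point_self) simp
 have "\<forall>i. \<exists>\<rho>'. i >= 1 \<longrightarrow> (\<forall>s x. density_matrix (\<rho>' s x)) \<and> (\<forall>x. continuous_on UNIV (%s. \<rho>' s x)) \<and>
   (%(s, x). \<rho>' s x) \<in> borel_measurable (borel \<Otimes>\<^sub>M M) \<and> (AE x in M. \<forall>s\<in>{0..T}. \<rho> i s x = \<rho>' s x) \<and>
   (\<forall>s\<in>{0..T}. \<exists>J. has_stoch_integral_vec M F (W i) (%k s x. diffusion_op (L k) (\<rho>' s x)) s J \<and>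
    (AE x in M. \<rho>' s x = \<rho>0 + (LBINT r:{0..s}. lindblad H L (\<rho>' r x)) + J x))"
 proof
  fix i
  show "\<exists>\<rho>'. i >= 1 \<longrightarrow> (\<forall>s x. density_matrix (\<rho>' s x)) \<and> (\<forall>x. continuous_on UNIV (%s. \<rho>' s x)) \<and>
   (%(s, x). \<rho>' s x) \<in> borel_measurable (borel \<Otimes>\<^sub>M M) \<and> (AE x in M. \<forall>s\<in>{0..T}. \<rho> i s x = \<rho>' s x) \<and>
   (\<forall>s\<in>{0..T}. \<exists>J. has_stoch_integral_vec M F (W i) (%k s x. diffusion_op (L k) (\<rho>' s x)) s J \<and>
    (AE x in M. \<rho>' s x = \<rho>0 + (LBINT r:{0..s}. lindblad H L (\<rho>' r x)) + J x))"
  proof (cases "i >= 1")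
   case True
   show ?thesis
    by (rule sme_solution_modification[OF prob_space_axioms filt less_imp_le[OF T] \<rho>0 sme[OF True]]) blast
  qed simp
 qed
 from choice[OF this] obtain \<rho>' where \<rho>': "!!i s x. i >= 1 ==> density_matrix (\<rho>' i s x)" "!!i x. i >= 1 ==> continuous_on UNIV (%s. \<rho>' i s x)"
  "!!i. i >= 1 ==> (%(s, x). \<rho>' i s x) \<in> borel_measurable (borel \<Otimes>\<^sub>M M)" "!!i. i >= 1 ==> AE x in M. \<forall>s\<in>{0..T}. \<rho> i s x = \<rho>' i s x"
  "!!i s. i >= 1 ==> s \<in> {0..T} ==> \<exists>J. has_stoch_integral_vec M F (W i) (%k s x. diffusion_op (L k) (\<rho>' i s x)) s J \<and>
    (AE x in M. \<rho>' i s x = \<rho>0 + (LBINT r:{0..s}. lindblad H L (\<rho>' i r x)) + J x)"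
  by blast
 have "path_functional (%i. \<rho>' i t)"
 proof (rule path_functional_strong_solution[where a="%u. lindblad H L (P u)" and \<sigma>="%k u. diffusion_op (L k) (P u)" and \<Lambda>=\<Lambda> and K="\<Lambda> * R" and R=R and ini=\<rho>0])
  show "norm (lindblad H L (P u) - lindblad H L (P v)) <= \<Lambda> * norm (u - v)" for u v
   unfolding P_def by (rule lipschitz_projection(1)[OF R(1) lipa \<Lambda>0])
  show "norm (diffusion_op (L k) (P u) - diffusion_op (L k) (P v)) <= \<Lambda> * norm (u - v)" for k u v
   unfolding P_def by (rule lipschitz_projection(1)[OF R(1) lips \<Lambda>0])
  show "norm (lindblad H L (P u)) <= \<Lambda> * R" for u
   unfolding P_def using lipschitz_projection(2)[OF R(1) lipa \<Lambda>0, of u] by (simp add: z)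
  show "norm (diffusion_op (L k) (P u)) <= \<Lambda> * R" for k u
   unfolding P_def using lipschitz_projection(2)[OF R(1) lips \<Lambda>0, of k u] by (simp add: z')
  show "t \<in> {0..T}" by fact
  fix i :: nat assume i: "i >= 1"
  show "continuous_on UNIV (%s. \<rho>' i s x)" for x by (rule \<rho>'(2)[OF i])
  show "(%(s, x). \<rho>' i s x) \<in> borel_measurable (borel \<Otimes>\<^sub>M M)" by (rule \<rho>'(3)[OF i])
  show "norm (\<rho>' i s x) <= R" for s x by (rule R(2)[OF \<rho>'(1)[OF i]])
  fix s assume s: "s \<in> {0..T}"
  show "\<exists>J. has_stoch_integral_vec M F (W i) (%k s x. diffusion_op (L k) (P (\<rho>' i s x))) s J \<and>
    (AE x in M. \<rho>' i s x = \<rho>0 + (LBINT r:{0..s}. lindblad H L (P (\<rho>' i r x))) + J x)"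
   using \<rho>'(5)[OF i s] by (simp only: Pd[OF \<rho>'(1)[OF i]])
 qed
 then show ?thesis
 proof (rule path_functional_cong_AE)
  fix i :: nat assume i: "i >= 1"
  show "\<rho> i t \<in> borel_measurable M"
   using sme[OF i] t filtration_on_measurable[OF filt] unfolding sme_solution_def by blast
  show "AE x in M. \<rho>' i t x = \<rho> i t x" using \<rho>'(4)[OF i] by eventually_elim (use t in auto)
 qed
qed

text \<open>The martingale part has mean zero and the drift is linear, so the nonlinearity of the diffusion disappears in the mean.\<close>

lemma mean_state_equation:
 fixes \<rho> :: "real => 'w => complex^'d::finite^'d"
 assumes pM: "prob_space M" and filt: "filtration_on M F" and T: "T >= 0" and wien: "wiener_process M F T W"
  and \<rho>0: "density_matrix \<rho>0" and sme: "sme_solution M F T W H L \<rho>0 \<rho>"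
 shows "continuous_on {0..T} (%t. integral\<^sup>L M (\<rho> t))"
  "!!t. t \<in> {0..T} ==> integral\<^sup>L M (\<rho> t) = \<rho>0 + integral {0..t} (%s. lindblad H L (integral\<^sup>L M (\<rho> s)))"
proof -
 interpret prob_space M by fact
 obtain \<rho>' where \<rho>': "!!s x. density_matrix (\<rho>' s x)" "!!x. continuous_on UNIV (%s. \<rho>' s x)"
  "!!s. \<rho>' s \<in> borel_measurable M" "(%(s, x). \<rho>' s x) \<in> borel_measurable (borel \<Otimes>\<^sub>M M)"
  "AE x in M. \<forall>s\<in>{0..T}. \<rho> s x = \<rho>' s x"
  and sol: "!!s. s \<in> {0..T} ==> \<exists>J. has_stoch_integral_vec M F W (%k s x. diffusion_op (L k) (\<rho>' s x)) s J \<and>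
    (AE x in M. \<rho>' s x = \<rho>0 + (LBINT r:{0..s}. lindblad H L (\<rho>' r x)) + J x)"
  by (rule sme_solution_modification[OF pM filt T \<rho>0 sme]) blast
 obtain R where R: "R >= 0" "!!\<rho> :: complex^'d^'d. density_matrix \<rho> ==> norm \<rho> <= R"
  using density_matrix_bounded by blast
 have i': "integrable M (\<rho>' s)" for s
  by (rule integrable_const_bound[of _ R]) (auto intro: R \<rho>')
 define m where "m s = expectation (\<rho>' s)" for s
 have eq: "integral\<^sup>L M (\<rho> s) = m s" if s: "s \<in> {0..T}" for s
  unfolding m_def
 proof (rule integral_cong_AE)
  show "\<rho> s \<in> borel_measurable M"
   using sme s filtration_on_measurable[OF filt] unfolding sme_solution_def by blast
  show "AE x in M. \<rho> s x = \<rho>' s x" using \<rho>'(5) by eventually_elim (use s in auto)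
 qed (rule \<rho>')
 have mc: "continuous_on UNIV m"
  unfolding continuous_on_sequentially comp_def
 proof (intro allI ballI impI)
  fix u s assume "(\<forall>n. u n \<in> (UNIV :: real set)) \<and> u \<longlonglongrightarrow> s"
  then have u: "u \<longlonglongrightarrow> s" by simp
  show "(%n. m (u n)) \<longlonglongrightarrow> m s"
   unfolding m_def
  proof (rule integral_dominated_convergence[where w="%_. R"])
   show "AE x in M. (%n. \<rho>' (u n) x) \<longlonglongrightarrow> \<rho>' s x"
    by (intro AE_I2 continuous_on_tendsto_compose[OF \<rho>'(2) u]) auto
  qed (auto intro: R \<rho>')
 qed
 show "continuous_on {0..T} (%t. integral\<^sup>L M (\<rho> t))"
  using continuous_on_subset[OF mc subset_UNIV] by (rule continuous_on_eq) (simp add: eq)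
 fix t assume t: "t \<in> {0..T}"
 let ?R = "restrict_space lborel {0..t}"
 interpret R: finite_measure ?R by (rule finite_measure_restrict_lborel)
 interpret P: pair_sigma_finite ?R M ..
 have bl: "bounded_linear (lindblad H L)" by (rule bounded_linear_lindblad)
 obtain J where J: "has_stoch_integral_vec M F W (%k s x. diffusion_op (L k) (\<rho>' s x)) t J"
  and Jeq: "AE x in M. \<rho>' t x = \<rho>0 + (LBINT r:{0..t}. lindblad H L (\<rho>' r x)) + J x"
  using sol[OF t] by blast
 obtain Jk where Jk: "!!k. has_stoch_integral M F (%s x. W s x $ k) (%s x. diffusion_op (L k) (\<rho>' s x)) t (Jk k)"
  and Jm: "J \<in> borel_measurable M" and Js: "AE x in M. J x = (\<Sum>k\<in>UNIV. Jk k x)"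
  using J unfolding has_stoch_integral_vec_def by blast
 have Jk0: "integrable M (Jk k)" "expectation (Jk k) = 0" for k
  using scalar_brownian.stoch_integral_mean_zero[OF wiener_scalar_brownian[OF pM filt wien] Jk t] by auto
 have Jkm: "Jk k \<in> borel_measurable M" for k using Jk0(1) by (rule borel_measurable_integrable)
 have J0: "expectation J = 0"
 proof -
  have "expectation J = expectation (%x. \<Sum>k\<in>UNIV. Jk k x)" using Js Jm Jkm by (intro integral_cong_AE) auto
  also have "\<dots> = 0" using Jk0 by simp
  finally show ?thesis .
 qed
 have Ji: "integrable M J"
 proof (rule integrable_cong_AE_imp)
  show "integrable M (%x. \<Sum>k\<in>UNIV. Jk k x)" using Jk0 by simp
 qed (use Jm Js in \<open>auto elim!: eventually_mono\<close>)
 have pi: "integrable (time_space t M) (%(s, x). \<rho>' s x)"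
 proof -
  interpret Q: finite_measure "time_space t M"
   by (rule finite_measure_pair_measure) unfold_locales
  show ?thesis
  proof (rule Q.integrable_const_bound[of _ R])
   show "AE p in time_space t M. norm (case p of (s, x) => \<rho>' s x) <= R"
    by (intro AE_I2) (simp add: case_prod_unfold R(2)[OF \<rho>'(1)])
  qed (rule measurable_time_spaceI[OF \<rho>'(4)])
 qed
 have pil: "integrable (time_space t M) (%(s, x). lindblad H L (\<rho>' s x))"
  using integrable_bounded_linear[OF bl pi] by (simp add: case_prod_unfold)
 have LR: "(LBINT r:{0..t}. f r) = (\<integral>r. f r \<partial>?R)" for f :: "real => complex^'d^'d"
  unfolding set_lebesgue_integral_def by (rule integral_restrict_space[symmetric]) simp
 have si: "integrable M (%x. \<integral>r. lindblad H L (\<rho>' r x) \<partial>?R)" by (rule P.integrable_snd[OF pil])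
 have "m t = expectation (%x. \<rho>0 + (\<integral>r. lindblad H L (\<rho>' r x) \<partial>?R) + J x)"
  unfolding m_def
 proof (rule integral_cong_AE)
  show "AE x in M. \<rho>' t x = \<rho>0 + (\<integral>r. lindblad H L (\<rho>' r x) \<partial>?R) + J x"
   using Jeq by eventually_elim (simp only: LR)
  show "(%x. \<rho>0 + (\<integral>r. lindblad H L (\<rho>' r x) \<partial>?R) + J x) \<in> borel_measurable M"
   by (intro borel_measurable_add borel_measurable_const borel_measurable_integrable[OF si] Jm)
 qed (rule \<rho>')
 also have "\<dots> = \<rho>0 + expectation (%x. \<integral>r. lindblad H L (\<rho>' r x) \<partial>?R)"
  using si Ji J0 by (simp add: prob_space)
 also have "expectation (%x. \<integral>r. lindblad H L (\<rho>' r x) \<partial>?R) = (\<integral>r. expectation (%x. lindblad H L (\<rho>' r x)) \<partial>?R)"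
  by (rule P.Fubini_integral[OF pil])
 also have "\<dots> = (\<integral>r. lindblad H L (m r) \<partial>?R)"
  unfolding m_def by (simp add: integral_bounded_linear[OF bl i'])
 also have "\<dots> = (LBINT r:{0..t}. lindblad H L (m r))" by (rule LR[symmetric])
 also have "\<dots> = integral {0..t} (%r. lindblad H L (m r))"
 proof (rule set_borel_integral_eq_integral(2))
  have "continuous_on {0..t} (%r. lindblad H L (m r))"
   by (rule continuous_on_subset[OF bounded_linear.continuous_on[OF bl mc]]) simp
  then show "set_integrable lborel {0..t} (%r. lindblad H L (m r))" by (rule borel_integrable_atLeastAtMost')
 qed
 also have "\<dots> = integral {0..t} (%s. lindblad H L (integral\<^sup>L M (\<rho> s)))"
  using t by (intro Henstock_Kurzweil_Integration.integral_cong) (simp add: eq)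
 finally show "integral\<^sup>L M (\<rho> t) = \<rho>0 + integral {0..t} (%s. lindblad H L (integral\<^sup>L M (\<rho> s)))"
  using eq[OF t] by simp
qed

section \<open>Regularity of the mean signal\<close>

text \<open>One level of the recursive notion of differentiability up to the boundary, with the derivatives made explicit.\<close>

definition C1_closure :: "'a::euclidean_space set => ('a => 'b::real_normed_vector) => ('a => 'a => 'b) => bool" where
 "C1_closure U f D \<longleftrightarrow> continuous_on (closure U) f \<and>
   (\<forall>x\<in>U. (f has_derivative (%v. \<Sum>b\<in>Basis. (v \<bullet> b) *\<^sub>R D b x)) (at x)) \<and> (\<forall>b\<in>Basis. continuous_on (closure U) (D b))"

lemma Ck_closure_imp_C1: "Ck_closure 2 U f ==> \<exists>D. C1_closure U f D"
 unfolding C1_closure_def by (auto simp: numeral_2_eq_2)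

lemma C1_closure_const: "C1_closure U (%_. c) (%b x. 0)"
 unfolding C1_closure_def by auto

lemma C1_closure_bounded_linear:
 assumes g: "bounded_linear g" and f: "C1_closure U f D"
 shows "C1_closure U (%x. g (f x)) (%b x. g (D b x))"
proof -
 interpret g: bounded_linear g by fact
 have "((%x. g (f x)) has_derivative (%v. \<Sum>b\<in>Basis. (v \<bullet> b) *\<^sub>R g (D b x))) (at x)" if "x \<in> U" for x
 proof -
  have "(f has_derivative (%v. \<Sum>b\<in>Basis. (v \<bullet> b) *\<^sub>R D b x)) (at x)" using f that by (simp add: C1_closure_def)
  from g.has_derivative[OF this] show ?thesis by (simp add: g.sum g.scaleR)
 qed
 then show ?thesis using f g.continuous_on unfolding C1_closure_def by blast
qed

lemma C1_closure_bilinear: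
 assumes p: "bounded_bilinear pr" and f: "C1_closure U f D" and g: "C1_closure U g E"
 shows "C1_closure U (%x. pr (f x) (g x)) (%b x. pr (f x) (E b x) + pr (D b x) (g x))"
proof -
 interpret p: bounded_bilinear pr by fact
 have "((%x. pr (f x) (g x)) has_derivative (%v. \<Sum>b\<in>Basis. (v \<bullet> b) *\<^sub>R (pr (f x) (E b x) + pr (D b x) (g x)))) (at x)" if "x \<in> U" for x
 proof -
  have "(f has_derivative (%v. \<Sum>b\<in>Basis. (v \<bullet> b) *\<^sub>R D b x)) (at x)" "(g has_derivative (%v. \<Sum>b\<in>Basis. (v \<bullet> b) *\<^sub>R E b x)) (at x)"
   using f g that by (simp_all add: C1_closure_def)
  from p.FDERIV[OF this] show ?thesis
   by (simp add: p.sum_right p.sum_left p.scaleR_right p.scaleR_left scaleR_add_right sum.distrib)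
 qed
 then show ?thesis using f g unfolding C1_closure_def by (auto intro!: continuous_on_add p.continuous_on)
qed

lemma C1_closure_add:
 assumes "C1_closure U f D" "C1_closure U g E"
 shows "C1_closure U (%x. f x + g x) (%b x. D b x + E b x)"
 using assms unfolding C1_closure_def
 by (auto intro!: continuous_on_add derivative_eq_intros simp: scaleR_add_right sum.distrib)

lemma C1_closure_diff:
 assumes "C1_closure U f D" "C1_closure U g E"
 shows "C1_closure U (%x. f x - g x) (%b x. D b x - E b x)"
 using C1_closure_add[OF assms(1) C1_closure_bounded_linear[OF bounded_linear_minus[OF bounded_linear_ident] assms(2)]] by simp

lemma C1_closure_sum:
 assumes "finite I" "!!i. i \<in> I ==> \<exists>D. C1_closure U (f i) D"
 shows "\<exists>D. C1_closure U (%x. \<Sum>i\<in>I. f i x) D"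
 using assms
proof (induction I rule: finite_induct)
 case empty
 then show ?case using C1_closure_const[of U 0] by auto
next
 case (insert i I)
 then obtain D E where "C1_closure U (f i) D" "C1_closure U (%x. \<Sum>i\<in>I. f i x) E" by blast
 from C1_closure_add[OF this] insert.hyps show ?case by auto
qed

lemma bounded_bilinear_matrix_mult:
 "bounded_bilinear ((**) :: complex^'d::finite^'d => complex^'d^'d => complex^'d^'d)"
 unfolding bilinear_conv_bounded_bilinear[symmetric] bilinear_def
 using linear_matrix_mult_left linear_matrix_mult_right by blast

definition mult_left_op :: "complex^'d::finite^'d => (complex^'d^'d) \<Rightarrow>\<^sub>L (complex^'d^'d)" where
 "mult_left_op A = Blinfun (%X. A ** X)"

definition mult_right_op :: "complex^'d::finite^'d => (complex^'d^'d) \<Rightarrow>\<^sub>L (complex^'d^'d)" where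
 "mult_right_op B = Blinfun (%X. X ** B)"

lemma mult_left_op_apply: "blinfun_apply (mult_left_op A) X = A ** X"
 unfolding mult_left_op_def by (simp add: bounded_linear_Blinfun_apply bounded_linear_matrix_mult_left)

lemma mult_right_op_apply: "blinfun_apply (mult_right_op B) X = X ** B"
 unfolding mult_right_op_def by (simp add: bounded_linear_Blinfun_apply bounded_linear_matrix_mult_right)

lemma bounded_linear_mult_left_op: "bounded_linear mult_left_op"
proof -
 have "linear mult_left_op"
  by (rule linearI) (auto intro!: blinfun_eqI simp: mult_left_op_apply blinfun.add_left blinfun.scaleR_left
    linear_add[OF linear_matrix_mult_right] linear_scale[OF linear_matrix_mult_right])
 then show ?thesis by (simp add: linear_conv_bounded_linear)
qed

lemma bounded_linear_mult_right_op: "bounded_linear mult_right_op"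
proof -
 have "linear mult_right_op"
  by (rule linearI) (auto intro!: blinfun_eqI simp: mult_right_op_apply blinfun.add_left blinfun.scaleR_left
    linear_add[OF linear_matrix_mult_left] linear_scale[OF linear_matrix_mult_left])
 then show ?thesis by (simp add: linear_conv_bounded_linear)
qed

text \<open>The generator as a bounded operator, built from operators which depend linearly on the matrices, so that its dependence on
the parameter is visible.\<close>

definition lindblad_op :: "complex^'d::finite^'d => ('r::finite => complex^'d^'d) => (complex^'d^'d) \<Rightarrow>\<^sub>L (complex^'d^'d)" where
 "lindblad_op H L = mult_left_op (cscale (- \<i>) H) - mult_right_op (cscale (- \<i>) H) +
   (\<Sum>k\<in>UNIV. (mult_left_op (L k) o\<^sub>L mult_right_op (adj (L k)))
    - (1/2) *\<^sub>R (mult_left_op (adj (L k) ** L k) + mult_right_op (adj (L k) ** L k)))"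

lemma lindblad_op_apply: "blinfun_apply (lindblad_op H L) X = lindblad H L X"
proof -
 have 1: "cscale c A ** X = cscale c (A ** X)" "X ** cscale c A = cscale c (X ** A)" for c and A X :: "complex^'d::finite^'d"
  by (simp_all add: vec_eq_iff cscale_def matrix_matrix_mult_def sum_distrib_left mult_ac)
 have 2: "cscale c (A - B) = cscale c A - cscale c B" for c and A B :: "complex^'d::finite^'d"
  by (rule linear_diff[OF linear_cscale])
 show ?thesis
  unfolding lindblad_op_def lindblad_def
  by (simp add: blinfun.add_left blinfun.diff_left blinfun.sum_left blinfun.scaleR_left mult_left_op_apply mult_right_op_apply
    matrix_mul_assoc 1 2)
qed

lemma C1_closure_lindblad_op:
 assumes H: "\<exists>D. C1_closure U H D" and L: "!!k. \<exists>D. C1_closure U (%\<theta>. L \<theta> k) D"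
 shows "\<exists>D. C1_closure U (%\<theta>. lindblad_op (H \<theta>) (L \<theta>)) D"
proof -
 obtain DH where DH: "C1_closure U H DH" using H by blast
 have bcs: "bounded_linear (cscale c)" for c using linear_cscale by (simp add: linear_conv_bounded_linear)
 have badj: "bounded_linear adj" using linear_adj by (simp add: linear_conv_bounded_linear)
 note cH = C1_closure_bounded_linear[OF bcs[of "- \<i>"] DH]
 note 1 = C1_closure_diff[OF C1_closure_bounded_linear[OF bounded_linear_mult_left_op cH] C1_closure_bounded_linear[OF bounded_linear_mult_right_op cH]]
 have "\<exists>D. C1_closure U (%\<theta>. (mult_left_op (L \<theta> k) o\<^sub>L mult_right_op (adj (L \<theta> k)))
    - (1/2) *\<^sub>R (mult_left_op (adj (L \<theta> k) ** L \<theta> k) + mult_right_op (adj (L \<theta> k) ** L \<theta> k))) D" for k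
 proof -
  obtain DL where DL: "C1_closure U (%\<theta>. L \<theta> k) DL" using L by blast
  note aL = C1_closure_bounded_linear[OF badj DL]
  note LL = C1_closure_bilinear[OF bounded_bilinear_matrix_mult aL DL]
  note c = C1_closure_bilinear[OF bounded_bilinear_blinfun_compose C1_closure_bounded_linear[OF bounded_linear_mult_left_op DL] C1_closure_bounded_linear[OF bounded_linear_mult_right_op aL]]
  note s = C1_closure_bounded_linear[OF bounded_linear_scaleR_right[of "1/2"] C1_closure_add[OF C1_closure_bounded_linear[OF bounded_linear_mult_left_op LL] C1_closure_bounded_linear[OF bounded_linear_mult_right_op LL]]]
  show ?thesis using C1_closure_diff[OF c s] by blast
 qed
 then obtain D2 where 2: "C1_closure U (%\<theta>. \<Sum>k\<in>UNIV. (mult_left_op (L \<theta> k) o\<^sub>L mult_right_op (adj (L \<theta> k)))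
    - (1/2) *\<^sub>R (mult_left_op (adj (L \<theta> k) ** L \<theta> k) + mult_right_op (adj (L \<theta> k) ** L \<theta> k))) D2"
  using C1_closure_sum[of UNIV U "%k \<theta>. (mult_left_op (L \<theta> k) o\<^sub>L mult_right_op (adj (L \<theta> k)))
    - (1/2) *\<^sub>R (mult_left_op (adj (L \<theta> k) ** L \<theta> k) + mult_right_op (adj (L \<theta> k) ** L \<theta> k))"] by auto
 show ?thesis unfolding lindblad_op_def using C1_closure_add[OF 1 2] by blast
qed

lemma C1_closure_bound:
 assumes "C1_closure U f D" "compact (closure U)"
 shows "\<exists>C. C >= 1 \<and> (\<forall>x\<in>closure U. norm (f x) <= C \<and> (\<forall>b\<in>Basis. norm (D b x) <= C))"
proof -
 have "bounded (f ` closure U)" using assms by (auto simp: C1_closure_def intro!: compact_imp_bounded compact_continuous_image)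
 then obtain c where c: "!!x. x \<in> closure U ==> norm (f x) <= c" by (auto simp: bounded_iff)
 have "\<forall>b\<in>Basis. \<exists>d. \<forall>x\<in>closure U. norm (D b x) <= d"
 proof
  fix b :: 'a assume "b \<in> Basis"
  then have "bounded (D b ` closure U)" using assms by (auto simp: C1_closure_def intro!: compact_imp_bounded compact_continuous_image)
  then show "\<exists>d. \<forall>x\<in>closure U. norm (D b x) <= d" by (auto simp: bounded_iff)
 qed
 from bchoice[OF this] obtain d where d: "\<forall>b\<in>Basis. \<forall>x\<in>closure U. norm (D b x) <= d b" ..
 define C where "C = 1 + \<bar>c\<bar> + (\<Sum>b\<in>Basis. \<bar>d b\<bar>)"
 have s: "\<bar>d b\<bar> <= (\<Sum>b\<in>Basis. \<bar>d b\<bar>)" if "b \<in> Basis" for b using that by (intro member_le_sum) auto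
 have s0: "0 <= (\<Sum>b\<in>(Basis :: 'a set). \<bar>d b\<bar>)" by (intro sum_nonneg) auto
 show ?thesis
 proof (intro exI[of _ C] conjI ballI)
  show "C >= 1" using s0 by (simp add: C_def)
  fix x assume x: "x \<in> closure U"
  show "norm (f x) <= C" using c[OF x] s0 unfolding C_def by linarith
  fix b :: 'a assume b: "b \<in> Basis"
  have "norm (D b x) <= d b" using d b x by blast
  then show "norm (D b x) <= C" using s[OF b] unfolding C_def by linarith
 qed
qed

text \<open>The exponential generating series of f.\<close>

definition egs :: "(nat => 'a => real) => real => 'a => real" where
 "egs f t \<theta> = (\<Sum>n. f n \<theta> / fact n * t ^ n)"

text \<open>Geometric growth of the coefficients makes every exponential generating series below converge uniformly on bounded
time intervals.\<close>

definition geometric_on :: "'a set => (nat => 'a => real) => bool" where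
 "geometric_on K f \<longleftrightarrow> (\<exists>G q. G >= 0 \<and> q >= 0 \<and> (\<forall>n. \<forall>\<theta>\<in>K. \<bar>f n \<theta>\<bar> <= G * q ^ n))"

lemma geometric_on_Suc: "geometric_on K f ==> geometric_on K (%n. f (Suc n))"
 unfolding geometric_on_def
proof (elim exE conjE)
 fix G q :: real assume G: "G >= 0" "q >= 0" and f: "\<forall>n. \<forall>\<theta>\<in>K. \<bar>f n \<theta>\<bar> <= G * q ^ n"
 have "\<forall>n. \<forall>\<theta>\<in>K. \<bar>f (Suc n) \<theta>\<bar> <= (G * q) * q ^ n"
  using f by (auto simp: mult.assoc simp flip: power_Suc)
 moreover have "G * q >= 0" using G by simp
 ultimately show "\<exists>G q. G >= 0 \<and> q >= 0 \<and> (\<forall>n. \<forall>\<theta>\<in>K. \<bar>f (Suc n) \<theta>\<bar> <= G * q ^ n)"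
  using G(2) by blast
qed

lemma egs_term_bound:
 fixes t :: real
 assumes "\<bar>c\<bar> <= G * q ^ n" "\<bar>t\<bar> <= T"
 shows "\<bar>c / fact n * t ^ n\<bar> <= G * ((q * T) ^ n / fact n)"
proof -
 have "\<bar>c / fact n * t ^ n\<bar> = \<bar>c\<bar> * \<bar>t\<bar> ^ n / fact n" by (simp add: abs_mult power_abs)
 also have "\<dots> <= (G * q ^ n) * T ^ n / fact n"
  using assms by (intro divide_right_mono mult_mono power_mono) auto
 finally show ?thesis by (simp add: power_mult_distrib)
qed

lemma summable_exp_bound: "summable (%n. G * ((x::real) ^ n / fact n))"
 using summable_exp_generic[of x] by (intro summable_mult) (simp add: divide_inverse mult.commute)

lemma egs_summable:
 assumes "geometric_on K f" "\<theta> \<in> K"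
 shows "summable (%n. f n \<theta> / fact n * t ^ n)"
proof -
 obtain G q where "\<forall>n. \<forall>\<theta>\<in>K. \<bar>f n \<theta>\<bar> <= G * q ^ n" using assms(1) unfolding geometric_on_def by blast
 then show ?thesis
  using assms(2) egs_term_bound[of _ G q _ t "\<bar>t\<bar>"]
  by (intro summable_comparison_test'[OF summable_exp_bound[of G "q * \<bar>t\<bar>"], of 0]) auto
qed

lemma egs_time_derivative:
 assumes f: "geometric_on K f" and \<theta>: "\<theta> \<in> K"
 shows "((%t. egs f t \<theta>) has_vector_derivative egs (%n. f (Suc n)) t \<theta>) (at t within S)"
proof -
 have "((%t. \<Sum>n. (f n \<theta> / fact n) * t ^ n) has_field_derivative (\<Sum>n. diffs (%n. f n \<theta> / fact n) n * t ^ n)) (at t)"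
  by (rule termdiffs_strong_converges_everywhere) (rule egs_summable[OF f \<theta>])
 moreover have "diffs (%n. f n \<theta> / fact n) n = f (Suc n) \<theta> / fact n" for n
  by (simp add: diffs_def divide_simps)
 ultimately show ?thesis
  unfolding egs_def by (simp add: has_real_derivative_iff_has_vector_derivative has_vector_derivative_at_within)
qed

lemma egs_continuous:
 fixes K :: "'a::topological_space set"
 assumes f: "geometric_on K f" and c: "!!n. continuous_on K (f n)"
 shows "continuous_on ({0..T} \<times> K) (%p. egs f (fst p) (snd p))"
proof -
 obtain G q where G: "\<forall>n. \<forall>\<theta>\<in>K. \<bar>f n \<theta>\<bar> <= G * q ^ n" using f unfolding geometric_on_def by blast
 have "uniform_limit ({0..T} \<times> K) (%n p. \<Sum>i<n. f i (snd p) / fact i * fst p ^ i) (%p. \<Sum>i. f i (snd p) / fact i * fst p ^ i) sequentially"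
 proof (rule Weierstrass_m_test)
  show "summable (%n. G * ((q * T) ^ n / fact n))" by (rule summable_exp_bound)
  fix n p assume "p \<in> {0..T} \<times> K"
  then have "\<bar>f n (snd p)\<bar> <= G * q ^ n" "\<bar>fst p\<bar> <= T" using G by auto
  from egs_term_bound[OF this]
  show "norm (f n (snd p) / fact n * fst p ^ n) <= G * ((q * T) ^ n / fact n)" by simp
 qed
 moreover have "continuous_on ({0..T} \<times> K) (%p. \<Sum>i<n. f i (snd p) / fact i * fst p ^ i)" for n
  by (intro continuous_on_sum continuous_on_mult continuous_on_divide continuous_on_power continuous_on_const
    continuous_on_fst continuous_on_id continuous_on_compose2[OF c continuous_on_snd[OF continuous_on_id]]) auto
 ultimately show ?thesis
  unfolding egs_def by (intro uniform_limit_theorem[OF always_eventually]) auto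
qed

text \<open>Differentiation term by term, justified by the uniform convergence of the differentiated series.\<close>

lemma egs_parameter_derivative:
 fixes U :: "'a::euclidean_space set"
 assumes U: "open U" "convex U" and f: "geometric_on U f"
  and D: "!!b. b \<in> Basis ==> geometric_on U (%n. D n b)"
  and der: "!!n x. x \<in> U ==> (f n has_derivative (%v. \<Sum>b\<in>Basis. (v \<bullet> b) *\<^sub>R D n b x)) (at x)" and x: "x \<in> U"
 shows "(egs f t has_derivative (%v. \<Sum>b\<in>Basis. (v \<bullet> b) *\<^sub>R egs (%n. D n b) t x)) (at x)"
proof -
 have "\<forall>b\<in>Basis. \<exists>G q. \<forall>n. \<forall>\<theta>\<in>U. \<bar>D n b \<theta>\<bar> <= G * q ^ n" using D unfolding geometric_on_def by blast
 from bchoice[OF this] obtain G where "\<forall>b\<in>Basis. \<exists>q. \<forall>n. \<forall>\<theta>\<in>U. \<bar>D n b \<theta>\<bar> <= G b * q ^ n" ..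
 from bchoice[OF this] obtain q where q: "\<forall>b\<in>Basis. \<forall>n. \<forall>\<theta>\<in>U. \<bar>D n b \<theta>\<bar> <= G b * q b ^ n" ..
 have ul: "uniform_limit U (%n y. \<Sum>i<n. D i b y / fact i * t ^ i) (%y. \<Sum>i. D i b y / fact i * t ^ i) sequentially" if "b \<in> Basis" for b
 proof (rule Weierstrass_m_test)
  show "summable (%n. G b * ((q b * \<bar>t\<bar>) ^ n / fact n))" by (rule summable_exp_bound)
  fix n y assume "y \<in> U"
  then have "\<bar>D n b y\<bar> <= G b * q b ^ n" using q that by blast
  from egs_term_bound[OF this order_refl]
  show "norm (D n b y / fact n * t ^ n) <= G b * ((q b * \<bar>t\<bar>) ^ n / fact n)" by simp
 qed
 have "\<exists>g. \<forall>y\<in>U. (%n. f n y / fact n * t ^ n) sums (g y) \<and> (g has_derivative (%v. \<Sum>b\<in>Basis. (v \<bullet> b) *\<^sub>R egs (%n. D n b) t y)) (at y within U)"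
 proof (rule has_derivative_series[OF U(2) _ _ x])
  show "(%n. f n x / fact n * t ^ n) sums egs f t x" unfolding egs_def by (rule summable_sums[OF egs_summable[OF f x]])
  show "((%y. f n y / fact n * t ^ n) has_derivative (%v. \<Sum>b\<in>Basis. (v \<bullet> b) *\<^sub>R (D n b y / fact n * t ^ n))) (at y within U)" if "y \<in> U" for n y
  proof -
   have d: "((%y. f n y * (t ^ n / fact n)) has_derivative (%v. (\<Sum>b\<in>Basis. (v \<bullet> b) *\<^sub>R D n b y) * (t ^ n / fact n))) (at y)"
    by (rule has_derivative_mult_left[OF der[OF that]])
   have e1: "(%y. f n y * (t ^ n / fact n)) = (%y. f n y / fact n * t ^ n)" by (intro ext) simp
   have e2: "(%v. (\<Sum>b\<in>Basis. (v \<bullet> b) *\<^sub>R D n b y) * (t ^ n / fact n)) = (%v. \<Sum>b\<in>Basis. (v \<bullet> b) *\<^sub>R (D n b y / fact n * t ^ n))"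
    unfolding sum_distrib_right by (intro ext sum.cong refl) simp
   show ?thesis by (rule has_derivative_at_withinI) (rule d[unfolded e1 e2])
  qed
  fix e :: real assume e: "e > 0"
  define e' where "e' = e / (1 + real DIM('a))"
  have e': "e' > 0" unfolding e'_def using e by simp
  have "eventually (%n. \<forall>b\<in>Basis. \<forall>y\<in>U. dist (\<Sum>i<n. D i b y / fact i * t ^ i) (\<Sum>i. D i b y / fact i * t ^ i) < e') sequentially"
  proof (rule eventually_ball_finite[OF finite_Basis], rule ballI)
   fix b :: 'a assume "b \<in> Basis"
   from ul[OF this] e'
   show "eventually (%n. \<forall>y\<in>U. dist (\<Sum>i<n. D i b y / fact i * t ^ i) (\<Sum>i. D i b y / fact i * t ^ i) < e') sequentially"
    unfolding uniform_limit_iff by blast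
  qed
  then show "\<forall>\<^sub>F n in sequentially. \<forall>y\<in>U. \<forall>v. norm ((\<Sum>i<n. \<Sum>b\<in>Basis. (v \<bullet> b) *\<^sub>R (D i b y / fact i * t ^ i)) - (\<Sum>b\<in>Basis. (v \<bullet> b) *\<^sub>R egs (%n. D n b) t y)) <= e * norm v"
  proof eventually_elim
   case (elim n)
   show ?case
   proof (intro ballI allI)
    fix y and v :: 'a assume y: "y \<in> U"
    have "(\<Sum>i<n. \<Sum>b\<in>Basis. (v \<bullet> b) *\<^sub>R (D i b y / fact i * t ^ i)) = (\<Sum>b\<in>Basis. (v \<bullet> b) *\<^sub>R (\<Sum>i<n. D i b y / fact i * t ^ i))"
     by (subst sum.swap) (simp only: scaleR_sum_right)
    then have "norm ((\<Sum>i<n. \<Sum>b\<in>Basis. (v \<bullet> b) *\<^sub>R (D i b y / fact i * t ^ i)) - (\<Sum>b\<in>Basis. (v \<bullet> b) *\<^sub>R egs (%n. D n b) t y))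
     = norm (\<Sum>b\<in>Basis. (v \<bullet> b) *\<^sub>R ((\<Sum>i<n. D i b y / fact i * t ^ i) - egs (%n. D n b) t y))"
     by (simp only: sum_subtractf scaleR_diff_right)
    also have "\<dots> <= (\<Sum>b\<in>(Basis :: 'a set). norm v * e')"
    proof (rule sum_norm_le)
     fix b :: 'a assume b: "b \<in> Basis"
     have "\<bar>(\<Sum>i<n. D i b y / fact i * t ^ i) - egs (%n. D n b) t y\<bar> <= e'"
      using elim b y unfolding egs_def dist_real_def by (meson less_imp_le)
     then show "norm ((v \<bullet> b) *\<^sub>R ((\<Sum>i<n. D i b y / fact i * t ^ i) - egs (%n. D n b) t y)) <= norm v * e'"
      unfolding norm_scaleR using Basis_le_norm[OF b, of v] by (intro mult_mono) auto
    qed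
    also have "\<dots> = norm v * (real DIM('a) * e')" by simp
    also have "\<dots> <= norm v * e" unfolding e'_def using e by (intro mult_left_mono) (auto simp: field_simps)
    finally show "norm ((\<Sum>i<n. \<Sum>b\<in>Basis. (v \<bullet> b) *\<^sub>R (D i b y / fact i * t ^ i)) - (\<Sum>b\<in>Basis. (v \<bullet> b) *\<^sub>R egs (%n. D n b) t y)) <= e * norm v"
     by (simp add: mult.commute)
   qed
  qed
 qed
 then obtain g where g: "!!y. y \<in> U ==> (%n. f n y / fact n * t ^ n) sums (g y)"
  "!!y. y \<in> U ==> (g has_derivative (%v. \<Sum>b\<in>Basis. (v \<bullet> b) *\<^sub>R egs (%n. D n b) t y)) (at y within U)" by blast
 have ge: "g y = egs f t y" if "y \<in> U" for y unfolding egs_def using g(1)[OF that] by (rule sums_unique)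
 have "(g has_derivative (%v. \<Sum>b\<in>Basis. (v \<bullet> b) *\<^sub>R egs (%n. D n b) t x)) (at x)"
  using g(2)[OF x] at_within_open[OF x U(1)] by simp
 then show ?thesis by (rule has_derivative_transform_within_open[OF _ U(1) x]) (rule ge)
qed

text \<open>Picard iteration of the integral equation: after n steps the remainder is at most a constant times
(norm S * t)^n / n!.\<close>

lemma linear_integral_equation_series:
 fixes S :: "'b::euclidean_space \<Rightarrow>\<^sub>L 'b"
 assumes m: "continuous_on {0..T} m" and eq: "!!t. t \<in> {0..T} ==> m t = v0 + integral {0..t} (%s. blinfun_apply S (m s))"
  and v: "v 0 = v0" "!!n. v (Suc n) = blinfun_apply S (v n)" and t: "t \<in> {0..T}"
 shows "(%n. (t ^ n / fact n) *\<^sub>R v n) sums m t"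
proof -
 obtain R where R: "!!s. s \<in> {0..T} ==> norm (m s) <= R"
 proof -
  have "bounded (m ` {0..T})" by (intro compact_imp_bounded compact_continuous_image m compact_Icc)
  then obtain R where "\<forall>y\<in>m ` {0..T}. norm y <= R" by (auto simp: bounded_iff)
  then show thesis using that by blast
 qed
 have R0: "R >= 0" using R[OF t] norm_ge_zero order_trans by blast
 let ?p = "%n t. \<Sum>i<n. (t ^ i / fact i) *\<^sub>R v i"
 have err: "t \<in> {0..T} ==> norm (m t - ?p n t) <= R * ((norm S * t) ^ n / fact n)" for n t
 proof (induction n arbitrary: t)
  case 0
  then show ?case using R by simp
 next
  case (Suc n)
  have t: "0 <= t" "{0..t} \<subseteq> {0..T}" using Suc.prems by auto
  have ci: "((%s. s ^ i / fact i) has_integral t ^ Suc i / fact (Suc i)) {0..t}" for i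
  proof -
   have "((%s. s ^ i / fact i) has_integral (t ^ Suc i / fact (Suc i) - 0 ^ Suc i / fact (Suc i))) {0..t}"
   proof (rule fundamental_theorem_of_calculus[OF t(1)])
    fix s assume "s \<in> {0..t}"
    have "((%s. s ^ Suc i / fact (Suc i)) has_real_derivative (real (Suc i) * s ^ i) / fact (Suc i)) (at s within {0..t})"
     by (intro DERIV_cdivide) (use DERIV_power[OF DERIV_ident, of "Suc i" s "{0..t}"] in simp)
    also have "(real (Suc i) * s ^ i) / fact (Suc i) = s ^ i / fact i" by (simp add: divide_simps)
    finally show "((%s. s ^ Suc i / fact (Suc i)) has_vector_derivative s ^ i / fact i) (at s within {0..t})"
     by (simp add: has_real_derivative_iff_has_vector_derivative)
   qed
   then show ?thesis by simp
  qed
  have pS: "((%s. blinfun_apply S (?p n s)) has_integral (?p (Suc n) t - v0)) {0..t}"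
  proof -
   have "((%s. \<Sum>i<n. (s ^ i / fact i) *\<^sub>R v (Suc i)) has_integral (\<Sum>i<n. (t ^ Suc i / fact (Suc i)) *\<^sub>R v (Suc i))) {0..t}"
    by (intro has_integral_sum has_integral_scaleR_left ci) auto
   moreover have "(\<Sum>i<n. (t ^ Suc i / fact (Suc i)) *\<^sub>R v (Suc i)) = ?p (Suc n) t - v0"
    by (subst sum.lessThan_Suc_shift) (simp add: v(1) del: power_Suc fact_Suc)
   ultimately show ?thesis by (simp add: blinfun.sum_right blinfun.scaleR_right v(2) del: power_Suc fact_Suc sum.lessThan_Suc)
  qed
  have mS: "continuous_on {0..t} (%s. blinfun_apply S (m s))"
   by (intro continuous_intros continuous_on_subset[OF m t(2)])
  have "m t - ?p (Suc n) t = integral {0..t} (%s. blinfun_apply S (m s)) - integral {0..t} (%s. blinfun_apply S (?p n s))"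
   using eq[OF Suc.prems] integral_unique[OF pS] by (simp del: sum.lessThan_Suc)
  also have "\<dots> = integral {0..t} (%s. blinfun_apply S (m s - ?p n s))"
   by (subst Henstock_Kurzweil_Integration.integral_diff[symmetric, OF integrable_continuous_real[OF mS] has_integral_integrable[OF pS]])
    (simp add: blinfun.diff_right)
  also have "norm \<dots> <= integral {0..t} (%s. norm S * (R * ((norm S * s) ^ n / fact n)))"
  proof (rule integral_norm_bound_integral)
   show "(%s. blinfun_apply S (m s - ?p n s)) integrable_on {0..t}"
    by (intro integrable_continuous_real continuous_intros continuous_on_subset[OF m t(2)]) auto
   show "(%s. norm S * (R * ((norm S * s) ^ n / fact n))) integrable_on {0..t}"
    by (intro integrable_continuous_real continuous_intros) auto
   fix s assume "s \<in> {0..t}"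
   then have "norm (m s - ?p n s) <= R * ((norm S * s) ^ n / fact n)" using t by (intro Suc.IH) auto
   then show "norm (blinfun_apply S (m s - ?p n s)) <= norm S * (R * ((norm S * s) ^ n / fact n))"
    using norm_blinfun[of S "m s - ?p n s"] mult_left_mono[OF _ norm_ge_zero[of S]] order_trans by blast
  qed
  also have "\<dots> = (norm S * R * norm S ^ n) * (t ^ Suc n / fact (Suc n))"
  proof -
   have "((%s. (norm S * R * norm S ^ n) * (s ^ n / fact n)) has_integral (norm S * R * norm S ^ n) * (t ^ Suc n / fact (Suc n))) {0..t}"
    by (rule has_integral_mult_right[OF ci])
   then show ?thesis by (intro integral_unique) (simp add: power_mult_distrib mult_ac)
  qed
  also have "\<dots> = R * ((norm S * t) ^ Suc n / fact (Suc n))"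
   by (simp only: power_mult_distrib power_Suc times_divide_eq_right) (simp only: mult_ac)
  finally show ?case .
 qed
 have "(%n. ?p n t) \<longlonglongrightarrow> m t"
 proof (rule LIM_zero_cancel, rule Lim_null_comparison)
  show "\<forall>\<^sub>F n in sequentially. norm (?p n t - m t) <= R * ((norm S * t) ^ n / fact n)"
   using err[OF t] by (intro always_eventually allI) (simp add: norm_minus_commute)
  show "(%n. R * ((norm S * t) ^ n / fact n)) \<longlonglongrightarrow> 0"
   by (rule summable_LIMSEQ_zero[OF summable_exp_bound])
 qed
 then show ?thesis by (simp add: sums_def)
qed

definition time_C1 :: "real => 'a::topological_space set => (real => 'a => 'b::real_normed_vector) => (real => 'a => 'b) => bool" where
 "time_C1 T K g g' \<longleftrightarrow> continuous_on ({0..T} \<times> K) (%p. g (fst p) (snd p)) \<and>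
   continuous_on ({0..T} \<times> K) (%p. g' (fst p) (snd p)) \<and>
   (\<forall>\<theta>\<in>K. \<forall>t\<in>{0..T}. ((%t. g t \<theta>) has_vector_derivative g' t \<theta>) (at t within {0..T}))"

lemma time_C1_egs:
 assumes "geometric_on K f" "!!n. continuous_on K (f n)"
 shows "time_C1 T K (egs f) (egs (%n. f (Suc n)))"
 unfolding time_C1_def
 using egs_continuous[OF assms] egs_continuous[OF geometric_on_Suc[OF assms(1)] assms(2)] egs_time_derivative[OF assms(1)] by blast

lemma time_C1_cong:
 assumes "time_C1 T K f g'" "!!t \<theta>. t \<in> {0..T} ==> \<theta> \<in> K ==> g t \<theta> = f t \<theta>"
 shows "time_C1 T K g g'"
 unfolding time_C1_def
proof (intro conjI ballI)
 have "continuous_on ({0..T} \<times> K) (%p. f (fst p) (snd p))" using assms(1) unfolding time_C1_def by blast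
 then show "continuous_on ({0..T} \<times> K) (%p. g (fst p) (snd p))"
  by (rule continuous_on_eq) (use assms(2) in auto)
 show "continuous_on ({0..T} \<times> K) (%p. g' (fst p) (snd p))" using assms(1) unfolding time_C1_def by blast
 fix \<theta> t assume \<theta>: "\<theta> \<in> K" and t: "t \<in> {0..T}"
 have "((%t. f t \<theta>) has_vector_derivative g' t \<theta>) (at t within {0..T})" using assms(1) \<theta> t unfolding time_C1_def by blast
 then show "((%t. g t \<theta>) has_vector_derivative g' t \<theta>) (at t within {0..T})"
  by (rule has_vector_derivative_transform[OF t, rotated]) (rule assms(2)[OF _ \<theta>])
qed

lemma time_C1_bounded_linear:
 assumes "bounded_linear l" "time_C1 T K g g'"
 shows "time_C1 T K (%t \<theta>. l (g t \<theta>)) (%t \<theta>. l (g' t \<theta>))"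
 using assms bounded_linear.continuous_on[OF assms(1)] bounded_linear.has_vector_derivative[OF assms(1)]
 unfolding time_C1_def by blast

lemma time_C1_sum:
 assumes "finite I" "!!i. i \<in> I ==> time_C1 T K (g i) (g' i)"
 shows "time_C1 T K (%t \<theta>. \<Sum>i\<in>I. g i t \<theta>) (%t \<theta>. \<Sum>i\<in>I. g' i t \<theta>)"
 using assms(2) unfolding time_C1_def
 by (intro conjI ballI continuous_on_sum has_vector_derivative_sum) blast+

lemma vec_lambda_eq_sum_axis: "(\<chi> j. f j) = (\<Sum>j\<in>UNIV. f j *\<^sub>R axis j (1::real))"
 using basis_expansion[of "\<chi> j. f j"] by (simp add: scalar_mult_eq_scaleR)

lemma time_C1_vec:
 fixes g g' :: "'n::finite => real => 'a::topological_space => real"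
 assumes "!!j. time_C1 T K (g j) (g' j)"
 shows "time_C1 T K (%t \<theta>. \<chi> j. g j t \<theta>) (%t \<theta>. \<chi> j. g' j t \<theta>)"
 unfolding vec_lambda_eq_sum_axis
 by (intro time_C1_sum time_C1_bounded_linear[OF bounded_linear_scaleR_left] assms finite_class.finite_UNIV)

text \<open>The coefficients of the power series in time of the mean state: the powers of the generator applied to the initial state.\<close>

primrec orbit :: "('a => 'b::real_normed_vector \<Rightarrow>\<^sub>L 'b) => 'b => nat => 'a => 'b" where
 "orbit S v0 0 \<theta> = v0"
| "orbit S v0 (Suc n) \<theta> = blinfun_apply (S \<theta>) (orbit S v0 n \<theta>)"

primrec orbit_deriv :: "('a => 'b::real_normed_vector \<Rightarrow>\<^sub>L 'b) => ('a => 'a => 'b \<Rightarrow>\<^sub>L 'b) => 'b => nat => 'a => 'a => 'b" where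
 "orbit_deriv S D v0 0 b \<theta> = 0"
| "orbit_deriv S D v0 (Suc n) b \<theta> = blinfun_apply (S \<theta>) (orbit_deriv S D v0 n b \<theta>) + blinfun_apply (D b \<theta>) (orbit S v0 n \<theta>)"

lemma C1_closure_orbit:
 assumes "C1_closure U S D"
 shows "C1_closure U (orbit S v0 n) (orbit_deriv S D v0 n)"
proof (induction n)
 case 0
 have "orbit S v0 0 = (%_. v0)" "orbit_deriv S D v0 0 = (%_ _. 0)" by (simp_all add: fun_eq_iff)
 then show ?case using C1_closure_const[of U v0] by simp
next
 case (Suc n)
 have "orbit S v0 (Suc n) = (%\<theta>. blinfun_apply (S \<theta>) (orbit S v0 n \<theta>))"
  "orbit_deriv S D v0 (Suc n) = (%b \<theta>. blinfun_apply (S \<theta>) (orbit_deriv S D v0 n b \<theta>) + blinfun_apply (D b \<theta>) (orbit S v0 n \<theta>))"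
  by (simp_all add: fun_eq_iff)
 then show ?case using C1_closure_bilinear[OF bounded_bilinear_blinfun_apply assms Suc.IH] by simp
qed

text \<open>The product rule produces n terms at step n. The base 2 C instead of C absorbs this factor in the induction.\<close>

lemma orbit_bounds:
 fixes S :: "'a => 'b::real_normed_vector \<Rightarrow>\<^sub>L 'b"
 assumes C: "C >= 1" "norm (S \<theta>) <= C" "norm (D b \<theta>) <= C"
 shows "norm (orbit S v0 n \<theta>) <= norm v0 * (2 * C) ^ n" "norm (orbit_deriv S D v0 n b \<theta>) <= norm v0 * (2 * C) ^ n"
proof -
 have C0: "C >= 0" using C by simp
 have "norm (orbit S v0 n \<theta>) <= norm v0 * (2 * C) ^ n \<and> norm (orbit_deriv S D v0 n b \<theta>) <= norm v0 * (2 * C) ^ n"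
 proof (induction n)
  case (Suc n)
  let ?B = "norm v0 * (2 * C) ^ n"
  have B0: "?B >= 0" using C0 by simp
  have a: "norm (blinfun_apply A u) <= C * ?B" if "norm A <= C" "norm u <= ?B" for A :: "'b \<Rightarrow>\<^sub>L 'b" and u
   by (rule order_trans[OF norm_blinfun]) (intro mult_mono that C0 norm_ge_zero)
  have "norm (orbit S v0 (Suc n) \<theta>) <= C * ?B" unfolding orbit.simps using Suc by (intro a C) auto
  moreover have "norm (orbit_deriv S D v0 (Suc n) b \<theta>) <= C * ?B + C * ?B"
   unfolding orbit_deriv.simps using Suc by (intro norm_triangle_mono a C) auto
  moreover have "norm v0 * (2 * C) ^ Suc n = C * ?B + C * ?B" by simp
  moreover have "0 <= C * ?B" using C0 B0 by (rule mult_nonneg_nonneg)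
  ultimately show ?case by linarith
 qed simp
 then show "norm (orbit S v0 n \<theta>) <= norm v0 * (2 * C) ^ n" "norm (orbit_deriv S D v0 n b \<theta>) <= norm v0 * (2 * C) ^ n" by auto
qed

text \<open>The mean state is the exponential of the generator applied to the initial state. Expanding it in time
separates the variables: every coefficient is differentiable in the parameter, with geometric bounds on the
coefficients and on their derivatives.\<close>

lemma mean_signal_series:
 fixes H :: "'a::euclidean_space => complex^'d::finite^'d" and L :: "'a => 'r::finite => complex^'d^'d"
 assumes cl: "compact (closure U)"
  and H: "\<exists>D. C1_closure U H D" and L: "!!k. \<exists>D. C1_closure U (%\<theta>. L \<theta> k) D"
  and mc: "!!\<theta>. \<theta> \<in> closure U ==> continuous_on {0..T} (m \<theta>)"
  and meq: "!!\<theta> t. \<theta> \<in> closure U ==> t \<in> {0..T} ==> m \<theta> t = \<rho>0 + integral {0..t} (%s. lindblad (H \<theta>) (L \<theta>) (m \<theta> s))"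
 shows "\<exists>c D. (\<forall>n. C1_closure U (c n) (D n)) \<and> geometric_on (closure U) c \<and> (\<forall>b\<in>Basis. geometric_on (closure U) (%n. D n b)) \<and>
   (\<forall>\<theta>\<in>closure U. \<forall>t\<in>{0..T}. b_form (L \<theta> k) (m \<theta> t) = egs c t \<theta>)"
proof -
 define S where "S \<theta> = lindblad_op (H \<theta>) (L \<theta>)" for \<theta>
 obtain DS where DS: "C1_closure U S DS" using C1_closure_lindblad_op[of U H L, OF H L] unfolding S_def by blast
 obtain DL where DL: "C1_closure U (%\<theta>. L \<theta> k) DL" using L by blast
 obtain C where C: "C >= 1" "!!\<theta>. \<theta> \<in> closure U ==> norm (S \<theta>) <= C" "!!\<theta> b. \<theta> \<in> closure U ==> b \<in> Basis ==> norm (DS b \<theta>) <= C"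
  using C1_closure_bound[OF DS cl] by blast
 obtain C' where C': "C' >= 1" "!!\<theta>. \<theta> \<in> closure U ==> norm (L \<theta> k) <= C'" "!!\<theta> b. \<theta> \<in> closure U ==> b \<in> Basis ==> norm (DL b \<theta>) <= C'"
  using C1_closure_bound[OF DL cl] by blast
 interpret b: bounded_bilinear "b_form :: complex^'d^'d => _" by (rule bounded_bilinear_b_form)
 obtain B where B: "B >= 0" "!!a b :: complex^'d^'d. norm (b_form a b) <= norm a * norm b * B" using b.nonneg_bounded by blast
 define v where "v = orbit S \<rho>0"
 define Dv where "Dv = orbit_deriv S DS \<rho>0"
 define c where "c n \<theta> = b_form (L \<theta> k) (v n \<theta>)" for n \<theta>
 define D where "D n b \<theta> = b_form (L \<theta> k) (Dv n b \<theta>) + b_form (DL b \<theta>) (v n \<theta>)" for n b \<theta>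
 define G where "G = C' * norm \<rho>0 * B"
 have G0: "G >= 0" unfolding G_def using C'(1) B(1) by simp
 have q0: "2 * C >= 0" using C(1) by simp
 have b1: "norm (v n \<theta>) <= norm \<rho>0 * (2 * C) ^ n" "b \<in> Basis ==> norm (Dv n b \<theta>) <= norm \<rho>0 * (2 * C) ^ n" if "\<theta> \<in> closure U" for n \<theta> b
 proof -
  obtain b0 :: 'a where b0: "b0 \<in> Basis" using nonempty_Basis by blast
  show "norm (v n \<theta>) <= norm \<rho>0 * (2 * C) ^ n" unfolding v_def by (rule orbit_bounds(1)[of C S \<theta> DS b0, OF C(1) C(2)[OF that] C(3)[OF that b0]])
  show "norm (Dv n b \<theta>) <= norm \<rho>0 * (2 * C) ^ n" if "b \<in> Basis"
   unfolding Dv_def by (rule orbit_bounds(2)[of C S \<theta> DS b, OF C(1) C(2)[OF \<open>\<theta> \<in> closure U\<close>] C(3)[OF \<open>\<theta> \<in> closure U\<close> that]])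
 qed
 have bb: "\<bar>b_form A w\<bar> <= G * (2 * C) ^ n" if "norm A <= C'" "norm w <= norm \<rho>0 * (2 * C) ^ n" for A w :: "complex^'d^'d" and n
 proof -
  have "\<bar>b_form A w\<bar> <= norm A * norm w * B" using B(2)[of A w] by simp
  also have "\<dots> <= C' * (norm \<rho>0 * (2 * C) ^ n) * B" using that C'(1) B(1) q0 by (intro mult_mono mult_nonneg_nonneg) auto
  finally show ?thesis unfolding G_def by (simp add: mult_ac)
 qed
 show ?thesis
 proof (intro exI[of _ c] exI[of _ D] conjI allI ballI)
  show "C1_closure U (c n) (D n)" for n
   using C1_closure_bilinear[OF bounded_bilinear_b_form DL C1_closure_orbit[OF DS, of \<rho>0 n]]
   unfolding c_def[abs_def] D_def[abs_def] v_def Dv_def .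
  show "geometric_on (closure U) c"
   unfolding geometric_on_def c_def
   by (intro exI[of _ G] exI[of _ "2 * C"] conjI allI ballI G0 q0 bb C'(2) b1)
  show "geometric_on (closure U) (%n. D n b)" if b: "b \<in> Basis" for b
   unfolding geometric_on_def
  proof (rule exI[of _ "2 * G"], rule exI[of _ "2 * C"], intro conjI allI ballI)
   fix n \<theta> assume \<theta>: "\<theta> \<in> closure U"
   have "\<bar>b_form (L \<theta> k) (Dv n b \<theta>)\<bar> <= G * (2 * C) ^ n"
    by (rule bb[OF C'(2)[OF \<theta>] b1(2)[OF \<theta> b]])
   moreover have "\<bar>b_form (DL b \<theta>) (v n \<theta>)\<bar> <= G * (2 * C) ^ n"
    by (rule bb[OF C'(3)[OF \<theta> b] b1(1)[OF \<theta>]])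
   ultimately show "\<bar>D n b \<theta>\<bar> <= 2 * G * (2 * C) ^ n" unfolding D_def by linarith
  qed (use G0 q0 in auto)
  fix \<theta> t assume \<theta>: "\<theta> \<in> closure U" and t: "t \<in> {0..T}"
  have "(%n. (t ^ n / fact n) *\<^sub>R v n \<theta>) sums m \<theta> t"
  proof (rule linear_integral_equation_series[OF mc[OF \<theta>] _ _ _ t])
   show "m \<theta> t = \<rho>0 + integral {0..t} (%s. blinfun_apply (S \<theta>) (m \<theta> s))" if "t \<in> {0..T}" for t
    unfolding S_def lindblad_op_apply by (rule meq[OF \<theta> that])
  qed (simp_all add: v_def)
  from bounded_linear.sums[OF b.bounded_linear_right[of "L \<theta> k"] this]
  have "(%n. c n \<theta> / fact n * t ^ n) sums b_form (L \<theta> k) (m \<theta> t)"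
   by (simp add: c_def b.scaleR_right mult.commute)
  then show "b_form (L \<theta> k) (m \<theta> t) = egs c t \<theta>" unfolding egs_def by (rule sums_unique)
 qed
qed

lemma C1_closureD:
 assumes "C1_closure U f D"
 shows "continuous_on (closure U) f" "x \<in> U ==> (f has_derivative (%v. \<Sum>b\<in>Basis. (v \<bullet> b) *\<^sub>R D b x)) (at x)"
  "b \<in> Basis ==> continuous_on (closure U) (D b)"
 using assms unfolding C1_closure_def by auto

lemma geometric_on_subset: "geometric_on K f ==> K' \<subseteq> K ==> geometric_on K' f"
 unfolding geometric_on_def by blast

text \<open>In the interior the series is differentiated term by term. On the boundary the gradient is defined as a limit from the
interior, and the series of derivatives is continuous up to the boundary.\<close>

lemma grad_closure_series:
 fixes h :: "real^'p::finite => real^'r::finite"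
 assumes U: "open U" "convex U"
  and c: "!!n. C1_closure U (c n) (D n)" "geometric_on (closure U) c" "!!b. b \<in> Basis ==> geometric_on (closure U) (%n. D n b)"
  and h: "!!\<theta>. \<theta> \<in> closure U ==> h \<theta> $ k = egs c t \<theta>" and t: "t >= 0" and \<theta>: "\<theta> \<in> closure U"
 shows "grad_closure U h \<theta> $ j $ k = egs (%n. D n (axis j 1)) t \<theta>"
proof -
 have ax: "axis j 1 \<in> (Basis :: (real^'p) set)" by simp
 have UU: "U \<subseteq> closure U" by (rule closure_subset)
 have pd: "partial_deriv j (%\<theta>'. h \<theta>' $ k) x = egs (%n. D n (axis j 1)) t x" if x: "x \<in> U" for x
 proof -
  have "(egs c t has_derivative (%v. \<Sum>b\<in>Basis. (v \<bullet> b) *\<^sub>R egs (%n. D n b) t x)) (at x)"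
   by (rule egs_parameter_derivative[OF U geometric_on_subset[OF c(2) UU] geometric_on_subset[OF c(3) UU] C1_closureD(2)[OF c(1)] x])
  then have "((%\<theta>'. h \<theta>' $ k) has_derivative (%v. \<Sum>b\<in>Basis. (v \<bullet> b) *\<^sub>R egs (%n. D n b) t x)) (at x)"
   by (rule has_derivative_transform_within_open[OF _ U(1) x]) (use h UU in auto)
  then have "frechet_derivative (%\<theta>'. h \<theta>' $ k) (at x) = (%v. \<Sum>b\<in>Basis. (v \<bullet> b) *\<^sub>R egs (%n. D n b) t x)"
   by (rule frechet_derivative_at[symmetric])
  then have "partial_deriv j (%\<theta>'. h \<theta>' $ k) x = (\<Sum>b\<in>Basis. (axis j 1 \<bullet> b) *\<^sub>R egs (%n. D n b) t x)"
   unfolding partial_deriv_def by simp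
  also have "\<dots> = (\<Sum>b\<in>(Basis :: (real^'p) set). if b = axis j 1 then egs (%n. D n (axis j 1)) t x else 0)"
   by (intro sum.cong refl) (auto simp: inner_Basis[OF ax])
  also have "\<dots> = egs (%n. D n (axis j 1)) t x" using ax by simp
  finally show ?thesis .
 qed
 show ?thesis
 proof (cases "\<theta> \<in> U")
  case True
  then show ?thesis by (simp add: grad_closure_def pd)
 next
  case False
  have "continuous_on (closure U) (%x. egs (%n. D n (axis j 1)) t x)"
  proof -
   have p: "continuous_on (closure U) (%x. (t, x))" by (intro continuous_intros)
   have "(%x. (t, x)) ` closure U \<subseteq> {0..t} \<times> closure U" using t by auto
   from continuous_on_compose2[OF egs_continuous[OF c(3)[OF ax] C1_closureD(3)[OF c(1) ax], of t] p this]
   show ?thesis by simp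
  qed
  then have "((%x. egs (%n. D n (axis j 1)) t x) \<longlongrightarrow> egs (%n. D n (axis j 1)) t \<theta>) (at \<theta> within U)"
   using \<theta> UU unfolding continuous_on_def by (blast intro: tendsto_within_subset)
  then have "((partial_deriv j (%\<theta>'. h \<theta>' $ k)) \<longlongrightarrow> egs (%n. D n (axis j 1)) t \<theta>) (at \<theta> within U)"
   by (rule Lim_transform_eventually) (auto simp: eventually_at_filter pd)
  moreover have "\<not> trivial_limit (at \<theta> within U)"
   using \<theta> False unfolding trivial_limit_within closure_def by blast
  ultimately have "Lim (at \<theta> within U) (partial_deriv j (%\<theta>'. h \<theta>' $ k)) = egs (%n. D n (axis j 1)) t \<theta>"
   by (intro tendsto_Lim)
  then show ?thesis using False by (simp add: grad_closure_def)
 qed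
qed

text \<open>Differentiating the power series in time again gives a series of the same kind. This provides the time derivatives that
integration by parts along a record needs.\<close>

lemma mean_signal_time_C1:
 fixes H :: "real^'p::finite => complex^'d::finite^'d" and L :: "real^'p => 'r::finite => complex^'d^'d"
  and h :: "real => real^'p => real^'r"
 assumes U: "open U" "convex U" "bounded U"
  and H: "\<exists>D. C1_closure U H D" and L: "!!k. \<exists>D. C1_closure U (%\<theta>. L \<theta> k) D"
  and mc: "!!\<theta>. \<theta> \<in> closure U ==> continuous_on {0..T} (m \<theta>)"
  and meq: "!!\<theta> t. \<theta> \<in> closure U ==> t \<in> {0..T} ==> m \<theta> t = \<rho>0 + integral {0..t} (%s. lindblad (H \<theta>) (L \<theta>) (m \<theta> s))"
  and h: "!!t \<theta>. h t \<theta> = b_vec (L \<theta>) (m \<theta> t)"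
 shows "\<exists>g'. \<forall>k. time_C1 T (closure U) (%t \<theta>. h t \<theta> $ k) (g' k)"
  "\<exists>g'. \<forall>k. time_C1 T (closure U) (%t \<theta>. column k (grad_closure U (h t) \<theta>)) (g' k)"
proof -
 have cl: "compact (closure U)" using U(3) by simp
 have "\<forall>k. \<exists>c D. (\<forall>n. C1_closure U (c n) (D n)) \<and> geometric_on (closure U) c \<and> (\<forall>b\<in>Basis. geometric_on (closure U) (%n. D n b)) \<and>
   (\<forall>\<theta>\<in>closure U. \<forall>t\<in>{0..T}. b_form (L \<theta> k) (m \<theta> t) = egs c t \<theta>)"
  by (rule allI) (rule mean_signal_series[OF cl H L mc meq])
 from choice[OF this] obtain c where "\<forall>k. \<exists>D. (\<forall>n. C1_closure U (c k n) (D n)) \<and> geometric_on (closure U) (c k) \<and> (\<forall>b\<in>Basis. geometric_on (closure U) (%n. D n b)) \<and>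
   (\<forall>\<theta>\<in>closure U. \<forall>t\<in>{0..T}. b_form (L \<theta> k) (m \<theta> t) = egs (c k) t \<theta>)" ..
 from choice[OF this] obtain D where cD: "\<forall>k. (\<forall>n. C1_closure U (c k n) (D k n)) \<and> geometric_on (closure U) (c k) \<and> (\<forall>b\<in>Basis. geometric_on (closure U) (%n. D k n b)) \<and>
   (\<forall>\<theta>\<in>closure U. \<forall>t\<in>{0..T}. b_form (L \<theta> k) (m \<theta> t) = egs (c k) t \<theta>)" ..
 have c1: "C1_closure U (c k n) (D k n)" and c2: "geometric_on (closure U) (c k)" and c3: "b \<in> Basis ==> geometric_on (closure U) (%n. D k n b)"
  for k n b using cD by blast+
 have hk: "h t \<theta> $ k = egs (c k) t \<theta>" if "t \<in> {0..T}" "\<theta> \<in> closure U" for t \<theta> k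
  using cD that by (simp add: h b_vec_def)
 have "time_C1 T (closure U) (%t \<theta>. h t \<theta> $ k) (egs (%n. c k (Suc n)))" for k
  by (rule time_C1_cong[OF time_C1_egs[OF c2 C1_closureD(1)[OF c1]]]) (rule hk)
 then show "\<exists>g'. \<forall>k. time_C1 T (closure U) (%t \<theta>. h t \<theta> $ k) (g' k)"
  by (intro exI[of _ "%k. egs (%n. c k (Suc n))"] allI)
 have ax: "axis j 1 \<in> (Basis :: (real^'p) set)" for j by simp
 have gr: "column k (grad_closure U (h t) \<theta>) = (\<chi> j. egs (%n. D k n (axis j 1)) t \<theta>)" if "t \<in> {0..T}" "\<theta> \<in> closure U" for k t \<theta>
 proof -
  have "grad_closure U (h t) \<theta> $ j $ k = egs (%n. D k n (axis j 1)) t \<theta>" for j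
   by (rule grad_closure_series[OF U(1,2) c1 c2 c3 hk[OF that(1)] _ that(2)]) (use that in auto)
  then show ?thesis by (simp add: column_def vec_eq_iff)
 qed
 have "time_C1 T (closure U) (%t \<theta>. column k (grad_closure U (h t) \<theta>)) (%t \<theta>. \<chi> j. egs (%n. D k (Suc n) (axis j 1)) t \<theta>)" for k
  by (rule time_C1_cong[OF time_C1_vec[OF time_C1_egs[OF c3[OF ax] C1_closureD(3)[OF c1 ax]]]]) (rule gr)
 then show "\<exists>g'. \<forall>k. time_C1 T (closure U) (%t \<theta>. column k (grad_closure U (h t) \<theta>)) (g' k)"
  by (intro exI[of _ "%k t \<theta>. \<chi> j. egs (%n. D k (Suc n) (axis j 1)) t \<theta>"] allI)
qed

section \<open>Deterministic convergence lemmas\<close>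

lemma tendsto_det:
 fixes A :: "nat => real^'n::finite^'n"
 assumes "!!i j. (%n. A n $ i $ j) \<longlonglongrightarrow> B $ i $ j"
 shows "(%n. det (A n)) \<longlonglongrightarrow> det B"
 unfolding det_def by (intro tendsto_sum tendsto_mult tendsto_const tendsto_prod assms)

text \<open>Cramer's rule, which shows the continuity of inversion.\<close>

lemma matrix_inv_entry:
 fixes A :: "real^'n::finite^'n"
 assumes "det A \<noteq> 0"
 shows "matrix_inv A $ i $ j = det (\<chi> a b. if b = i then axis j 1 $ a else A $ a $ b) / det A"
proof -
 have "invertible A" using assms by (simp add: invertible_det_nz)
 then have "A ** matrix_inv A = mat 1 \<and> matrix_inv A ** A = mat 1"
  unfolding invertible_def matrix_inv_def by (rule someI_ex)
 then have "A ** matrix_inv A = mat 1" ..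
 then have "A *v (matrix_inv A *v axis j 1) = axis j 1" by (simp add: matrix_vector_mul_assoc)
 then have "matrix_inv A *v axis j 1 = (\<chi> k. det (\<chi> a b. if b = k then axis j 1 $ a else A $ a $ b) / det A)"
  using cramer[OF assms] by blast
 moreover have "(matrix_inv A *v axis j 1) $ i = matrix_inv A $ i $ j"
  by (simp add: matrix_vector_mult_basis column_def)
 ultimately show ?thesis by simp
qed

lemma tendsto_matrix_inv:
 fixes A :: "nat => real^'n::finite^'n"
 assumes A: "A \<longlonglongrightarrow> B" and B: "invertible B"
 shows "eventually (%n. invertible (A n)) sequentially" "(%n. matrix_inv (A n)) \<longlonglongrightarrow> matrix_inv B"
proof -
 have Aij: "(%n. A n $ i $ j) \<longlonglongrightarrow> B $ i $ j" for i j by (intro tendsto_vec_nth A)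
 have dB: "det B \<noteq> 0" using B by (simp add: invertible_det_nz)
 have ev: "eventually (%n. det (A n) \<noteq> 0) sequentially"
  using tendsto_imp_eventually_ne[OF tendsto_det[OF Aij] dB] .
 then show "eventually (%n. invertible (A n)) sequentially" by (simp add: invertible_det_nz)
 have entry: "(%n. matrix_inv (A n) $ i $ j) \<longlonglongrightarrow> matrix_inv B $ i $ j" for i j
 proof -
  have c: "(%n. (\<chi> a b. if b = i then axis j 1 $ a else A n $ a $ b) $ a $ b) \<longlonglongrightarrow> (\<chi> a b. if b = i then axis j 1 $ a else B $ a $ b) $ a $ b" for a b
   using Aij[of a b] by (cases "b = i") auto
  have "(%n. det (\<chi> a b. if b = i then axis j 1 $ a else A n $ a $ b) / det (A n)) \<longlonglongrightarrow> matrix_inv B $ i $ j"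
   unfolding matrix_inv_entry[OF dB] by (intro tendsto_divide tendsto_det Aij c dB)
  then show ?thesis
   by (rule Lim_transform_eventually) (use ev in eventually_elim, simp add: matrix_inv_entry)
 qed
 show "(%n. matrix_inv (A n)) \<longlonglongrightarrow> matrix_inv B" by (intro vec_tendstoI entry)
qed

lemma pos_definite_invertible:
 fixes S :: "real^'n::finite^'n"
 assumes "pos_definite S"
 shows "invertible S"
proof -
 have "v = 0" if "S *v v = 0" for v using assms that unfolding pos_definite_def by (metis inner_zero_right less_irrefl)
 then show ?thesis by (simp add: invertible_left_inverse matrix_left_invertible_ker)
qed

text \<open>Equicontinuity on a compact set turns pointwise convergence on a dense set into uniform convergence. Then any maximizer
must lie where the limit is nearly maximal, that is, near its unique maximizer. A countable dense set is what the almost sure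
statements will offer.\<close>

lemma argmax_tendsto:
 fixes \<Phi> :: "nat => 'a::metric_space => real"
 assumes K: "compact K" and z: "z \<in> K" and D: "D \<subseteq> K" "K \<subseteq> closure D"
  and equi: "!!e. e > 0 ==> \<exists>d>0. \<forall>N. \<forall>x\<in>K. \<forall>y\<in>K. dist x y < d \<longrightarrow> \<bar>\<Phi> N x - \<Phi> N y\<bar> <= e"
  and lim: "!!x. x \<in> D ==> (%N. \<Phi> N x) \<longlonglongrightarrow> \<Psi> x" and \<Psi>: "continuous_on K \<Psi>"
  and mx: "!!x. x \<in> K ==> x \<noteq> z ==> \<Psi> x < \<Psi> z"
  and s: "!!N. N >= 1 ==> s N \<in> K" "!!N x. N >= 1 ==> x \<in> K ==> \<Phi> N x <= \<Phi> N (s N)"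
 shows "s \<longlonglongrightarrow> z"
proof -
 have unif: "eventually (%N. \<forall>x\<in>K. \<bar>\<Phi> N x - \<Psi> x\<bar> < e) sequentially" if e: "e > 0" for e
 proof -
  obtain d1 where d1: "d1 > 0" "!!N x y. x \<in> K ==> y \<in> K ==> dist x y < d1 ==> \<bar>\<Phi> N x - \<Phi> N y\<bar> <= e / 4"
   using equi[of "e / 4"] e by auto
  have "uniformly_continuous_on K \<Psi>" by (rule compact_uniformly_continuous[OF \<Psi> K])
  then obtain d2 where d2: "d2 > 0" "!!x y. x \<in> K ==> y \<in> K ==> dist y x < d2 ==> dist (\<Psi> y) (\<Psi> x) < e / 4"
   using e unfolding uniformly_continuous_on_def by (metis divide_pos_pos zero_less_numeral)
  define d where "d = min d1 d2"
  have d: "d > 0" using d1 d2 by (simp add: d_def)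
  have "K \<subseteq> (\<Union>x\<in>D. ball x d)"
  proof
   fix y assume "y \<in> K"
   then have "y \<in> closure D" using D by blast
   then obtain x where "x \<in> D" "dist x y < d" using d unfolding closure_approachable by blast
   then show "y \<in> (\<Union>x\<in>D. ball x d)" by auto
  qed
  then obtain D' where D': "D' \<subseteq> D" "finite D'" "K \<subseteq> (\<Union>x\<in>D'. ball x d)"
   using compactE_image[OF K, of D "%x. ball x d"] by blast
  have "eventually (%N. \<forall>x\<in>D'. dist (\<Phi> N x) (\<Psi> x) < e / 4) sequentially"
  proof (rule eventually_ball_finite[OF D'(2)], rule ballI)
   fix x assume "x \<in> D'"
   then have "(%N. \<Phi> N x) \<longlonglongrightarrow> \<Psi> x" using D' lim by blast
   then show "eventually (%N. dist (\<Phi> N x) (\<Psi> x) < e / 4) sequentially" using e by (intro tendstoD) auto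
  qed
  then show ?thesis
  proof eventually_elim
   case (elim N)
   show ?case
   proof
    fix y assume y: "y \<in> K"
    then obtain x where x: "x \<in> D'" "dist x y < d" using D'(3) by auto
    have xK: "x \<in> K" using x D' D by blast
    have "\<bar>\<Phi> N x - \<Phi> N y\<bar> <= e / 4" using d1(2)[OF xK y] x by (simp add: d_def)
    moreover have "\<bar>\<Phi> N x - \<Psi> x\<bar> < e / 4" using elim x by (auto simp: dist_real_def)
    moreover have "\<bar>\<Psi> x - \<Psi> y\<bar> < e / 4" using d2(2)[OF y xK] x by (simp add: d_def dist_real_def)
    ultimately show "\<bar>\<Phi> N y - \<Psi> y\<bar> < e" using e by linarith
   qed
  qed
 qed
 show ?thesis
 proof (rule metric_LIMSEQ_I)
  fix r :: real assume r: "r > 0"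
  let ?K = "K - ball z r"
  show "\<exists>no. \<forall>n\<ge>no. dist (s n) z < r"
  proof (cases "?K = {}")
   case True
   show ?thesis
   proof (intro exI allI impI)
    fix n :: nat assume "1 <= n"
    then have "s n \<in> ball z r" using s(1) True by blast
    then show "dist (s n) z < r" by (simp add: dist_commute)
   qed
  next
   case False
   have "compact ?K" using K by (rule compact_diff) simp
   moreover have "continuous_on ?K \<Psi>" by (rule continuous_on_subset[OF \<Psi>]) blast
   ultimately obtain m where m: "m \<in> ?K" "!!y. y \<in> ?K ==> \<Psi> y <= \<Psi> m" using continuous_attains_sup[OF _ False] by blast
   have "m \<noteq> z" using m(1) r by auto
   then have g: "\<Psi> z - \<Psi> m > 0" using mx[of m] m(1) by simp
   then have "eventually (%N. \<forall>x\<in>K. \<bar>\<Phi> N x - \<Psi> x\<bar> < (\<Psi> z - \<Psi> m) / 2) sequentially" by (intro unif) simp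
   then obtain n0 where n0: "!!N x. N >= n0 ==> x \<in> K ==> \<bar>\<Phi> N x - \<Psi> x\<bar> < (\<Psi> z - \<Psi> m) / 2"
    unfolding eventually_sequentially by blast
   show ?thesis
   proof (intro exI allI impI, rule ccontr)
    fix n assume n: "max 1 n0 <= n" and "\<not> dist (s n) z < r"
    then have "s n \<in> ?K" using s(1)[of n] by (auto simp: dist_commute)
    then have "\<Psi> (s n) <= \<Psi> m" "s n \<in> K" using m(2) by auto
    moreover have "\<Phi> n z <= \<Phi> n (s n)" using s(2)[of n z] z n by simp
    moreover have "\<bar>\<Phi> n z - \<Psi> z\<bar> < (\<Psi> z - \<Psi> m) / 2" using n0[of n z] z n by simp
    moreover have "\<bar>\<Phi> n (s n) - \<Psi> (s n)\<bar> < (\<Psi> z - \<Psi> m) / 2" using n0[of n "s n"] n \<open>s n \<in> K\<close> by simp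
    ultimately show False by (simp add: field_simps abs_if split: if_splits)
   qed
  qed
 qed
qed

text \<open>Replacing u and v by approximations whose errors are small relative to the weights kappa does not change the limit of
the averaged product, provided that the averages of kappa squared stay bounded.\<close>

lemma empirical_product_tendsto:
 fixes u v \<kappa> e :: "nat => real" and p q :: "nat => nat => real"
 assumes e: "e \<longlonglongrightarrow> 0" "!!N. e N >= 0" and C: "C >= 0" and \<kappa>: "!!i. \<kappa> i >= 0"
  and u: "!!i. i >= 1 ==> \<bar>u i\<bar> <= C * \<kappa> i" and v: "!!i. i >= 1 ==> \<bar>v i\<bar> <= C * \<kappa> i"
  and p: "!!N i. N >= 1 ==> i >= 1 ==> \<bar>p N i - u i\<bar> <= e N * \<kappa> i" and q: "!!N i. N >= 1 ==> i >= 1 ==> \<bar>q N i - v i\<bar> <= e N * \<kappa> i"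
  and B: "!!N. (1 / real N) * (\<Sum>i=1..N. (\<kappa> i)\<^sup>2) <= B"
  and lim: "(%N. (1 / real N) * (\<Sum>i=1..N. u i * v i)) \<longlonglongrightarrow> l"
 shows "(%N. (1 / real N) * (\<Sum>i=1..N. p N i * q N i)) \<longlonglongrightarrow> l"
proof -
 have bound: "\<bar>(1 / real N) * (\<Sum>i=1..N. p N i * q N i) - (1 / real N) * (\<Sum>i=1..N. u i * v i)\<bar> <= (2 * C * e N + (e N)\<^sup>2) * \<bar>B\<bar>" if N: "N >= 1" for N
 proof -
  have t: "\<bar>p N i * q N i - u i * v i\<bar> <= (2 * C * e N + (e N)\<^sup>2) * (\<kappa> i)\<^sup>2" if i: "i >= 1" for i
  proof -
   have "p N i * q N i - u i * v i = (p N i - u i) * v i + u i * (q N i - v i) + (p N i - u i) * (q N i - v i)"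
    by (simp add: algebra_simps)
   then have "\<bar>p N i * q N i - u i * v i\<bar> <= \<bar>p N i - u i\<bar> * \<bar>v i\<bar> + \<bar>u i\<bar> * \<bar>q N i - v i\<bar> + \<bar>p N i - u i\<bar> * \<bar>q N i - v i\<bar>"
    by (simp only: abs_mult[symmetric])
   also have "\<dots> <= (e N * \<kappa> i) * (C * \<kappa> i) + (C * \<kappa> i) * (e N * \<kappa> i) + (e N * \<kappa> i) * (e N * \<kappa> i)"
    using e(2)[of N] C \<kappa>[of i] by (intro add_mono mult_mono p q u v i N mult_nonneg_nonneg abs_ge_zero)
   also have "\<dots> = (2 * C * e N + (e N)\<^sup>2) * (\<kappa> i)\<^sup>2" by (simp add: power2_eq_square algebra_simps)
   finally show ?thesis .
  qed
  have c0: "2 * C * e N + (e N)\<^sup>2 >= 0" using C e(2)[of N] by simp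
  have "\<bar>(1 / real N) * (\<Sum>i=1..N. p N i * q N i) - (1 / real N) * (\<Sum>i=1..N. u i * v i)\<bar> =
    (1 / real N) * \<bar>\<Sum>i=1..N. p N i * q N i - u i * v i\<bar>"
   unfolding right_diff_distrib[symmetric] sum_subtractf[symmetric] abs_mult by simp
  also have "\<dots> <= (1 / real N) * (\<Sum>i=1..N. (2 * C * e N + (e N)\<^sup>2) * (\<kappa> i)\<^sup>2)"
   by (intro mult_left_mono order_trans[OF sum_abs] sum_mono t) auto
  also have "\<dots> = (2 * C * e N + (e N)\<^sup>2) * ((1 / real N) * (\<Sum>i=1..N. (\<kappa> i)\<^sup>2))"
   by (simp add: sum_distrib_left[symmetric])
  also have "\<dots> <= (2 * C * e N + (e N)\<^sup>2) * \<bar>B\<bar>" using B[of N] by (intro mult_left_mono c0) linarith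
  finally show ?thesis .
 qed
 have "(%N. (2 * C * e N + (e N)\<^sup>2) * \<bar>B\<bar>) \<longlonglongrightarrow> (2 * C * 0 + 0\<^sup>2) * \<bar>B\<bar>" by (intro tendsto_intros e)
 then have z: "(%N. (2 * C * e N + (e N)\<^sup>2) * \<bar>B\<bar>) \<longlonglongrightarrow> 0" by simp
 have "(%N. (1 / real N) * (\<Sum>i=1..N. p N i * q N i) - (1 / real N) * (\<Sum>i=1..N. u i * v i)) \<longlonglongrightarrow> 0"
  by (rule Lim_null_comparison[OF _ z]) (use bound in \<open>auto simp: eventually_sequentially intro!: exI[of _ 1]\<close>)
 from tendsto_add[OF this lim] show ?thesis by simp
qed

section \<open>Integration by parts along a record\<close>

text \<open>The stochastic integral of g against the path y after integration by parts. It is defined for every continuous path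
and linear in it.\<close>

definition by_parts :: "real => ('r::finite => real => 'a => 'b::euclidean_space) => ('r => real => 'a => 'b) => (real => real^'r) => 'a => 'b" where
 "by_parts T g g' y \<theta> = (\<Sum>k\<in>UNIV. y T $ k *\<^sub>R g k T \<theta> - integral {0..T} (%s. y s $ k *\<^sub>R g' k s \<theta>))"

text \<open>The size of a path that controls the integral above.\<close>

definition path_size :: "real => (real => real^'r::finite) => real" where
 "path_size T y = norm (y T) + integral {0..T} (%s. norm (y s))"

lemma path_size_nonneg: "continuous_on {0..T} y ==> 0 <= path_size T y"
 unfolding path_size_def by (intro add_nonneg_nonneg integral_nonneg integrable_continuous_real continuous_intros) auto

lemma by_parts_bound:
 fixes a :: "'r::finite => 'b::euclidean_space" and b :: "'r => real => 'b"
 assumes y: "continuous_on {0..T} y" and a: "!!k. norm (a k) <= e" and b: "!!k s. s \<in> {0..T} ==> norm (b k s) <= e"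
  and bc: "!!k. continuous_on {0..T} (b k)" and e: "e >= 0"
 shows "norm (\<Sum>k\<in>UNIV. y T $ k *\<^sub>R a k - integral {0..T} (%s. y s $ k *\<^sub>R b k s)) <= real CARD('r) * e * path_size T y"
proof -
 have "norm (y T $ k *\<^sub>R a k - integral {0..T} (%s. y s $ k *\<^sub>R b k s)) <= e * path_size T y" for k
 proof -
  have i: "norm (integral {0..T} (%s. y s $ k *\<^sub>R b k s)) <= integral {0..T} (%s. e * norm (y s))"
  proof (rule integral_norm_bound_integral)
   show "(%s. y s $ k *\<^sub>R b k s) integrable_on {0..T}"
    by (intro integrable_continuous_real continuous_intros y bc)
   show "(%s. e * norm (y s)) integrable_on {0..T}"
    by (intro integrable_continuous_real continuous_intros y)
   fix s assume s: "s \<in> {0..T}"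
   have "norm (y s $ k *\<^sub>R b k s) <= norm (y s) * e"
    unfolding norm_scaleR using component_le_norm_cart[of "y s" k] b[OF s] by (intro mult_mono) auto
   then show "norm (y s $ k *\<^sub>R b k s) <= e * norm (y s)" by (simp add: mult.commute)
  qed
  have "norm (y T $ k *\<^sub>R a k) <= norm (y T) * e"
   unfolding norm_scaleR using component_le_norm_cart[of "y T" k] a[of k] by (intro mult_mono) auto
  then have "norm (y T $ k *\<^sub>R a k - integral {0..T} (%s. y s $ k *\<^sub>R b k s)) <= norm (y T) * e + integral {0..T} (%s. e * norm (y s))"
   using norm_triangle_ineq4[of "y T $ k *\<^sub>R a k" "integral {0..T} (%s. y s $ k *\<^sub>R b k s)"] i by linarith
  also have "\<dots> = e * path_size T y" unfolding path_size_def by (simp add: algebra_simps)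
  finally show ?thesis .
 qed
 then have "norm (\<Sum>k\<in>UNIV. y T $ k *\<^sub>R a k - integral {0..T} (%s. y s $ k *\<^sub>R b k s)) <= (\<Sum>k\<in>(UNIV :: 'r set). e * path_size T y)"
  by (intro sum_norm_le) auto
 then show ?thesis by simp
qed

lemma time_C1_slice:
 assumes "time_C1 T K g g'" "\<theta> \<in> K"
 shows "continuous_on {0..T} (%t. g t \<theta>)" "continuous_on {0..T} (%t. g' t \<theta>)"
  "!!t. t \<in> {0..T} ==> ((%t. g t \<theta>) has_vector_derivative g' t \<theta>) (at t within {0..T})"
proof -
 have p: "continuous_on {0..T} (%t. (t, \<theta>))" by (intro continuous_intros)
 have s: "(%t. (t, \<theta>)) ` {0..T} \<subseteq> {0..T} \<times> K" using assms(2) by auto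
 show "continuous_on {0..T} (%t. g t \<theta>)" "continuous_on {0..T} (%t. g' t \<theta>)"
  using assms(1) continuous_on_compose2[OF _ p s] unfolding time_C1_def by fastforce+
 show "((%t. g t \<theta>) has_vector_derivative g' t \<theta>) (at t within {0..T})" if "t \<in> {0..T}" for t
  using assms that unfolding time_C1_def by blast
qed

lemma continuous_Times_bound:
 fixes f :: "'r::finite => real => 'a::metric_space => 'b::euclidean_space"
 assumes "!!k. continuous_on ({0..T} \<times> K) (%p. f k (fst p) (snd p))" "compact K"
 shows "\<exists>C\<ge>0. \<forall>k. \<forall>t\<in>{0..T}. \<forall>\<theta>\<in>K. norm (f k t \<theta>) <= C"
  "e > 0 ==> \<exists>d>0. \<forall>k. \<forall>t\<in>{0..T}. \<forall>\<theta>\<in>K. \<forall>\<theta>'\<in>K. dist \<theta> \<theta>' < d \<longrightarrow> norm (f k t \<theta> - f k t \<theta>') <= e"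
proof -
 have cp: "compact ({0..T} \<times> K)" by (intro compact_Times compact_Icc assms(2))
 have "\<forall>k. \<exists>C. \<forall>p\<in>{0..T} \<times> K. norm (f k (fst p) (snd p)) <= C"
 proof
  fix k
  have "bounded ((%p. f k (fst p) (snd p)) ` ({0..T} \<times> K))" by (intro compact_imp_bounded compact_continuous_image assms(1) cp)
  then show "\<exists>C. \<forall>p\<in>{0..T} \<times> K. norm (f k (fst p) (snd p)) <= C" unfolding bounded_iff by blast
 qed
 from choice[OF this] obtain C where C: "\<forall>k. \<forall>p\<in>{0..T} \<times> K. norm (f k (fst p) (snd p)) <= C k" ..
 show "\<exists>C\<ge>0. \<forall>k. \<forall>t\<in>{0..T}. \<forall>\<theta>\<in>K. norm (f k t \<theta>) <= C"
 proof (intro exI[of _ "\<Sum>k\<in>UNIV. \<bar>C k\<bar>"] conjI allI ballI sum_nonneg)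
  fix k t \<theta> assume "t \<in> {0..T}" "\<theta> \<in> K"
  then have "norm (f k t \<theta>) <= C k" using C by force
  also have "\<dots> <= \<bar>C k\<bar>" by simp
  also have "\<dots> <= (\<Sum>k\<in>UNIV. \<bar>C k\<bar>)" by (intro member_le_sum) auto
  finally show "norm (f k t \<theta>) <= (\<Sum>k\<in>UNIV. \<bar>C k\<bar>)" .
 qed simp
 assume e: "e > 0"
 have "\<forall>k. \<exists>d. d > 0 \<and> (\<forall>p\<in>{0..T} \<times> K. \<forall>p'\<in>{0..T} \<times> K. dist p' p < d \<longrightarrow> dist (f k (fst p') (snd p')) (f k (fst p) (snd p)) < e)"
  using compact_uniformly_continuous[OF assms(1) cp] e unfolding uniformly_continuous_on_def by blast
 from choice[OF this] obtain d where d: "\<forall>k. d k > 0 \<and> (\<forall>p\<in>{0..T} \<times> K. \<forall>p'\<in>{0..T} \<times> K. dist p' p < d k \<longrightarrow> dist (f k (fst p') (snd p')) (f k (fst p) (snd p)) < e)" ..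
 show "\<exists>d>0. \<forall>k. \<forall>t\<in>{0..T}. \<forall>\<theta>\<in>K. \<forall>\<theta>'\<in>K. dist \<theta> \<theta>' < d \<longrightarrow> norm (f k t \<theta> - f k t \<theta>') <= e"
 proof (intro exI[of _ "Min (range d)"] conjI allI ballI impI)
  show "0 < Min (range d)" using d by (subst Min_gr_iff) auto
  fix k t \<theta> \<theta>' assume t: "t \<in> {0..T}" and \<theta>: "\<theta> \<in> K" "\<theta>' \<in> K" and "dist \<theta> \<theta>' < Min (range d)"
  then have "dist (t, \<theta>) (t, \<theta>') < d k" using Min_le[of "range d" "d k"] by (simp add: dist_Pair_Pair)
  then have "dist (f k t \<theta>) (f k t \<theta>') < e" using d t \<theta> by force
  then show "norm (f k t \<theta> - f k t \<theta>') <= e" by (simp add: dist_norm)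
 qed
qed

text \<open>The modulus of continuity in the parameter does not depend on the path except through its size. This gives a
control that is uniform over all records.\<close>

lemma by_parts_regular:
 fixes g g' :: "'r::finite => real => 'a::metric_space => 'b::euclidean_space"
 assumes g: "!!k. time_C1 T K (g k) (g' k)" and K: "compact K" and T: "T >= 0"
 shows "\<exists>C\<ge>0. \<forall>y. continuous_on {0..T} y \<longrightarrow> (\<forall>\<theta>\<in>K. norm (by_parts T g g' y \<theta>) <= C * path_size T y)"
  "e > 0 ==> \<exists>d>0. \<forall>y. continuous_on {0..T} y \<longrightarrow> (\<forall>\<theta>\<in>K. \<forall>\<theta>'\<in>K. dist \<theta> \<theta>' < d \<longrightarrow> norm (by_parts T g g' y \<theta> - by_parts T g g' y \<theta>') <= e * path_size T y)"
proof -
 have c: "continuous_on ({0..T} \<times> K) (%p. g k (fst p) (snd p))" "continuous_on ({0..T} \<times> K) (%p. g' k (fst p) (snd p))" for k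
  using g[of k] unfolding time_C1_def by auto
 have TT: "T \<in> {0..T}" using T by simp
 obtain C C' where C: "C >= 0" "!!k t \<theta>. t \<in> {0..T} ==> \<theta> \<in> K ==> norm (g k t \<theta>) <= C"
  "C' >= 0" "!!k t \<theta>. t \<in> {0..T} ==> \<theta> \<in> K ==> norm (g' k t \<theta>) <= C'"
  using continuous_Times_bound(1)[of T K g, OF c(1) K] continuous_Times_bound(1)[of T K g', OF c(2) K] by blast
 have "norm (by_parts T g g' y \<theta>) <= (real CARD('r) * (C + C')) * path_size T y" if y: "continuous_on {0..T} y" and \<theta>: "\<theta> \<in> K" for y \<theta>
  unfolding by_parts_def
  using C TT \<theta> by (intro by_parts_bound[OF y _ _ time_C1_slice(2)[OF g \<theta>]]) (auto intro: add_increasing add_increasing2)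
 then show "\<exists>C\<ge>0. \<forall>y. continuous_on {0..T} y \<longrightarrow> (\<forall>\<theta>\<in>K. norm (by_parts T g g' y \<theta>) <= C * path_size T y)"
  using C by (intro exI[of _ "real CARD('r) * (C + C')"]) auto
 assume e: "e > 0"
 define e' where "e' = e / real CARD('r)"
 have e': "e' > 0" unfolding e'_def using e by simp
 obtain d1 d2 where d: "d1 > 0" "!!k t \<theta> \<theta>'. t \<in> {0..T} ==> \<theta> \<in> K ==> \<theta>' \<in> K ==> dist \<theta> \<theta>' < d1 ==> norm (g k t \<theta> - g k t \<theta>') <= e'"
  "d2 > 0" "!!k t \<theta> \<theta>'. t \<in> {0..T} ==> \<theta> \<in> K ==> \<theta>' \<in> K ==> dist \<theta> \<theta>' < d2 ==> norm (g' k t \<theta> - g' k t \<theta>') <= e'"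
  using continuous_Times_bound(2)[of T K g, OF c(1) K e'] continuous_Times_bound(2)[of T K g', OF c(2) K e'] by blast
 have "norm (by_parts T g g' y \<theta> - by_parts T g g' y \<theta>') <= e * path_size T y"
  if y: "continuous_on {0..T} y" and \<theta>: "\<theta> \<in> K" "\<theta>' \<in> K" "dist \<theta> \<theta>' < min d1 d2" for y \<theta> \<theta>'
 proof -
  have i: "(%s. y s $ k *\<^sub>R g' k s \<theta>) integrable_on {0..T}" if "\<theta> \<in> K" for k \<theta>
   by (intro integrable_continuous_real continuous_intros y time_C1_slice(2)[OF g that])
  have "by_parts T g g' y \<theta> - by_parts T g g' y \<theta>' =
    (\<Sum>k\<in>UNIV. y T $ k *\<^sub>R (g k T \<theta> - g k T \<theta>') - integral {0..T} (%s. y s $ k *\<^sub>R (g' k s \<theta> - g' k s \<theta>')))"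
   unfolding by_parts_def sum_subtractf[symmetric] scaleR_diff_right Henstock_Kurzweil_Integration.integral_diff[OF i[OF \<theta>(1)] i[OF \<theta>(2)]]
   by (intro sum.cong refl) simp
  also have "norm \<dots> <= real CARD('r) * e' * path_size T y"
   using d TT \<theta> e' by (intro by_parts_bound[OF y] continuous_on_diff time_C1_slice(2)[OF g]) auto
  also have "real CARD('r) * e' = e" unfolding e'_def by simp
  finally show ?thesis .
 qed
 then show "\<exists>d>0. \<forall>y. continuous_on {0..T} y \<longrightarrow> (\<forall>\<theta>\<in>K. \<forall>\<theta>'\<in>K. dist \<theta> \<theta>' < d \<longrightarrow> norm (by_parts T g g' y \<theta> - by_parts T g g' y \<theta>') <= e * path_size T y)"
  using d by (intro exI[of _ "min d1 d2"]) auto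
qed

section \<open>Integrals of smooth deterministic signals\<close>

lemma integrator_cong_AE:
 assumes B: "integrator M F T B" and B'm: "!!t. t \<in> {0..T} ==> B' t \<in> borel_measurable M"
  and eq: "AE x in M. \<forall>t\<in>{0..T}. B t x = B' t x"
 shows "integrator M F T B'"
proof -
 have same: "msq M (increment_sum B' n a b \<xi>) = msq M (increment_sum B n a b \<xi>)"
  if t: "t \<in> {0..T}" and e: "elementary M F t n a b \<xi>" for t n a b and \<xi> :: "nat => 'a => real"
 proof (rule msq_cong_AE)
  have r: "a j \<in> {0..T}" "b j \<in> {0..T}" if "j < n" for j using e t that unfolding elementary_def by force+
  show "AE x in M. increment_sum B' n a b \<xi> x = increment_sum B n a b \<xi> x"
   using eq by eventually_elim (unfold increment_sum_def, intro sum.cong refl, use r in auto)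
 qed
 obtain C where "C >= 0" "\<forall>t\<in>{0..T}. \<forall>n a b (\<xi> :: nat => 'a => real). elementary M F t n a b \<xi> \<longrightarrow>
    msq M (increment_sum B n a b \<xi>) <= ennreal C * msq (time_space t M) (%(s, x). simple_sum n a b \<xi> s x)"
  using B unfolding integrator_def by blast
 then show ?thesis unfolding integrator_def using B'm by (intro conjI ballI exI[of _ C]) (auto simp: same)
qed

lemma (in prob_space) expectation_time_integral:
 fixes f :: "real => 'a => real"
 assumes f: "(%(s, x). f s x) \<in> borel_measurable (borel \<Otimes>\<^sub>M M)" and K: "!!s x. \<bar>f s x\<bar> <= K"
 shows "integrable M (%x. LBINT s:{0..t}. f s x)"
  "expectation (%x. LBINT s:{0..t}. f s x) = (LBINT s:{0..t}. expectation (f s))"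
proof -
 let ?R = "restrict_space lborel {0..t}"
 interpret R: finite_measure ?R by (rule finite_measure_restrict_lborel)
 interpret P: pair_sigma_finite ?R M ..
 interpret Q: finite_measure "time_space t M" by (rule finite_measure_pair_measure) unfold_locales
 have pi: "integrable (time_space t M) (%(s, x). f s x)"
 proof (rule Q.integrable_const_bound[of _ K])
  show "AE p in time_space t M. norm (case p of (s, x) => f s x) <= K"
   using K by (intro AE_I2) (simp add: case_prod_unfold)
 qed (rule measurable_time_spaceI[OF f])
 have LR: "(LBINT r:{0..t}. g r) = (\<integral>r. g r \<partial>?R)" for g :: "real => real"
  unfolding set_lebesgue_integral_def by (rule integral_restrict_space[symmetric]) simp
 show "integrable M (%x. LBINT s:{0..t}. f s x)" unfolding LR by (rule P.integrable_snd[OF pi])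
 show "expectation (%x. LBINT s:{0..t}. f s x) = (LBINT s:{0..t}. expectation (f s))"
  unfolding LR by (rule P.Fubini_integral[OF pi])
qed

text \<open>The integral is the mean-square limit of its Riemann sums. They converge pathwise by Abel summation, and
their expectations are Riemann-Stieltjes sums against the mean path.\<close>

lemma smooth_stoch_integral:
 fixes g g' :: "real => 'b::euclidean_space" and B :: "real => 'w => real"
 assumes pM: "prob_space M" and F: "filtration_on M F" and T: "T >= 0" and B: "integrator M F T B"
  and Bc: "AE x in M. continuous_on {0..T} (%t. B t x)" and B0: "AE x in M. B 0 x = 0"
  and g: "!!t. t \<in> {0..T} ==> (g has_vector_derivative g' t) (at t within {0..T})" and g'c: "continuous_on {0..T} g'"
  and J: "has_stoch_integral M F B (%t _. g t) T J"
 shows "AE x in M. J x = B T x *\<^sub>R g T - integral {0..T} (%t. B t x *\<^sub>R g' t)"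
  and "[|!!t. t \<in> {0..T} ==> integrable M (B t); !!t. t \<in> {0..T} ==> integral\<^sup>L M (B t) = integral {0..t} m; continuous_on {0..T} m|]
   ==> integrable M J \<and> integral\<^sup>L M J = integral {0..T} (%t. m t *\<^sub>R g t)"
proof -
 interpret prob_space M by fact
 have TT: "T \<in> {0..T}" using T by simp
 have gc: "continuous_on {0..T} g" unfolding continuous_on_eq_continuous_within using has_vector_derivative_continuous[OF g] by blast
 define cl where "cl t = max 0 (min T t)" for t :: real
 have cl: "cl t \<in> {0..T}" "t \<in> {0..T} ==> cl t = t" for t using T by (auto simp: cl_def)
 have gcl: "continuous_on UNIV (%t. g (cl t))"
  by (rule continuous_on_compose2[OF gc]) (use cl in \<open>auto simp: cl_def intro!: continuous_intros\<close>)
 obtain R where R: "!!t. t \<in> {0..T} ==> norm (g t) <= R"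
 proof -
  have "bounded (g ` {0..T})" by (intro compact_imp_bounded compact_continuous_image gc compact_Icc)
  then obtain R where "\<forall>y\<in>g ` {0..T}. norm y <= R" by (auto simp: bounded_iff)
  then show thesis using that by blast
 qed
 define \<xi> where "\<xi> n j x = g (grid T (Suc n) j)" for n j and x :: 'w
 define f where "f n = simple_integral B (Suc n) (grid T (Suc n)) (\<xi> n)" for n
 have gT: "grid T (Suc n) j \<in> {0..T}" if "j <= Suc n" for n j using grid_in[OF T that] by simp
 have Bm: "!!t. t \<in> {0..T} ==> B t \<in> borel_measurable M" using B unfolding integrator_def by auto
 have Jm: "J \<in> borel_measurable M" using J unfolding has_stoch_integral_def by blast
 have sd: "simple_data M F T (Suc n) (grid T (Suc n)) (\<xi> n)" for n
  using simple_data_grid[OF T, of "Suc n" "Suc n" "\<xi> n" F M] unfolding \<xi>_def by (simp add: bounded_iff) blast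
 have fm: "f n \<in> borel_measurable M" for n
  unfolding f_def simple_integral_eq by (rule borel_measurable_increment_sum[OF Bm F simple_data_elementary[OF sd] order_refl])
 obtain C where C: "C >= 0" "!!n. msq M (%x. J x - f n x) <= ennreal C * msq (time_space T M) (%(s, x). g s - simple_process (Suc n) (grid T (Suc n)) (\<xi> n) s x)"
  using stoch_integral_approx[OF B F, where 'b='b] TT J sd unfolding f_def by blast
 have "(%n. msq (time_space T M) (%(s, x). g (cl s) - simple_process (Suc n) (grid T (Suc n)) (%j x. g (cl (grid T (Suc n) j))) s x)) \<longlonglongrightarrow> 0"
 proof (rule msq_grid_approximation[OF pM T, where U="%s x. g (cl s)" and B=R])
  show "(%(s, x). g (cl s)) \<in> borel_measurable (borel \<Otimes>\<^sub>M M)"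
   using measurable_compose[OF measurable_fst borel_measurable_continuous_onI[OF gcl]] by (simp add: case_prod_unfold)
  show "continuous_on {0..T} (%s. g (cl s))" by (rule continuous_on_subset[OF gcl]) simp
  show "norm (g (cl s)) <= R" for s by (rule R[OF cl(1)])
 qed
 moreover have "msq (time_space T M) (%(s, x). g (cl s) - simple_process (Suc n) (grid T (Suc n)) (%j x. g (cl (grid T (Suc n) j))) s x) =
   msq (time_space T M) (%(s, x). g s - simple_process (Suc n) (grid T (Suc n)) (\<xi> n) s x)" for n
 proof (rule msq_cong)
  fix p assume "p \<in> space (time_space T M)"
  then obtain s x where p: "p = (s, x)" "s \<in> {0..T}" by (auto simp: space_pair_measure space_restrict_space)
  have "simple_process (Suc n) (grid T (Suc n)) (%j x. g (cl (grid T (Suc n) j))) s x = simple_process (Suc n) (grid T (Suc n)) (\<xi> n) s x"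
   unfolding simple_process_def \<xi>_def using gT cl by (intro sum.cong refl) simp
  then show "norm (case p of (s, x) => g (cl s) - simple_process (Suc n) (grid T (Suc n)) (%j x. g (cl (grid T (Suc n) j))) s x) =
    norm (case p of (s, x) => g s - simple_process (Suc n) (grid T (Suc n)) (\<xi> n) s x)"
   using p cl by simp
 qed
 ultimately have "(%n. ennreal C * msq (time_space T M) (%(s, x). g s - simple_process (Suc n) (grid T (Suc n)) (\<xi> n) s x)) \<longlonglongrightarrow> ennreal C * 0"
  by (intro ennreal_tendsto_cmult) auto
 then have lim: "(%n. msq M (%x. J x - f n x)) \<longlonglongrightarrow> 0"
  using tendsto_sandwich[OF always_eventually[OF allI[OF zero_le]] always_eventually[OF allI[OF C(2)]] tendsto_const] by simp
 have feq: "f n x = (\<Sum>j<Suc n. (B (grid T (Suc n) (Suc j)) x - B (grid T (Suc n) j) x) *\<^sub>R g (grid T (Suc n) j))" for n x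
  unfolding f_def simple_integral_def \<xi>_def ..
 show "AE x in M. J x = B T x *\<^sub>R g T - integral {0..T} (%t. B t x *\<^sub>R g' t)"
 proof (rule msq_limit_eq_AE_limit[OF fm Jm])
  show "(%n. msq M (%x. f n x - J x)) \<longlonglongrightarrow> 0" using lim by (subst msq_minus_commute)
  show "AE x in M. (%n. f n x) \<longlonglongrightarrow> B T x *\<^sub>R g T - integral {0..T} (%t. B t x *\<^sub>R g' t)"
   using Bc B0
  proof eventually_elim
   case (elim x)
   show ?case unfolding feq using stieltjes_sum_by_parts_tendsto[OF T elim(1) g'c g] elim(2) by simp
  qed
 qed
 assume Bi: "!!t. t \<in> {0..T} ==> integrable M (B t)" and Be: "!!t. t \<in> {0..T} ==> expectation (B t) = integral {0..t} m"
  and mc: "continuous_on {0..T} m"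
 have ti: "integrable M (%x. (B (grid T (Suc n) (Suc j)) x - B (grid T (Suc n) j) x) *\<^sub>R g (grid T (Suc n) j))" if "j < Suc n" for n j
  using that by (intro integrable_scaleR_left Bochner_Integration.integrable_diff Bi gT) auto
 have fi: "integrable M (f n)" for n
  unfolding feq[abs_def] by (rule Bochner_Integration.integrable_sum) (use ti in auto)
 have fe: "expectation (f n) = (\<Sum>j<Suc n. integral {grid T (Suc n) j..grid T (Suc n) (Suc j)} m *\<^sub>R g (grid T (Suc n) j))" for n
 proof -
  have "expectation (f n) = (\<Sum>j<Suc n. expectation (%x. (B (grid T (Suc n) (Suc j)) x - B (grid T (Suc n) j) x) *\<^sub>R g (grid T (Suc n) j)))"
   unfolding feq[abs_def] by (rule Bochner_Integration.integral_sum) (use ti in auto)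
  also have "\<dots> = (\<Sum>j<Suc n. integral {grid T (Suc n) j..grid T (Suc n) (Suc j)} m *\<^sub>R g (grid T (Suc n) j))"
  proof (rule sum.cong[OF refl])
   fix j assume "j \<in> {..<Suc n}"
   then have j: "j < Suc n" by simp
   let ?a = "grid T (Suc n) j" and ?b = "grid T (Suc n) (Suc j)"
   have ab: "?a \<in> {0..T}" "?b \<in> {0..T}" "?a <= ?b" using j gT grid_mono[OF T, of j "Suc j"] by auto
   have i: "integrable M (%x. B ?b x - B ?a x)" using Bi ab by simp
   have "m integrable_on {0..?b}" using ab by (intro integrable_continuous_real continuous_on_subset[OF mc]) auto
   from Henstock_Kurzweil_Integration.integral_combine[OF _ ab(3) this] ab
   have "integral {0..?b} m - integral {0..?a} m = integral {?a..?b} m" by (simp add: algebra_simps)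
   then have "expectation (%x. B ?b x - B ?a x) = integral {?a..?b} m" using Bi Be ab by simp
   then show "expectation (%x. (B ?b x - B ?a x) *\<^sub>R g ?a) = integral {?a..?b} m *\<^sub>R g ?a"
    using i by (subst integral_scaleR_left) auto
  qed
  finally show ?thesis .
 qed
 have el: "(%n. expectation (f n)) \<longlonglongrightarrow> integral {0..T} (%t. m t *\<^sub>R g t)"
  unfolding fe using grid_mono[OF T, of _ "Suc _"]
  by (intro riemann_stieltjes_sum_tendsto[OF bounded_bilinear.flip[OF bounded_bilinear_scaleR] T gc mc]) auto
 show "integrable M J \<and> expectation J = integral {0..T} (%t. m t *\<^sub>R g t)"
  using msq_limit_tendsto_expectation[OF fi Jm lim el] by blast
qed

section \<open>Pathwise consistency\<close>

lemma by_parts_continuous: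
 fixes g g' :: "'r::finite => real => 'a::metric_space => 'b::euclidean_space"
 assumes g: "!!k. time_C1 T K (g k) (g' k)" and K: "compact K" and T: "T >= 0" and y: "continuous_on {0..T} y"
 shows "continuous_on K (by_parts T g g' y)"
 unfolding continuous_on_iff
proof (intro ballI allI impI)
 fix \<theta> and e :: real assume \<theta>: "\<theta> \<in> K" and e: "e > 0"
 have p: "path_size T y >= 0" by (rule path_size_nonneg[OF y])
 define e' where "e' = e / (2 * (1 + path_size T y))"
 have e': "e' > 0" unfolding e'_def using e p by (intro divide_pos_pos) auto
 obtain d where d0: "d > 0 \<and> (\<forall>y. continuous_on {0..T} y \<longrightarrow> (\<forall>\<theta>\<in>K. \<forall>\<theta>'\<in>K. dist \<theta> \<theta>' < d \<longrightarrow>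
   norm (by_parts T g g' y \<theta> - by_parts T g g' y \<theta>') <= e' * path_size T y))"
  using by_parts_regular(2)[OF g K T e'] ..
 note d = conjunct1[OF d0] conjunct2[OF d0, rule_format]
 have "e' * path_size T y <= e' * (1 + path_size T y)" using e' by simp
 also have "\<dots> = e / 2" unfolding e'_def using p by (simp add: field_simps)
 also have "\<dots> < e" using e by simp
 finally have "e' * path_size T y < e" .
 then show "\<exists>d>0. \<forall>\<theta>'\<in>K. dist \<theta>' \<theta> < d \<longrightarrow> dist (by_parts T g g' y \<theta>') (by_parts T g g' y \<theta>) < e"
  using d(1) d(2)[OF y _ \<theta>] by (intro exI[of _ d]) (force simp: dist_norm)
qed

lemma by_parts_mean:
 assumes g: "!!k. time_C1 T K (g k) (g' k)" and \<theta>: "\<theta> \<in> K" and I: "finite I" and y: "!!i. i \<in> I ==> continuous_on {0..T} (y i)"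
 shows "by_parts T g g' (%t. c *\<^sub>R (\<Sum>i\<in>I. y i t)) \<theta> = c *\<^sub>R (\<Sum>i\<in>I. by_parts T g g' (y i) \<theta>)"
proof -
 have i: "(%s. y i s $ k *\<^sub>R g' k s \<theta>) integrable_on {0..T}" if "i \<in> I" for i k
  by (intro integrable_continuous_real continuous_intros y that time_C1_slice(2)[OF g \<theta>])
 have "integral {0..T} (%s. (c *\<^sub>R (\<Sum>i\<in>I. y i s)) $ k *\<^sub>R g' k s \<theta>) = c *\<^sub>R (\<Sum>i\<in>I. integral {0..T} (%s. y i s $ k *\<^sub>R g' k s \<theta>))" for k
 proof -
  have "(%s. (c *\<^sub>R (\<Sum>i\<in>I. y i s)) $ k *\<^sub>R g' k s \<theta>) = (%s. c *\<^sub>R (\<Sum>i\<in>I. y i s $ k *\<^sub>R g' k s \<theta>))"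
   by (simp add: sum_component scaleR_sum_left[symmetric])
  then show ?thesis using i by (simp add: Henstock_Kurzweil_Integration.integral_sum[OF I])
 qed
 then have "by_parts T g g' (%t. c *\<^sub>R (\<Sum>i\<in>I. y i t)) \<theta> =
   (\<Sum>k\<in>UNIV. c *\<^sub>R (\<Sum>i\<in>I. y i T $ k *\<^sub>R g k T \<theta> - integral {0..T} (%s. y i s $ k *\<^sub>R g' k s \<theta>)))"
  unfolding by_parts_def
  by (intro sum.cong refl) (simp add: sum_component scaleR_sum_left scaleR_sum_right sum_subtractf scaleR_diff_right)
 also have "\<dots> = c *\<^sub>R (\<Sum>i\<in>I. by_parts T g g' (y i) \<theta>)"
  unfolding by_parts_def scaleR_sum_right[symmetric] by (subst sum.swap) simp
 finally show ?thesis .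
qed

lemma time_integral_eq:
 fixes f :: "real => 'b::euclidean_space"
 assumes "continuous_on {0..T} f"
 shows "(LBINT t:{0..T}. f t) = integral {0..T} f"
 by (rule set_borel_integral_eq_integral(2)[OF borel_integrable_atLeastAtMost'[OF assms]])

lemma time_integral_continuous:
 fixes f :: "real => 'a::metric_space => 'b::euclidean_space"
 assumes f: "continuous_on ({0..T} \<times> K) (%p. f (fst p) (snd p))"
 shows "continuous_on K (%\<theta>. LBINT t:{0..T}. f t \<theta>)"
proof -
 have s: "continuous_on {0..T} (%t. f t \<theta>)" if "\<theta> \<in> K" for \<theta>
 proof -
  have c: "continuous_on {0..T} (%t. (t, \<theta>))" by (intro continuous_intros)
  have i: "(%t. (t, \<theta>)) ` {0..T} \<subseteq> {0..T} \<times> K" using that by auto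
  show ?thesis using continuous_on_compose2[OF f c i] by simp
 qed
 have "continuous_on (K \<times> cbox 0 T) (%(\<theta>, t). f t \<theta>)"
 proof -
  have c: "continuous_on (K \<times> cbox 0 T) (%p. (snd p, fst p))" by (intro continuous_intros)
  have i: "(%p. (snd p, fst p)) ` (K \<times> cbox 0 T) \<subseteq> {0..T} \<times> K" by (auto simp: cbox_interval)
  show ?thesis using continuous_on_compose2[OF f c i] by (simp add: case_prod_unfold)
 qed
 then have "continuous_on K (%\<theta>. integral (cbox 0 T) (%t. f t \<theta>))" by (rule integral_continuous_on_param)
 then show ?thesis by (rule continuous_on_eq) (simp add: time_integral_eq[OF s] cbox_interval)
qed

text \<open>The difference of the two sides is half of the squared distance of a and b in L2, and continuous functions that differ at one
point have positive distance.\<close>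

lemma signal_contrast_maximal:
 fixes a b :: "real => real^'r::finite"
 assumes T: "T > 0" and a: "continuous_on {0..T} a" and b: "continuous_on {0..T} b" and ne: "\<exists>t\<in>{0..T}. a t \<noteq> b t"
 shows "integral {0..T} (%t. b t \<bullet> a t) - 1/2 * integral {0..T} (%t. (norm (a t))\<^sup>2) <
   integral {0..T} (%t. b t \<bullet> b t) - 1/2 * integral {0..T} (%t. (norm (b t))\<^sup>2)"
proof -
 have c: "continuous_on {0..T} (%t. (norm (a t - b t))\<^sup>2)" by (intro continuous_intros a b)
 have i: "(%t. b t \<bullet> a t) integrable_on {0..T}" "(%t. (norm (a t))\<^sup>2) integrable_on {0..T}" "(%t. (norm (b t))\<^sup>2) integrable_on {0..T}"
  by (intro integrable_continuous_real continuous_intros a b)+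
 have "integral {0..T} (%t. (norm (a t - b t))\<^sup>2) \<noteq> 0"
  using integral_eq_0_iff[OF c T] ne by auto
 moreover have "integral {0..T} (%t. (norm (a t - b t))\<^sup>2) >= 0" by (intro integral_nonneg integrable_continuous_real c) auto
 ultimately have pos: "integral {0..T} (%t. (norm (a t - b t))\<^sup>2) > 0" by linarith
 have "integral {0..T} (%t. (norm (a t - b t))\<^sup>2) = integral {0..T} (%t. ((norm (a t))\<^sup>2 - 2 * (b t \<bullet> a t)) + (norm (b t))\<^sup>2)"
  by (intro integral_cong) (simp add: power2_norm_eq_inner inner_diff_left inner_diff_right inner_commute)
 also have "\<dots> = (integral {0..T} (%t. (norm (a t))\<^sup>2) - 2 * integral {0..T} (%t. b t \<bullet> a t)) + integral {0..T} (%t. (norm (b t))\<^sup>2)"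
  using i by (simp add: Henstock_Kurzweil_Integration.integral_add Henstock_Kurzweil_Integration.integral_diff integrable_diff)
 finally show ?thesis using pos by (simp add: power2_norm_eq_inner)
qed

lemma empirical_covariance:
 fixes p q :: "nat => real"
 assumes N: "N >= 1"
 defines "m \<equiv> (1 / real N) * (\<Sum>i=1..N. p i)" and "l \<equiv> (1 / real N) * (\<Sum>i=1..N. q i)"
 shows "(1 / real N) * (\<Sum>i=1..N. (p i - m) * (q i - l)) = (1 / real N) * (\<Sum>i=1..N. p i * q i) - m * l"
proof -
 have s: "(\<Sum>i=1..N. p i) = real N * m" "(\<Sum>i=1..N. q i) = real N * l" using N unfolding m_def l_def by auto
 have "(\<Sum>i=1..N. (p i - m) * (q i - l)) = (\<Sum>i=1..N. p i * q i) - (\<Sum>i=1..N. p i) * l - m * (\<Sum>i=1..N. q i) + real N * (m * l)"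
  by (simp add: algebra_simps sum.distrib sum_subtractf sum_distrib_left sum_distrib_right)
 also have "\<dots> = (\<Sum>i=1..N. p i * q i) - real N * (m * l)" unfolding s by (simp add: algebra_simps)
 finally show ?thesis using N by (simp add: field_simps)
qed

text \<open>The deterministic core of the theorem, for one fixed realization of all records. Once the laws of large numbers hold at a
countable dense set of parameters for the contrast and at z for the scores, the maximizers converge to z; the scores at the
maximizers differ from those at z by a small multiple of the size of the records, and so their empirical covariance has the same
limit.\<close>

lemma pathwise_consistency:
 fixes y :: "nat => real => real^'r::finite" and h h' :: "'r => real => 'a::metric_space => real"
  and G G' :: "'r => real => 'a => real^'p::finite" and S :: "real^'p^'p"
 assumes T: "T >= 0" and K: "compact K" and z: "z \<in> K" and D: "D \<subseteq> K" "K \<subseteq> closure D"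
  and h: "!!k. time_C1 T K (h k) (h' k)" and G: "!!k. time_C1 T K (G k) (G' k)"
  and q: "continuous_on K q" and r: "continuous_on K r"
  and y: "!!i. i >= 1 ==> continuous_on {0..T} (y i)"
  and size: "convergent (%N. (1 / real N) * (\<Sum>i=1..N. (1 + path_size T (y i))\<^sup>2))"
  and \<mu>: "!!\<theta>. \<theta> \<in> D ==> (%N. (1 / real N) * (\<Sum>i=1..N. by_parts T h h' (y i) \<theta>)) \<longlonglongrightarrow> \<mu> \<theta>" "continuous_on K \<mu>"
  and mx: "!!\<theta>. \<theta> \<in> K ==> \<theta> \<noteq> z ==> \<mu> \<theta> - q \<theta> < \<mu> z - q z"
  and mean: "!!a. (%N. (1 / real N) * (\<Sum>i=1..N. (by_parts T G G' (y i) z - r z) $ a)) \<longlonglongrightarrow> 0"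
  and prd: "!!a b. (%N. (1 / real N) * (\<Sum>i=1..N. (by_parts T G G' (y i) z - r z) $ a * (by_parts T G G' (y i) z - r z) $ b)) \<longlonglongrightarrow> S $ a $ b"
  and s: "!!N. N >= 1 ==> s N \<in> K" "!!N \<theta>. N >= 1 ==> \<theta> \<in> K ==>
    (1 / real N) * (\<Sum>i=1..N. by_parts T h h' (y i) \<theta>) - q \<theta> <= (1 / real N) * (\<Sum>i=1..N. by_parts T h h' (y i) (s N)) - q (s N)"
 shows "s \<longlonglongrightarrow> z"
  and "(%N. (1 / real N) *\<^sub>R (\<Sum>i=1..N. outer
     (by_parts T G G' (y i) (s N) - r (s N) - (1 / real N) *\<^sub>R (\<Sum>j=1..N. by_parts T G G' (y j) (s N) - r (s N)))
     (by_parts T G G' (y i) (s N) - r (s N) - (1 / real N) *\<^sub>R (\<Sum>j=1..N. by_parts T G G' (y j) (s N) - r (s N))))) \<longlonglongrightarrow> S"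
proof -
 \<comment> \<open>the summand 1 lets the weight dominate the deterministic term r as well as the record\<close>
 define \<kappa> where "\<kappa> i = (if i >= 1 then 1 + path_size T (y i) else 1)" for i
 have \<kappa>1: "\<kappa> i >= 1" for i unfolding \<kappa>_def using path_size_nonneg[OF y[of i]] by simp
 have \<kappa>p: "i >= 1 ==> path_size T (y i) <= \<kappa> i" for i unfolding \<kappa>_def by simp
 have ksum: "(\<Sum>i=1..N. (\<kappa> i)\<^sup>2) = (\<Sum>i=1..N. (1 + path_size T (y i))\<^sup>2)" for N
  by (intro sum.cong refl) (simp add: \<kappa>_def)
 from convergent_imp_Bseq[OF size] obtain B where Bn: "\<forall>N. norm ((1 / real N) * (\<Sum>i=1..N. (1 + path_size T (y i))\<^sup>2)) <= B" by (rule BseqE)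
 have B: "(1 / real N) * (\<Sum>i=1..N. (\<kappa> i)\<^sup>2) <= B" for N
  unfolding ksum using Bn[rule_format, of N] unfolding real_norm_def by linarith
 have B0: "B >= 0" using B[of 0] by simp
 have B1: "(1 / real N) * (\<Sum>i=1..N. path_size T (y i)) <= B" for N
 proof -
  have "path_size T (y i) <= (\<kappa> i)\<^sup>2" if "i >= 1" for i
   using \<kappa>p[OF that] \<kappa>1[of i] self_le_power[of "\<kappa> i" 2] by simp
  then have "(1 / real N) * (\<Sum>i=1..N. path_size T (y i)) <= (1 / real N) * (\<Sum>i=1..N. (\<kappa> i)\<^sup>2)"
   by (intro mult_left_mono sum_mono) auto
  with B[of N] show ?thesis by linarith
 qed
 define \<Phi> where "\<Phi> N \<theta> = (1 / real N) * (\<Sum>i=1..N. by_parts T h h' (y i) \<theta>) - q \<theta>" for N :: nat and \<theta>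
 show sz: "s \<longlonglongrightarrow> z"
 proof (rule argmax_tendsto[OF K z D, of \<Phi> "%\<theta>. \<mu> \<theta> - q \<theta>"])
  fix e :: real assume e: "e > 0"
  define e' where "e' = e / (2 * (1 + B))"
  have e': "e' > 0" unfolding e'_def using e B0 by (intro divide_pos_pos) auto
  have e'B: "e' * B <= e / 2"
  proof -
   have "e' * B <= e' * (1 + B)" using e' by simp
   also have "\<dots> = e / 2" unfolding e'_def using B0 by (simp add: field_simps)
   finally show ?thesis .
  qed
  obtain d where d0: "d > 0 \<and> (\<forall>y. continuous_on {0..T} y \<longrightarrow> (\<forall>\<theta>\<in>K. \<forall>\<theta>'\<in>K. dist \<theta> \<theta>' < d \<longrightarrow>
    norm (by_parts T h h' y \<theta> - by_parts T h h' y \<theta>') <= e' * path_size T y))"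
   using by_parts_regular(2)[OF h K T e'] ..
  note d = conjunct1[OF d0] conjunct2[OF d0, rule_format]
  have "uniformly_continuous_on K q" by (rule compact_uniformly_continuous[OF q K])
  from this[unfolded uniformly_continuous_on_def, rule_format, OF half_gt_zero[OF e]]
  obtain d' where d0': "d' > 0 \<and> (\<forall>x\<in>K. \<forall>x'\<in>K. dist x' x < d' \<longrightarrow> dist (q x') (q x) < e / 2)" by blast
  note d' = conjunct1[OF d0'] conjunct2[OF d0', rule_format]
  show "\<exists>d>0. \<forall>N. \<forall>x\<in>K. \<forall>x'\<in>K. dist x x' < d \<longrightarrow> \<bar>\<Phi> N x - \<Phi> N x'\<bar> <= e"
  proof (intro exI[of _ "min d d'"] conjI allI ballI impI)
   show "min d d' > 0" using d d' by simp
   fix N x x' assume x: "x \<in> K" "x' \<in> K" "dist x x' < min d d'"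
   have "\<bar>(\<Sum>i=1..N. by_parts T h h' (y i) x - by_parts T h h' (y i) x')\<bar> <= (\<Sum>i=1..N. e' * path_size T (y i))"
    using x d(2)[OF y x(1,2)] by (intro order_trans[OF sum_abs] sum_mono) auto
   then have "(1 / real N) * \<bar>(\<Sum>i=1..N. by_parts T h h' (y i) x - by_parts T h h' (y i) x')\<bar> <= (1 / real N) * (\<Sum>i=1..N. e' * path_size T (y i))"
    by (intro mult_left_mono) auto
   also have "\<dots> = e' * ((1 / real N) * (\<Sum>i=1..N. path_size T (y i)))" by (simp add: sum_distrib_left[symmetric])
   also have "\<dots> <= e' * B" using B1[of N] e' by (intro mult_left_mono) auto
   finally have 1: "(1 / real N) * \<bar>(\<Sum>i=1..N. by_parts T h h' (y i) x - by_parts T h h' (y i) x')\<bar> <= e / 2" using e'B by linarith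
   have 2: "\<bar>q x - q x'\<bar> < e / 2" using d'(2)[OF x(2,1)] x(3) by (simp add: dist_real_def)
   have "\<Phi> N x - \<Phi> N x' = (1 / real N) * (\<Sum>i=1..N. by_parts T h h' (y i) x - by_parts T h h' (y i) x') - (q x - q x')"
    unfolding \<Phi>_def sum_subtractf right_diff_distrib by simp
   then have "\<bar>\<Phi> N x - \<Phi> N x'\<bar> <= \<bar>(1 / real N) * (\<Sum>i=1..N. by_parts T h h' (y i) x - by_parts T h h' (y i) x')\<bar> + \<bar>q x - q x'\<bar>" by linarith
   also have "\<bar>(1 / real N) * (\<Sum>i=1..N. by_parts T h h' (y i) x - by_parts T h h' (y i) x')\<bar> = (1 / real N) * \<bar>(\<Sum>i=1..N. by_parts T h h' (y i) x - by_parts T h h' (y i) x')\<bar>"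
    unfolding abs_mult by simp
   finally show "\<bar>\<Phi> N x - \<Phi> N x'\<bar> <= e" using 1 2 by linarith
  qed
 next
  fix x assume "x \<in> D"
  then show "(%N. \<Phi> N x) \<longlonglongrightarrow> \<mu> x - q x" unfolding \<Phi>_def by (intro tendsto_intros \<mu>)
 qed (use \<mu>(2) q mx s in \<open>auto simp: \<Phi>_def intro: continuous_on_diff\<close>)
 \<comment> \<open>no assumption is made on s 0, which is therefore replaced\<close>
 define s' where "s' N = (if N >= 1 then s N else z)" for N
 have s'K: "s' N \<in> K" for N using s(1) z by (simp add: s'_def)
 have s'z: "s' \<longlonglongrightarrow> z"
  using sz by (rule Lim_transform_eventually) (auto simp: s'_def eventually_sequentially intro!: exI[of _ 1])
 define \<eta> where "\<eta> i \<theta> = by_parts T G G' (y i) \<theta> - r \<theta>" for i \<theta>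
 obtain C1 where "C1 >= 0 \<and> (\<forall>y. continuous_on {0..T} y \<longrightarrow> (\<forall>\<theta>\<in>K. norm (by_parts T G G' y \<theta>) <= C1 * path_size T y))"
  using by_parts_regular(1)[OF G K T] ..
 then have C1: "C1 >= 0" "!!i \<theta>. i >= 1 ==> \<theta> \<in> K ==> norm (by_parts T G G' (y i) \<theta>) <= C1 * path_size T (y i)"
  using y by simp_all
 have "bounded (r ` K)" by (intro compact_imp_bounded compact_continuous_image r K)
 then obtain C2 where C2: "!!\<theta>. \<theta> \<in> K ==> norm (r \<theta>) <= C2" by (auto simp: bounded_iff)
 define C where "C = C1 + C2"
 have C20: "C2 >= 0" using C2[OF z] norm_ge_zero[of "r z"] by linarith
 have C0: "C >= 0" unfolding C_def using C1 C20 by simp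
 have bd: "norm (\<eta> i \<theta>) <= C * \<kappa> i" if i: "i >= 1" and \<theta>: "\<theta> \<in> K" for i \<theta>
 proof -
  have "norm (\<eta> i \<theta>) <= norm (by_parts T G G' (y i) \<theta>) + norm (r \<theta>)" unfolding \<eta>_def by (rule norm_triangle_ineq4)
  also have "\<dots> <= C1 * \<kappa> i + C2 * \<kappa> i"
  proof (intro add_mono)
   show "norm (by_parts T G G' (y i) \<theta>) <= C1 * \<kappa> i" using C1(2)[OF i \<theta>] mult_left_mono[OF \<kappa>p[OF i] C1(1)] by linarith
   show "norm (r \<theta>) <= C2 * \<kappa> i" using C2[OF \<theta>] mult_left_mono[OF \<kappa>1[of i] C20] by simp
  qed
  finally show ?thesis by (simp add: C_def algebra_simps)
 qed
 \<comment> \<open>the largest deviation of a score relative to its weight, over infinitely many records at once\<close>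
 define e where "e N = (SUP i\<in>{1..}. norm (\<eta> i (s' N) - \<eta> i z) / \<kappa> i)" for N
 have quot: "norm (\<eta> i (s' N) - \<eta> i z) / \<kappa> i <= 2 * C" if "i >= 1" for i N
 proof -
  have "norm (\<eta> i (s' N) - \<eta> i z) <= C * \<kappa> i + C * \<kappa> i"
   using bd[OF that s'K[of N]] bd[OF that z] norm_triangle_ineq4[of "\<eta> i (s' N)" "\<eta> i z"] by linarith
  then show ?thesis using \<kappa>1[of i] by (simp add: divide_le_eq)
 qed
 have ba: "bdd_above ((%i. norm (\<eta> i (s' N) - \<eta> i z) / \<kappa> i) ` {1..})" for N
  by (rule bdd_aboveI2[of _ _ "2 * C"]) (use quot in auto)
 have eu: "norm (\<eta> i (s' N) - \<eta> i z) <= e N * \<kappa> i" if "i >= 1" for i N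
 proof -
  have "norm (\<eta> i (s' N) - \<eta> i z) / \<kappa> i <= e N" unfolding e_def using that by (intro cSUP_upper ba) simp
  then show ?thesis using \<kappa>1[of i] by (simp add: divide_le_eq)
 qed
 have e0: "e N >= 0" for N
 proof -
  have "0 <= norm (\<eta> 1 (s' N) - \<eta> 1 z)" by simp
  also have "\<dots> <= e N * \<kappa> 1" by (rule eu) simp
  finally show ?thesis using \<kappa>1[of 1] by (simp add: zero_le_mult_iff)
 qed
 have elim: "e \<longlonglongrightarrow> 0"
 proof (rule LIMSEQ_I)
  fix \<epsilon> :: real assume \<epsilon>: "\<epsilon> > 0"
  then have \<epsilon>4: "\<epsilon> / 4 > 0" by simp
  obtain d where d0: "d > 0 \<and> (\<forall>y. continuous_on {0..T} y \<longrightarrow> (\<forall>\<theta>\<in>K. \<forall>\<theta>'\<in>K. dist \<theta> \<theta>' < d \<longrightarrow>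
    norm (by_parts T G G' y \<theta> - by_parts T G G' y \<theta>') <= \<epsilon> / 4 * path_size T y))"
   using by_parts_regular(2)[OF G K T \<epsilon>4] ..
  note d = conjunct1[OF d0] conjunct2[OF d0, rule_format]
  obtain d' where d0': "d' > 0 \<and> (\<forall>x\<in>K. dist x z < d' \<longrightarrow> dist (r x) (r z) < \<epsilon> / 4)"
   using r[unfolded continuous_on_iff, rule_format, OF z \<epsilon>4] by blast
  note d' = conjunct1[OF d0'] conjunct2[OF d0', rule_format]
  obtain N0 where N0: "!!N. N >= N0 ==> dist (s' N) z < min d d'"
   using metric_LIMSEQ_D[OF s'z, of "min d d'"] d d' by auto
  have "norm (e N - 0) < \<epsilon>" if N: "N >= N0" for N
  proof -
   have "norm (\<eta> i (s' N) - \<eta> i z) / \<kappa> i <= \<epsilon> / 2" if i: "i >= 1" for i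
   proof -
    have "\<eta> i (s' N) - \<eta> i z = (by_parts T G G' (y i) (s' N) - by_parts T G G' (y i) z) - (r (s' N) - r z)" by (simp add: \<eta>_def)
    then have "norm (\<eta> i (s' N) - \<eta> i z) <= norm (by_parts T G G' (y i) (s' N) - by_parts T G G' (y i) z) + norm (r (s' N) - r z)"
     by (simp only: norm_triangle_ineq4)
    also have "\<dots> <= \<epsilon> / 4 * path_size T (y i) + \<epsilon> / 4"
     using d(2)[OF y[OF i] s'K[of N] z] d'(2)[OF s'K[of N]] N0[OF N] by (intro add_mono) (auto simp: dist_norm)
    also have "\<dots> <= \<epsilon> / 4 * \<kappa> i + \<epsilon> / 4 * \<kappa> i"
     using mult_left_mono[OF \<kappa>p[OF i], of "\<epsilon> / 4"] mult_left_mono[OF \<kappa>1[of i], of "\<epsilon> / 4"] \<epsilon> by linarith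
    finally show ?thesis using \<kappa>1[of i] by (simp add: divide_le_eq)
   qed
   then have "e N <= \<epsilon> / 2" unfolding e_def by (intro cSUP_least) auto
   then show ?thesis using e0[of N] \<epsilon> by simp
  qed
  then show "\<exists>no. \<forall>n\<ge>no. norm (e n - 0) < \<epsilon>" by blast
 qed
 have cb: "\<bar>\<eta> i z $ a\<bar> <= C * \<kappa> i" if "i >= 1" for i a
  using component_le_norm_cart[of "\<eta> i z" a] bd[OF that z] by linarith
 have cd: "\<bar>\<eta> i (s' N) $ a - \<eta> i z $ a\<bar> <= e N * \<kappa> i" if "i >= 1" for i a N
  using component_le_norm_cart[of "\<eta> i (s' N) - \<eta> i z" a] eu[OF that, of N] by simp
 have P: "(%N. (1 / real N) * (\<Sum>i=1..N. \<eta> i (s' N) $ a * \<eta> i (s' N) $ b)) \<longlonglongrightarrow> S $ a $ b" for a b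
  by (rule empirical_product_tendsto[where \<kappa>=\<kappa> and u="%i. \<eta> i z $ a" and v="%i. \<eta> i z $ b", OF elim e0 C0])
   (use \<kappa>1 cb cd B prd in \<open>auto simp: \<eta>_def intro: order_trans[OF zero_le_one]\<close>)
 have m: "(%N. (1 / real N) * (\<Sum>i=1..N. \<eta> i (s' N) $ a * 1)) \<longlonglongrightarrow> 0" for a
 proof (rule empirical_product_tendsto[where \<kappa>=\<kappa> and u="%i. \<eta> i z $ a" and v="%i. 1", OF elim e0, of "C + 1"])
  show "C + 1 >= 0" using C0 by simp
  show "0 <= \<kappa> i" for i using \<kappa>1[of i] by linarith
  show "\<bar>\<eta> i z $ a\<bar> <= (C + 1) * \<kappa> i" if "i >= 1" for i using cb[OF that, of a] \<kappa>1[of i] by (simp add: algebra_simps)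
  show "\<bar>1\<bar> <= (C + 1) * \<kappa> i" for i using mult_mono[of 1 "C + 1" 1 "\<kappa> i"] \<kappa>1[of i] C0 by simp
  show "\<bar>\<eta> i (s' N) $ a - \<eta> i z $ a\<bar> <= e N * \<kappa> i" if "N >= 1" "i >= 1" for N i using cd[OF that(2)] .
  show "\<bar>1 - 1\<bar> <= e N * \<kappa> i" for N i using e0[of N] \<kappa>1[of i] by simp
  show "(1 / real N) * (\<Sum>i=1..N. (\<kappa> i)\<^sup>2) <= B" for N by (rule B)
  show "(%N. (1 / real N) * (\<Sum>i=1..N. \<eta> i z $ a * 1)) \<longlonglongrightarrow> 0" using mean[of a] by (simp add: \<eta>_def)
 qed
 let ?m = "%N. (1 / real N) *\<^sub>R (\<Sum>j=1..N. \<eta> j (s N))"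
 have "(%N. ((1 / real N) *\<^sub>R (\<Sum>i=1..N. outer (\<eta> i (s N) - ?m N) (\<eta> i (s N) - ?m N))) $ a $ b) \<longlonglongrightarrow> S $ a $ b" for a b
 proof -
  have "(%N. (1 / real N) * (\<Sum>i=1..N. \<eta> i (s' N) $ a * \<eta> i (s' N) $ b) -
    ((1 / real N) * (\<Sum>i=1..N. \<eta> i (s' N) $ a * 1)) * ((1 / real N) * (\<Sum>i=1..N. \<eta> i (s' N) $ b * 1))) \<longlonglongrightarrow> S $ a $ b - 0 * 0"
   by (intro tendsto_diff tendsto_mult[OF m m] P)
  then have l: "(%N. (1 / real N) * (\<Sum>i=1..N. \<eta> i (s' N) $ a * \<eta> i (s' N) $ b) -
    ((1 / real N) * (\<Sum>i=1..N. \<eta> i (s' N) $ a)) * ((1 / real N) * (\<Sum>i=1..N. \<eta> i (s' N) $ b))) \<longlonglongrightarrow> S $ a $ b" by simp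
  have eq: "(1 / real N) * (\<Sum>i=1..N. \<eta> i (s' N) $ a * \<eta> i (s' N) $ b) -
    ((1 / real N) * (\<Sum>i=1..N. \<eta> i (s' N) $ a)) * ((1 / real N) * (\<Sum>i=1..N. \<eta> i (s' N) $ b)) =
    ((1 / real N) *\<^sub>R (\<Sum>i=1..N. outer (\<eta> i (s N) - ?m N) (\<eta> i (s N) - ?m N))) $ a $ b" if N: "N >= 1" for N
   unfolding empirical_covariance[OF N, symmetric] using N by (simp add: s'_def outer_def sum_component)
  show ?thesis by (rule Lim_transform_eventually[OF l]) (use eq in \<open>auto simp: eventually_sequentially intro!: exI[of _ 1]\<close>)
 qed
 then show "(%N. (1 / real N) *\<^sub>R (\<Sum>i=1..N. outer
     (by_parts T G G' (y i) (s N) - r (s N) - (1 / real N) *\<^sub>R (\<Sum>j=1..N. by_parts T G G' (y j) (s N) - r (s N)))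
     (by_parts T G G' (y i) (s N) - r (s N) - (1 / real N) *\<^sub>R (\<Sum>j=1..N. by_parts T G G' (y j) (s N) - r (s N))))) \<longlonglongrightarrow> S"
  unfolding \<eta>_def[symmetric] by (intro vec_tendstoI) 
qed

section \<open>The observed records\<close>

text \<open>Fourth moments of the records are needed because the law of large numbers is applied to products of scores.\<close>

lemma wiener_fourth_moment:
 fixes W :: "real => 'w => real^'r::finite"
 assumes pM: "prob_space M" and W: "wiener_process M F T W" and t: "t \<in> {0..T}"
 shows "msq M (%x. (W t x $ k)\<^sup>2) <= ennreal (3 * t\<^sup>2)"
proof (cases "t = 0")
 case True
 have "AE x in M. (W t x $ k)\<^sup>2 = 0" using W True unfolding wiener_process_def by auto
 then have "msq M (%x. (W t x $ k)\<^sup>2) = msq M (%x. 0 :: real)" by (rule msq_cong_AE)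
 then show ?thesis by (simp add: msq_def)
next
 case False
 then have t0: "0 < t" "t <= T" using t by auto
 let ?X = "%x. (W t x - W 0 x) $ k"
 let ?d = "normal_density 0 (sqrt t)"
 have d: "distributed M lborel ?X (%y. ennreal (?d y))"
 proof -
  have "\<forall>s t. 0 <= s \<and> s < t \<and> t <= T \<longrightarrow> (\<forall>k. distributed M lborel (%x. (W t x - W s x) $ k) (normal_density 0 (sqrt (t - s))))"
   using W unfolding wiener_process_def by blast
  from this[rule_format, of 0 t k] t0 show ?thesis by simp
 qed
 have "AE x in M. (W t x $ k)\<^sup>2 = (?X x)\<^sup>2" using W unfolding wiener_process_def by auto
 then have "msq M (%x. (W t x $ k)\<^sup>2) = msq M (%x. (?X x)\<^sup>2)" by (rule msq_cong_AE)
 also have "\<dots> = (\<integral>\<^sup>+x. ennreal ((?X x) ^ (2 * 2)) \<partial>M)" unfolding msq_def by (simp add: power_mult[symmetric])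
 also have "\<dots> = (\<integral>\<^sup>+y. ennreal (?d y) * ennreal (y ^ (2 * 2)) \<partial>lborel)"
  by (rule distributed_nn_integral[OF d, symmetric]) simp
 also have "\<dots> = (\<integral>\<^sup>+y. ennreal (?d y * (y - 0) ^ (2 * 2)) \<partial>lborel)" by (simp add: ennreal_mult)
 also have "\<dots> = ennreal (\<integral>y. ?d y * (y - 0) ^ (2 * 2) \<partial>lborel)"
  using normal_moment_even[of "sqrt t" 0 2] t0
  by (intro nn_integral_eq_integral AE_I2) (auto simp: has_bochner_integral_iff)
 also have "(\<integral>y. ?d y * (y - 0) ^ (2 * 2) \<partial>lborel) = fact (2 * 2) / ((2 / (sqrt t)\<^sup>2)^2 * fact 2)"
  using normal_moment_even[of "sqrt t" 0 2] t0 unfolding has_bochner_integral_iff by simp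
 also have "\<dots> = 3 * t\<^sup>2" using t0 by (simp add: fact_numeral field_simps power2_eq_square)
 finally show ?thesis by simp
qed

text \<open>The state is replaced by a continuous density-matrix valued version, so that the drift of the record is bounded and the
record has moments like those of the noise.\<close>

lemma record_modification:
 fixes \<rho> :: "real => 'w => complex^'d::finite^'d" and W Y :: "real => 'w => real^'r::finite"
 assumes pM: "prob_space M" and filt: "filtration_on M F" and T: "T > 0" and W: "wiener_process M F T W"
  and \<rho>0: "density_matrix \<rho>0" and sme: "sme_solution M F T W H L \<rho>0 \<rho>"
  and Y: "!!t x. Y t x = (LBINT s:{0..t}. b_vec L (\<rho> s x)) + W t x"
 shows "\<exists>Y'. (\<forall>x. continuous_on UNIV (%t. Y' t x)) \<and> (\<forall>t. Y' t \<in> borel_measurable M) \<and>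
  (%(t, x). Y' t x) \<in> borel_measurable (borel \<Otimes>\<^sub>M M) \<and>
  (AE x in M. \<forall>t\<in>{0..T}. Y t x = Y' t x) \<and> (AE x in M. Y' 0 x = 0) \<and>
  (\<forall>k. integrator M F T (%t x. Y' t x $ k)) \<and>
  (\<forall>t\<in>{0..T}. \<forall>k. integrable M (%x. Y' t x $ k) \<and>
    integral\<^sup>L M (%x. Y' t x $ k) = integral {0..t} (%s. b_form (L k) (integral\<^sup>L M (\<rho> s)))) \<and>
  (\<exists>V<\<infinity>. \<forall>t\<in>{0..T}. msq M (%x. (norm (Y' t x))\<^sup>2) <= V)"
proof -
 interpret prob_space M by fact
 have T0: "T >= 0" using T by simp
 obtain \<rho>' where \<rho>': "!!s x. density_matrix (\<rho>' s x)" "!!x. continuous_on UNIV (%s. \<rho>' s x)"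
  "!!s. \<rho>' s \<in> borel_measurable M" "(%(s, x). \<rho>' s x) \<in> borel_measurable (borel \<Otimes>\<^sub>M M)"
  "AE x in M. \<forall>s\<in>{0..T}. \<rho> s x = \<rho>' s x"
  "!!s. s \<in> {0..T} ==> \<exists>J. has_stoch_integral_vec M F W (%k s x. diffusion_op (L k) (\<rho>' s x)) s J \<and>
    (AE x in M. \<rho>' s x = \<rho>0 + (LBINT r:{0..s}. lindblad H L (\<rho>' r x)) + J x)"
  by (rule sme_solution_modification[OF pM filt T0 \<rho>0 sme]) blast
 obtain R where R: "R >= 0" "!!\<rho> :: complex^'d^'d. density_matrix \<rho> ==> norm \<rho> <= R"
  using density_matrix_bounded by blast
 interpret bv: bounded_linear "b_vec L :: _ => real^'r" by (rule bounded_linear_b_vec)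
 obtain A where A: "A >= 0" "!!u. norm (b_vec L u) <= norm u * A" using bv.nonneg_bounded by blast
 define c where "c s x = b_vec L (\<rho>' s x)" for s x
 define K where "K = R * A"
 have K0: "K >= 0" unfolding K_def using R A by simp
 have cK: "norm (c s x) <= K" for s x
  using A(2)[of "\<rho>' s x"] mult_right_mono[OF R(2)[OF \<rho>'(1)[of s x]] A(1)] unfolding c_def K_def by linarith
 have ckK: "\<bar>c s x $ k\<bar> <= K" for s x k using component_le_norm_cart[of "c s x" k] cK[of s x] by linarith
 have cc: "continuous_on UNIV (%s. c s x)" for x unfolding c_def by (rule bv.continuous_on[OF \<rho>'(2)])
 have cc': "continuous_on S (%s. c s x)" for x S by (rule continuous_on_subset[OF cc]) simp
 have bvm: "b_vec L \<in> borel_measurable borel" by (rule borel_measurable_continuous_onI) (rule bv.continuous_on[OF continuous_on_id])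
 have cm: "(%(s, x). c s x) \<in> borel_measurable (borel \<Otimes>\<^sub>M M)"
  using measurable_compose[OF \<rho>'(4) bvm] by (simp add: case_prod_unfold c_def)
 have vm: "(%v. v $ k) \<in> borel_measurable borel" for k :: 'r by (intro borel_measurable_continuous_onI continuous_intros)
 have ckm: "(%(s, x). c s x $ k) \<in> borel_measurable (borel \<Otimes>\<^sub>M M)" for k
  using measurable_compose[OF cm vm] by (simp add: case_prod_unfold)
 define D where "D t x = integral {0..t} (%s. c s x)" for t x
 have Dk: "D t x $ k = (LBINT s:{0..t}. c s x $ k)" for t x k
 proof -
  have "(LBINT s:{0..t}. c s x $ k) = integral {0..t} (%s. c s x $ k)"
   by (intro time_integral_eq continuous_intros cc')
  also have "\<dots> = integral {0..t} (%s. c s x) $ k"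
   using integral_linear[OF integrable_continuous_real[OF cc'] bounded_linear_vec_nth[of k], of 0 t x] by (simp add: o_def)
  finally show ?thesis unfolding D_def by simp
 qed
 have ck_int: "integrator M F T (%t x. D t x $ k)" for k
  unfolding Dk by (rule integrator_drift[OF pM filt ckm ckK])
 have W_int: "integrator M F T (%t x. W t x $ k)" for k
  by (rule scalar_brownian.integrator_brownian[OF wiener_scalar_brownian[OF pM filt W]])
 have Wm: "t \<in> {0..T} ==> W t \<in> borel_measurable M" for t by (rule wiener_measurable[OF filt W])
 define Z where "Z t x = D t x + W t x" for t x
 have Z_int: "integrator M F T (%t x. Z t x $ k)" for k
  using integrator_add[OF ck_int W_int filt] by (simp add: Z_def)
 have Zm: "Z t \<in> borel_measurable M" if "t \<in> {0..T}" for t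
  unfolding borel_measurable_euclidean_space[of "Z t"]
 proof
  fix b :: "real^'r" assume "b \<in> Basis"
  then obtain k where b: "b = axis k 1" by (auto simp: Basis_vec_def)
  have "(%x. Z t x $ k) \<in> borel_measurable M" using Z_int[of k] that unfolding integrator_def by blast
  then show "(%x. Z t x \<bullet> b) \<in> borel_measurable M" by (simp add: b inner_axis)
 qed
 have W0: "AE x in M. W 0 x = 0" using W unfolding wiener_process_def by blast
 have Wc: "AE x in M. continuous_on {0..T} (%t. W t x)" using W unfolding wiener_process_def by blast
 have Dc: "continuous_on {0..T} (%t. D t x)" for x
  unfolding D_def by (intro indefinite_integral_continuous_1 integrable_continuous_real cc')
 have Zc: "AE x in M. continuous_on {0..T} (%t. Z t x)"
  using Wc by eventually_elim (simp add: Z_def continuous_on_add[OF Dc])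
 have YZ: "AE x in M. \<forall>t\<in>{0..T}. Y t x = Z t x"
  using \<rho>'(5)
 proof eventually_elim
  case (elim x)
  show ?case
  proof
   fix t assume t: "t \<in> {0..T}"
   have "(LBINT s:{0..t}. b_vec L (\<rho> s x)) = (LBINT s:{0..t}. c s x)"
    using elim t by (intro set_lebesgue_integral_cong) (auto simp: c_def)
   also have "\<dots> = D t x" unfolding D_def by (rule time_integral_eq[OF cc'])
   finally show "Y t x = Z t x" unfolding Y Z_def by simp
  qed
 qed
 have ZU: "AE x in M. \<forall>t\<in>{0..T}. Z t x \<in> UNIV" by simp
 obtain Y' where "!!t x. Y' t x \<in> UNIV" and Y'c: "!!x. continuous_on UNIV (%t. Y' t x)" and Y'm: "!!t. Y' t \<in> borel_measurable M"
  and Y'j: "(%(t, x). Y' t x) \<in> borel_measurable (borel \<Otimes>\<^sub>M M)" and ZY': "AE x in M. \<forall>t\<in>{0..T}. Z t x = Y' t x"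
  by (rule continuous_modification[OF T0 Zm Zc ZU UNIV_I]) (assumption, rule that)
 have Y'Z: "AE x in M. Y' t x = Z t x" if "t \<in> {0..T}" for t
  using ZY' by eventually_elim (use that in simp)
 have i1: "AE x in M. \<forall>t\<in>{0..T}. Y t x = Y' t x" using YZ ZY' by eventually_elim simp
 have i2: "AE x in M. Y' 0 x = 0"
  using ZY' W0 by eventually_elim (use T in \<open>auto simp: Z_def D_def dest: bspec[of _ _ 0]\<close>)
 have i3: "integrator M F T (%t x. Y' t x $ k)" for k
 proof (rule integrator_cong_AE[OF Z_int])
  show "(%x. Y' t x $ k) \<in> borel_measurable M" for t by (rule measurable_compose[OF Y'm vm])
  show "AE x in M. \<forall>t\<in>{0..T}. Z t x $ k = Y' t x $ k" using ZY' by eventually_elim simp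
 qed
 have \<rho>i: "integrable M (\<rho>' s)" for s
  by (rule integrable_const_bound[of _ R]) (use \<rho>' R in auto)
 have \<rho>e: "expectation (\<rho>' s) = expectation (\<rho> s)" if "s \<in> {0..T}" for s
 proof (rule integral_cong_AE)
  show "\<rho>' s \<in> borel_measurable M" by (rule \<rho>')
  show "\<rho> s \<in> borel_measurable M" using sme that filtration_on_measurable[OF filt] unfolding sme_solution_def by blast
  show "AE x in M. \<rho>' s x = \<rho> s x" using \<rho>'(5) by eventually_elim (use that in simp)
 qed
 have mc: "continuous_on {0..T} (%s. b_form (L k) (expectation (\<rho> s)))" for k
  by (rule bounded_linear.continuous_on[OF bounded_linear_b_form mean_state_equation(1)[OF pM filt T0 W \<rho>0 sme]])
 have i4: "integrable M (%x. Y' t x $ k)"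
  "expectation (%x. Y' t x $ k) = integral {0..t} (%s. b_form (L k) (expectation (\<rho> s)))" if t: "t \<in> {0..T}" for t k
 proof -
  interpret B: scalar_brownian M F T "%t x. W t x $ k" by (rule wiener_scalar_brownian[OF pM filt W])
  have wk: "(%x. W t x $ k) \<in> borel_measurable M" by (rule measurable_compose[OF Wm[OF t] vm])
  have WW: "AE x in M. W t x $ k - W 0 x $ k = W t x $ k" using W0 by eventually_elim simp
  have m0: "(%x. W t x $ k - W 0 x $ k) \<in> borel_measurable M" using B.increment_measurable[of 0 t] t by auto
  have wi: "integrable M (%x. W t x $ k)"
   using B.increment_integrable[of 0 t] t integrable_cong_AE[OF m0 wk WW] by auto
  have "expectation (%x. W t x $ k) = expectation (%x. W t x $ k - W 0 x $ k)"
   by (rule integral_cong_AE[OF wk m0]) (use WW in eventually_elim, simp)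
  also have "\<dots> = 0" using B.mean[of 0 t] t by (cases "t = 0") auto
  finally have we: "expectation (%x. W t x $ k) = 0" .
  have di: "integrable M (%x. D t x $ k)" unfolding Dk by (rule expectation_time_integral(1)[OF ckm ckK])
  have "expectation (%x. D t x $ k) = (LBINT s:{0..t}. expectation (%x. c s x $ k))"
   unfolding Dk by (rule expectation_time_integral(2)[OF ckm ckK])
  also have "\<dots> = (LBINT s:{0..t}. b_form (L k) (expectation (\<rho> s)))"
  proof (intro set_lebesgue_integral_cong allI impI)
   fix s assume "s \<in> {0..t}"
   then have "s \<in> {0..T}" using t by auto
   then show "expectation (%x. c s x $ k) = b_form (L k) (expectation (\<rho> s))"
    using integral_bounded_linear[OF bounded_linear_b_form \<rho>i, of "L k" s] by (simp add: c_def b_vec_def \<rho>e)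
  qed simp
  also have "\<dots> = integral {0..t} (%s. b_form (L k) (expectation (\<rho> s)))"
   using t by (intro time_integral_eq continuous_on_subset[OF mc]) auto
  finally have de: "expectation (%x. D t x $ k) = integral {0..t} (%s. b_form (L k) (expectation (\<rho> s)))" .
  have ym: "(%x. Y' t x $ k) \<in> borel_measurable M" by (rule measurable_compose[OF Y'm vm])
  have sm: "(%x. D t x $ k + W t x $ k) \<in> borel_measurable M" using di wk by simp
  have eq: "AE x in M. Y' t x $ k = D t x $ k + W t x $ k" using Y'Z[OF t] by eventually_elim (simp add: Z_def)
  show "integrable M (%x. Y' t x $ k)" using integrable_cong_AE[OF ym sm eq] di wi by simp
  show "expectation (%x. Y' t x $ k) = integral {0..t} (%s. b_form (L k) (expectation (\<rho> s)))"
   using integral_cong_AE[OF ym sm eq] di wi we de by simp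
 qed
 define V where "V = 2 * ennreal ((2 * (T * K)\<^sup>2)\<^sup>2) + 2 * (ennreal (2\<^sup>2) * (of_nat CARD('r) * (\<Sum>k\<in>(UNIV :: 'r set). ennreal (3 * T\<^sup>2))))"
 have Vfin: "V < \<infinity>" unfolding V_def by (simp add: ennreal_mult_less_top of_nat_less_top)
 have i5: "msq M (%x. (norm (Y' t x))\<^sup>2) <= V" if t: "t \<in> {0..T}" for t
 proof -
  have wk: "(%x. (W t x $ k)\<^sup>2) \<in> borel_measurable M" for k
   using measurable_compose[OF Wm[OF t] vm] by (rule borel_measurable_power)
  have Dn: "norm (D t x) <= T * K" for x
  proof -
   have "norm (D t x) <= integral {0..t} (%s. K)" unfolding D_def
    by (rule integral_norm_bound_integral) (auto intro!: integrable_continuous_real cc' cK)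
   also have "\<dots> = t * K" using t by simp
   also have "\<dots> <= T * K" using t K0 by (intro mult_right_mono) auto
   finally show ?thesis .
  qed
  have Wn: "(norm (W t x))\<^sup>2 = (\<Sum>k\<in>UNIV. (W t x $ k)\<^sup>2)" for x
   unfolding power2_norm_eq_inner inner_vec_def by (simp add: power2_eq_square)
  have "AE x in M. norm ((norm (Y' t x))\<^sup>2) <= norm (2 * (T * K)\<^sup>2 + 2 *\<^sub>R (\<Sum>k\<in>UNIV. (W t x $ k)\<^sup>2))"
   using Y'Z[OF t]
  proof eventually_elim
   case (elim x)
   have "(norm (Y' t x))\<^sup>2 <= 2 * (norm (D t x))\<^sup>2 + 2 * (norm (W t x))\<^sup>2"
    unfolding elim Z_def by (rule power2_norm_add_le)
   also have "\<dots> <= 2 * (T * K)\<^sup>2 + 2 * (norm (W t x))\<^sup>2" using Dn[of x] by (intro add_mono mult_left_mono power_mono) auto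
   finally show ?case unfolding Wn by simp
  qed
  then have "msq M (%x. (norm (Y' t x))\<^sup>2) <= msq M (%x. 2 * (T * K)\<^sup>2 + 2 *\<^sub>R (\<Sum>k\<in>UNIV. (W t x $ k)\<^sup>2))" by (rule msq_mono_AE)
  also have "\<dots> <= 2 * msq M (%x. 2 * (T * K)\<^sup>2) + 2 * msq M (%x. 2 *\<^sub>R (\<Sum>k\<in>UNIV. (W t x $ k)\<^sup>2))"
   using wk by (intro msq_add_le) auto
  also have "msq M (%x. 2 * (T * K)\<^sup>2) = ennreal ((2 * (T * K)\<^sup>2)\<^sup>2)"
   unfolding msq_def by (simp add: emeasure_space_1)
  also have "msq M (%x. 2 *\<^sub>R (\<Sum>k\<in>UNIV. (W t x $ k)\<^sup>2)) = ennreal (2\<^sup>2) * msq M (%x. \<Sum>k\<in>UNIV. (W t x $ k)\<^sup>2)"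
   using wk by (intro msq_scaleR) auto
  also have "2 * ennreal ((2 * (T * K)\<^sup>2)\<^sup>2) + 2 * (ennreal (2\<^sup>2) * msq M (%x. \<Sum>k\<in>UNIV. (W t x $ k)\<^sup>2)) <= V"
   unfolding V_def
  proof (intro add_mono mult_left_mono order_refl)
   have "msq M (%x. \<Sum>k\<in>UNIV. (W t x $ k)\<^sup>2) <= of_nat CARD('r) * (\<Sum>k\<in>UNIV. msq M (%x. (W t x $ k)\<^sup>2))"
    using wk by (intro msq_sum_le) auto
   also have "\<dots> <= of_nat CARD('r) * (\<Sum>k\<in>(UNIV :: 'r set). ennreal (3 * T\<^sup>2))"
   proof (intro mult_left_mono sum_mono)
    fix k :: 'r
    have "msq M (%x. (W t x $ k)\<^sup>2) <= ennreal (3 * t\<^sup>2)" by (rule wiener_fourth_moment[OF pM W t])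
    also have "\<dots> <= ennreal (3 * T\<^sup>2)" using t by (intro ennreal_leI mult_left_mono power_mono) auto
    finally show "msq M (%x. (W t x $ k)\<^sup>2) <= ennreal (3 * T\<^sup>2)" .
   qed simp
   finally show "msq M (%x. \<Sum>k\<in>UNIV. (W t x $ k)\<^sup>2) <= of_nat CARD('r) * (\<Sum>k\<in>(UNIV :: 'r set). ennreal (3 * T\<^sup>2))" .
  qed simp_all
  finally show ?thesis .
 qed
 show ?thesis
  by (intro exI[of _ Y'] conjI allI ballI exI[of _ V] Y'c Y'm Y'j i1 i2 i3 i4 i5 Vfin)
qed

lemma (in noise) path_functional_time_integral:
 fixes Z :: "nat => real => 'w => 'b::euclidean_space"
 assumes pf: "!!t. t \<in> {0..T} ==> path_functional (%i. Z i t)"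
  and c: "!!i x. i >= 1 ==> continuous_on {0..T} (%t. Z i t x)"
 shows "path_functional (%i x. integral {0..T} (%t. Z i t x))"
proof -
 have T0: "T >= 0" using T by simp
 let ?S = "%n i x. \<Sum>j<Suc n. (T / real (Suc n)) *\<^sub>R Z i (grid T (Suc n) j) x"
 have S: "path_functional (?S n)" for n
 proof (rule path_functional_sum)
  fix j assume "j \<in> {..<Suc n}"
  then have "grid T (Suc n) j \<in> {0..T}" using grid_in[OF T0, of j "Suc n"] by simp
  then show "path_functional (%i x. (T / real (Suc n)) *\<^sub>R Z i (grid T (Suc n) j) x)"
   by (intro path_functional_compose[where f="%z. (T / real (Suc n)) *\<^sub>R z"] pf continuous_intros)
 qed simp
 have l: "(%n. ?S n i x) \<longlonglongrightarrow> integral {0..T} (%t. Z i t x)" if "i >= 1" for i x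
  by (rule riemann_sum_tendsto[OF T0 c[OF that]])
 show ?thesis
 proof (rule path_functional_limit_AE[OF S])
  fix i :: nat assume i: "i >= 1"
  show "(%x. integral {0..T} (%t. Z i t x)) \<in> borel_measurable M"
   by (rule borel_measurable_LIMSEQ_metric[OF path_functional_measurable[OF S i] l[OF i]])
  show "AE x in M. (%n. ?S n i x) \<longlonglongrightarrow> integral {0..T} (%t. Z i t x)" by (intro AE_I2 l i)
 qed
qed

lemma (in noise) path_functional_by_parts:
 fixes y :: "nat => real => 'w => real^'r" and g g' :: "'r => real => 'a::metric_space => 'b::euclidean_space"
 assumes pf: "!!t. t \<in> {0..T} ==> path_functional (%i. y i t)"
  and c: "!!i x. i >= 1 ==> continuous_on {0..T} (%t. y i t x)"
  and g: "!!k. time_C1 T K (g k) (g' k)" and \<theta>: "\<theta> \<in> K"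
 shows "path_functional (%i x. by_parts T g g' (%t. y i t x) \<theta>)"
 unfolding by_parts_def
proof (rule path_functional_sum)
 fix k :: 'r
 have TT: "T \<in> {0..T}" using T by simp
 have 1: "path_functional (%i x. y i t x $ k *\<^sub>R v)" if "t \<in> {0..T}" for t and v :: 'b
  by (intro path_functional_compose[where f="%z. z $ k *\<^sub>R v"] pf that continuous_intros)
 have 2: "path_functional (%i x. integral {0..T} (%t. y i t x $ k *\<^sub>R g' k t \<theta>))"
  by (intro path_functional_time_integral 1 continuous_intros c time_C1_slice(2)[OF g \<theta>])
 show "path_functional (%i x. y i T x $ k *\<^sub>R g k T \<theta> - integral {0..T} (%t. y i t x $ k *\<^sub>R g' k t \<theta>))"
  by (rule path_functional_compose2[where f="%a b. a - b", OF 1[OF TT] 2]) (intro continuous_intros)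
qed simp

lemma (in noise) path_functional_path_size:
 fixes y :: "nat => real => 'w => real^'r"
 assumes pf: "!!t. t \<in> {0..T} ==> path_functional (%i. y i t)"
  and c: "!!i x. i >= 1 ==> continuous_on {0..T} (%t. y i t x)"
 shows "path_functional (%i x. path_size T (%t. y i t x))"
 unfolding path_size_def
proof (rule path_functional_add)
 have n: "path_functional (%i x. norm (y i t x))" if "t \<in> {0..T}" for t
  by (intro path_functional_compose[where f=norm] pf that continuous_intros)
 show "path_functional (%i x. norm (y i T x))" using T by (intro n) simp
 show "path_functional (%i x. integral {0..T} (%t. norm (y i t x)))"
  by (intro path_functional_time_integral n continuous_intros c)
qed

text \<open>The integral of the squared deviation of the norm of y from its time average is nonnegative.\<close>

lemma path_size_square:
 assumes T: "T > 0" and y: "continuous_on {0..T} y"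
 shows "(path_size T y)\<^sup>2 <= 2 * (norm (y T))\<^sup>2 + 2 * (T * integral {0..T} (%s. (norm (y s))\<^sup>2))"
proof -
 define I where "I = integral {0..T} (%s. norm (y s))"
 define Q where "Q = integral {0..T} (%s. (norm (y s))\<^sup>2)"
 have i: "(%s. norm (y s)) integrable_on {0..T}" "(%s. (norm (y s))\<^sup>2) integrable_on {0..T}"
  "(%s. (norm (y s) - I / T)\<^sup>2) integrable_on {0..T}"
  by (intro integrable_continuous_real continuous_intros y)+
 have "0 <= integral {0..T} (%s. (norm (y s) - I / T)\<^sup>2)" using i(3) by (intro integral_nonneg) auto
 also have "\<dots> = integral {0..T} (%s. ((norm (y s))\<^sup>2 - 2 * (I / T) * norm (y s)) + (I / T)\<^sup>2)"
  by (intro integral_cong) (simp add: power2_diff)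
 also have "\<dots> = (Q - 2 * (I / T) * I) + T * (I / T)\<^sup>2"
 proof -
  have j: "(%s. 2 * (I / T) * norm (y s)) integrable_on {0..T}" by (intro integrable_continuous_real continuous_intros y)
  have "integral {0..T} (%s. ((norm (y s))\<^sup>2 - 2 * (I / T) * norm (y s)) + (I / T)\<^sup>2) =
    (Q - integral {0..T} (%s. 2 * (I / T) * norm (y s))) + integral {0..T} (%s. (I / T)\<^sup>2)"
   unfolding Q_def Henstock_Kurzweil_Integration.integral_diff[OF i(2) j, symmetric]
   by (rule Henstock_Kurzweil_Integration.integral_add[OF integrable_diff[OF i(2) j] integrable_const_ivl])
  also have "integral {0..T} (%s. 2 * (I / T) * norm (y s)) = 2 * (I / T) * I" unfolding I_def by (rule integral_mult_right)
  also have "integral {0..T} (%s. (I / T)\<^sup>2) = T * (I / T)\<^sup>2" using T by simp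
  finally show ?thesis .
 qed
 also have "\<dots> = Q - I\<^sup>2 / T" using T by (simp add: power2_eq_square field_simps)
 finally have "I\<^sup>2 <= T * Q" using T by (simp add: field_simps)
 then show ?thesis using power2_norm_add_le[of "norm (y T)" I] unfolding path_size_def I_def Q_def by simp
qed

lemma msq_path_size_square:
 fixes y :: "real => 'w => real^'r::finite"
 assumes pM: "prob_space M" and T: "T > 0" and c: "!!x. continuous_on UNIV (%t. y t x)"
  and ym: "!!t. y t \<in> borel_measurable M" and yj: "(%(t, x). y t x) \<in> borel_measurable (borel \<Otimes>\<^sub>M M)"
  and V: "V < \<infinity>" "!!t. t \<in> {0..T} ==> msq M (%x. (norm (y t x))\<^sup>2) <= V"
  and pm: "(%x. path_size T (%t. y t x)) \<in> borel_measurable M"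
 shows "msq M (%x. (1 + path_size T (%t. y t x))\<^sup>2) < \<infinity>"
proof -
 interpret prob_space M by fact
 let ?R = "restrict_space lborel {0..T}"
 interpret R: finite_measure ?R by (rule finite_measure_restrict_lborel)
 have T0: "T >= 0" "T \<in> {0..T}" using T by auto
 have c': "continuous_on S (%t. y t x)" for S x by (rule continuous_on_subset[OF c]) simp
 define Q where "Q x = integral {0..T} (%s. (norm (y s x))\<^sup>2)" for x
 have qj: "(%(s, x). (norm (y s x))\<^sup>2) \<in> borel_measurable (time_space T M)"
  using measurable_time_spaceI[OF yj, of T] by (simp add: case_prod_unfold)
 have si: "set_integrable lborel {0..T} (%s. (norm (y s x))\<^sup>2)" for x
  by (intro borel_integrable_atLeastAtMost' continuous_intros c')
 have ri: "integrable ?R (%s. (norm (y s x))\<^sup>2)" for x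
  using si unfolding set_integrable_def by (subst integrable_restrict_space) simp_all
 have QR: "Q x = (\<integral>s. (norm (y s x))\<^sup>2 \<partial>?R)" for x
 proof -
  have "(\<integral>s. (norm (y s x))\<^sup>2 \<partial>?R) = (LBINT s:{0..T}. (norm (y s x))\<^sup>2)"
   unfolding set_lebesgue_integral_def by (rule integral_restrict_space) simp
  then show ?thesis unfolding Q_def by (simp add: time_integral_eq continuous_on_power continuous_on_norm c')
 qed
 have "msq M Q <= ennreal T * msq (time_space T M) (%(s, x). (norm (y s x))\<^sup>2)"
  unfolding QR[abs_def] by (rule msq_time_integral_le[OF pM T0(1) qj ri])
 also have "msq (time_space T M) (%(s, x). (norm (y s x))\<^sup>2) = (\<integral>\<^sup>+s. msq M (%x. (norm (y s x))\<^sup>2) \<partial>?R)"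
 proof -
  have "(%p. ennreal ((norm (case p of (s, x) => (norm (y s x))\<^sup>2))\<^sup>2)) \<in> borel_measurable (time_space T M)"
   using qj by measurable
  from nn_integral_fst[OF this, symmetric] show ?thesis unfolding msq_def by simp
 qed
 also have "\<dots> <= (\<integral>\<^sup>+s. V \<partial>?R)" by (intro nn_integral_mono V(2)) (simp add: space_restrict_space)
 also have "\<dots> = V * emeasure ?R (space ?R)" by simp
 finally have "msq M Q <= ennreal T * (V * emeasure ?R (space ?R))" by (simp add: mult_left_mono)
 also have "\<dots> < \<infinity>" using V(1) T0(1) by (simp add: ennreal_mult_less_top emeasure_restrict_space)
 finally have Qf: "msq M Q < \<infinity>" .
 have Qm [measurable]: "Q \<in> borel_measurable M"
 proof -
  have "(%(x, s). (norm (y s x))\<^sup>2) \<in> borel_measurable (M \<Otimes>\<^sub>M ?R)" using measurable_pair_swap[OF qj] by simp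
  from R.borel_measurable_lebesgue_integral[OF this] show ?thesis unfolding QR[abs_def] .
 qed
 have nm [measurable]: "(%x. (norm (y T x))\<^sup>2) \<in> borel_measurable M" using ym[of T] by simp
 have "msq M (%x. (1 + path_size T (%t. y t x))\<^sup>2) <= msq M (%x. 2 + 4 *\<^sub>R ((norm (y T x))\<^sup>2 + T *\<^sub>R Q x))"
 proof (rule msq_mono_AE, rule AE_I2)
  fix x
  have "(1 + path_size T (%t. y t x))\<^sup>2 <= 2 + 2 * (path_size T (%t. y t x))\<^sup>2"
   using power2_norm_add_le[of 1 "path_size T (%t. y t x)"] by simp
  also have "\<dots> <= 2 + 4 *\<^sub>R ((norm (y T x))\<^sup>2 + T *\<^sub>R Q x)"
   using path_size_square[OF T c'[of "{0..T}" x]] unfolding Q_def by simp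
  finally show "norm ((1 + path_size T (%t. y t x))\<^sup>2) <= norm (2 + 4 *\<^sub>R ((norm (y T x))\<^sup>2 + T *\<^sub>R Q x))" by simp
 qed
 also have "\<dots> <= 2 * msq M (%x. 2 :: real) + 2 * msq M (%x. 4 *\<^sub>R ((norm (y T x))\<^sup>2 + T *\<^sub>R Q x))"
  by (intro msq_add_le) measurable
 also have "msq M (%x. 4 *\<^sub>R ((norm (y T x))\<^sup>2 + T *\<^sub>R Q x)) = ennreal (4\<^sup>2) * msq M (%x. (norm (y T x))\<^sup>2 + T *\<^sub>R Q x)"
  by (intro msq_scaleR) measurable
 also have "2 * msq M (%x. 2 :: real) + 2 * (ennreal (4\<^sup>2) * msq M (%x. (norm (y T x))\<^sup>2 + T *\<^sub>R Q x)) < \<infinity>"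
 proof -
  have "msq M (%x. (norm (y T x))\<^sup>2 + T *\<^sub>R Q x) <= 2 * msq M (%x. (norm (y T x))\<^sup>2) + 2 * msq M (%x. T *\<^sub>R Q x)"
   by (intro msq_add_le) measurable
  also have "msq M (%x. T *\<^sub>R Q x) = ennreal (T\<^sup>2) * msq M Q" by (intro msq_scaleR) measurable
  also have "2 * msq M (%x. (norm (y T x))\<^sup>2) + 2 * (ennreal (T\<^sup>2) * msq M Q) < \<infinity>"
   using V(2)[OF T0(2)] V(1) Qf by (auto simp: ennreal_mult_less_top intro: order.strict_trans1)
  finally have "msq M (%x. (norm (y T x))\<^sup>2 + T *\<^sub>R Q x) < \<infinity>" .
  moreover have "msq M (%x. 2 :: real) < \<infinity>" unfolding msq_def by (simp add: emeasure_space_1)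
  ultimately show ?thesis by (auto simp: ennreal_mult_less_top)
 qed
 finally show ?thesis .
qed

text \<open>At a fixed parameter the identity holds almost surely, hence almost surely at all parameters of a countable dense
set. Both sides are continuous in the parameter, which extends it to all parameters, and in particular to random ones.\<close>

lemma continuous_version_by_parts:
 fixes g g' :: "'r::finite => real => 'a::euclidean_space => 'b::euclidean_space"
  and B B' :: "real => 'w => real^'r"
 assumes pM: "prob_space M" and filt: "filtration_on M F" and T: "T >= 0"
  and int: "!!k. integrator M F T (%t x. B' t x $ k)" and cont: "!!x. continuous_on {0..T} (%t. B' t x)"
  and B0: "AE x in M. B' 0 x = 0" and eq: "AE x in M. \<forall>t\<in>{0..T}. B t x = B' t x"
  and g: "!!k. time_C1 T K (g k) (g' k)" and K: "compact K"
  and Z: "continuous_integral_version M F B T K (%\<theta> k t. g k t \<theta>) Z"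
 shows "AE x in M. \<forall>\<theta>\<in>K. Z \<theta> x = by_parts T g g' (%t. B' t x) \<theta>"
  and "[|\<theta> \<in> K; !!k t. t \<in> {0..T} ==> integrable M (%x. B' t x $ k);
    !!k t. t \<in> {0..T} ==> integral\<^sup>L M (%x. B' t x $ k) = integral {0..t} (m k); !!k. continuous_on {0..T} (m k)|] ==>
    integrable M (Z \<theta>) \<and> integral\<^sup>L M (Z \<theta>) = (\<Sum>k\<in>UNIV. integral {0..T} (%t. m k t *\<^sub>R g k t \<theta>))"
proof -
 have J: "\<exists>J. (\<forall>k. has_stoch_integral M F (%t x. B' t x $ k) (%t _. g k t \<theta>) T (J k)) \<and>
   Z \<theta> \<in> borel_measurable M \<and> (AE x in M. Z \<theta> x = (\<Sum>k\<in>UNIV. J k x))" if \<theta>: "\<theta> \<in> K" for \<theta>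
 proof -
  have "has_stoch_integral_vec M F B (%k t _. g k t \<theta>) T (Z \<theta>)"
   using Z \<theta> unfolding continuous_integral_version_def by blast
  then obtain J where J: "!!k. has_stoch_integral M F (%t x. B t x $ k) (%t _. g k t \<theta>) T (J k)"
   "Z \<theta> \<in> borel_measurable M" "AE x in M. Z \<theta> x = (\<Sum>k\<in>UNIV. J k x)"
   unfolding has_stoch_integral_vec_def by blast
  have "AE x in M. \<forall>t\<in>{0..T}. B t x $ k = B' t x $ k" for k using eq by eventually_elim simp
  then have "has_stoch_integral M F (%t x. B' t x $ k) (%t _. g k t \<theta>) T (J k)" for k
   by (rule has_stoch_integral_cong_AE[OF J(1)])
  then show ?thesis using J(2,3) by blast
 qed
 have ck: "AE x in M. continuous_on {0..T} (%t. B' t x $ k)" for k by (intro AE_I2 continuous_intros cont)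
 have zk: "AE x in M. B' 0 x $ k = 0" for k using B0 by eventually_elim simp
 have pt: "AE x in M. Z \<theta> x = by_parts T g g' (%t. B' t x) \<theta>" if \<theta>: "\<theta> \<in> K" for \<theta>
 proof -
  obtain J where J: "\<forall>k. has_stoch_integral M F (%t x. B' t x $ k) (%t _. g k t \<theta>) T (J k)"
   "AE x in M. Z \<theta> x = (\<Sum>k\<in>UNIV. J k x)" using J[OF \<theta>] by blast
  have "AE x in M. J k x = B' T x $ k *\<^sub>R g k T \<theta> - integral {0..T} (%t. B' t x $ k *\<^sub>R g' k t \<theta>)" for k
   by (rule smooth_stoch_integral(1)[OF pM filt T int ck zk time_C1_slice(3)[OF g \<theta>] time_C1_slice(2)[OF g \<theta>] J(1)[rule_format]])
  then have "AE x in M. \<forall>k\<in>UNIV. J k x = B' T x $ k *\<^sub>R g k T \<theta> - integral {0..T} (%t. B' t x $ k *\<^sub>R g' k t \<theta>)"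
   by (intro AE_finite_allI) auto
  with J(2) show ?thesis unfolding by_parts_def by eventually_elim simp
 qed
 obtain D where D: "countable D" "D \<subseteq> K" "K \<subseteq> closure D" by (rule separable)
 have "AE x in M. \<forall>\<theta>\<in>D. Z \<theta> x = by_parts T g g' (%t. B' t x) \<theta>"
  using D pt by (subst AE_ball_countable) auto
 moreover have "AE x in M. continuous_on K (%\<theta>. Z \<theta> x)" using Z unfolding continuous_integral_version_def by blast
 ultimately show "AE x in M. \<forall>\<theta>\<in>K. Z \<theta> x = by_parts T g g' (%t. B' t x) \<theta>"
 proof eventually_elim
  case (elim x)
  have c: "continuous_on K (%\<theta>. Z \<theta> x - by_parts T g g' (%t. B' t x) \<theta>)"
   by (intro continuous_on_diff elim(2) by_parts_continuous[OF g K T cont])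
  have "closed {\<theta> \<in> K. Z \<theta> x - by_parts T g g' (%t. B' t x) \<theta> = 0}"
   by (rule continuous_closed_preimage_constant[OF c compact_imp_closed[OF K]])
  then have "closure D \<subseteq> {\<theta> \<in> K. Z \<theta> x - by_parts T g g' (%t. B' t x) \<theta> = 0}"
   using elim(1) D(2) by (intro closure_minimal) auto
  then show ?case using D(3) by auto
 qed
 assume \<theta>: "\<theta> \<in> K" and i: "!!k t. t \<in> {0..T} ==> integrable M (%x. B' t x $ k)"
  and e: "!!k t. t \<in> {0..T} ==> integral\<^sup>L M (%x. B' t x $ k) = integral {0..t} (m k)" and mc: "!!k. continuous_on {0..T} (m k)"
 obtain J where J: "\<forall>k. has_stoch_integral M F (%t x. B' t x $ k) (%t _. g k t \<theta>) T (J k)"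
  "Z \<theta> \<in> borel_measurable M" "AE x in M. Z \<theta> x = (\<Sum>k\<in>UNIV. J k x)" using J[OF \<theta>] by blast
 have Jk: "integrable M (J k) \<and> integral\<^sup>L M (J k) = integral {0..T} (%t. m k t *\<^sub>R g k t \<theta>)" for k
  by (rule smooth_stoch_integral(2)[OF pM filt T int ck zk time_C1_slice(3)[OF g \<theta>] time_C1_slice(2)[OF g \<theta>] J(1)[rule_format] i e mc])
 have s: "integrable M (%x. \<Sum>k\<in>UNIV. J k x)" using Jk by (intro Bochner_Integration.integrable_sum) blast
 have "integrable M (Z \<theta>)" using integrable_cong_AE[OF J(2) borel_measurable_integrable[OF s] J(3)] s by blast
 moreover have "integral\<^sup>L M (Z \<theta>) = integral\<^sup>L M (%x. \<Sum>k\<in>UNIV. J k x)"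
  by (rule integral_cong_AE[OF J(2) borel_measurable_integrable[OF s] J(3)])
 ultimately show "integrable M (Z \<theta>) \<and> integral\<^sup>L M (Z \<theta>) = (\<Sum>k\<in>UNIV. integral {0..T} (%t. m k t *\<^sub>R g k t \<theta>))"
  using Jk by (simp add: Bochner_Integration.integral_sum)
qed

text \<open>The integral in the record is a limit of Riemann sums of states that depend on the noise in the same way for every i.\<close>

lemma (in noise) path_functional_record:
 fixes \<rho> :: "nat => real => 'w => complex^'d::finite^'d"
 assumes \<rho>0: "density_matrix \<rho>0" and sme: "!!i. i >= 1 ==> sme_solution M F T (W i) H L \<rho>0 (\<rho> i)" and t: "t \<in> {0..T}"
  and Zm: "!!i. i >= 1 ==> Z i \<in> borel_measurable M"
  and Z: "!!i. i >= 1 ==> AE x in M. (LBINT s:{0..t}. b_vec L (\<rho> i s x)) + W i t x = Z i x"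
 shows "path_functional Z"
proof -
 let ?X = "%n i x. (\<Sum>j<Suc n. (t / real (Suc n)) *\<^sub>R b_vec L (\<rho> i (grid t (Suc n) j) x)) + W i t x"
 have t0: "t >= 0" using t by simp
 interpret bv: bounded_linear "b_vec L :: _ => real^'r" by (rule bounded_linear_b_vec)
 have X: "path_functional (?X n)" for n
 proof (rule path_functional_add[OF path_functional_sum path_functional_noise[OF t]])
  fix j assume "j \<in> {..<Suc n}"
  then have "grid t (Suc n) j \<in> {0..t}" using grid_in[OF t0, of j "Suc n"] by simp
  then have "grid t (Suc n) j \<in> {0..T}" using t by auto
  then have "path_functional (%i. \<rho> i (grid t (Suc n) j))" by - (rule path_functional_sme[OF \<rho>0 sme], assumption+)
  then show "path_functional (%i x. (t / real (Suc n)) *\<^sub>R b_vec L (\<rho> i (grid t (Suc n) j) x))"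
   by (rule path_functional_compose[where f="%z. (t / real (Suc n)) *\<^sub>R b_vec L z"])
    (intro continuous_intros bv.continuous_on)
 qed simp
 show ?thesis
 proof (rule path_functional_limit_AE[OF X Zm])
  fix i :: nat assume i: "i >= 1"
  have "AE x in M. continuous_on {0..T} (%s. \<rho> i s x)" using sme[OF i] unfolding sme_solution_def by blast
  then show "AE x in M. (%n. ?X n i x) \<longlonglongrightarrow> Z i x"
   using Z[OF i]
  proof eventually_elim
   case (elim x)
   have "continuous_on {0..t} (%s. \<rho> i s x)" by (rule continuous_on_subset[OF elim(1)]) (use t in auto)
   then have c: "continuous_on {0..t} (%s. b_vec L (\<rho> i s x))" by (rule bv.continuous_on)
   have "(%n. ?X n i x) \<longlonglongrightarrow> integral {0..t} (%s. b_vec L (\<rho> i s x)) + W i t x"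
    by (intro tendsto_add tendsto_const riemann_sum_tendsto[OF t0 c])
   then show ?case unfolding elim(2)[symmetric] time_integral_eq[OF c] .
  qed
 qed
qed

lemma (in noise) slln_dominated:
 fixes X :: "nat => 'w => real"
 assumes X: "path_functional X" and le: "!!x. \<bar>X 1 x\<bar> <= C * S x" and S: "S \<in> borel_measurable M" "msq M S < \<infinity>"
 shows "AE x in M. (%N. (1 / real N) * (\<Sum>i=1..N. X i x)) \<longlonglongrightarrow> expectation (X 1)" "integrable M (X 1)"
proof -
 have "msq M (X 1) <= msq M (%x. C *\<^sub>R S x)"
  by (rule msq_mono_AE, rule AE_I2) (use le in \<open>auto intro: order_trans[OF _ abs_ge_self]\<close>)
 also have "\<dots> = ennreal (C\<^sup>2) * msq M S" by (rule msq_scaleR[OF S(1)])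
 also have "\<dots> < \<infinity>" using S(2) by (simp add: ennreal_mult_less_top)
 finally have f: "msq M (X 1) < \<infinity>" .
 show "AE x in M. (%N. (1 / real N) * (\<Sum>i=1..N. X i x)) \<longlonglongrightarrow> expectation (X 1)" by (rule path_functional_slln[OF X f])
 show "integrable M (X 1)" by (rule msq_finite_integrable1[OF path_functional_measurable[OF X] f]) simp
qed

lemma tendsto_matrix_mult:
 fixes A :: "nat => real^'n^'m" and B :: "nat => real^'k^'n"
 assumes "A \<longlonglongrightarrow> A'" "B \<longlonglongrightarrow> B'"
 shows "(%n. A n ** B n) \<longlonglongrightarrow> A' ** B'"
 by (intro vec_tendstoI) (auto simp: matrix_matrix_mult_def intro!: tendsto_intros tendsto_vec_nth assms)

section \<open>Consistency of the covariance estimators\<close>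

theorem theorem3p3:
  fixes M :: "'w measure"
    and F :: "real \<Rightarrow> 'w measure"
    and T :: real
    and \<Theta>o \<Theta> :: "(real^'p::finite) set"
    and \<theta>0 :: "real^'p"
    and A :: "'p set"
    and \<alpha> \<beta> :: "real^'p \<Rightarrow> real^'p"
    and H :: "real^'p \<Rightarrow> complex^'d::finite^'d"
    and L :: "real^'p \<Rightarrow> 'r::finite \<Rightarrow> complex^'d^'d"
    and W :: "nat \<Rightarrow> real \<Rightarrow> 'w \<Rightarrow> real^'r"
    and \<rho>0 :: "complex^'d^'d"
    and \<rho> :: "real^'p \<Rightarrow> nat \<Rightarrow> real \<Rightarrow> 'w \<Rightarrow> complex^'d^'d"
    and \<rho>bar :: "real^'p \<Rightarrow> real \<Rightarrow> complex^'d^'d"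
    and h :: "real \<Rightarrow> real^'p \<Rightarrow> real^'r"
    and Dh :: "real \<Rightarrow> real^'p \<Rightarrow> real^'r^'p"
    and Y Ybar :: "nat \<Rightarrow> real \<Rightarrow> 'w \<Rightarrow> real^'r"
    and \<I> :: "real^'p \<Rightarrow> real^'p^'p"
    and JPhi :: "nat \<Rightarrow> real^'p \<Rightarrow> 'w \<Rightarrow> real"
    and Jeta :: "nat \<Rightarrow> real^'p \<Rightarrow> 'w \<Rightarrow> real^'p"
    and \<Phi> :: "nat \<Rightarrow> real^'p \<Rightarrow> 'w \<Rightarrow> real"
    and \<theta>hat :: "nat \<Rightarrow> 'w \<Rightarrow> real^'p"
    and \<eta> :: "nat \<Rightarrow> real^'p \<Rightarrow> 'w \<Rightarrow> real^'p"
    and \<Sigma> :: "real^'p^'p"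
    and \<eta>hat :: "nat \<Rightarrow> nat \<Rightarrow> 'w \<Rightarrow> real^'p"
    and \<eta>bar :: "nat \<Rightarrow> 'w \<Rightarrow> real^'p"
    and \<Sigma>hat Ihat Vhat :: "nat \<Rightarrow> 'w \<Rightarrow> real^'p^'p"
  assumes "\<Theta> = closure \<Theta>o"
    and "\<alpha> = sub_coords A"
    and "\<beta> = sub_coords (- A)"
    and "\<rho>bar = (\<lambda>\<theta> t. integral\<^sup>L M (\<rho> \<theta> 1 t))"
    and "h = (\<lambda>t \<theta>. b_vec (L (\<beta> \<theta>)) (\<rho>bar \<theta> t))"
    and "Dh = (\<lambda>t. grad_closure \<Theta>o (h t))"
    and "Y = (\<lambda>i t x. (LBINT s:{0..t}. b_vec (L (\<beta> \<theta>0)) (\<rho> \<theta>0 i s x)) + W i t x)"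
    and "Ybar = (\<lambda>N t x. (1 / real N) *\<^sub>R (\<Sum>i=1..N. Y i t x))"
    and "\<I> = (\<lambda>\<theta>. LBINT t:{0..T}. Dh t \<theta> ** transpose (Dh t \<theta>))"
    and "\<Phi> = (\<lambda>N \<theta> x. JPhi N \<theta> x - 1/2 * (LBINT t:{0..T}. (norm (h t \<theta>))\<^sup>2))"
    and "\<eta> = (\<lambda>i \<theta> x. Jeta i \<theta> x - (LBINT t:{0..T}. Dh t \<theta> *v h t \<theta>))"
    and "\<Sigma> = integral\<^sup>L M (\<lambda>x. outer (\<eta> 1 \<theta>0 x) (\<eta> 1 \<theta>0 x))"
    and "\<eta>hat = (\<lambda>N i x. \<eta> i (\<theta>hat N x) x)"
    and "\<eta>bar = (\<lambda>N x. (1 / real N) *\<^sub>R (\<Sum>i=1..N. \<eta>hat N i x))"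
    and "\<Sigma>hat = (\<lambda>N x. (1 / real N) *\<^sub>R
           (\<Sum>i=1..N. outer (\<eta>hat N i x - \<eta>bar N x) (\<eta>hat N i x - \<eta>bar N x)))"
    and "Ihat = (\<lambda>N x. \<I> (\<theta>hat N x))"
    and "Vhat = (\<lambda>N x. if invertible (Ihat N x)
           then matrix_inv (Ihat N x) ** \<Sigma>hat N x ** matrix_inv (Ihat N x) else 0)"
    and "prob_space M" and "filtration_on M F" and "T > 0"
    and "open \<Theta>o" and "convex \<Theta>o" and "bounded \<Theta>o" and "\<theta>0 \<in> \<Theta>o"
    and "\<forall>\<theta>\<in>\<Theta>. adj (H (\<alpha> \<theta>)) = H (\<alpha> \<theta>)"
    and "\<forall>i\<ge>1. wiener_process M F T (W i)"
    and "prob_space.indep_vars M (\<lambda>_. Pi\<^sub>M {0..T} (\<lambda>_. borel)) (\<lambda>i x. \<lambda>t\<in>{0..T}. W i t x) {1..}"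
    and "density_matrix \<rho>0"
    and "\<forall>\<theta>\<in>\<Theta>. \<forall>i\<ge>1. sme_solution M F T (W i) (H (\<alpha> \<theta>)) (L (\<beta> \<theta>)) \<rho>0 (\<rho> \<theta> i)"
    \<comment> \<open>versions of the stochastic integrals in \<Phi> and \<eta>, continuous in \<theta>\<close>
    and "\<forall>N\<ge>1. continuous_integral_version M F (Ybar N) T \<Theta> (\<lambda>\<theta> k t. h t \<theta> $ k) (JPhi N)"
    and "\<forall>i\<ge>1. continuous_integral_version M F (Y i) T \<Theta> (\<lambda>\<theta> k t. column k (Dh t \<theta>)) (Jeta i)"
    and "\<forall>N\<ge>1. \<theta>hat N \<in> borel_measurable M \<and>
           (AE x in M. \<theta>hat N x \<in> \<Theta> \<and> (\<forall>\<theta>\<in>\<Theta>. \<Phi> N \<theta> x \<le> \<Phi> N (\<theta>hat N x) x))"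
    \<comment> \<open>(a), (b), (c)\<close>
    and "Ck_closure 2 \<Theta>o (\<lambda>\<theta>. H (\<alpha> \<theta>))"
    and "\<forall>k. Ck_closure 2 \<Theta>o (\<lambda>\<theta>. L (\<beta> \<theta>) k)"
    and "\<forall>\<theta>\<in>\<Theta>. \<theta> \<noteq> \<theta>0 \<longrightarrow> (\<exists>t\<in>{0..T}. h t \<theta> \<noteq> h t \<theta>0)"
    and "pos_definite (\<I> \<theta>0)"
  shows "(AE x in M. (\<lambda>N. \<Sigma>hat N x) \<longlonglongrightarrow> \<Sigma>) \<and>
         (AE x in M. (\<lambda>N. Vhat N x) \<longlonglongrightarrow> matrix_inv (\<I> \<theta>0) ** \<Sigma> ** matrix_inv (\<I> \<theta>0))"
proof -
 note \<Theta> = assms(1) and \<rho>bar = assms(4) and h = assms(5) and Dh = assms(6) and Y = assms(7) and Ybar = assms(8)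
  and \<I> = assms(9) and \<Phi> = assms(10) and \<eta> = assms(11) and \<Sigma> = assms(12) and pM = assms(18) and filt' = assms(19) and \<rho>0 = assms(28)
 interpret noise M F T W
 proof (rule noise.intro[OF pM], rule noise_axioms.intro)
  show "wiener_process M F T (W i)" if "i >= 1" for i using assms(26) that by blast
 qed (rule assms)+
 have T0: "T >= 0" and TT: "T \<in> {0..T}" using T by auto
 have cK: "compact \<Theta>" unfolding \<Theta> using assms(23) by simp
 have \<theta>0: "\<theta>0 \<in> \<Theta>" unfolding \<Theta> using assms(24) closure_subset by blast
 have sme: "sme_solution M F T (W i) (H (\<alpha> \<theta>)) (L (\<beta> \<theta>)) \<rho>0 (\<rho> \<theta> i)" if "\<theta> \<in> \<Theta>" "i >= 1" for \<theta> i
  using assms(29) that by blast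
 \<comment> \<open>the mean state solves a linear equation whose coefficients depend smoothly on the parameter\<close>
 have reg: "\<exists>g'. \<forall>k. time_C1 T \<Theta> (%t \<theta>. h t \<theta> $ k) (g' k)" "\<exists>g'. \<forall>k. time_C1 T \<Theta> (%t \<theta>. column k (Dh t \<theta>)) (g' k)"
 proof -
  have HC: "\<exists>D. C1_closure \<Theta>o (%\<theta>. H (\<alpha> \<theta>)) D" by (rule Ck_closure_imp_C1[OF assms(33)])
  have LC: "\<exists>D. C1_closure \<Theta>o (%\<theta>. L (\<beta> \<theta>) k) D" for k by (rule Ck_closure_imp_C1[OF assms(34)[rule_format]])
  have mc: "continuous_on {0..T} (\<rho>bar \<theta>)" if "\<theta> \<in> closure \<Theta>o" for \<theta>
   using mean_state_equation(1)[OF pM filt' T0 wiener[OF order_refl] \<rho>0 sme[OF _ order_refl]] that unfolding \<Theta> \<rho>bar by simp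
  have me: "\<rho>bar \<theta> t = \<rho>0 + integral {0..t} (%s. lindblad (H (\<alpha> \<theta>)) (L (\<beta> \<theta>)) (\<rho>bar \<theta> s))" if "\<theta> \<in> closure \<Theta>o" "t \<in> {0..T}" for \<theta> t
   using mean_state_equation(2)[OF pM filt' T0 wiener[OF order_refl] \<rho>0 sme[OF _ order_refl] that(2)] that(1) unfolding \<Theta> \<rho>bar by simp
  have he: "h t \<theta> = b_vec (L (\<beta> \<theta>)) (\<rho>bar \<theta> t)" for t \<theta> unfolding h ..
  show "\<exists>g'. \<forall>k. time_C1 T \<Theta> (%t \<theta>. h t \<theta> $ k) (g' k)"
   using mean_signal_time_C1(1)[OF assms(21-23) HC LC mc me he] unfolding \<Theta> .
  show "\<exists>g'. \<forall>k. time_C1 T \<Theta> (%t \<theta>. column k (Dh t \<theta>)) (g' k)"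
   using mean_signal_time_C1(2)[OF assms(21-23) HC LC mc me he] unfolding \<Theta> Dh .
 qed
 from reg(1) obtain h' where h'all: "\<forall>k. time_C1 T \<Theta> (%t \<theta>. h t \<theta> $ k) (h' k)" ..
 from reg(2) obtain G' where G'all: "\<forall>k. time_C1 T \<Theta> (%t \<theta>. column k (Dh t \<theta>)) (G' k)" ..
 define hc where "hc k t \<theta> = h t \<theta> $ k" for k t \<theta>
 define G where "G k t \<theta> = column k (Dh t \<theta>)" for k t \<theta>
 have hC1: "time_C1 T \<Theta> (hc k) (h' k)" for k using h'all unfolding hc_def by blast
 have GC1: "time_C1 T \<Theta> (G k) (G' k)" for k using G'all unfolding G_def by blast
 have hj: "continuous_on ({0..T} \<times> \<Theta>) (%p. h (fst p) (snd p))"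
 proof -
  have "continuous_on ({0..T} \<times> \<Theta>) (%p. \<chi> k. hc k (fst p) (snd p))"
   by (intro continuous_on_vec_lambda) (use hC1 in \<open>simp add: time_C1_def\<close>)
  then show ?thesis by (simp add: hc_def)
 qed
 have Dj: "continuous_on ({0..T} \<times> \<Theta>) (%p. Dh (fst p) (snd p))"
 proof -
  have "continuous_on ({0..T} \<times> \<Theta>) (%p. G k (fst p) (snd p))" for k using GC1[of k] unfolding time_C1_def by blast
  then have "continuous_on ({0..T} \<times> \<Theta>) (%p. \<chi> a k. G k (fst p) (snd p) $ a)"
   by (intro continuous_on_vec_lambda bounded_linear.continuous_on[OF bounded_linear_vec_nth])
  then show ?thesis by (rule continuous_on_eq) (simp add: vec_eq_iff G_def column_def)
 qed
 have slice: "continuous_on {0..T} (%t. f t \<theta>)" if f: "continuous_on ({0..T} \<times> \<Theta>) (%p. f (fst p) (snd p))" and \<theta>: "\<theta> \<in> \<Theta>"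
  for f :: "real => real^'p => 'z::euclidean_space" and \<theta>
 proof -
  have c: "continuous_on {0..T} (%t. (t, \<theta>))" by (intro continuous_intros)
  have i: "(%t. (t, \<theta>)) ` {0..T} \<subseteq> {0..T} \<times> \<Theta>" using \<theta> by auto
  show ?thesis using continuous_on_compose2[OF f c i] by simp
 qed
 have h0j: "continuous_on ({0..T} \<times> \<Theta>) (%p. h (fst p) \<theta>0)"
  by (rule continuous_on_compose2[OF slice[OF hj \<theta>0], where f=fst]) (auto intro: continuous_intros)
 define q where "q \<theta> = 1/2 * (LBINT t:{0..T}. (norm (h t \<theta>))\<^sup>2)" for \<theta>
 define r where "r \<theta> = (LBINT t:{0..T}. Dh t \<theta> *v h t \<theta>)" for \<theta>
 define \<mu> where "\<mu> \<theta> = (LBINT t:{0..T}. h t \<theta>0 \<bullet> h t \<theta>)" for \<theta>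
 have vj: "continuous_on ({0..T} \<times> \<Theta>) (%p. Dh (fst p) (snd p) *v h (fst p) (snd p))"
  unfolding matrix_vector_mult_def by (intro continuous_on_vec_lambda continuous_intros Dj hj)
 have qc: "continuous_on \<Theta> q"
  unfolding q_def by (intro continuous_on_mult continuous_on_const time_integral_continuous continuous_intros hj)
 have rc: "continuous_on \<Theta> r" unfolding r_def by (intro time_integral_continuous vj)
 have \<mu>c: "continuous_on \<Theta> \<mu>" unfolding \<mu>_def by (intro time_integral_continuous continuous_intros hj h0j)
 have \<I>c: "continuous_on \<Theta> \<I>"
 proof -
  have eq: "A ** transpose A = (\<chi> i j. \<Sum>k\<in>UNIV. A $ i $ k * A $ j $ k)" for A :: "real^'r^'p"
   by (simp add: matrix_matrix_mult_def transpose_def)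
  show ?thesis unfolding \<I> eq
   by (intro time_integral_continuous continuous_on_vec_lambda continuous_on_sum continuous_on_mult bounded_linear.continuous_on[OF bounded_linear_vec_nth] Dj)
 qed
 \<comment> \<open>the limit of the contrast, with identifiability\<close>
 have mx: "\<mu> \<theta> - q \<theta> < \<mu> \<theta>0 - q \<theta>0" if \<theta>: "\<theta> \<in> \<Theta>" "\<theta> \<noteq> \<theta>0" for \<theta>
 proof -
  have c: "continuous_on {0..T} (%t. h t \<theta>)" if "\<theta> \<in> \<Theta>" for \<theta> by (rule slice[OF hj that])
  have "\<mu> \<theta> - q \<theta> = integral {0..T} (%t. h t \<theta>0 \<bullet> h t \<theta>) - 1/2 * integral {0..T} (%t. (norm (h t \<theta>))\<^sup>2)" if "\<theta> \<in> \<Theta>" for \<theta>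
   unfolding \<mu>_def q_def using c[OF that] c[OF \<theta>0] by (simp add: time_integral_eq continuous_on_inner continuous_on_power continuous_on_norm)
  then show ?thesis
   using signal_contrast_maximal[OF T c[OF \<theta>(1)] c[OF \<theta>0]] assms(35) \<theta> \<theta>0 by simp
 qed
 \<comment> \<open>versions of the records that are continuous at every outcome, so that pathwise estimates need no exceptional set\<close>
 have "\<forall>i. \<exists>Y'. i >= 1 \<longrightarrow> ((\<forall>x. continuous_on UNIV (%t. Y' t x)) \<and> (\<forall>t. Y' t \<in> borel_measurable M) \<and>
  (%(t, x). Y' t x) \<in> borel_measurable (borel \<Otimes>\<^sub>M M) \<and>
  (AE x in M. \<forall>t\<in>{0..T}. Y i t x = Y' t x) \<and> (AE x in M. Y' 0 x = 0) \<and>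
  (\<forall>k. integrator M F T (%t x. Y' t x $ k)) \<and>
  (\<forall>t\<in>{0..T}. \<forall>k. integrable M (%x. Y' t x $ k) \<and>
    integral\<^sup>L M (%x. Y' t x $ k) = integral {0..t} (%s. b_form (L (\<beta> \<theta>0) k) (integral\<^sup>L M (\<rho> \<theta>0 i s)))) \<and>
  (\<exists>V<\<infinity>. \<forall>t\<in>{0..T}. msq M (%x. (norm (Y' t x))\<^sup>2) <= V))" (is "\<forall>i. \<exists>Y'. i >= 1 \<longrightarrow> ?P i Y'")
 proof
  fix i
  show "\<exists>Y'. i >= 1 \<longrightarrow> ?P i Y'"
  proof (cases "i >= 1")
   case True
   have Yi: "Y i t x = (LBINT s:{0..t}. b_vec (L (\<beta> \<theta>0)) (\<rho> \<theta>0 i s x)) + W i t x" for t x unfolding Y ..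
   have "\<exists>Y'. ?P i Y'" by (rule record_modification[OF pM filt' T wiener[OF True] \<rho>0 sme[OF \<theta>0 True] Yi])
   then show ?thesis by blast
  qed blast
 qed
 from choice[OF this] obtain y where y: "\<forall>i. i >= 1 \<longrightarrow> ?P i (y i)" ..
 have yc: "continuous_on S (%t. y i t x)" if "i >= 1" for i x S
 proof -
  have "continuous_on UNIV (%t. y i t x)" using y that by blast
  then show ?thesis by (rule continuous_on_subset) simp
 qed
 have ym: "y i t \<in> borel_measurable M" if "i >= 1" for i t using y that by blast
 have yj: "(%(t, x). y 1 t x) \<in> borel_measurable (borel \<Otimes>\<^sub>M M)" using y[rule_format, of 1] by blast
 have yY: "AE x in M. \<forall>t\<in>{0..T}. Y i t x = y i t x" if "i >= 1" for i using y that by blast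
 have y0: "AE x in M. y i 0 x = 0" if "i >= 1" for i using y that by blast
 have yint: "integrator M F T (%t x. y i t x $ k)" if "i >= 1" for i k using y that by blast
 have yi: "integrable M (%x. y 1 t x $ k)" if "t \<in> {0..T}" for t k using y[rule_format, of 1] that by blast
 have ye: "expectation (%x. y 1 t x $ k) = integral {0..t} (%s. hc k s \<theta>0)" if "t \<in> {0..T}" for t k
 proof -
  have "expectation (%x. y 1 t x $ k) = integral {0..t} (%s. b_form (L (\<beta> \<theta>0) k) (integral\<^sup>L M (\<rho> \<theta>0 1 s)))"
   using y[rule_format, of 1] that by blast
  then show ?thesis by (simp add: hc_def h \<rho>bar b_vec_def)
 qed
 have "\<exists>V<\<infinity>. \<forall>t\<in>{0..T}. msq M (%x. (norm (y 1 t x))\<^sup>2) <= V" using y[rule_format, of 1] by blast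
 then obtain V where V: "V < \<infinity>" "!!t. t \<in> {0..T} ==> msq M (%x. (norm (y 1 t x))\<^sup>2) <= V" by blast
 have pfy: "path_functional (%i. y i t)" if t: "t \<in> {0..T}" for t
 proof (rule path_functional_record[OF \<rho>0 sme[OF \<theta>0] t])
  show "y i t \<in> borel_measurable M" if "i >= 1" for i by (rule ym[OF that])
  show "AE x in M. (LBINT s:{0..t}. b_vec (L (\<beta> \<theta>0)) (\<rho> \<theta>0 i s x)) + W i t x = y i t x" if "i >= 1" for i
   using yY[OF that]
  proof eventually_elim
   case (elim x)
   then have "Y i t x = y i t x" using t by blast
   then show ?case unfolding Y .
  qed
 qed
 have m0c: "continuous_on {0..T} (%s. hc k s \<theta>0)" for k by (rule time_C1_slice(1)[OF hC1 \<theta>0])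
 \<comment> \<open>the stochastic integrals are functionals of these versions, simultaneously for all parameters\<close>
 define \<psi> where "\<psi> i \<theta> x = by_parts T hc h' (%t. y i t x) \<theta>" for i \<theta> x
 define \<zeta> where "\<zeta> i \<theta> x = by_parts T G G' (%t. y i t x) \<theta> - r \<theta>" for i \<theta> x
 have JetaV: "continuous_integral_version M F (Y i) T \<Theta> (%\<theta> k t. G k t \<theta>) (Jeta i)" if "i >= 1" for i
  using assms(31) that unfolding G_def by blast
 have JPhiV: "continuous_integral_version M F (Ybar N) T \<Theta> (%\<theta> k t. hc k t \<theta>) (JPhi N)" if "N >= 1" for N
  using assms(30) that unfolding hc_def by blast
 have eta_eq: "AE x in M. \<forall>i. i >= 1 \<longrightarrow> (\<forall>\<theta>\<in>\<Theta>. \<eta> i \<theta> x = \<zeta> i \<theta> x)"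
  unfolding AE_all_countable
 proof
  fix i
  show "AE x in M. i >= 1 \<longrightarrow> (\<forall>\<theta>\<in>\<Theta>. \<eta> i \<theta> x = \<zeta> i \<theta> x)"
  proof (cases "i >= 1")
   case True
   show ?thesis
    using continuous_version_by_parts(1)[OF pM filt' T0 yint[OF True] yc[OF True] y0[OF True] yY[OF True] GC1 cK JetaV[OF True]]
    by eventually_elim (simp add: \<eta> \<zeta>_def r_def)
  qed simp
 qed
 define yb where "yb N t x = (1 / real N) *\<^sub>R (\<Sum>i=1..N. y i t x)" for N t x
 have ybY: "AE x in M. \<forall>t\<in>{0..T}. Ybar N t x = yb N t x" for N
 proof -
  have "AE x in M. \<forall>i\<in>{1..N}. \<forall>t\<in>{0..T}. Y i t x = y i t x" by (rule AE_finite_allI) (use yY in auto)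
  then show ?thesis by eventually_elim (simp add: Ybar yb_def)
 qed
 have yb0: "AE x in M. yb N 0 x = 0" for N
 proof -
  have "AE x in M. \<forall>i\<in>{1..N}. y i 0 x = 0" using y0 by (intro AE_finite_allI) auto
  then show ?thesis by eventually_elim (simp add: yb_def)
 qed
 have ybc: "continuous_on {0..T} (%t. yb N t x)" for N x
  unfolding yb_def using yc by (intro continuous_intros) auto
 have ybint: "integrator M F T (%t x. yb N t x $ k)" for N k
 proof -
  have "integrator M F T (%t x. \<Sum>i\<in>{1..N}. y i t x $ k)" using yint by (intro integrator_sum filt') auto
  from integrator_scale[OF this filt', of "1 / real N"] show ?thesis by (simp add: yb_def sum_component)
 qed
 have Phi_eq: "AE x in M. \<forall>N. N >= 1 \<longrightarrow> (\<forall>\<theta>\<in>\<Theta>. \<Phi> N \<theta> x = (1 / real N) * (\<Sum>i=1..N. \<psi> i \<theta> x) - q \<theta>)"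
  unfolding AE_all_countable
 proof
  fix N
  show "AE x in M. N >= 1 \<longrightarrow> (\<forall>\<theta>\<in>\<Theta>. \<Phi> N \<theta> x = (1 / real N) * (\<Sum>i=1..N. \<psi> i \<theta> x) - q \<theta>)"
  proof (cases "N >= 1")
   case True
   \<comment> \<open>integration by parts is linear in the path, so the averaged record gives the averaged contrast\<close>
   have lin: "by_parts T hc h' (%t. yb N t x) \<theta> = (1 / real N) * (\<Sum>i=1..N. \<psi> i \<theta> x)" if "\<theta> \<in> \<Theta>" for x \<theta>
    using by_parts_mean[where y="%i t. y i t x" and I="{1..N}" and c="1 / real N", OF hC1 that] yc by (simp add: yb_def \<psi>_def)
   show ?thesis
    using continuous_version_by_parts(1)[OF pM filt' T0 ybint ybc yb0 ybY hC1 cK JPhiV[OF True]]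
    by eventually_elim (simp add: \<Phi> q_def lin)
  qed simp
 qed
 \<comment> \<open>one dominating variable for the contrast, the scores and their products\<close>
 define S where "S x = (1 + path_size T (%t. y 1 t x))\<^sup>2" for x
 have pfs: "path_functional (%i x. path_size T (%t. y i t x))" by (rule path_functional_path_size[OF pfy yc])
 have sm: "(%x. path_size T (%t. y 1 t x)) \<in> borel_measurable M" by (rule path_functional_measurable[OF pfs]) simp
 have Sm: "S \<in> borel_measurable M" unfolding S_def[abs_def] using sm by measurable
 have Sf: "msq M S < \<infinity>" unfolding S_def[abs_def]
  by (rule msq_path_size_square[OF pM T yc ym yj V sm]) simp_all
 have S1: "1 + path_size T (%t. y 1 t x) <= S x" "path_size T (%t. y 1 t x) >= 0" for x
  using path_size_nonneg[OF yc[of 1]] self_le_power[of "1 + path_size T (%t. y 1 t x)" 2] unfolding S_def by auto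
 have size: "AE x in M. convergent (%N. (1 / real N) * (\<Sum>i=1..N. (1 + path_size T (%t. y i t x))\<^sup>2))"
 proof -
  have pf: "path_functional (%i x. (1 + path_size T (%t. y i t x))\<^sup>2)"
   by (rule path_functional_compose[where f="%z. (1 + z)\<^sup>2", OF pfs]) (intro continuous_intros)
  have "AE x in M. (%N. (1 / real N) * (\<Sum>i=1..N. (1 + path_size T (%t. y i t x))\<^sup>2)) \<longlonglongrightarrow> expectation S"
   using slln_dominated(1)[OF pf _ Sm Sf, of 1] unfolding S_def[abs_def] by simp
  then show ?thesis by eventually_elim (auto simp: convergent_def)
 qed
 obtain C1 where C1: "C1 >= 0 \<and> (\<forall>y. continuous_on {0..T} y \<longrightarrow> (\<forall>\<theta>\<in>\<Theta>. norm (by_parts T hc h' y \<theta>) <= C1 * path_size T y))"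
  using by_parts_regular(1)[OF hC1 cK T0] ..
 obtain C2 where C2: "C2 >= 0 \<and> (\<forall>y. continuous_on {0..T} y \<longrightarrow> (\<forall>\<theta>\<in>\<Theta>. norm (by_parts T G G' y \<theta>) <= C2 * path_size T y))"
  using by_parts_regular(1)[OF GC1 cK T0] ..
 have \<psi>lim: "AE x in M. (%N. (1 / real N) * (\<Sum>i=1..N. \<psi> i \<theta> x)) \<longlonglongrightarrow> \<mu> \<theta>" if \<theta>: "\<theta> \<in> \<Theta>" for \<theta>
 proof -
  have pf: "path_functional (%i. \<psi> i \<theta>)" unfolding \<psi>_def by (rule path_functional_by_parts[OF pfy yc hC1 \<theta>])
  have le: "\<bar>\<psi> 1 \<theta> x\<bar> <= C1 * S x" for x
  proof -
   have "\<bar>\<psi> 1 \<theta> x\<bar> <= C1 * path_size T (%t. y 1 t x)" using C1 yc[of 1] \<theta> unfolding \<psi>_def by simp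
   also have "\<dots> <= C1 * S x" using S1[of x] C1 by (intro mult_left_mono) auto
   finally show ?thesis .
  qed
  have Y1: "AE x in M. \<forall>t\<in>{0..T}. Ybar 1 t x = y 1 t x" using yY[of 1] by (simp add: Ybar)
  note V1 = continuous_version_by_parts[OF pM filt' T0 yint[OF order_refl] yc[OF order_refl] y0[OF order_refl] Y1 hC1 cK JPhiV[OF order_refl]]
  have e: "integrable M (JPhi 1 \<theta>) \<and> expectation (JPhi 1 \<theta>) = (\<Sum>k\<in>UNIV. integral {0..T} (%t. hc k t \<theta>0 *\<^sub>R hc k t \<theta>))"
   by (rule V1(2)[OF \<theta> yi ye m0c])
  have "expectation (\<psi> 1 \<theta>) = expectation (JPhi 1 \<theta>)"
  proof (rule integral_cong_AE)
   show "\<psi> 1 \<theta> \<in> borel_measurable M" by (rule path_functional_measurable[OF pf]) simp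
   show "JPhi 1 \<theta> \<in> borel_measurable M" using e by auto
   show "AE x in M. \<psi> 1 \<theta> x = JPhi 1 \<theta> x" using V1(1) by eventually_elim (simp add: \<psi>_def \<theta>)
  qed
  also have "\<dots> = integral {0..T} (%t. \<Sum>k\<in>UNIV. hc k t \<theta>0 *\<^sub>R hc k t \<theta>)"
   using e time_C1_slice(1)[OF hC1 \<theta>] m0c
   by (subst Henstock_Kurzweil_Integration.integral_sum) (auto intro!: integrable_continuous_real continuous_intros)
  also have "\<dots> = integral {0..T} (%t. h t \<theta>0 \<bullet> h t \<theta>)" by (simp add: inner_vec_def hc_def)
  also have "\<dots> = \<mu> \<theta>" unfolding \<mu>_def using slice[OF hj \<theta>] slice[OF hj \<theta>0] by (intro time_integral_eq[symmetric] continuous_intros)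
  finally have "expectation (\<psi> 1 \<theta>) = \<mu> \<theta>" .
  with slln_dominated(1)[OF pf le Sm Sf] show ?thesis by simp
 qed
 have pf\<zeta>: "path_functional (%i. \<zeta> i \<theta>0)"
 proof -
  have "path_functional (%i x. by_parts T G G' (%t. y i t x) \<theta>0)" by (rule path_functional_by_parts[OF pfy yc GC1 \<theta>0])
  then show ?thesis unfolding \<zeta>_def
   by (rule path_functional_compose[where f="%z. z - r \<theta>0"]) (intro continuous_intros)
 qed
 have \<zeta>m: "\<zeta> 1 \<theta>0 \<in> borel_measurable M" by (rule path_functional_measurable[OF pf\<zeta>]) simp
 define C where "C = C2 + norm (r \<theta>0)"
 have C0: "C >= 0" unfolding C_def using C2 by simp
 have \<zeta>le: "norm (\<zeta> 1 \<theta>0 x) <= C * (1 + path_size T (%t. y 1 t x))" for x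
 proof -
  have "norm (\<zeta> 1 \<theta>0 x) <= norm (by_parts T G G' (%t. y 1 t x) \<theta>0) + norm (r \<theta>0)" unfolding \<zeta>_def by (rule norm_triangle_ineq4)
  also have "norm (by_parts T G G' (%t. y 1 t x) \<theta>0) <= C2 * path_size T (%t. y 1 t x)" using C2 yc[of 1] \<theta>0 by simp
  also have "C2 * path_size T (%t. y 1 t x) + norm (r \<theta>0) <= C * (1 + path_size T (%t. y 1 t x))"
   unfolding C_def using C2 S1(2)[of x] by (simp add: algebra_simps)
  finally show ?thesis by simp
 qed
 have \<zeta>a: "\<bar>\<zeta> 1 \<theta>0 x $ a\<bar> <= C * (1 + path_size T (%t. y 1 t x))" for x a
  using component_le_norm_cart[of "\<zeta> 1 \<theta>0 x" a] \<zeta>le[of x] by linarith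
 have pf\<zeta>a: "path_functional (%i x. \<zeta> i \<theta>0 x $ a)" for a
  by (rule path_functional_compose[where f="%z. z $ a", OF pf\<zeta>]) (intro continuous_intros)
 have e\<zeta>: "integrable M (\<zeta> 1 \<theta>0) \<and> expectation (\<zeta> 1 \<theta>0) = 0"
 proof -
  note V1 = continuous_version_by_parts[OF pM filt' T0 yint[OF order_refl] yc[OF order_refl] y0[OF order_refl] yY[OF order_refl] GC1 cK JetaV[OF order_refl]]
  have e: "integrable M (Jeta 1 \<theta>0) \<and> expectation (Jeta 1 \<theta>0) = (\<Sum>k\<in>UNIV. integral {0..T} (%t. hc k t \<theta>0 *\<^sub>R G k t \<theta>0))"
   by (rule V1(2)[OF \<theta>0 yi ye m0c])
  have "(\<Sum>k\<in>UNIV. integral {0..T} (%t. hc k t \<theta>0 *\<^sub>R G k t \<theta>0)) = integral {0..T} (%t. \<Sum>k\<in>UNIV. hc k t \<theta>0 *\<^sub>R G k t \<theta>0)"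
   using time_C1_slice(1)[OF GC1 \<theta>0] m0c
   by (subst Henstock_Kurzweil_Integration.integral_sum) (auto intro!: integrable_continuous_real continuous_intros)
  also have "\<dots> = integral {0..T} (%t. Dh t \<theta>0 *v h t \<theta>0)"
   by (simp add: matrix_mult_sum hc_def G_def scalar_mult_eq_scaleR)
  also have "\<dots> = r \<theta>0" unfolding r_def by (intro time_integral_eq[symmetric] slice[OF vj \<theta>0])
  finally have er: "expectation (Jeta 1 \<theta>0) = r \<theta>0" using e by simp
  have ae: "AE x in M. \<zeta> 1 \<theta>0 x = Jeta 1 \<theta>0 x - r \<theta>0" using V1(1) by eventually_elim (simp add: \<zeta>_def \<theta>0)
  have i: "integrable M (%x. Jeta 1 \<theta>0 x - r \<theta>0)" using e by simp
  have "integrable M (\<zeta> 1 \<theta>0)" using integrable_cong_AE[OF \<zeta>m borel_measurable_integrable[OF i] ae] i by simp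
  moreover have "expectation (\<zeta> 1 \<theta>0) = expectation (%x. Jeta 1 \<theta>0 x - r \<theta>0)"
   by (rule integral_cong_AE[OF \<zeta>m borel_measurable_integrable[OF i] ae])
  ultimately show ?thesis using e er by (simp add: prob_space)
 qed
 have mean: "AE x in M. \<forall>a. (%N. (1 / real N) * (\<Sum>i=1..N. \<zeta> i \<theta>0 x $ a)) \<longlonglongrightarrow> 0"
 proof -
  have "AE x in M. (%N. (1 / real N) * (\<Sum>i=1..N. \<zeta> i \<theta>0 x $ a)) \<longlonglongrightarrow> 0" for a
  proof -
   have le: "\<bar>\<zeta> 1 \<theta>0 x $ a\<bar> <= C * S x" for x
    using \<zeta>a[of x a] mult_left_mono[OF S1(1)[of x] C0] by linarith
   have "expectation (%x. \<zeta> 1 \<theta>0 x $ a) = expectation (\<zeta> 1 \<theta>0) $ a"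
    by (rule integral_bounded_linear[OF bounded_linear_vec_nth]) (use e\<zeta> in blast)
   then show ?thesis using slln_dominated(1)[OF pf\<zeta>a le Sm Sf] e\<zeta> by simp
  qed
  then have "AE x in M. \<forall>a\<in>UNIV. (%N. (1 / real N) * (\<Sum>i=1..N. \<zeta> i \<theta>0 x $ a)) \<longlonglongrightarrow> 0" by (intro AE_finite_allI) auto
  then show ?thesis by simp
 qed
 have prd: "AE x in M. \<forall>a b. (%N. (1 / real N) * (\<Sum>i=1..N. \<zeta> i \<theta>0 x $ a * \<zeta> i \<theta>0 x $ b)) \<longlonglongrightarrow> \<Sigma> $ a $ b"
 proof -
  have oc: "continuous_on UNIV (%v :: real^'p. outer v v)"
   unfolding outer_def by (intro continuous_on_vec_lambda continuous_intros)
  have pp: "path_functional (%i x. \<zeta> i \<theta>0 x $ a * \<zeta> i \<theta>0 x $ b)" for a b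
   by (rule path_functional_compose[where f="%z. z $ a * z $ b", OF pf\<zeta>]) (intro continuous_intros)
  have le: "\<bar>\<zeta> 1 \<theta>0 x $ a * \<zeta> 1 \<theta>0 x $ b\<bar> <= C\<^sup>2 * S x" for x a b
  proof -
   have "\<bar>\<zeta> 1 \<theta>0 x $ a * \<zeta> 1 \<theta>0 x $ b\<bar> <= (C * (1 + path_size T (%t. y 1 t x))) * (C * (1 + path_size T (%t. y 1 t x)))"
    unfolding abs_mult using C0 S1(2)[of x] by (intro mult_mono \<zeta>a) auto
   also have "\<dots> = C\<^sup>2 * S x" unfolding S_def by (simp add: power2_eq_square algebra_simps)
   finally show ?thesis .
  qed
  note sl = slln_dominated[OF pp le Sm Sf]
  have om: "(%x. outer (\<zeta> 1 \<theta>0 x) (\<zeta> 1 \<theta>0 x)) \<in> borel_measurable M"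
   by (rule borel_measurable_continuous_on[OF oc \<zeta>m])
  have oi: "integrable M (%x. outer (\<zeta> 1 \<theta>0 x) (\<zeta> 1 \<theta>0 x))"
  proof (rule Bochner_Integration.integrable_bound[OF _ om])
   show "integrable M (%x. \<Sum>a\<in>UNIV. \<Sum>b\<in>UNIV. \<bar>\<zeta> 1 \<theta>0 x $ a * \<zeta> 1 \<theta>0 x $ b\<bar>)"
    by (intro Bochner_Integration.integrable_sum integrable_abs sl(2))
   show "AE x in M. norm (outer (\<zeta> 1 \<theta>0 x) (\<zeta> 1 \<theta>0 x)) <= norm (\<Sum>a\<in>UNIV. \<Sum>b\<in>UNIV. \<bar>\<zeta> 1 \<theta>0 x $ a * \<zeta> 1 \<theta>0 x $ b\<bar>)"
   proof (rule AE_I2)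
    fix x
    let ?o = "outer (\<zeta> 1 \<theta>0 x) (\<zeta> 1 \<theta>0 x)"
    have "norm ?o <= (\<Sum>a\<in>UNIV. norm (?o $ a))" by (simp add: norm_vec_def L2_set_le_sum)
    also have "\<dots> <= (\<Sum>a\<in>UNIV. \<Sum>b\<in>UNIV. \<bar>?o $ a $ b\<bar>)" by (intro sum_mono norm_le_l1_cart)
    finally show "norm ?o <= norm (\<Sum>a\<in>UNIV. \<Sum>b\<in>UNIV. \<bar>\<zeta> 1 \<theta>0 x $ a * \<zeta> 1 \<theta>0 x $ b\<bar>)"
     unfolding outer_def by (simp add: sum_nonneg)
   qed
  qed
  have oe: "\<Sigma> = expectation (%x. outer (\<zeta> 1 \<theta>0 x) (\<zeta> 1 \<theta>0 x))"
  proof -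
   have ae: "AE x in M. \<eta> 1 \<theta>0 x = \<zeta> 1 \<theta>0 x" using eta_eq by eventually_elim (simp add: \<theta>0)
   have Jm: "Jeta 1 \<theta>0 \<in> borel_measurable M"
    using assms(31) \<theta>0 unfolding continuous_integral_version_def has_stoch_integral_vec_def by blast
   have "\<eta> 1 \<theta>0 \<in> borel_measurable M" unfolding \<eta> using Jm by simp
   then have "(%x. outer (\<eta> 1 \<theta>0 x) (\<eta> 1 \<theta>0 x)) \<in> borel_measurable M" by (rule borel_measurable_continuous_on[OF oc])
   then show ?thesis unfolding \<Sigma> using om by (rule integral_cong_AE) (use ae in eventually_elim, simp)
  qed
  have \<Sigma>e: "\<Sigma> $ a $ b = expectation (%x. \<zeta> 1 \<theta>0 x $ a * \<zeta> 1 \<theta>0 x $ b)" for a b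
  proof -
   have bl: "bounded_linear (%A :: real^'p^'p. A $ a $ b)"
    by (rule bounded_linear_compose[OF bounded_linear_vec_nth bounded_linear_vec_nth])
   show ?thesis unfolding oe using integral_bounded_linear[OF bl oi] by (simp add: outer_def)
  qed
  have "AE x in M. \<forall>a\<in>UNIV. \<forall>b\<in>UNIV. (%N. (1 / real N) * (\<Sum>i=1..N. \<zeta> i \<theta>0 x $ a * \<zeta> i \<theta>0 x $ b)) \<longlonglongrightarrow> \<Sigma> $ a $ b"
   unfolding \<Sigma>e by (intro AE_finite_allI sl(1)) auto
  then show ?thesis by simp
 qed
 obtain D where D: "countable D" "D \<subseteq> \<Theta>" "\<Theta> \<subseteq> closure D" by (rule separable)
 have \<psi>D: "AE x in M. \<forall>\<theta>\<in>D. (%N. (1 / real N) * (\<Sum>i=1..N. \<psi> i \<theta> x)) \<longlonglongrightarrow> \<mu> \<theta>"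
  using D \<psi>lim by (subst AE_ball_countable) auto
 have arg: "AE x in M. \<forall>N. N >= 1 \<longrightarrow> \<theta>hat N x \<in> \<Theta> \<and> (\<forall>\<theta>\<in>\<Theta>. \<Phi> N \<theta> x <= \<Phi> N (\<theta>hat N x) x)"
  unfolding AE_all_countable
 proof
  fix N show "AE x in M. N >= 1 \<longrightarrow> \<theta>hat N x \<in> \<Theta> \<and> (\<forall>\<theta>\<in>\<Theta>. \<Phi> N \<theta> x <= \<Phi> N (\<theta>hat N x) x)"
   using assms(32) by (cases "N >= 1") simp_all
 qed
 have main: "AE x in M. (%N. \<theta>hat N x) \<longlonglongrightarrow> \<theta>0 \<and> (%N. \<Sigma>hat N x) \<longlonglongrightarrow> \<Sigma>"
  using eta_eq Phi_eq size \<psi>D mean prd arg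
 proof eventually_elim
  case (elim x)
  have hat: "\<theta>hat N x \<in> \<Theta>" if "N >= 1" for N using elim(7) that by blast
  have mxN: "(1 / real N) * (\<Sum>i=1..N. by_parts T hc h' (%t. y i t x) \<theta>) - q \<theta> \<le>
    (1 / real N) * (\<Sum>i=1..N. by_parts T hc h' (%t. y i t x) (\<theta>hat N x)) - q (\<theta>hat N x)" if "N >= 1" "\<theta> \<in> \<Theta>" for N \<theta>
  proof -
   have "\<Phi> N \<theta> x <= \<Phi> N (\<theta>hat N x) x" using elim(7) that by blast
   moreover have "\<Phi> N \<theta> x = (1 / real N) * (\<Sum>i=1..N. \<psi> i \<theta> x) - q \<theta>" if "\<theta> \<in> \<Theta>" for \<theta>
    using elim(2) that \<open>N >= 1\<close> by blast
   ultimately show ?thesis using that(2) hat[OF that(1)] unfolding \<psi>_def by simp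
  qed
  have cyi: "i >= 1 ==> continuous_on {0..T} (%t. y i t x)" for i by (rule yc)
  note cons = pathwise_consistency[where y="%i t. y i t x" and s="%N. \<theta>hat N x" and S=\<Sigma>, OF T0 cK \<theta>0 D(2,3) hC1 GC1 qc rc cyi elim(3)
    elim(4)[unfolded \<psi>_def, rule_format] \<mu>c mx elim(5)[unfolded \<zeta>_def, rule_format] elim(6)[unfolded \<zeta>_def, rule_format] hat mxN]
  have eq: "\<eta>hat N i x = by_parts T G G' (%t. y i t x) (\<theta>hat N x) - r (\<theta>hat N x)" if "N >= 1" "i >= 1" for N i
   using elim(1) hat[OF that(1)] that(2) unfolding assms(13) \<zeta>_def by blast
  have "\<Sigma>hat N x = (1 / real N) *\<^sub>R (\<Sum>i=1..N. outer
     (by_parts T G G' (%t. y i t x) (\<theta>hat N x) - r (\<theta>hat N x) - (1 / real N) *\<^sub>R (\<Sum>j=1..N. by_parts T G G' (%t. y j t x) (\<theta>hat N x) - r (\<theta>hat N x)))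
     (by_parts T G G' (%t. y i t x) (\<theta>hat N x) - r (\<theta>hat N x) - (1 / real N) *\<^sub>R (\<Sum>j=1..N. by_parts T G G' (%t. y j t x) (\<theta>hat N x) - r (\<theta>hat N x))))" if N: "N >= 1" for N
  proof -
   have b: "\<eta>bar N x = (1 / real N) *\<^sub>R (\<Sum>j=1..N. by_parts T G G' (%t. y j t x) (\<theta>hat N x) - r (\<theta>hat N x))"
    unfolding assms(14) using eq[OF N] by (auto intro!: arg_cong[where f="%z. (1 / real N) *\<^sub>R z"] sum.cong)
   show ?thesis unfolding assms(15) b using eq[OF N] by (auto intro!: arg_cong[where f="%z. (1 / real N) *\<^sub>R z"] sum.cong)
  qed
  then have "eventually (%N. (1 / real N) *\<^sub>R (\<Sum>i=1..N. outer
     (by_parts T G G' (%t. y i t x) (\<theta>hat N x) - r (\<theta>hat N x) - (1 / real N) *\<^sub>R (\<Sum>j=1..N. by_parts T G G' (%t. y j t x) (\<theta>hat N x) - r (\<theta>hat N x)))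
     (by_parts T G G' (%t. y i t x) (\<theta>hat N x) - r (\<theta>hat N x) - (1 / real N) *\<^sub>R (\<Sum>j=1..N. by_parts T G G' (%t. y j t x) (\<theta>hat N x) - r (\<theta>hat N x)))) = \<Sigma>hat N x) sequentially"
   unfolding eventually_sequentially by (intro exI[of _ 1]) simp
  from Lim_transform_eventually[OF cons(2) this] cons(1) show ?case by blast
 qed
 \<comment> \<open>the matrix depends continuously on the parameter, so it is eventually invertible\<close>
 have V: "AE x in M. (%N. Vhat N x) \<longlonglongrightarrow> matrix_inv (\<I> \<theta>0) ** \<Sigma> ** matrix_inv (\<I> \<theta>0)"
  using main arg
 proof eventually_elim
  case (elim x)
  have ev: "eventually (%N. \<theta>hat N x \<in> \<Theta>) sequentially" unfolding eventually_sequentially using elim(2) by blast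
  have "(%N. \<I> (\<theta>hat N x)) \<longlonglongrightarrow> \<I> \<theta>0" by (rule continuous_on_tendsto_compose[OF \<I>c conjunct1[OF elim(1)] \<theta>0 ev])
  then have Il: "(%N. Ihat N x) \<longlonglongrightarrow> \<I> \<theta>0" unfolding assms(16) .
  note inv = tendsto_matrix_inv[OF Il pos_definite_invertible[OF assms(36)]]
  have "(%N. matrix_inv (Ihat N x) ** \<Sigma>hat N x ** matrix_inv (Ihat N x)) \<longlonglongrightarrow> matrix_inv (\<I> \<theta>0) ** \<Sigma> ** matrix_inv (\<I> \<theta>0)"
   using elim(1) by (intro tendsto_matrix_mult inv(2)) blast
  then show ?case by (rule Lim_transform_eventually) (use inv(1) in eventually_elim, simp add: assms(17))
 qed
 from main have "AE x in M. (%N. \<Sigma>hat N x) \<longlonglongrightarrow> \<Sigma>" by eventually_elim blast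
 with V show ?thesis by blast
qed

end
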